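(* Let $M$ and $N$ be two (smooth) Riemannian manifolds and let $p\in M$, $q\in N$ be any points. Then for any linear subspace $V\subset T_qN$ with $\dim V\le\dim M$ there are a neighborhood $U$ of $p$ in $M$ and a harmonic map $f:U\to N$ with $f(p)=q$ whose tangent space at $q$ is $V$, i.e. $df_p(T_pM)=V$.
   Context: A map $f$ between Riemannian manifolds $(M,\gamma)$ and $(N,g)$ is harmonic if, in local coordinates $x=(x^1,\dots,x^m)$ on $M$ and local coordinates on $N$, $$\frac{1}{\sqrt{\gamma}}\frac{\partial}{\partial x^\alpha}\Big(\sqrt{\gamma}\,\gamma^{\alpha\beta}\frac{\partial f^i}{\partial x^\beta}\Big)+\gamma^{\alpha\beta}(x)\,\Gamma^i_{jk}(f(x))\,\frac{\partial f^j}{\partial x^\alpha}\frac{\partial f^k}{\partial x^\beta}=0$$ for all $i$, where $(\gamma_{\alpha\beta})$ is the metric of $M$, $(\gamma^{\alpha\beta})$ its inverse, $\gamma=\det(\gamma_{\alpha\beta})$ under the square root, $\Gamma^i_{jk}$ are the Christoffel symbols of $g$ on $N$, and repeated indices are summed. *)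

theory Defs
  imports "HOL-Analysis.Analysis" "HOL-Library.Function_Algebras"
begin

text \<open>\<open>Ck_on\<close> and \<open>smooth_on\<close> are meant for open sets \<open>S\<close>.\<close>

primrec Ck_on :: "nat \<Rightarrow> ('a::real_normed_vector \<Rightarrow> 'b::real_normed_vector) \<Rightarrow> 'a set \<Rightarrow> bool" where
  "Ck_on 0 f S \<longleftrightarrow> continuous_on S f"
| "Ck_on (Suc k) f S \<longleftrightarrow>
     f differentiable_on S \<and> (\<forall>v. Ck_on k (\<lambda>x. frechet_derivative f (at x) v) S)"

definition smooth_on :: "('a::real_normed_vector \<Rightarrow> 'b::real_normed_vector) \<Rightarrow> 'a set \<Rightarrow> bool" where
  "smooth_on f S \<longleftrightarrow> (\<forall>k. Ck_on k f S)"

definition partial_deriv :: "'m::finite \<Rightarrow> (real^'m \<Rightarrow> real) \<Rightarrow> real^'m \<Rightarrow> real" where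
  "partial_deriv i f x = frechet_derivative f (at x) (axis i 1)"

instantiation "fun" :: (type, real_vector) real_vector
begin

definition scaleR_fun :: "real \<Rightarrow> ('a \<Rightarrow> 'b) \<Rightarrow> 'a \<Rightarrow> 'b" where
  "scaleR_fun r f = (\<lambda>x. r *\<^sub>R f x)"

instance
  by standard (auto simp: scaleR_fun_def fun_eq_iff scaleR_add_right scaleR_add_left)

end

text \<open>
  A chart is its domain together with its coordinate map, whose values outside the domain are
  irrelevant. An atlas need not be maximal.
\<close>

type_synonym ('a, 'm) chart = "'a set \<times> ('a \<Rightarrow> real^'m)"

abbreviation chart_dom :: "('a, 'm) chart \<Rightarrow> 'a set" where
  "chart_dom \<equiv> fst"

abbreviation chart_map :: "('a, 'm) chart \<Rightarrow> 'a \<Rightarrow> real^'m" where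
  "chart_map \<equiv> snd"

definition chart_inv :: "('a, 'm) chart \<Rightarrow> real^'m \<Rightarrow> 'a" where
  "chart_inv c = inv_into (chart_dom c) (chart_map c)"

definition is_chart :: "'a topology \<Rightarrow> ('a, 'm::finite) chart \<Rightarrow> bool" where
  "is_chart X c \<longleftrightarrow>
     openin X (chart_dom c) \<and>
     open (chart_map c ` chart_dom c) \<and>
     homeomorphic_map (subtopology X (chart_dom c))
       (top_of_set (chart_map c ` chart_dom c)) (chart_map c)"

definition smooth_atlas :: "'a topology \<Rightarrow> ('a, 'm::finite) chart set \<Rightarrow> bool" where
  "smooth_atlas X A \<longleftrightarrow>
     (\<forall>c\<in>A. is_chart X c) \<and>
     (\<Union>c\<in>A. chart_dom c) = topspace X \<and>
     (\<forall>c\<in>A. \<forall>d\<in>A. smooth_on (chart_map d \<circ> chart_inv c)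
                        (chart_map c ` (chart_dom c \<inter> chart_dom d)))"

definition smooth_manifold :: "'a topology \<Rightarrow> ('a, 'm::finite) chart set \<Rightarrow> bool" where
  "smooth_manifold X A \<longleftrightarrow> Hausdorff_space X \<and> second_countable X \<and> smooth_atlas X A"

text \<open>
  A tangent vector at \<open>p\<close> is the family of its coordinate vectors in all charts around \<open>p\<close>,
  which transform into each other by the Jacobians of the coordinate changes. Charts that do not
  contain \<open>p\<close> are given the value 0, so that a tangent vector is determined by its coordinates
  and the pointwise operations make \<open>tangent_space A p\<close> a vector space.
\<close>

type_synonym ('a, 'm) tangent_vector = "('a, 'm) chart \<Rightarrow> real^'m"

definition tangent_space ::
    "('a, 'm::finite) chart set \<Rightarrow> 'a \<Rightarrow> ('a, 'm) tangent_vector set" where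
  "tangent_space A p =
     {v. (\<forall>c\<in>A. \<forall>d\<in>A. p \<in> chart_dom c \<inter> chart_dom d \<longrightarrow>
            v d = frechet_derivative (chart_map d \<circ> chart_inv c) (at (chart_map c p)) (v c)) \<and>
         (\<forall>c. \<not> (c \<in> A \<and> p \<in> chart_dom c) \<longrightarrow> v c = 0)}"

text \<open>The tangent vector at \<open>p\<close> whose coordinate vector in \<open>c\<close>, a chart around \<open>p\<close>, is \<open>e\<close>.\<close>

definition tangent_of_coords ::
    "('a, 'm::finite) chart set \<Rightarrow> ('a, 'm) chart \<Rightarrow> 'a \<Rightarrow> real^'m \<Rightarrow> ('a, 'm) tangent_vector" where
  "tangent_of_coords A c p e =
     (\<lambda>d. if d \<in> A \<and> p \<in> chart_dom d
          then frechet_derivative (chart_map d \<circ> chart_inv c) (at (chart_map c p)) e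
          else 0)"

text \<open>
  The differential at \<open>p\<close> of a map between manifolds with atlases \<open>A\<close> and \<open>B\<close>. By the chain rule
  it does not depend on which chart around \<open>p\<close> is selected.
\<close>

definition differential ::
    "('a, 'm::finite) chart set \<Rightarrow> ('b, 'n::finite) chart set \<Rightarrow> ('a \<Rightarrow> 'b) \<Rightarrow> 'a \<Rightarrow>
     ('a, 'm) tangent_vector \<Rightarrow> ('b, 'n) tangent_vector" where
  "differential A B f p v =
     (let c = (SOME c. c \<in> A \<and> p \<in> chart_dom c)
      in (\<lambda>d. if d \<in> B \<and> f p \<in> chart_dom d
             then frechet_derivative (chart_map d \<circ> f \<circ> chart_inv c) (at (chart_map c p)) (v c)
             else 0))"

record ('a, 'm) riemannian =
  mtop :: "'a topology"
  atlas :: "('a, 'm) chart set"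
  metric :: "'a \<Rightarrow> ('a, 'm) tangent_vector \<Rightarrow> ('a, 'm) tangent_vector \<Rightarrow> real"

definition metric_matrix ::
    "('a, 'm::finite) riemannian \<Rightarrow> ('a, 'm) chart \<Rightarrow> real^'m \<Rightarrow> real^'m^'m" where
  "metric_matrix M c x =
     (\<chi> i j. metric M (chart_inv c x)
               (tangent_of_coords (atlas M) c (chart_inv c x) (axis i 1))
               (tangent_of_coords (atlas M) c (chart_inv c x) (axis j 1)))"

definition inner_product_on :: "'v::real_vector set \<Rightarrow> ('v \<Rightarrow> 'v \<Rightarrow> real) \<Rightarrow> bool" where
  "inner_product_on T g \<longleftrightarrow>
     (\<forall>u\<in>T. \<forall>v\<in>T. g u v = g v u) \<and>
     (\<forall>u\<in>T. \<forall>v\<in>T. \<forall>w\<in>T. g (u + v) w = g u w + g v w) \<and>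
     (\<forall>r. \<forall>u\<in>T. \<forall>w\<in>T. g (r *\<^sub>R u) w = r * g u w) \<and>
     (\<forall>u\<in>T. u \<noteq> 0 \<longrightarrow> g u u > 0)"

definition riemannian_manifold :: "('a, 'm::finite) riemannian \<Rightarrow> bool" where
  "riemannian_manifold M \<longleftrightarrow>
     smooth_manifold (mtop M) (atlas M) \<and>
     (\<forall>p\<in>topspace (mtop M). inner_product_on (tangent_space (atlas M) p) (metric M p)) \<and>
     (\<forall>c\<in>atlas M. smooth_on (metric_matrix M c) (chart_map c ` chart_dom c))"

definition christoffel :: "(real^'n::finite \<Rightarrow> real^'n^'n) \<Rightarrow> 'n \<Rightarrow> 'n \<Rightarrow> 'n \<Rightarrow> real^'n \<Rightarrow> real" where
  "christoffel g i j k y =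
     (1/2) * (\<Sum>l\<in>UNIV. matrix_inv (g y) $ i $ l *
        (partial_deriv j (\<lambda>z. g z $ l $ k) y
         + partial_deriv k (\<lambda>z. g z $ j $ l) y
         - partial_deriv l (\<lambda>z. g z $ j $ k) y))"

text \<open>
  The \<open>i\<close>-th component, in coordinates, of the left-hand side of the harmonic map equation for
  the coordinate expression \<open>F\<close> of a map, where \<open>\<gamma>\<close> and \<open>g\<close> are the metric matrices on the domain
  and on the target.
\<close>

definition tension ::
    "(real^'m::finite \<Rightarrow> real^'m^'m) \<Rightarrow> (real^'n::finite \<Rightarrow> real^'n^'n) \<Rightarrow>
     (real^'m \<Rightarrow> real^'n) \<Rightarrow> 'n \<Rightarrow> real^'m \<Rightarrow> real" where
  "tension \<gamma> g F i x =
     1 / sqrt (det (\<gamma> x)) *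
       (\<Sum>\<alpha>\<in>UNIV. partial_deriv \<alpha>
          (\<lambda>y. \<Sum>\<beta>\<in>UNIV. sqrt (det (\<gamma> y)) * matrix_inv (\<gamma> y) $ \<alpha> $ \<beta>
                          * partial_deriv \<beta> (\<lambda>z. F z $ i) y) x)
     + (\<Sum>\<alpha>\<in>UNIV. \<Sum>\<beta>\<in>UNIV. \<Sum>j\<in>UNIV. \<Sum>k\<in>UNIV.
          matrix_inv (\<gamma> x) $ \<alpha> $ \<beta> * christoffel g i j k (F x)
            * partial_deriv \<alpha> (\<lambda>z. F z $ j) x * partial_deriv \<beta> (\<lambda>z. F z $ k) x)"

text \<open>
  \<open>U\<close> is meant to be open in \<open>M\<close> and carries the restricted metric. The map \<open>f\<close> is required to be
  smooth; its values outside \<open>U\<close> are irrelevant.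
\<close>

definition harmonic_map_on ::
    "('a, 'm::finite) riemannian \<Rightarrow> ('b, 'n::finite) riemannian \<Rightarrow> 'a set \<Rightarrow> ('a \<Rightarrow> 'b) \<Rightarrow> bool" where
  "harmonic_map_on M N U f \<longleftrightarrow>
     continuous_map (subtopology (mtop M) U) (mtop N) f \<and>
     (\<forall>c\<in>atlas M. \<forall>d\<in>atlas N.
        let F = chart_map d \<circ> f \<circ> chart_inv c;
            W = chart_map c ` {x \<in> U \<inter> chart_dom c. f x \<in> chart_dom d}
        in smooth_on F W \<and>
           (\<forall>x\<in>W. \<forall>i. tension (metric_matrix M c) (metric_matrix N d) F i x = 0))"

end

theory Submission
  imports Defs
begin

text \<open>
  In charts the harmonic map equation is a semilinear elliptic system
  \<open>a\<^sup>\<alpha>\<^sup>\<beta>(x) \<partial>\<^sub>\<alpha>\<partial>\<^sub>\<beta> F + H(x, F, DF) = 0\<close>, and it suffices to solve it near the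
  origin with prescribed 1-jet. After rescaling \<open>F(e z) = e (A z + w(z) - w(0) - Dw(0) z)\<close> the
  deviation from the constant coefficient equation \<open>a(0) D\<^sup>2 w = f\<close> is of size \<open>e\<close>. The latter is
  inverted on the torus by a Fourier multiplier, the obstructing mean being moved away from the origin, so
  that the nonlinear problem becomes a contraction for small \<open>e\<close>. The norms are sums of
  \<open>(1 + |k|)^s |f^(k)|\<close> over the Fourier coefficients: they are submultiplicative, elliptic regularity
  for them is evident, and tame estimates for products and compositions keep all higher norms bounded along
  the iteration.

  The tension field is the metric trace of a second fundamental form, which transforms tensorially under
  changes of charts in the domain and in the target. Hence a map that is harmonic in one pair of charts is
  harmonic in all of them. Its 1-jet at \<open>p\<close> is a linear map with image \<open>V\<close>, which exists because
  \<open>dim V \<le> dim M\<close>.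
\<close>


subsection \<open>Calculus of smooth maps\<close>

text \<open>One scale \<open>e\<close> has to serve all orders of smoothness. The term
  \<open>(a(e z) - a(0)) D^2 w\<close> has the same order as the unknown
  \<open>f = a(0) D^2 w\<close>, and in the norm of order \<open>s\<close> the deviation of the
  coefficients is bounded only by \<open>C_s e\<close>; a contraction in every norm would force
  \<open>e\<close> to shrink with \<open>s\<close>. The contraction is therefore run in the single
  norm of order \<open>2 * CARD('m)\<close>. At higher orders the top-order norm of \<open>f\<close>
  meets only the lowest norm of the deviation and a bound \<open>L\<close> for \<open>D^2 T\<close>
  that is the same at all orders. The nonlinearity is of lower order, since \<open>T\<close> gains
  two derivatives and the jet spends one. All iterates are smooth and the limit is formed
  coefficient by coefficient, so no complete function space is introduced. The nonlinearity is
  smooth but not analytic, so power series are of no help for compositions; these are estimated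
  through sup norms of derivatives. Linear functions are not periodic, so on the torus they are
  replaced by periodic functions that agree with the coordinates near the origin, where alone the
  equation is wanted.\<close>

lemma frechet_derivative_cong_open:
  assumes "open S" "x \<in> S" "\<And>y. y \<in> S \<Longrightarrow> f y = g y"
  shows "frechet_derivative f (at x) = frechet_derivative g (at x)"
proof -
  have "(f has_derivative D) (at x) \<longleftrightarrow> (g has_derivative D) (at x)" for D
    using has_derivative_transform_within_open[OF _ assms(1,2)] assms(3) by metis
  then show ?thesis by (simp add: frechet_derivative_def)
qed

lemma Ck_on_cong:
  assumes "open S" "\<And>x. x \<in> S \<Longrightarrow> f x = g x" "Ck_on k f S"
  shows "Ck_on k g S"
  using assms(2,3)
proof (induction k arbitrary: f g)
  case 0
  then show ?case using continuous_on_cong by fastforce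
next
  case (Suc k)
  have d: "f differentiable_on S" and c: "\<And>v. Ck_on k (\<lambda>x. frechet_derivative f (at x) v) S"
    using Suc.prems by auto
  have "g differentiable_on S"
    using d Suc.prems(1) unfolding differentiable_on_def
    by (meson differentiable_transform_within dist_commute zero_less_one)
  moreover have "Ck_on k (\<lambda>x. frechet_derivative g (at x) v) S" for v
    using frechet_derivative_cong_open[OF assms(1) _ Suc.prems(1)]
    by (intro Suc.IH[OF _ c[of v]]) simp
  ultimately show ?case by simp
qed

lemma Ck_on_deriv:
  assumes "open S" "Ck_on (Suc k) f S" "x \<in> S"
  shows "(f has_derivative frechet_derivative f (at x)) (at x)"
  using assms by (simp add: differentiable_on_eq_differentiable_at frechet_derivative_works)

text \<open>Any explicit derivative may be supplied instead of \<open>frechet_derivative\<close>: on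
  an open set the two coincide, and \<open>Ck_on\<close> depends only on the values there.\<close>

lemma Ck_onI:
  assumes "open S" "\<And>x. x \<in> S \<Longrightarrow> (f has_derivative D x) (at x)"
    and "\<And>v. Ck_on k (\<lambda>x. D x v) S"
  shows "Ck_on (Suc k) f S"
proof -
  have "f differentiable_on S"
    using assms(1,2) by (auto simp: differentiable_on_eq_differentiable_at differentiable_def)
  moreover have "Ck_on k (\<lambda>x. frechet_derivative f (at x) v) S" for v
    using assms(2)[THEN frechet_derivative_at]
    by (intro Ck_on_cong[OF assms(1) _ assms(3)[of v]]) simp
  ultimately show ?thesis by simp
qed

lemma Ck_on_subset: "Ck_on k f S \<Longrightarrow> T \<subseteq> S \<Longrightarrow> Ck_on k f T"
  by (induction k arbitrary: f) (auto intro: continuous_on_subset differentiable_on_subset)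

lemma Ck_on_Suc_D: "Ck_on (Suc k) f S \<Longrightarrow> Ck_on k f S"
proof (induction k arbitrary: f)
  case 0
  then show ?case by (auto intro: differentiable_imp_continuous_on)
next
  case (Suc k)
  then show ?case by (metis Ck_on.simps(2))
qed

lemma Ck_on_const [simp]: "open S \<Longrightarrow> Ck_on k (\<lambda>_. c) S"
proof (induction k arbitrary: c)
  case (Suc k)
  show ?case by (rule Ck_onI[where D="\<lambda>_ _. 0"]) (use Suc in auto)
qed simp

lemma Ck_on_add:
  assumes "open S" "Ck_on k f S" "Ck_on k g S"
  shows "Ck_on k (\<lambda>x. f x + g x) S"
  using assms(2,3)
proof (induction k arbitrary: f g)
  case (Suc k)
  have "\<And>x. x \<in> S \<Longrightarrow> ((\<lambda>x. f x + g x) has_derivative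
      (\<lambda>v. frechet_derivative f (at x) v + frechet_derivative g (at x) v)) (at x)"
    using Ck_on_deriv[OF assms(1) Suc.prems(1)] Ck_on_deriv[OF assms(1) Suc.prems(2)]
    by (intro has_derivative_add)
  then show ?case by (rule Ck_onI[OF assms(1)]) (use Suc in auto)
qed (auto intro: continuous_on_add)

lemma Ck_on_bounded_linear:
  assumes "open S" "bounded_linear L" "Ck_on k f S"
  shows "Ck_on k (\<lambda>x. L (f x)) S"
  using assms(3)
proof (induction k arbitrary: f)
  case 0
  then show ?case using assms(2) by (auto intro: bounded_linear.continuous_on)
next
  case (Suc k)
  have "\<And>x. x \<in> S \<Longrightarrow> ((\<lambda>x. L (f x)) has_derivative (\<lambda>v. L (frechet_derivative f (at x) v))) (at x)"
    using Ck_on_deriv[OF assms(1) Suc.prems] bounded_linear.has_derivative[OF assms(2)] by blast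
  then show ?case by (rule Ck_onI[OF assms(1)]) (use Suc in auto)
qed

lemma Ck_on_bilinear:
  assumes "open S" "bounded_bilinear B" "Ck_on k f S" "Ck_on k g S"
  shows "Ck_on k (\<lambda>x. B (f x) (g x)) S"
  using assms(3,4)
proof (induction k arbitrary: f g)
  case 0
  then show ?case using assms(2) by (auto intro: bounded_bilinear.continuous_on)
next
  case (Suc k)
  have "\<And>x. x \<in> S \<Longrightarrow> ((\<lambda>x. B (f x) (g x)) has_derivative
      (\<lambda>v. B (f x) (frechet_derivative g (at x) v) + B (frechet_derivative f (at x) v) (g x))) (at x)"
    using Ck_on_deriv[OF assms(1) Suc.prems(1)] Ck_on_deriv[OF assms(1) Suc.prems(2)]
    by (intro bounded_bilinear.FDERIV[OF assms(2)])
  then show ?case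
  proof (rule Ck_onI[OF assms(1)])
    fix v
    show "Ck_on k (\<lambda>x. B (f x) (frechet_derivative g (at x) v)
        + B (frechet_derivative f (at x) v) (g x)) S"
      using Suc.prems Suc.prems[THEN Ck_on_Suc_D]
      by (intro Ck_on_add[OF assms(1)] Suc.IH) auto
  qed
qed

lemma Ck_on_sum:
  assumes "open S" "\<And>i. i \<in> I \<Longrightarrow> Ck_on k (f i) S"
  shows "Ck_on k (\<lambda>x. \<Sum>i\<in>I. f i x) S"
  using assms(2)
  by (induction I rule: infinite_finite_induct) (auto simp: assms(1) intro!: Ck_on_add)

text \<open>The chain rule evaluates the derivative of \<open>f\<close> in the moving direction
  \<open>Dg(x) v\<close>, whereas \<open>Ck_on\<close> controls it only in fixed directions.
  Expanding the direction in a basis gives a finite sum of products of functions covered by the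
  induction, which is the reason for a Euclidean middle space.\<close>

lemma Ck_on_compose:
  fixes g :: "'a::real_normed_vector \<Rightarrow> 'b::euclidean_space"
  assumes "open S" "open T" "g ` S \<subseteq> T" "Ck_on k f T" "Ck_on k g S"
  shows "Ck_on k (\<lambda>x. f (g x)) S"
  using assms(4,5)
proof (induction k arbitrary: f)
  case 0
  then show ?case using assms(3) continuous_on_compose2 by fastforce
next
  case (Suc k)
  define D where "D = (\<lambda>x v. \<Sum>b\<in>Basis. (frechet_derivative g (at x) v \<bullet> b) *\<^sub>R frechet_derivative f (at (g x)) b)"
  have D: "D x v = frechet_derivative f (at (g x)) (frechet_derivative g (at x) v)" if "x \<in> S" for x v
  proof -
    have "g x \<in> T" using assms(3) that by auto
    then have l: "linear (frechet_derivative f (at (g x)))"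
      using Ck_on_deriv[OF assms(2) Suc.prems(1)] has_derivative_linear by blast
    have "frechet_derivative f (at (g x)) (\<Sum>b\<in>Basis. (w \<bullet> b) *\<^sub>R b)
        = (\<Sum>b\<in>Basis. (w \<bullet> b) *\<^sub>R frechet_derivative f (at (g x)) b)" for w
      using l by (simp add: linear_sum linear_scale)
    then show ?thesis unfolding D_def by (metis euclidean_representation)
  qed
  have "((\<lambda>x. f (g x)) has_derivative D x) (at x)" if "x \<in> S" for x
  proof -
    have "g x \<in> T" using assms(3) that by auto
    have "((\<lambda>x. f (g x)) has_derivative (\<lambda>v. frechet_derivative f (at (g x)) (frechet_derivative g (at x) v))) (at x)"
      by (rule has_derivative_compose[OF Ck_on_deriv[OF assms(1) Suc.prems(2) that] Ck_on_deriv[OF assms(2) Suc.prems(1) \<open>g x \<in> T\<close>]])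
    then show ?thesis using D[OF that] by presburger
  qed
  then show ?case
  proof (rule Ck_onI[OF assms(1)])
    fix v
    have 1: "Ck_on k (\<lambda>x. frechet_derivative f (at (g x)) b) S" for b
      using Suc.prems Ck_on_Suc_D by (intro Suc.IH) auto
    have 2: "Ck_on k (\<lambda>x. frechet_derivative g (at x) v \<bullet> b) S" for b
      using Suc.prems by (intro Ck_on_bounded_linear[OF assms(1) bounded_linear_inner_left]) auto
    show "Ck_on k (\<lambda>x. D x v) S"
      unfolding D_def
      by (intro Ck_on_sum[OF assms(1)] Ck_on_bilinear[OF assms(1) bounded_bilinear_scaleR 2 1])
  qed
qed

lemma smooth_on_cong:
  "open S \<Longrightarrow> smooth_on f S \<Longrightarrow> (\<And>x. x \<in> S \<Longrightarrow> f x = g x) \<Longrightarrow> smooth_on g S"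
  unfolding smooth_on_def using Ck_on_cong by blast

lemma smooth_on_subset: "smooth_on f S \<Longrightarrow> T \<subseteq> S \<Longrightarrow> smooth_on f T"
  unfolding smooth_on_def using Ck_on_subset by blast

lemma smooth_on_continuous: "smooth_on f S \<Longrightarrow> continuous_on S f"
  unfolding smooth_on_def by (metis Ck_on.simps(1))

lemma smooth_on_deriv:
  "smooth_on f S \<Longrightarrow> open S \<Longrightarrow> x \<in> S \<Longrightarrow> (f has_derivative frechet_derivative f (at x)) (at x)"
  unfolding smooth_on_def using Ck_on_deriv by blast

lemma smooth_on_frechet: "smooth_on f S \<Longrightarrow> smooth_on (\<lambda>x. frechet_derivative f (at x) v) S"
  unfolding smooth_on_def by (metis Ck_on.simps(2))

lemma smooth_onI:
  assumes "open S" "\<And>x. x \<in> S \<Longrightarrow> (f has_derivative D x) (at x)"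
    and "\<And>v. smooth_on (\<lambda>x. D x v) S"
  shows "smooth_on f S"
  unfolding smooth_on_def
proof
  fix k
  have "Ck_on (Suc k) f S" using assms by (intro Ck_onI) (auto simp: smooth_on_def)
  then show "Ck_on k f S" by (rule Ck_on_Suc_D)
qed

lemma smooth_on_localI:
  assumes "\<And>x. x \<in> S \<Longrightarrow> \<exists>T. open T \<and> x \<in> T \<and> smooth_on f T"
  shows "smooth_on f S"
proof -
  have "Ck_on k f S" if "\<And>x. x \<in> S \<Longrightarrow> \<exists>T. open T \<and> x \<in> T \<and> Ck_on k f T" for k and f :: "'a \<Rightarrow> 'b"
    using that
  proof (induction k arbitrary: f)
    case 0
    have "isCont f x" if "x \<in> S" for x
      using 0[OF that] by (auto simp: continuous_on_eq_continuous_at)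
    then show ?case by (simp add: continuous_at_imp_continuous_on)
  next
    case (Suc k)
    have "f differentiable (at x)" if "x \<in> S" for x
      using Suc.prems[OF that] by (auto simp: differentiable_on_eq_differentiable_at)
    moreover have "Ck_on k (\<lambda>x. frechet_derivative f (at x) v) S" for v
      using Suc.prems by (intro Suc.IH) (fastforce simp: Ck_on.simps(2))
    ultimately show ?case by (simp add: differentiable_at_imp_differentiable_on)
  qed
  then show ?thesis using assms unfolding smooth_on_def by meson
qed

section \<open>Smoothness of algebraic combinations and elementary functions\<close>

named_theorems smooth_intros

lemma smooth_on_const [smooth_intros]: "open S \<Longrightarrow> smooth_on (\<lambda>_. c) S"
  by (simp add: smooth_on_def)

lemma smooth_on_add [smooth_intros]:
  "open S \<Longrightarrow> smooth_on f S \<Longrightarrow> smooth_on g S \<Longrightarrow> smooth_on (\<lambda>x. f x + g x) S"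
  unfolding smooth_on_def using Ck_on_add by blast

lemma smooth_on_sum [smooth_intros]:
  "open S \<Longrightarrow> (\<And>i. i \<in> I \<Longrightarrow> smooth_on (f i) S) \<Longrightarrow> smooth_on (\<lambda>x. \<Sum>i\<in>I. f i x) S"
  unfolding smooth_on_def by (simp add: Ck_on_sum)

lemma smooth_on_bounded_linear:
  "open S \<Longrightarrow> bounded_linear L \<Longrightarrow> smooth_on f S \<Longrightarrow> smooth_on (\<lambda>x. L (f x)) S"
  unfolding smooth_on_def by (simp add: Ck_on_bounded_linear)

lemma smooth_on_linear: "open S \<Longrightarrow> bounded_linear L \<Longrightarrow> smooth_on L S"
  by (rule smooth_onI[where D="\<lambda>_. L"]) (auto intro: bounded_linear_imp_has_derivative smooth_on_const)

lemma smooth_on_id [smooth_intros]: "open S \<Longrightarrow> smooth_on (\<lambda>x. x) S"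
  by (rule smooth_on_linear) simp_all

lemma smooth_on_bilinear:
  "open S \<Longrightarrow> bounded_bilinear B \<Longrightarrow> smooth_on f S \<Longrightarrow> smooth_on g S \<Longrightarrow> smooth_on (\<lambda>x. B (f x) (g x)) S"
  unfolding smooth_on_def by (simp add: Ck_on_bilinear)

lemma smooth_on_mult [smooth_intros]:
  fixes f g :: "'a::real_normed_vector \<Rightarrow> 'b::real_normed_algebra"
  shows "open S \<Longrightarrow> smooth_on f S \<Longrightarrow> smooth_on g S \<Longrightarrow> smooth_on (\<lambda>x. f x * g x) S"
  using smooth_on_bilinear[OF _ bounded_bilinear_mult] .

lemma smooth_on_scaleR [smooth_intros]:
  "open S \<Longrightarrow> smooth_on f S \<Longrightarrow> smooth_on g S \<Longrightarrow> smooth_on (\<lambda>x. f x *\<^sub>R g x) S"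
  using smooth_on_bilinear[OF _ bounded_bilinear_scaleR] .

lemma smooth_on_inner [smooth_intros]:
  "open S \<Longrightarrow> smooth_on f S \<Longrightarrow> smooth_on g S \<Longrightarrow> smooth_on (\<lambda>x. f x \<bullet> g x) S"
  using smooth_on_bilinear[OF _ bounded_bilinear_inner] .

lemma smooth_on_minus [smooth_intros]: "open S \<Longrightarrow> smooth_on f S \<Longrightarrow> smooth_on (\<lambda>x. - f x) S"
  using smooth_on_bounded_linear[OF _ bounded_linear_minus[OF bounded_linear_ident]] .

lemma smooth_on_diff [smooth_intros]:
  "open S \<Longrightarrow> smooth_on f S \<Longrightarrow> smooth_on g S \<Longrightarrow> smooth_on (\<lambda>x. f x - g x) S"
  using smooth_on_add[of S f "\<lambda>x. - g x"] smooth_on_minus[of S g] by simp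

lemma smooth_on_nth [smooth_intros]: "open S \<Longrightarrow> smooth_on f S \<Longrightarrow> smooth_on (\<lambda>x. f x $ i) S"
  using smooth_on_bounded_linear[OF _ bounded_linear_vec_nth] .

lemma smooth_on_prod [smooth_intros]:
  fixes f :: "'i \<Rightarrow> 'a::real_normed_vector \<Rightarrow> real"
  assumes "open S" "\<And>i. i \<in> I \<Longrightarrow> smooth_on (f i) S"
  shows "smooth_on (\<lambda>x. \<Prod>i\<in>I. f i x) S"
  using assms(2)
  by (induction I rule: infinite_finite_induct) (auto intro!: smooth_intros assms(1))

lemma smooth_on_power [smooth_intros]:
  fixes f :: "'a::real_normed_vector \<Rightarrow> real"
  assumes "open S" "smooth_on f S"
  shows "smooth_on (\<lambda>x. f x ^ n) S"
  by (induction n) (auto intro!: smooth_intros assms)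

text \<open>The vector is a finite sum of its components re-embedded by the bounded linear maps
  \<open>axis i\<close>.\<close>

lemma smooth_on_vec [smooth_intros]:
  fixes f :: "'a::real_normed_vector \<Rightarrow> 'i::finite \<Rightarrow> 'b::real_normed_vector"
  assumes "open S" "\<And>i. smooth_on (\<lambda>x. f x i) S"
  shows "smooth_on (\<lambda>x. \<chi> i. f x i) S"
proof -
  have "bounded_linear (\<lambda>y. axis i y :: 'b ^ 'i)" for i
  proof (rule bounded_linear_intro[where K=1])
    fix y :: 'b
    have "(norm ((axis i y :: 'b^'i) $ j))\<^sup>2 = (if j = i then (norm y)\<^sup>2 else 0)" for j
      by (simp add: axis_def)
    then have "norm (axis i y :: 'b ^ 'i) = sqrt (\<Sum>j\<in>UNIV. if j = i then (norm y)\<^sup>2 else 0)"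
      unfolding norm_vec_def L2_set_def by presburger
    then show "norm (axis i y :: 'b ^ 'i) \<le> norm y * 1" by simp
  qed (simp_all add: vec_eq_iff axis_def)
  then have "smooth_on (\<lambda>x. \<Sum>i\<in>UNIV. axis i (f x i)) S"
    by (intro smooth_on_sum[OF assms(1)] smooth_on_bounded_linear[OF assms(1) _ assms(2)])
  moreover have "(\<Sum>i\<in>UNIV. axis i (f x i)) = (\<chi> i. f x i)" for x
  proof -
    have "(\<Sum>i\<in>UNIV. axis i (f x i) $ j) = (\<Sum>i\<in>UNIV. if i = j then f x j else 0)" for j
      by (intro sum.cong) (auto simp: axis_def)
    then show ?thesis by (simp add: vec_eq_iff)
  qed
  ultimately show ?thesis by simp
qed

lemma smooth_on_compose:
  fixes g :: "'a::real_normed_vector \<Rightarrow> 'b::euclidean_space"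
  assumes "open S" "open T" "g ` S \<subseteq> T" "smooth_on f T" "smooth_on g S"
  shows "smooth_on (\<lambda>x. f (g x)) S"
  unfolding smooth_on_def
proof
  fix k show "Ck_on k (\<lambda>x. f (g x)) S"
    using assms(4,5) by (auto intro: Ck_on_compose[OF assms(1-3)] simp: smooth_on_def)
qed

text \<open>The derivative \<open>- v / x^2\<close> is a polynomial in the inverse itself, so each
  order of differentiability follows from the one before.\<close>

lemma smooth_on_inverse_real: "smooth_on (inverse :: real \<Rightarrow> real) (- {0})"
proof -
  have "Ck_on k (inverse :: real \<Rightarrow> real) (- {0})" for k
  proof (induction k)
    case 0
    show ?case by (auto intro!: continuous_intros)
  next
    case (Suc k)
    show ?case
    proof (rule Ck_onI[where D="\<lambda>x v. - (v * (inverse x * inverse x))"])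
      show "Ck_on k (\<lambda>x::real. - (v * (inverse x * inverse x))) (- {0})" for v
        using Suc by (intro Ck_on_bounded_linear[OF _ bounded_linear_minus[OF bounded_linear_mult_right]]
            Ck_on_bilinear[OF _ bounded_bilinear_mult]) auto
      show "(inverse has_derivative (\<lambda>v. - (v * (inverse x * inverse x)))) (at x)" if "x \<in> - {0}" for x :: real
      proof -
        have "(\<lambda>v. - (v * (inverse x * inverse x))) = (*) (- (inverse x ^ Suc (Suc 0)))"
          by (rule ext) simp
        then show ?thesis using DERIV_inverse[of x UNIV] that unfolding has_field_derivative_def by auto
      qed
    qed auto
  qed
  then show ?thesis by (simp add: smooth_on_def)
qed

lemma smooth_on_inverse [smooth_intros]:
  fixes f :: "'a::real_normed_vector \<Rightarrow> real"
  assumes "open S" "smooth_on f S" "\<And>x. x \<in> S \<Longrightarrow> f x \<noteq> 0"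
  shows "smooth_on (\<lambda>x. inverse (f x)) S"
proof -
  have im: "f ` S \<subseteq> - {0}"
  proof
    fix y assume "y \<in> f ` S"
    then obtain x where "x \<in> S" "y = f x" by auto
    then show "y \<in> - {0}" using assms(3)[of x] by simp
  qed
  have op: "open (- {0::real})" by (rule open_Compl) simp
  show ?thesis
    by (rule smooth_on_compose[OF assms(1) op im smooth_on_inverse_real assms(2)])
qed

lemma smooth_on_divide [smooth_intros]:
  fixes f :: "'a::real_normed_vector \<Rightarrow> real"
  assumes "open S" "smooth_on f S" "smooth_on g S" "\<And>x. x \<in> S \<Longrightarrow> g x \<noteq> 0"
  shows "smooth_on (\<lambda>x. f x / g x) S"
  unfolding divide_inverse using assms by (intro smooth_intros)

text \<open>The derivative is a multiple of \<open>inverse\<close> after \<open>sqrt\<close>, so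
  \<open>C^k\<close> for \<open>sqrt\<close> passes through the composition and yields
  \<open>C^(k+1)\<close>.\<close>

lemma smooth_on_sqrt_real: "smooth_on sqrt {0<..}"
proof -
  have "Ck_on k sqrt {0<..}" for k
  proof (induction k)
    case 0
    show ?case by (auto intro!: continuous_intros)
  next
    case (Suc k)
    show ?case
    proof (rule Ck_onI[where D="\<lambda>x v. (v/2) * inverse (sqrt x)"])
      show "Ck_on k (\<lambda>x. (v/2) * inverse (sqrt x)) {0<..}" for v
        using Suc smooth_on_inverse_real
        by (intro Ck_on_bounded_linear[OF _ bounded_linear_mult_right]
            Ck_on_compose[where T="- {0}" and f=inverse and g=sqrt]) (auto simp: smooth_on_def)
      show "(sqrt has_derivative (\<lambda>v. (v/2) * inverse (sqrt x))) (at x)" if "x \<in> {0<..}" for x :: real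
      proof -
        have "(\<lambda>v. (v/2) * inverse (sqrt x)) = (*) (inverse (sqrt x) / 2)"
          by (rule ext) simp
        then show ?thesis using DERIV_real_sqrt[of x] that unfolding has_field_derivative_def by auto
      qed
    qed auto
  qed
  then show ?thesis by (simp add: smooth_on_def)
qed

lemma smooth_on_sqrt [smooth_intros]:
  assumes "open S" "smooth_on f S" "\<And>x. x \<in> S \<Longrightarrow> f x > 0"
  shows "smooth_on (\<lambda>x. sqrt (f x)) S"
proof -
  have im: "f ` S \<subseteq> {0<..}" using assms(3) by (auto simp: image_subset_iff)
  show ?thesis
    by (rule smooth_on_compose[OF assms(1) open_greaterThan im smooth_on_sqrt_real assms(2)])
qed

text \<open>Sine and cosine are each other's derivative up to sign, so the induction runs on both at
  once.\<close>

lemma smooth_on_sin_cos_real: "smooth_on (sin :: real \<Rightarrow> real) UNIV" "smooth_on (cos :: real \<Rightarrow> real) UNIV"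
proof -
  have "Ck_on k (sin :: real \<Rightarrow> real) UNIV \<and> Ck_on k (cos :: real \<Rightarrow> real) UNIV" for k
  proof (induction k)
    case 0
    show ?case by (auto intro!: continuous_intros)
  next
    case (Suc k)
    have "Ck_on (Suc k) (sin :: real \<Rightarrow> real) UNIV"
      by (rule Ck_onI[where D="\<lambda>x v. v * cos x"])
        (use Suc in \<open>auto intro!: derivative_eq_intros Ck_on_bounded_linear[OF _ bounded_linear_mult_right]\<close>)
    moreover have "Ck_on (Suc k) (cos :: real \<Rightarrow> real) UNIV"
    proof (rule Ck_onI[where D="\<lambda>x v. (- v) * sin x"])
      show "Ck_on k (\<lambda>x::real. (- v) * sin x) UNIV" for v
        using Suc by (intro Ck_on_bounded_linear[OF _ bounded_linear_mult_right]) auto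
    qed (auto intro!: derivative_eq_intros)
    ultimately show ?case by blast
  qed
  then show "smooth_on (sin :: real \<Rightarrow> real) UNIV" "smooth_on (cos :: real \<Rightarrow> real) UNIV"
    by (simp_all add: smooth_on_def)
qed

lemma smooth_on_sin [smooth_intros]:
  fixes f :: "'a::real_normed_vector \<Rightarrow> real"
  shows "open S \<Longrightarrow> smooth_on f S \<Longrightarrow> smooth_on (\<lambda>x. sin (f x)) S"
  by (rule smooth_on_compose[OF _ open_UNIV subset_UNIV smooth_on_sin_cos_real(1)])

lemma smooth_on_cos [smooth_intros]:
  fixes f :: "'a::real_normed_vector \<Rightarrow> real"
  shows "open S \<Longrightarrow> smooth_on f S \<Longrightarrow> smooth_on (\<lambda>x. cos (f x)) S"
  by (rule smooth_on_compose[OF _ open_UNIV subset_UNIV smooth_on_sin_cos_real(2)])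

text \<open>Serves to invert the sine near 0: \<open>arcsin (sin t)\<close> is the source of
  periodic functions that agree with the coordinates near the origin.\<close>

lemma smooth_on_arcsin: "smooth_on arcsin {-1<..<1}"
proof (rule smooth_onI[where D="\<lambda>x v. v * inverse (sqrt (1 - x^2))"])
  fix x :: real assume "x \<in> {-1<..<1}"
  then show "(arcsin has_derivative (\<lambda>v. v * inverse (sqrt (1 - x\<^sup>2)))) (at x)"
    using DERIV_arcsin[of x] by (simp add: has_field_derivative_def mult_commute_abs)
next
  fix v :: real
  have "x^2 < 1" if "x \<in> {-1<..<1}" for x :: real
    using that abs_square_less_1[of x] by auto
  then show "smooth_on (\<lambda>x. v * inverse (sqrt (1 - x\<^sup>2))) {- 1<..<1::real}"
    by (intro smooth_intros) force+
qed simp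

lemma smooth_on_det [smooth_intros]:
  fixes A :: "'a::real_normed_vector \<Rightarrow> real^'n^'n"
  assumes "open S" "smooth_on A S"
  shows "smooth_on (\<lambda>x. det (A x)) S"
  unfolding det_def using assms by (intro smooth_intros)

lemma matrix_inv_mult:
  fixes A :: "real^'n^'n"
  assumes "det A \<noteq> 0"
  shows "A ** matrix_inv A = mat 1" "matrix_inv A ** A = mat 1"
proof -
  have "\<exists>B. A ** B = mat 1 \<and> B ** A = mat 1"
    using assms unfolding invertible_det_nz[symmetric] invertible_def .
  from someI_ex[OF this] show "A ** matrix_inv A = mat 1" "matrix_inv A ** A = mat 1"
    unfolding matrix_inv_def by simp_all
qed

text \<open>Makes the entries of the inverse quotients of determinants, whose smoothness in the
  matrix is already known.\<close>

lemma matrix_inv_cramer: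
  fixes A :: "real^'n^'n"
  assumes "det A \<noteq> 0"
  shows "matrix_inv A $ k $ j = det (\<chi> i l. if l = k then axis j 1 $ i else A $ i $ l) / det A"
proof -
  have "A *v (matrix_inv A *v axis j 1) = axis j 1"
    using assms by (simp add: matrix_vector_mul_assoc matrix_inv_mult)
  then have "matrix_inv A *v axis j 1 = (\<chi> k. det (\<chi> i l. if l = k then axis j 1 $ i else A $ i $ l) / det A)"
    using cramer[OF assms] by blast
  moreover have "(matrix_inv A *v axis j 1) $ k = matrix_inv A $ k $ j"
    by (simp add: matrix_vector_mult_basis column_def)
  ultimately show ?thesis by simp
qed

lemma smooth_on_matrix_inv [smooth_intros]:
  fixes A :: "'a::real_normed_vector \<Rightarrow> real^'n^'n"
  assumes "open S" "smooth_on A S" "\<And>x. x \<in> S \<Longrightarrow> det (A x) \<noteq> 0"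
  shows "smooth_on (\<lambda>x. matrix_inv (A x)) S"
proof -
  have "smooth_on (\<lambda>x. if l = k then axis j 1 $ i else A x $ i $ l) S" for i j k l
    using assms by (cases "l = k") (auto intro!: smooth_intros)
  then have "smooth_on (\<lambda>x. \<chi> k j. det (\<chi> i l. if l = k then axis j 1 $ i else A x $ i $ l) / det (A x)) S"
    using assms by (intro smooth_intros)
  then show ?thesis
  proof (rule smooth_on_cong[OF assms(1)])
    fix x assume "x \<in> S"
    then show "(\<chi> k j. det (\<chi> i l. if l = k then axis j 1 $ i else A x $ i $ l) / det (A x)) = matrix_inv (A x)"
      using matrix_inv_cramer[OF assms(3)] by (subst vec_eq_iff, subst vec_eq_iff) simp
  qed
qed

subsection \<open>Smooth extensions\<close>

text \<open>The classical flat function \<open>exp (- 1 / t)\<close> times powers of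
  \<open>1 / t\<close>. With all powers included, the linear span of the family is closed under
  differentiation, so one induction over all \<open>n\<close> gives smoothness.\<close>

definition flat_exp :: "nat \<Rightarrow> real \<Rightarrow> real" where
  "flat_exp n t = (if t > 0 then exp (- inverse t) * inverse t ^ n else 0)"

text \<open>With \<open>x = 1 / t\<close>, \<open>exp x\<close> dominates its single series term of
  degree \<open>n + 2\<close>. The quadratic bound makes the difference quotient at 0 tend to
  0.\<close>

lemma flat_exp_le: "\<bar>flat_exp n t\<bar> \<le> fact (n + 2) * t^2"
proof (cases "t > 0")
  case True
  define x where "x = inverse t"
  have x: "x > 0" using True by (simp add: x_def)
  have "x ^ (n+2) / fact (n+2) \<le> exp x"
  proof -
    have s: "summable (\<lambda>n. x ^ n / fact n)" using summable_exp[of x] by (simp add: field_simps)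
    have "(\<Sum>i\<in>{n+2}. x ^ i / fact i) \<le> (\<Sum>i. x ^ i / fact i)"
      using x by (intro sum_le_suminf s) auto
    then show ?thesis by (simp add: exp_def field_simps scaleR_conv_of_real)
  qed
  then have "exp (-x) * x ^ n \<le> fact (n+2) * inverse (x^2)"
  proof -
    have "exp (-x) * x ^ n = (x ^ (n+2) / fact (n+2)) * (exp (-x) * fact (n+2) * inverse (x^2))"
      using x by (simp add: power_add power2_eq_square field_simps del: fact_Suc)
    also have "\<dots> \<le> exp x * (exp (-x) * fact (n+2) * inverse (x^2))"
      using x \<open>x ^ (n+2) / fact (n+2) \<le> exp x\<close> by (intro mult_right_mono) auto
    finally show ?thesis by (simp add: exp_minus field_simps del: fact_Suc)
  qed
  then show ?thesis using True by (simp add: flat_exp_def x_def power_inverse)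
qed (simp add: flat_exp_def)

lemma flat_exp_deriv: "(flat_exp n has_real_derivative flat_exp (n+2) t - n * flat_exp (n+1) t) (at t)"
proof -
  consider "t > 0" | "t < 0" | "t = 0" by linarith
  then show ?thesis
  proof cases
    case 1
    have inv: "(inverse has_real_derivative - (inverse t * inverse t)) (at t)"
      using DERIV_inverse[of t UNIV] 1 by simp
    have "((\<lambda>t. exp (- inverse t) * inverse t ^ n) has_real_derivative
        flat_exp (n+2) t - n * flat_exp (n+1) t) (at t)"
    proof (rule DERIV_cong[OF DERIV_mult[OF DERIV_chain2[OF DERIV_exp DERIV_minus[OF inv]] DERIV_power[OF inv]]])
      show "exp (- inverse t) * - (- (inverse t * inverse t)) * inverse t ^ n
          + of_nat n * (- (inverse t * inverse t) * inverse t ^ (n - Suc 0)) * exp (- inverse t)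
          = flat_exp (n+2) t - n * flat_exp (n+1) t"
        using 1 by (cases n) (simp_all add: flat_exp_def algebra_simps)
    qed
    then show ?thesis
      by (rule has_field_derivative_transform_within[where d=t]) (use 1 in \<open>auto simp: flat_exp_def dist_real_def\<close>)
  next
    case 2
    have "((\<lambda>t. 0) has_real_derivative 0) (at t)" by simp
    then have "(flat_exp n has_real_derivative 0) (at t)"
      by (rule has_field_derivative_transform_within[where d="-t"]) (use 2 in \<open>auto simp: flat_exp_def dist_real_def\<close>)
    then show ?thesis using 2 by (simp add: flat_exp_def)
  next
    case 3
    have "((\<lambda>h. (flat_exp n (0 + h) - flat_exp n 0) / h) \<longlongrightarrow> 0) (at 0)"
    proof (rule Lim_null_comparison[where g="\<lambda>h. fact (n+2) * \<bar>h\<bar>"])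
      show "\<forall>\<^sub>F h in at 0. norm ((flat_exp n (0 + h) - flat_exp n 0) / h) \<le> fact (n + 2) * \<bar>h\<bar>"
        unfolding eventually_at_filter
      proof (intro always_eventually allI impI)
        fix h :: real assume h: "h \<noteq> 0"
        have "\<bar>flat_exp n h\<bar> \<le> fact (n+2) * (\<bar>h\<bar> * \<bar>h\<bar>)"
          using flat_exp_le[of n h] by (simp add: power2_eq_square)
        then have "\<bar>flat_exp n h\<bar> / \<bar>h\<bar> \<le> fact (n+2) * \<bar>h\<bar>"
          using h by (simp add: field_simps del: abs_mult_self_eq)
        then show "norm ((flat_exp n (0 + h) - flat_exp n 0) / h) \<le> fact (n + 2) * \<bar>h\<bar>"
          by (simp add: flat_exp_def[of n 0] abs_divide)
      qed
      show "((\<lambda>h::real. fact (n + 2) * \<bar>h\<bar>) \<longlongrightarrow> 0) (at 0)"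
        by (auto intro!: tendsto_eq_intros)
    qed
    then show ?thesis using 3 by (simp add: DERIV_def flat_exp_def[of _ 0])
  qed
qed

lemma smooth_on_flat_exp: "smooth_on (flat_exp n) UNIV"
proof -
  have "Ck_on k (flat_exp n) UNIV" for k
  proof (induction k arbitrary: n)
    case 0
    have "isCont (flat_exp n) x" for x using flat_exp_deriv DERIV_isCont by blast
    then show ?case by (simp add: continuous_at_imp_continuous_on)
  next
    case (Suc k)
    show ?case
    proof (rule Ck_onI[where D="\<lambda>t v. v * flat_exp (n+2) t + (- (real n * v)) * flat_exp (n+1) t"])
      show "(flat_exp n has_derivative (\<lambda>v. v * flat_exp (n + 2) t + (- (real n * v)) * flat_exp (n + 1) t)) (at t)" for t
      proof -
        have "(\<lambda>v::real. v * flat_exp (n + 2) t + (- (real n * v)) * flat_exp (n + 1) t)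
            = (*) (flat_exp (n+2) t - n * flat_exp (n+1) t)"
          by (simp add: fun_eq_iff algebra_simps)
        then show ?thesis using flat_exp_deriv[of n t] by (simp add: has_field_derivative_def)
      qed
      show "Ck_on k (\<lambda>x. v * flat_exp (n + 2) x + (- (real n * v)) * flat_exp (n + 1) x) UNIV" for v
        by (intro Ck_on_add Ck_on_bounded_linear[OF _ bounded_linear_mult_right] Suc) auto
    qed simp
  qed
  then show ?thesis by (simp add: smooth_on_def)
qed

text \<open>Multiplication by a bump function supported in \<open>S\<close>. Agreement holds only on
  a smaller ball, which suffices because everything to be solved is local.\<close>

lemma smooth_extension:
  fixes f :: "'a::euclidean_space \<Rightarrow> 'b::real_normed_vector"
  assumes "open S" "x0 \<in> S" "smooth_on f S"
  obtains g r where "smooth_on g UNIV" "r > 0" "ball x0 r \<subseteq> S" "\<And>x. x \<in> ball x0 r \<Longrightarrow> g x = f x"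
proof -
  obtain r where r: "r > 0" "cball x0 r \<subseteq> S" using assms(1,2) open_contains_cball by blast
  \<comment> \<open>\<open>s\<close> is the squared distance in units of \<open>r\<close>, a
    polynomial and thus smooth also at the centre. The quotient \<open>B\<close> is 1 where
    \<open>s \<le> 1/4\<close> and 0 where \<open>s \<ge> 1\<close>; its denominator cannot vanish
    because \<open>1 - s\<close> and \<open>s - 1/4\<close> are never both nonpositive.\<close>
  define s where "s = (\<lambda>x. ((x - x0) \<bullet> (x - x0)) / r^2)"
  define B where "B = (\<lambda>x. flat_exp 0 (1 - s x) / (flat_exp 0 (1 - s x) + flat_exp 0 (s x - 1/4)))"
  have pos: "flat_exp 0 t \<ge> 0" "t > 0 \<Longrightarrow> flat_exp 0 t > 0" "t \<le> 0 \<Longrightarrow> flat_exp 0 t = 0" for t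
    by (auto simp: flat_exp_def)
  have ne: "flat_exp 0 (1 - s x) + flat_exp 0 (s x - 1/4) \<noteq> 0" for x
  proof (cases "s x < 1")
    case True
    then show ?thesis using pos(1)[of "s x - 1/4"] pos(2)[of "1 - s x"] by linarith
  next
    case False
    then show ?thesis using pos(1)[of "1 - s x"] pos(2)[of "s x - 1/4"] by linarith
  qed
  have s: "smooth_on s UNIV" unfolding s_def using r by (intro smooth_intros) auto
  have F: "smooth_on (\<lambda>x. flat_exp 0 (h x)) UNIV" if "smooth_on h UNIV" for h :: "'a \<Rightarrow> real"
    by (rule smooth_on_compose[OF open_UNIV open_UNIV subset_UNIV smooth_on_flat_exp that])
  have B: "smooth_on B UNIV"
    unfolding B_def using ne by (intro smooth_intros F s) auto
  have sd: "s x = (dist x x0 / r)^2" for x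
    by (simp add: s_def dist_norm power_divide power2_norm_eq_inner)
  have B0: "B x = 0" if "x \<notin> cball x0 r" for x
  proof -
    have "dist x x0 / r > 1" using that r by (simp add: dist_commute)
    then have "s x > 1" unfolding sd by (simp only: one_less_power zero_less_numeral)
    then show ?thesis by (simp add: B_def pos)
  qed
  have B1: "B x = 1" if "x \<in> ball x0 (r/2)" for x
  proof -
    have "dist x x0 / r \<le> 1/2" using that r by (simp add: dist_commute field_simps)
    then have "s x \<le> (1/2)^2" unfolding sd using r by (intro power_mono) auto
    then have "s x \<le> 1/4" by (simp add: power2_eq_square)
    then show ?thesis using ne[of x] by (simp add: B_def pos(3))
  qed
  define g where "g = (\<lambda>x. if x \<in> S then B x *\<^sub>R f x else 0)"
  \<comment> \<open>\<open>S\<close> and the complement of the closed ball are open and cover the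
    space, and \<open>g\<close> vanishes on the latter.\<close>
  have "smooth_on g UNIV"
  proof (rule smooth_on_localI)
    fix x
    show "\<exists>T. open T \<and> x \<in> T \<and> smooth_on g T"
    proof (cases "x \<in> S")
      case True
      have "smooth_on (\<lambda>x. B x *\<^sub>R f x) S"
        using assms smooth_on_subset[OF B] by (intro smooth_intros) auto
      then have "smooth_on g S" by (rule smooth_on_cong[OF assms(1)]) (simp add: g_def)
      then show ?thesis using True assms(1) by blast
    next
      case False
      have "smooth_on (\<lambda>_::'a. 0::'b) (- cball x0 r)" by (intro smooth_intros) auto
      then have "smooth_on g (- cball x0 r)" 
        by (rule smooth_on_cong[rotated]) (auto simp: g_def B0 simp del: mem_cball)
      then show ?thesis using False r(2) by (intro exI[of _ "- cball x0 r"]) auto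
    qed
  qed
  moreover have "ball x0 (r/2) \<subseteq> S" using r by auto
  moreover have "g x = f x" if "x \<in> ball x0 (r/2)" for x
    using that B1[OF that] calculation(2) by (auto simp: g_def)
  ultimately show thesis using that[of g "r/2"] r(1) by simp
qed

subsection \<open>Fourier series of smooth periodic functions\<close>

text \<open>The character \<open>exp (i k . x)\<close> of the torus with period
  \<open>2 pi\<close>.\<close>

definition wave :: "('m::finite \<Rightarrow> int) \<Rightarrow> real^'m \<Rightarrow> complex" where
  "wave k x = cis (\<Sum>i\<in>UNIV. of_int (k i) * x $ i)"

definition periodic :: "(real^'m::finite \<Rightarrow> 'b) \<Rightarrow> bool" where
  "periodic f \<longleftrightarrow> (\<forall>x i. f (x + axis i (2*pi)) = f x)"

text \<open>For periodic arguments this is the integral over the torus with respect to its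
  normalised Haar measure.\<close>

definition mean :: "(real^'m::finite \<Rightarrow> complex) \<Rightarrow> complex" where
  "mean f = inverse ((2*pi) ^ CARD('m)) *\<^sub>R integral (cbox 0 (\<chi> i. 2*pi)) f"

lemma wave_simps:
  "wave 0 x = 1" "wave (k + l) x = wave k x * wave l x" "wave k (x + y) = wave k x * wave k y"
  "cnj (wave k x) = wave (- k) x" "norm (wave k x) = 1" "wave k 0 = 1"
  by (simp_all add: wave_def cis_mult cis_cnj sum.distrib algebra_simps sum_negf)

lemma wave_axis: "wave k (axis i t) = cis (of_int (k i) * t)"
proof -
  have "(\<Sum>j\<in>UNIV. of_int (k j) * axis i t $ j) = (\<Sum>j\<in>UNIV. if j = i then of_int (k i) * t else 0)"
    by (intro sum.cong) (auto simp: axis_def)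
  then show ?thesis by (simp add: wave_def)
qed

lemma continuous_on_wave [continuous_intros]: "continuous_on S (wave k)"
  unfolding wave_def by (intro continuous_intros)

lemma periodic_wave: "periodic (wave k)"
proof -
  have "cis (of_int j * (2 * pi)) = 1" for j
    using cis_multiple_2pi[of "of_int j"] by (simp add: mult.commute mult.left_commute)
  then show ?thesis by (simp add: periodic_def wave_simps wave_axis)
qed

lemma periodic_int:
  assumes "periodic f"
  shows "f (x + axis i (2*pi * of_int n)) = f x"
proof -
  have *: "f (x + axis i (2*pi * real n)) = f x" for x n
  proof (induction n)
    case 0
    have "x + axis i (2*pi * real 0) = x" by (simp add: axis_def vec_eq_iff)
    then show ?case by (rule arg_cong)
  next
    case (Suc n)
    have "x + axis i (2*pi * real (Suc n)) = (x + axis i (2*pi * real n)) + axis i (2*pi)"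
      by (simp add: axis_def vec_eq_iff algebra_simps)
    then show ?case using Suc assms unfolding periodic_def by metis
  qed
  show ?thesis
  proof (cases n rule: int_cases2)
    case (nonneg k)
    then show ?thesis using * by simp
  next
    case (nonpos k)
    have "x = (x + axis i (2*pi * of_int n)) + axis i (2*pi * real k)"
      using nonpos by (simp add: axis_def vec_eq_iff)
    then show ?thesis using * by metis
  qed
qed

lemma sum_axis_eq: "(\<Sum>i\<in>UNIV. axis i (c i)) = (\<chi> i. (c i :: real))"
proof -
  have "(\<Sum>i\<in>UNIV. axis i (c i) $ j) = (\<Sum>i\<in>UNIV. if i = j then c j else 0)" for j
    by (intro sum.cong) (auto simp: axis_def)
  then show ?thesis by (simp add: vec_eq_iff)
qed

lemma periodic_lattice:
  assumes "periodic f"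
  shows "f (x + (\<chi> i. 2*pi * of_int (n i))) = f x"
proof -
  have "f (x + (\<Sum>i\<in>S. axis i (2*pi * of_int (n i)))) = f x" if "finite S" for S x
    using that
  proof (induction S arbitrary: x)
    case (insert j S)
    have "f (x + (\<Sum>i\<in>insert j S. axis i (2*pi * of_int (n i))))
        = f ((x + axis j (2*pi * of_int (n j))) + (\<Sum>i\<in>S. axis i (2*pi * of_int (n i))))"
      using insert(1,2) by (simp add: add.assoc)
    then show ?case using insert(3) periodic_int[OF assms] by simp
  qed simp
  from this[of UNIV] show ?thesis by (simp add: sum_axis_eq)
qed

lemma periodic_reduce:
  fixes x :: "real^'m"
  obtains n :: "'m \<Rightarrow> int" and y where "y = x + (\<chi> i. 2*pi * of_int (n i))" "\<And>i. \<bar>y $ i\<bar> \<le> pi"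
proof -
  define n where "n = (\<lambda>i. - round (x $ i / (2*pi)))"
  have "\<bar>x $ i + 2*pi * of_int (n i)\<bar> \<le> pi" for i
  proof -
    have "\<bar>of_int (round (x $ i / (2*pi))) - x $ i / (2*pi)\<bar> \<le> 1/2" by (rule of_int_round_abs_le)
    then have "\<bar>x $ i / (2*pi) + of_int (n i)\<bar> \<le> 1/2" by (simp add: n_def abs_minus_commute)
    moreover have "x $ i + 2*pi * of_int (n i) = 2*pi * (x $ i / (2*pi) + of_int (n i))"
      by (simp add: field_simps)
    ultimately show ?thesis by (simp add: abs_mult)
  qed
  then show thesis using that[of "x + (\<chi> i. 2*pi * of_int (n i))" n] by simp
qed

lemma periodic_bounded:
  fixes f :: "real^'m \<Rightarrow> 'b::real_normed_vector"
  assumes "continuous_on UNIV f" "periodic f"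
  obtains B where "B \<ge> 0" "\<And>x. norm (f x) \<le> B"
proof -
  have "compact (f ` cbox (\<chi> i. - pi) (\<chi> i. pi))"
    using assms(1) by (intro compact_continuous_image) (auto intro: continuous_on_subset)
  then obtain B where B: "\<And>y. y \<in> cbox (\<chi> i. - pi) (\<chi> i. pi) \<Longrightarrow> norm (f y) \<le> B"
    using compact_imp_bounded bounded_iff by (metis imageI)
  have "norm (f x) \<le> B" for x
  proof -
    obtain n and y where y: "y = x + (\<chi> i. 2*pi * of_int (n i))" "\<And>i. \<bar>y $ i\<bar> \<le> pi"
      using periodic_reduce[of x] by blast
    have "y \<in> cbox (\<chi> i. - pi) (\<chi> i. pi)" using y(2) by (simp add: mem_box_cart abs_le_iff minus_le_iff)
    then show ?thesis using B periodic_lattice[OF assms(2), of x n] y(1) by metis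
  qed
  moreover from this[of 0] have "B \<ge> 0" using norm_ge_zero order_trans by blast
  ultimately show thesis using that by blast
qed

lemma periodic_mult: "periodic f \<Longrightarrow> periodic g \<Longrightarrow> periodic (\<lambda>x. f x * g x)"
  by (simp add: periodic_def)

lemma periodic_shift: "periodic f \<Longrightarrow> periodic (\<lambda>x. f (x + c))"
  unfolding periodic_def by (metis add.assoc add.commute)

lemma mean_const [simp]: "mean (\<lambda>_::real^'m. c) = c"
proof -
  define P :: real where "P = (2*pi) ^ CARD('m)"
  have "P \<noteq> 0" by (simp add: P_def)
  moreover have "measure lborel (cbox 0 (\<chi> i. 2*pi) :: (real^'m) set) = P"
    unfolding P_def by (subst content_cbox_cart) (auto simp: interval_ne_empty_cart)
  ultimately show ?thesis
    unfolding mean_def P_def[symmetric] integral_const by simp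
qed

lemma integrable_cell: "continuous_on UNIV (f :: real^'m \<Rightarrow> 'b::banach) \<Longrightarrow> f integrable_on cbox a b"
  by (rule integrable_continuous) (auto intro: continuous_on_subset)

lemma mean_add: "continuous_on UNIV f \<Longrightarrow> continuous_on UNIV g \<Longrightarrow> mean (\<lambda>x. f x + g x) = mean f + mean g"
  by (simp add: mean_def integral_add integrable_cell scaleR_add_right)

lemma mean_diff: "continuous_on UNIV f \<Longrightarrow> continuous_on UNIV g \<Longrightarrow> mean (\<lambda>x. f x - g x) = mean f - mean g"
  by (simp add: mean_def integral_diff integrable_cell scaleR_diff_right)

lemma mean_cmult: "mean (\<lambda>x. c * f x) = c * mean f"
  by (simp add: mean_def)

lemma mean_sum:
  "(\<And>i. i \<in> I \<Longrightarrow> continuous_on UNIV (f i)) \<Longrightarrow> mean (\<lambda>x. \<Sum>i\<in>I. f i x) = (\<Sum>i\<in>I. mean (f i))"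
  by (induction I rule: infinite_finite_induct) (auto simp: mean_add continuous_on_sum)

lemma mean_norm_le:
  assumes "continuous_on UNIV f" "continuous_on UNIV h" "\<And>x. norm (f x) \<le> h x"
  shows "norm (mean f) \<le> Re (mean (\<lambda>x. of_real (h x)))"
proof -
  have "norm (integral (cbox 0 (\<chi> i. 2*pi)) f) \<le> integral (cbox 0 (\<chi> i. 2*pi)) h"
    by (intro integral_norm_bound_integral integrable_cell assms)
  moreover have "integral (cbox 0 (\<chi> i. 2*pi)) (\<lambda>x. complex_of_real (h x)) = of_real (integral (cbox 0 (\<chi> i. 2*pi)) h)"
    using integral_linear[OF integrable_cell[OF assms(2)] bounded_linear_of_real[where 'a=complex]]
    by (simp add: o_def)
  ultimately show ?thesis by (simp add: mean_def mult_left_mono)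
qed

lemma mean_norm_le_const:
  assumes "continuous_on UNIV f" "\<And>x. norm (f x) \<le> B"
  shows "norm (mean f) \<le> B"
  using mean_norm_le[of f "\<lambda>_. B"] assms by simp

text \<open>The shifted cell sticks out beyond the hyperplane \<open>x_i = 2 pi\<close> in a slab of
  width \<open>h\<close>. Moved back by one period, the slab fills exactly the part of the original
  cell that the shift uncovered; \<open>h \<le> 2 pi\<close> keeps it inside one period.\<close>

lemma mean_shift_axis:
  fixes f :: "real^'m \<Rightarrow> complex"
  assumes f: "continuous_on UNIV f" "periodic f" and h: "0 \<le> h" "h \<le> 2*pi"
  shows "mean (\<lambda>x. f (x + axis i h)) = mean f"
proof -
  let ?b = "\<chi> i. 2*pi :: real^'m" and ?c = "axis i h :: real^'m" and ?k = "axis i 1 :: real^'m"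
  let ?I = "\<lambda>a b. integral (cbox a b) f"
  have k: "?k \<in> Basis" by simp
  have box: "x \<in> cbox a b \<longleftrightarrow> (\<forall>j. a $ j \<le> x $ j \<and> x $ j \<le> b $ j)" for a b x :: "real^'m"
    by (simp add: mem_box_cart)
  have ax: "axis i t $ j = (if j = i then t else 0)" for t :: real and j by (auto simp: axis_def)
  have s1: "cbox ?c (?b + ?c) \<inter> {x. x \<bullet> ?k \<le> 2*pi} = cbox ?c ?b"
    using h by (auto simp: box inner_axis ax) (smt (verit))+
  have s2: "cbox ?c (?b + ?c) \<inter> {x. x \<bullet> ?k \<ge> 2*pi} = cbox (axis i (2*pi)) (?b + ?c)"
    using h by (auto simp: box inner_axis ax) (smt (verit))+
  have s3: "cbox 0 ?b \<inter> {x. x \<bullet> ?k \<ge> h} = cbox ?c ?b"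
    using h by (auto simp: box inner_axis ax) (smt (verit))+
  have s4: "cbox 0 ?b \<inter> {x. x \<bullet> ?k \<le> h} = cbox 0 (?b + ?c - axis i (2*pi))"
    using h by (auto simp: box inner_axis ax) (smt (verit))+
  have "integral (cbox 0 ?b) (\<lambda>x. f (x + ?c)) = ?I ?c (?b + ?c)"
    using integral_shift_cbox[of ?c ?c "?b + ?c" f] by simp
  also have "\<dots> = ?I ?c ?b + ?I (axis i (2*pi)) (?b + ?c)"
    using integral_split[OF integrable_cell[OF f(1)] k, of ?c "?b + ?c" "2*pi"] by (simp only: s1 s2)
  also have "?I (axis i (2*pi)) (?b + ?c) = integral (cbox 0 (?b + ?c - axis i (2*pi))) (\<lambda>x. f (x + axis i (2*pi)))"
    using integral_shift_cbox[of "axis i (2*pi)" "axis i (2*pi)" "?b + ?c" f] by simp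
  also have "\<dots> = ?I 0 (?b + ?c - axis i (2*pi))"
    using f(2) by (simp add: periodic_def)
  also have "?I ?c ?b + \<dots> = ?I 0 ?b"
    using integral_split[OF integrable_cell[OF f(1)] k, of 0 ?b h] by (simp only: s3 s4 add.commute)
  finally show ?thesis by (simp add: mean_def)
qed

lemma mean_shift:
  fixes f :: "real^'m \<Rightarrow> complex"
  assumes f: "continuous_on UNIV f" "periodic f"
  shows "mean (\<lambda>x. f (x + c)) = mean f"
proof -
  have *: "mean (\<lambda>x. f (x + axis i t)) = mean f"
    if f: "continuous_on UNIV f" "periodic f" for f :: "real^'m \<Rightarrow> complex" and i t
  proof -
    \<comment> \<open>The shift is reduced modulo \<open>2 pi\<close> to the range covered by
      \<open>mean_shift_axis\<close>.\<close>
    define h where "h = t + 2*pi * of_int (- \<lfloor>t / (2*pi)\<rfloor>)"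
    have "of_int \<lfloor>t / (2*pi)\<rfloor> \<le> t / (2*pi)" "t / (2*pi) \<le> of_int \<lfloor>t / (2*pi)\<rfloor> + 1" by linarith+
    then have "2*pi * of_int \<lfloor>t / (2*pi)\<rfloor> \<le> 2*pi * (t / (2*pi))" "2*pi * (t / (2*pi)) \<le> 2*pi * (of_int \<lfloor>t / (2*pi)\<rfloor> + 1)"
      by (simp_all only: mult_left_mono pi_ge_zero mult_nonneg_nonneg zero_le_numeral)
    then have h: "0 \<le> h" "h \<le> 2*pi" by (simp_all add: h_def algebra_simps)
    have "x + axis i h = (x + axis i t) + axis i (2*pi * of_int (- \<lfloor>t / (2*pi)\<rfloor>))" for x
      by (simp add: h_def axis_def vec_eq_iff)
    then have "(\<lambda>x. f (x + axis i t)) = (\<lambda>x. f (x + axis i h))"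
      using periodic_int[OF f(2)] by metis
    then show ?thesis using mean_shift_axis[OF f h] by simp
  qed
  have "mean (\<lambda>x. f (x + (\<Sum>i\<in>S. axis i (c $ i)))) = mean f" if "finite S" for S
    using that
  proof (induction S)
    case (insert j S)
    let ?g = "\<lambda>x. f (x + (\<Sum>i\<in>S. axis i (c $ i)))"
    have "continuous_on UNIV ?g"
      using f(1) by (intro continuous_on_compose2[OF f(1)] continuous_intros) auto
    then have "mean (\<lambda>x. ?g (x + axis j (c $ j))) = mean ?g"
      using f(2) periodic_shift by (intro *) auto
    moreover have "?g (x + axis j (c $ j)) = f (x + (\<Sum>i\<in>insert j S. axis i (c $ i)))" for x
      using insert(1,2) by (simp add: add.assoc)
    ultimately show ?case using insert(3) by simp
  qed simp
  from this[of UNIV] show ?thesis by (simp add: sum_axis_eq)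
qed

text \<open>If \<open>k i \<noteq> 0\<close>, a shift by \<open>pi / k i\<close> along axis
  \<open>i\<close> negates the wave, so its mean equals its own negative.\<close>

lemma mean_wave: "mean (wave k) = (if k = 0 then 1 else 0)"
proof (cases "k = 0")
  case True
  then have "wave k = (\<lambda>_. 1)" using wave_simps(1) by blast
  then show ?thesis using True by simp
next
  case False
  then obtain i where i: "k i \<noteq> 0" by (auto simp: fun_eq_iff)
  have "wave k (x + axis i (pi / of_int (k i))) = - 1 * wave k x" for x
    using i by (simp add: wave_simps wave_axis)
  then have "- 1 * mean (wave k) = mean (wave k)"
    using mean_shift[OF continuous_on_wave periodic_wave, of k "axis i (pi / of_int (k i))"]
    by (simp only: mean_cmult)
  then show ?thesis using False by simp
qed

text \<open>By the Weierstrass test the series converges uniformly along the finite index sets, so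
  summation and mean commute.\<close>

lemma mean_has_sum:
  fixes h :: "'k \<Rightarrow> real^'m \<Rightarrow> complex"
  assumes c: "\<And>k. continuous_on UNIV (h k)" and b: "\<And>k x. norm (h k x) \<le> b k" "b summable_on UNIV"
  shows "((\<lambda>k. mean (h k)) has_sum mean (\<lambda>x. \<Sum>\<^sub>\<infinity>k. h k x)) UNIV"
    and "continuous_on UNIV (\<lambda>x. \<Sum>\<^sub>\<infinity>k. h k x)"
proof -
  let ?F = "finite_subsets_at_top UNIV :: 'k set filter" and ?g = "\<lambda>x. \<Sum>\<^sub>\<infinity>k. h k x"
  have u: "uniform_limit UNIV (\<lambda>X y. \<Sum>x\<in>X. h x y) ?g ?F"
    using b by (intro Weierstrass_m_test_general)
  have cs: "continuous_on A (\<lambda>y. \<Sum>x\<in>X. h x y)" for A X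
    using c by (intro continuous_on_sum) (auto intro: continuous_on_subset)
  show g: "continuous_on UNIV ?g"
    by (rule uniform_limit_theorem[OF _ u]) (auto simp: cs)
  obtain I J where I: "\<And>X. ((\<lambda>y. \<Sum>x\<in>X. h x y) has_integral I X) (cbox 0 (\<chi> i. 2*pi))"
    and J: "(?g has_integral J) (cbox 0 (\<chi> i. 2*pi))" and lim: "(I \<longlongrightarrow> J) ?F"
    using uniform_limit_integral_cbox[OF uniform_limit_on_subset[OF u subset_UNIV] cs finite_subsets_at_top_neq_bot]
    by blast
  have "inverse ((2*pi) ^ CARD('m)) *\<^sub>R I X = (\<Sum>k\<in>X. mean (h k))" for X
    using integral_unique[OF I[of X]] mean_sum[of X h] c by (simp add: mean_def)
  moreover have "inverse ((2*pi) ^ CARD('m)) *\<^sub>R J = mean ?g"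
    using integral_unique[OF J] by (simp add: mean_def)
  ultimately show "((\<lambda>k. mean (h k)) has_sum mean ?g) UNIV"
    using tendsto_scaleR[OF tendsto_const lim, of "inverse ((2*pi) ^ CARD('m))"]
    unfolding has_sum_def by simp
qed

text \<open>The mean of a translate does not depend on the translation; differentiating under the
  integral at translation 0 gives the claim. This replaces integration by parts over the cell with
  its boundary terms.\<close>

lemma mean_partial_zero:
  fixes f :: "real^'m \<Rightarrow> complex"
  assumes f: "periodic f" "\<And>x. (f has_derivative f' x) (at x)"
    and c: "continuous_on UNIV (\<lambda>x. f' x (axis i 1))"
  shows "mean (\<lambda>x. f' x (axis i 1)) = 0"
proof -
  let ?e = "axis i 1 :: real^'m" and ?C = "cbox 0 (\<chi> i. 2*pi) :: (real^'m) set"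
  have cf: "continuous_on UNIV f"
    using f(2) has_derivative_continuous by (metis continuous_at_imp_continuous_on)
  have "((\<lambda>t. integral ?C (\<lambda>x. f (x + t *\<^sub>R ?e))) has_vector_derivative
      integral ?C (\<lambda>x. f' (x + 0 *\<^sub>R ?e) ?e)) (at 0 within UNIV)"
  proof (rule leibniz_rule_vector_derivative)
    fix t x
    have "((\<lambda>t. x + t *\<^sub>R ?e) has_vector_derivative ?e) (at t)"
      by (auto intro!: derivative_eq_intros)
    then have "((\<lambda>t. x + t *\<^sub>R ?e) has_derivative (\<lambda>s. s *\<^sub>R ?e)) (at t)"
      by (simp add: has_vector_derivative_def)
    from has_derivative_compose[OF this f(2)]
    have "((\<lambda>t. f (x + t *\<^sub>R ?e)) has_derivative (\<lambda>s. f' (x + t *\<^sub>R ?e) (s *\<^sub>R ?e))) (at t)" .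
    moreover have "f' (x + t *\<^sub>R ?e) (s *\<^sub>R ?e) = s *\<^sub>R f' (x + t *\<^sub>R ?e) ?e" for s
      using f(2)[THEN has_derivative_linear] by (simp add: linear_scale)
    ultimately show "((\<lambda>t. f (x + t *\<^sub>R ?e)) has_vector_derivative f' (x + t *\<^sub>R ?e) ?e) (at t within UNIV)"
      by (simp add: has_vector_derivative_def)
  next
    show "(\<lambda>x. f (x + t *\<^sub>R ?e)) integrable_on ?C" for t
      by (intro integrable_cell continuous_on_compose2[OF cf] continuous_intros) auto
    show "continuous_on (UNIV \<times> ?C) (\<lambda>(t, x). f' (x + t *\<^sub>R ?e) ?e)"
      unfolding split_def by (intro continuous_on_compose2[OF c] continuous_intros) auto
  qed auto
  moreover have "integral ?C (\<lambda>x. f (x + t *\<^sub>R ?e)) = integral ?C f" for t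
    using mean_shift[OF cf f(1), of "t *\<^sub>R ?e"] by (simp add: mean_def)
  ultimately have "integral ?C (\<lambda>x. f' x ?e) = 0"
    using vector_derivative_unique_at[OF _ has_vector_derivative_const] by fastforce
  then show ?thesis by (simp add: mean_def)
qed

section \<open>The Fejer kernel and the uniqueness of Fourier coefficients\<close>

definition fejer_box :: "nat \<Rightarrow> ('m::finite \<Rightarrow> int) set" where
  "fejer_box n = PiE UNIV (\<lambda>_. {0..<int n})"

text \<open>The product of the one-dimensional Fejer kernels. As the normalised square of a modulus
  it is visibly nonnegative, and multiplying out leaves only waves with frequencies
  \<open>j - l\<close> from the box.\<close>

definition fejer :: "nat \<Rightarrow> real^'m::finite \<Rightarrow> real" where
  "fejer n y = (norm (\<Sum>j\<in>fejer_box n. wave j y))\<^sup>2 / n ^ CARD('m)"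

lemma finite_fejer_box: "finite (fejer_box n :: ('m::finite \<Rightarrow> int) set)"
  unfolding fejer_box_def by (intro finite_PiE) auto

lemma fejer_expand:
  "of_real (fejer n y) = inverse (of_nat n ^ CARD('m)) *
     (\<Sum>j\<in>fejer_box n. \<Sum>l\<in>fejer_box n. wave (j - l) (y :: real^'m::finite))"
proof -
  have "of_real ((norm (\<Sum>j\<in>fejer_box n. wave j y))\<^sup>2)
      = (\<Sum>j\<in>fejer_box n. wave j y) * cnj (\<Sum>j\<in>fejer_box n. wave j y)"
    by (rule complex_norm_square)
  also have "\<dots> = (\<Sum>j\<in>fejer_box n. \<Sum>l\<in>fejer_box n. wave (j - l) y)"
    unfolding cnj_sum sum_product wave_simps(4) by (simp flip: wave_simps(2))
  finally show ?thesis by (simp add: fejer_def divide_inverse)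
qed

lemma continuous_on_fejer: "continuous_on S (fejer n)"
  unfolding fejer_def divide_inverse by (intro continuous_intros)

lemma mean_fejer:
  assumes h: "continuous_on UNIV h"
  shows "mean (\<lambda>y::real^'m::finite. h y * of_real (fejer n y)) = inverse (of_nat n ^ CARD('m)) *
     (\<Sum>j\<in>fejer_box n. \<Sum>l\<in>fejer_box n. mean (\<lambda>y. h y * wave (j - l) y))"
proof -
  have "(\<lambda>y. h y * of_real (fejer n y)) = (\<lambda>y::real^'m. inverse (of_nat n ^ CARD('m)) *
     (\<Sum>j\<in>fejer_box n. \<Sum>l\<in>fejer_box n. h y * wave (j - l) y))"
    by (simp add: fejer_expand sum_distrib_left mult.left_commute fun_eq_iff)
  then show ?thesis
    by (simp only: mean_cmult) (simp add: mean_sum h continuous_intros)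
qed

text \<open>Orthogonality of the waves reduces both means to counting pairs in the box: the diagonal
  pairs in the first case, and in the second those \<open>j\<close> whose unit step in direction
  \<open>i\<close> stays in the box, a fraction \<open>(n - 1) / n\<close>.\<close>

lemma mean_fejer_wave_axis:
  assumes "n > 0"
  shows "mean (\<lambda>y::real^'m::finite. of_real (fejer n y)) = 1"
    and "mean (\<lambda>y::real^'m. wave (\<lambda>j. if j = i then 1 else 0) y * of_real (fejer n y)) = of_real (1 - 1 / n)"
proof -
  let ?Q = "fejer_box n :: ('m \<Rightarrow> int) set" and ?d = "\<lambda>j. if j = i then 1 else 0 :: int"
  have card: "card ?Q = n ^ CARD('m)" unfolding fejer_box_def by (simp add: card_PiE)
  have "mean (\<lambda>y::real^'m. of_real (fejer n y)) = inverse (of_nat n ^ CARD('m)) *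
     (\<Sum>j\<in>?Q. \<Sum>l\<in>?Q. if l = j then 1 else 0)"
  proof -
    have "mean (\<lambda>y::real^'m. 1 * wave (j - l) y) = (if l = j then 1 else 0)" for j l :: "'m \<Rightarrow> int"
      by (simp add: mean_wave)
    then show ?thesis using mean_fejer[of "\<lambda>_::real^'m. 1" n] by simp
  qed
  then show "mean (\<lambda>y::real^'m. of_real (fejer n y)) = 1"
    using assms by (simp add: finite_fejer_box card)
  have "mean (\<lambda>y. wave ?d y * of_real (fejer n y)) = inverse (of_nat n ^ CARD('m)) *
     (\<Sum>j\<in>?Q. \<Sum>l\<in>?Q. if l = j + ?d then 1 else 0)"
  proof -
    have "mean (\<lambda>y::real^'m. wave ?d y * wave (j - l) y) = (if l = j + ?d then 1 else 0)" for j l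
    proof -
      have "?d + (j - l) = 0 \<longleftrightarrow> l = j + ?d" by (auto simp: algebra_simps)
      then show ?thesis using mean_wave[of "?d + (j - l)"] by (simp flip: wave_simps(2))
    qed
    then show ?thesis using mean_fejer[of "wave ?d" n] by (simp add: continuous_intros)
  qed
  also have "(\<Sum>j\<in>?Q. \<Sum>l\<in>?Q. if l = j + ?d then 1 else 0) = (\<Sum>j\<in>?Q. if j + ?d \<in> ?Q then 1 else 0 :: complex)"
    by (simp add: finite_fejer_box)
  also have "\<dots> = of_nat (card {j \<in> ?Q. j + ?d \<in> ?Q})"
    by (simp add: finite_fejer_box sum.If_cases Int_def)
  also have "{j \<in> ?Q. j + ?d \<in> ?Q} = PiE UNIV (\<lambda>j. if j = i then {0..<int n - 1} else {0..<int n})"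
    by (auto simp: fejer_box_def PiE_iff split: if_splits) (smt (verit))+
  also have "card \<dots> = (n - 1) * n ^ (CARD('m) - 1)"
  proof -
    have "card (PiE UNIV (\<lambda>j. if j = i then {0..<int n - 1} else {0..<int n}))
        = (\<Prod>j\<in>UNIV. if j = i then n - 1 else n)"
      by (subst card_PiE) (auto intro!: prod.cong)
    also have "\<dots> = (n - 1) * (\<Prod>j\<in>UNIV - {i}. n)"
      by (subst prod.remove[of UNIV i]) (auto intro!: prod.cong)
    finally show ?thesis by (simp add: card_Diff_singleton)
  qed
  finally have *: "mean (\<lambda>y::real^'m. wave ?d y * of_real (fejer n y))
     = inverse (of_nat n ^ CARD('m)) * of_nat ((n - 1) * n ^ (CARD('m) - 1))" .
  have "(of_nat n :: complex) ^ CARD('m) = of_nat n * of_nat n ^ (CARD('m) - 1)"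
    by (simp flip: power_Suc)
  then show "mean (\<lambda>y::real^'m. wave ?d y * of_real (fejer n y)) = of_real (1 - 1 / n)"
    using assms unfolding * by (simp add: of_nat_diff field_simps)
qed

text \<open>Near \<open>y = 0\<close>, modulo the periods, continuity gives \<open>\<eta>\<close>;
  elsewhere some \<open>1 - cos (y $ i)\<close> is bounded below and a large \<open>C\<close>
  absorbs twice a bound of \<open>g\<close>. The majorant is a trigonometric polynomial, so its mean
  against the Fejer kernel is explicit.\<close>

lemma korovkin_bound:
  fixes g :: "real^'m \<Rightarrow> complex"
  assumes g: "continuous_on UNIV g" "periodic g" and "\<eta> > 0"
  obtains C where "C \<ge> 0" "\<And>y. norm (g (x + y) - g x) \<le> \<eta> + C * (\<Sum>i\<in>UNIV. 1 - cos (y $ i))"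
proof -
  obtain B where B: "B \<ge> 0" "\<And>x. norm (g x) \<le> B" using periodic_bounded[OF g] by blast
  obtain \<delta> where \<delta>: "\<delta> > 0" "\<And>z. dist z x < \<delta> \<Longrightarrow> dist (g z) (g x) < \<eta>"
    using g(1) assms(3) unfolding continuous_on_iff by (metis UNIV_I)
  \<comment> \<open>\<open>CARD('m)\<close> coordinates of modulus below \<open>d\<close> add up to
    at most \<open>\<delta> / 2\<close>; \<open>d \<le> pi\<close> keeps the cosine
    monotone.\<close>
  define d where "d = min pi (\<delta> / (2 * CARD('m)))"
  have d: "0 < d" "d \<le> pi" using \<delta>(1) by (auto simp: d_def)
  have cd: "1 - cos d > 0" using cos_monotone_0_pi[of 0 d] d by simp
  define C where "C = 2 * B / (1 - cos d)"
  have C0: "C \<ge> 0" using B cd by (simp add: C_def)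
  have "norm (g (x + y) - g x) \<le> \<eta> + C * (\<Sum>i\<in>UNIV. 1 - cos (y $ i))" for y
  proof -
    obtain n and z where z: "z = y + (\<chi> i. 2*pi * of_int (n i))" "\<And>i. \<bar>z $ i\<bar> \<le> pi"
      using periodic_reduce[of y] by blast
    have gz: "g (x + y) = g (x + z)"
      using periodic_lattice[OF g(2), of "x + y" n] by (simp add: z(1) add.assoc)
    have cz: "cos (y $ i) = cos (z $ i)" for i
      using cos_int_2pin[of "n i"] sin_int_2pin[of "n i"] by (simp add: z(1) cos_add)
    have nn: "0 \<le> 1 - cos (z $ i)" for i by simp
    show ?thesis
    proof (cases "\<forall>i. \<bar>z $ i\<bar> < d")
      case True
      have "norm z \<le> (\<Sum>i\<in>UNIV. \<bar>z $ i\<bar>)" by (rule norm_le_l1_cart)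
      also have "\<dots> \<le> (\<Sum>i\<in>(UNIV::'m set). \<delta> / (2 * CARD('m)))"
        using True by (intro sum_mono) (auto simp: d_def less_imp_le)
      also have "\<dots> < \<delta>" using \<delta>(1) by simp
      finally have "dist (g (x + z)) (g x) < \<eta>" using \<delta>(2)[of "x + z"] by (simp add: dist_norm)
      moreover have "0 \<le> C * (\<Sum>i\<in>UNIV. 1 - cos (z $ i))" using C0 nn by (intro mult_nonneg_nonneg sum_nonneg)
      ultimately show ?thesis by (simp add: gz cz dist_norm)
    next
      case False
      then obtain i where i: "d \<le> \<bar>z $ i\<bar>" by (auto simp: not_less)
      have "cos \<bar>z $ i\<bar> \<le> cos d" using i z(2)[of i] d by (intro cos_monotone_0_pi_le) auto
      then have "1 - cos d \<le> 1 - cos (z $ i)" by simp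
      also have "\<dots> \<le> (\<Sum>i\<in>UNIV. 1 - cos (z $ i))" using nn by (intro member_le_sum) auto
      finally have "C * (1 - cos d) \<le> C * (\<Sum>i\<in>UNIV. 1 - cos (z $ i))" using C0 by (rule mult_left_mono)
      moreover have "C * (1 - cos d) = 2 * B" using cd by (simp add: C_def)
      moreover have "norm (g (x + z) - g x) \<le> B + B" using B(2) by (meson add_mono norm_triangle_le_diff)
      ultimately show ?thesis using assms(3) by (simp add: gz cz)
    qed
  qed
  then show thesis using that C0 by blast
qed

text \<open>Korovkin's argument: the mean of \<open>g (x + y)\<close> against the Fejer kernel is a
  combination of Fourier coefficients and vanishes, while the kernel has mass 1 and concentrates at
  0, so that this mean approximates \<open>g x\<close>.\<close>

lemma fourier_unique:
  fixes g :: "real^'m \<Rightarrow> complex"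
  assumes g: "continuous_on UNIV g" "periodic g" and z: "\<And>k. mean (\<lambda>x. g x * wave k x) = 0"
  shows "g x = 0"
proof -
  have cx: "continuous_on UNIV (\<lambda>y. g (x + y))"
    by (intro continuous_on_compose2[OF g(1)] continuous_intros) auto
  \<comment> \<open>Translation multiplies each coefficient by a nonzero phase, so all translates of
    \<open>g\<close> have vanishing coefficients as well.\<close>
  have zx: "mean (\<lambda>y. g (x + y) * wave k y) = 0" for k
  proof -
    have "mean (\<lambda>y. g (y + x) * wave k (y + x)) = mean (\<lambda>y. g y * wave k y)"
      by (intro mean_shift[of "\<lambda>y. g y * wave k y" x] periodic_mult g periodic_wave continuous_intros)
    moreover have "g (y + x) * wave k (y + x) = wave k x * (g (x + y) * wave k y)" for y
      by (simp add: wave_simps algebra_simps)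
    ultimately have "wave k x * mean (\<lambda>y. g (x + y) * wave k y) = 0" using z[of k] by (simp add: mean_cmult)
    moreover have "wave k x \<noteq> 0" using wave_simps(5)[of k x] by auto
    ultimately show ?thesis by simp
  qed
  have "norm (g x) \<le> \<eta>" if \<eta>: "\<eta> > 0" for \<eta>
  proof -
    obtain C where C: "C \<ge> 0" "\<And>y. norm (g (x + y) - g x) \<le> \<eta>/2 + C * (\<Sum>i\<in>UNIV. 1 - cos (y $ i))"
      using korovkin_bound[OF g, of "\<eta>/2" x] \<eta> by auto
    \<comment> \<open>The kernel gives each \<open>1 - cos (y $ i)\<close> the mean
      \<open>1 / n\<close>, hence the error \<open>C * CARD('m) / n\<close>.\<close>
    obtain n :: nat where n: "n > 0" "C * CARD('m) / n < \<eta>/2"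
    proof -
      obtain n :: nat where "C * CARD('m) / (\<eta>/2) < n" using reals_Archimedean2 by blast
      moreover have "0 \<le> C * CARD('m) / (\<eta>/2)" using C(1) \<eta> by simp
      ultimately have "n > 0" "C * CARD('m) / (\<eta>/2) < n" by linarith+
      then show thesis using that[of n] \<eta> by (simp add: field_simps)
    qed
    let ?w = "\<lambda>i. wave (\<lambda>j. if j = i then 1 else 0)"
    have Rew: "Re (?w i y) = cos (y $ i)" for i and y :: "real^'m"
    proof -
      have "(\<Sum>j\<in>UNIV. of_int (if j = i then 1 else 0) * y $ j) = (\<Sum>j\<in>UNIV. if j = i then y $ i else 0)"
        by (intro sum.cong) auto
      then show ?thesis by (simp add: wave_def)
    qed
    have mc: "Re (mean (\<lambda>y::real^'m. of_real (cos (y $ i) * fejer n y))) = 1 - 1 / n" for i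
    proof -
      have R: "Re (mean f) = Re (mean (\<lambda>y. of_real (Re (f y))))" if "continuous_on UNIV f" for f :: "real^'m \<Rightarrow> complex"
      proof -
        have 1: "integral (cbox 0 (\<chi> i. 2*pi)) (\<lambda>y. Re (f y)) = Re (integral (cbox 0 (\<chi> i. 2*pi)) f)"
          using integral_linear[OF integrable_cell[OF that] bounded_linear_Re] by (simp add: o_def)
        have "continuous_on UNIV (\<lambda>y. Re (f y))" using that by (intro continuous_intros)
        then have "integral (cbox 0 (\<chi> i. 2*pi)) (\<lambda>y. complex_of_real (Re (f y))) = of_real (integral (cbox 0 (\<chi> i. 2*pi)) (\<lambda>y. Re (f y)))"
          using integral_linear[OF integrable_cell bounded_linear_of_real[where 'a=complex]]
          by (simp add: o_def)
        then show ?thesis by (simp add: mean_def 1)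
      qed
      have "continuous_on UNIV (\<lambda>y::real^'m. ?w i y * of_real (fejer n y))"
        by (intro continuous_intros continuous_on_fejer)
      from R[OF this] show ?thesis
        unfolding mean_fejer_wave_axis(2)[OF n(1)] by (simp add: Rew)
    qed
    define h where "h = (\<lambda>y::real^'m. (\<eta>/2 + C * (\<Sum>i\<in>UNIV. 1 - cos (y $ i))) * fejer n y)"
    have ch: "continuous_on UNIV h" unfolding h_def by (intro continuous_intros continuous_on_fejer)
    have f0: "fejer n y \<ge> 0" for y :: "real^'m" by (simp add: fejer_def)
    have "g x = mean (\<lambda>y::real^'m. g x * of_real (fejer n y)) - mean (\<lambda>y. g (x + y) * of_real (fejer n y))"
      by (simp add: mean_fejer[OF cx] zx mean_cmult mean_fejer_wave_axis(1)[OF n(1)])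
    also have "\<dots> = mean (\<lambda>y. g x * of_real (fejer n y) - g (x + y) * of_real (fejer n y))"
      by (intro mean_diff[symmetric] continuous_intros continuous_on_fejer cx)
    also have "norm \<dots> \<le> Re (mean (\<lambda>y. of_real (h y)))"
    proof (rule mean_norm_le[OF _ ch])
      show "continuous_on UNIV (\<lambda>y. g x * of_real (fejer n y) - g (x + y) * of_real (fejer n y))"
        by (intro continuous_intros continuous_on_fejer cx)
      fix y
      have "g x * of_real (fejer n y) - g (x + y) * of_real (fejer n y) = - ((g (x + y) - g x) * of_real (fejer n y))"
        by (simp add: algebra_simps)
      then have "norm (g x * of_real (fejer n y) - g (x + y) * of_real (fejer n y)) = norm (g (x + y) - g x) * fejer n y"
        using f0 by (simp add: norm_mult)
      also have "\<dots> \<le> h y" unfolding h_def using C(2) f0 by (intro mult_right_mono)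
      finally show "norm (g x * of_real (fejer n y) - g (x + y) * of_real (fejer n y)) \<le> h y" .
    qed
    also have "mean (\<lambda>y::real^'m. of_real (h y)) = of_real (\<eta>/2 + C * CARD('m)) * mean (\<lambda>y::real^'m. of_real (fejer n y))
        - of_real C * (\<Sum>i\<in>UNIV. mean (\<lambda>y::real^'m. of_real (cos (y $ i) * fejer n y)))"
    proof -
      have cc: "continuous_on UNIV (\<lambda>y::real^'m. complex_of_real (cos (y $ i) * fejer n y))" for i
        by (intro continuous_intros continuous_on_fejer)
      have e: "complex_of_real (h y) = of_real (\<eta>/2 + C * CARD('m)) * of_real (fejer n y)
        - of_real C * (\<Sum>i\<in>UNIV. of_real (cos (y $ i) * fejer n y))" for y :: "real^'m"
        by (simp add: h_def sum_subtractf algebra_simps sum_distrib_right sum_distrib_left)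
      have "mean (\<lambda>y::real^'m. of_real (h y)) = mean (\<lambda>y::real^'m. of_real (\<eta>/2 + C * CARD('m)) * of_real (fejer n y)
        - of_real C * (\<Sum>i\<in>UNIV. of_real (cos (y $ i) * fejer n y)))" by (rule arg_cong[where f=mean]) (rule ext, rule e)
      also have "\<dots> = mean (\<lambda>y::real^'m. of_real (\<eta>/2 + C * CARD('m)) * of_real (fejer n y))
        - mean (\<lambda>y::real^'m. of_real C * (\<Sum>i\<in>UNIV. of_real (cos (y $ i) * fejer n y)))"
        by (intro mean_diff continuous_intros continuous_on_fejer)
      finally show ?thesis by (simp only: mean_cmult mean_sum[OF cc])
    qed
    also have "Re \<dots> = \<eta>/2 + C * CARD('m) - C * (\<Sum>i\<in>(UNIV::'m set). 1 - 1 / n)"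
      by (simp only: mean_fejer_wave_axis(1)[OF n(1)] minus_complex.sel Re_sum mc Re_complex_of_real
          mult_1_right Re_divide_of_real of_real_mult[symmetric] times_complex.sel Im_complex_of_real mult_zero_left diff_zero)
    also have "\<dots> = \<eta>/2 + C * CARD('m) / n" by (simp add: algebra_simps)
    finally show ?thesis using n(2) by linarith
  qed
  then have "norm (g x) \<le> 0" using field_le_epsilon[of "norm (g x)" 0] by simp
  then show ?thesis by simp
qed

section \<open>Smooth periodic functions and their partial derivatives\<close>

definition smooth_periodic :: "(real^'m::finite \<Rightarrow> real) \<Rightarrow> bool" where
  "smooth_periodic f \<longleftrightarrow> smooth_on f UNIV \<and> periodic f"

lemma partial_deriv_eqI:
  "(f has_derivative f') (at x) \<Longrightarrow> partial_deriv i f x = f' (axis i 1)"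
  by (simp add: partial_deriv_def frechet_derivative_at[symmetric])

lemma smooth_on_partial: "smooth_on f S \<Longrightarrow> smooth_on (partial_deriv i f) S"
  unfolding partial_deriv_def[abs_def] by (rule smooth_on_frechet)

lemma partial_add:
  assumes "smooth_on f UNIV" "smooth_on g UNIV"
  shows "partial_deriv i (\<lambda>x. f x + g x) = (\<lambda>x. partial_deriv i f x + partial_deriv i g x)"
proof
  fix x
  show "partial_deriv i (\<lambda>x. f x + g x) x = partial_deriv i f x + partial_deriv i g x"
    using partial_deriv_eqI[OF has_derivative_add[OF smooth_on_deriv[OF assms(1)] smooth_on_deriv[OF assms(2)]], of x i]
    by (simp add: partial_deriv_def)
qed

lemma partial_cmult:
  assumes "smooth_on f UNIV"
  shows "partial_deriv i (\<lambda>x. c * f x) = (\<lambda>x. c * partial_deriv i f x)"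
proof
  fix x
  show "partial_deriv i (\<lambda>x. c * f x) x = c * partial_deriv i f x"
    using partial_deriv_eqI[OF has_derivative_mult_right[OF smooth_on_deriv[OF assms(1)], of x c], of i]
    by (simp add: partial_deriv_def)
qed

lemma partial_mult:
  assumes "smooth_on f UNIV" "smooth_on g UNIV"
  shows "partial_deriv i (\<lambda>x. f x * g x) = (\<lambda>x. f x * partial_deriv i g x + partial_deriv i f x * g x)"
proof
  fix x
  show "partial_deriv i (\<lambda>x. f x * g x) x = f x * partial_deriv i g x + partial_deriv i f x * g x"
    using partial_deriv_eqI[OF has_derivative_mult[OF smooth_on_deriv[OF assms(1)] smooth_on_deriv[OF assms(2)]], of x i]
    by (simp add: partial_deriv_def)
qed

lemma partial_const: "partial_deriv i (\<lambda>_. c) = (\<lambda>_. 0)"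
  using partial_deriv_eqI[OF has_derivative_const] by (auto simp: fun_eq_iff)

lemma partial_diff:
  assumes "smooth_on f UNIV" "smooth_on g UNIV"
  shows "partial_deriv i (\<lambda>x. f x - g x) = (\<lambda>x. partial_deriv i f x - partial_deriv i g x)"
  using partial_add[OF assms(1), of "\<lambda>x. (-1) * g x" i] assms partial_cmult[of g i "-1"]
  by (simp add: smooth_on_minus)

lemma partial_chain:
  fixes H :: "real^'p::finite \<Rightarrow> real" and U :: "'p \<Rightarrow> real^'m::finite \<Rightarrow> real"
  assumes H: "smooth_on H T" "open T" "(\<chi> p. U p x) \<in> T" and U: "\<And>p. smooth_on (U p) S" "open S" "x \<in> S"
  shows "partial_deriv i (\<lambda>x. H (\<chi> p. U p x)) x
    = (\<Sum>p\<in>UNIV. partial_deriv p H (\<chi> p. U p x) * partial_deriv i (U p) x)"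
proof -
  let ?u = "\<lambda>x. \<chi> p. U p x" and ?D = "frechet_derivative H (at (\<chi> p. U p x))"
  have "smooth_on ?u S" using U(1,2) by (intro smooth_on_vec)
  then obtain u' where u': "(?u has_derivative u') (at x)" using smooth_on_deriv U(2,3) by blast
  have HD: "(H has_derivative ?D) (at (?u x))" using smooth_on_deriv[OF H] .
  have a: "(U p has_derivative (\<lambda>v. u' v $ p)) (at x)" for p
    using bounded_linear.has_derivative[OF bounded_linear_vec_nth u', of p] by simp
  have ax: "t *\<^sub>R axis p 1 = axis p (t::real)" for p :: 'p and t by (simp add: vec_eq_iff axis_def)
  have u'_eq: "u' (axis i 1) = (\<Sum>p\<in>UNIV. partial_deriv i (U p) x *\<^sub>R axis p 1)"
    unfolding ax sum_axis_eq by (simp add: vec_eq_iff partial_deriv_eqI[OF a])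
  have "linear ?D" using HD has_derivative_linear by blast
  have "partial_deriv i (\<lambda>x. H (?u x)) x = ?D (u' (axis i 1))"
    by (rule partial_deriv_eqI[OF has_derivative_compose[OF u' HD]])
  also have "\<dots> = (\<Sum>p\<in>UNIV. partial_deriv i (U p) x *\<^sub>R ?D (axis p 1))"
    unfolding u'_eq by (simp add: linear_sum[OF \<open>linear ?D\<close>] linear_scale[OF \<open>linear ?D\<close>])
  finally show ?thesis by (simp add: partial_deriv_def mult.commute)
qed

lemma smooth_periodicD:
  "smooth_periodic f \<Longrightarrow> smooth_on f UNIV" "smooth_periodic f \<Longrightarrow> periodic f"
  "smooth_periodic f \<Longrightarrow> continuous_on UNIV f"
  by (auto simp: smooth_periodic_def intro: smooth_on_continuous)

named_theorems sp_intros

lemma sp_const [sp_intros]: "smooth_periodic (\<lambda>_. c)"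
  by (simp add: smooth_periodic_def periodic_def smooth_on_const)

lemma sp_add [sp_intros]: "smooth_periodic f \<Longrightarrow> smooth_periodic g \<Longrightarrow> smooth_periodic (\<lambda>x. f x + g x)"
  by (simp add: smooth_periodic_def periodic_def smooth_on_add)

lemma sp_diff [sp_intros]: "smooth_periodic f \<Longrightarrow> smooth_periodic g \<Longrightarrow> smooth_periodic (\<lambda>x. f x - g x)"
  by (simp add: smooth_periodic_def periodic_def smooth_on_diff)

lemma sp_minus [sp_intros]: "smooth_periodic f \<Longrightarrow> smooth_periodic (\<lambda>x. - f x)"
  by (simp add: smooth_periodic_def periodic_def smooth_on_minus)

lemma sp_mult [sp_intros]: "smooth_periodic f \<Longrightarrow> smooth_periodic g \<Longrightarrow> smooth_periodic (\<lambda>x. f x * g x)"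
  by (simp add: smooth_periodic_def periodic_def smooth_on_mult)

lemma sp_sum [sp_intros]: "(\<And>i. i \<in> I \<Longrightarrow> smooth_periodic (f i)) \<Longrightarrow> smooth_periodic (\<lambda>x. \<Sum>i\<in>I. f i x)"
  by (simp add: smooth_periodic_def periodic_def smooth_on_sum)

lemma sp_compose:
  fixes H :: "real^'p::finite \<Rightarrow> real" and U :: "'p \<Rightarrow> real^'m::finite \<Rightarrow> real"
  assumes "smooth_on H UNIV" "\<And>p. smooth_periodic (U p)"
  shows "smooth_periodic (\<lambda>x. H (\<chi> p. U p x))"
proof -
  have "smooth_on (\<lambda>x. \<chi> p. U p x) UNIV"
    using assms(2) by (intro smooth_on_vec) (auto simp: smooth_periodic_def)
  then have "smooth_on (\<lambda>x. H (\<chi> p. U p x)) UNIV"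
    by (rule smooth_on_compose[OF open_UNIV open_UNIV subset_UNIV assms(1)])
  then show ?thesis using assms(2) by (simp add: smooth_periodic_def periodic_def)
qed

lemma sp_partial [sp_intros]:
  assumes "smooth_periodic f"
  shows "smooth_periodic (partial_deriv i f)"
proof -
  have "partial_deriv i f (x + axis j (2*pi)) = partial_deriv i f x" for x j
  proof -
    have t: "((\<lambda>y. y + axis j (2*pi)) has_derivative (\<lambda>v. v)) (at x)"
      by (auto intro!: derivative_eq_intros)
    have "((\<lambda>y. f (y + axis j (2*pi))) has_derivative frechet_derivative f (at (x + axis j (2*pi)))) (at x)"
      using smooth_on_deriv[OF smooth_periodicD(1)[OF assms] open_UNIV]
      by (intro has_derivative_compose[OF t, where g=f]) auto
    moreover have "(\<lambda>y. f (y + axis j (2*pi))) = f"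
      using assms by (auto simp: smooth_periodic_def periodic_def)
    ultimately show ?thesis by (metis partial_deriv_eqI partial_deriv_def)
  qed
  then show ?thesis using assms by (auto simp: smooth_periodic_def smooth_on_partial periodic_def[of "partial_deriv i f"])
qed

section \<open>Fourier coefficients and their decay\<close>

definition fourier :: "(real^'m::finite \<Rightarrow> real) \<Rightarrow> ('m \<Rightarrow> int) \<Rightarrow> complex" where
  "fourier f k = mean (\<lambda>x. of_real (f x) * wave (- k) x)"

text \<open>The \<open>l^1\<close> norm is chosen so that one more factor \<open>weight k\<close>
  accounts exactly for the function together with all its first partial derivatives.\<close>

definition weight :: "('m::finite \<Rightarrow> int) \<Rightarrow> real" where
  "weight k = 1 + (\<Sum>i\<in>UNIV. \<bar>of_int (k i)\<bar>)"

definition rapid :: "(('m::finite \<Rightarrow> int) \<Rightarrow> complex) \<Rightarrow> bool" where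
  "rapid c \<longleftrightarrow> (\<forall>N. (\<lambda>k. norm (c k) * weight k ^ N) summable_on UNIV)"

lemma continuous_on_sp_wave:
  "smooth_periodic f \<Longrightarrow> continuous_on UNIV (\<lambda>x. complex_of_real (f x) * wave k x)"
  by (intro continuous_intros smooth_periodicD)

lemma fourier_add:
  "smooth_periodic f \<Longrightarrow> smooth_periodic g \<Longrightarrow> fourier (\<lambda>x. f x + g x) k = fourier f k + fourier g k"
  unfolding fourier_def by (simp add: distrib_right mean_add continuous_on_sp_wave)

lemma fourier_cmult: "fourier (\<lambda>x. c * f x) k = of_real c * fourier f k"
  unfolding fourier_def by (simp add: mult.assoc mean_cmult)

lemma fourier_diff:
  "smooth_periodic f \<Longrightarrow> smooth_periodic g \<Longrightarrow> fourier (\<lambda>x. f x - g x) k = fourier f k - fourier g k"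
  unfolding fourier_def by (simp add: left_diff_distrib mean_diff continuous_on_sp_wave)

lemma fourier_const: "fourier (\<lambda>_::real^'m::finite. c) k = (if k = 0 then of_real c else 0)"
  using mean_wave[of "- k"] by (simp add: fourier_def mean_cmult)

lemma fourier_cnj:
  assumes "smooth_periodic f"
  shows "fourier f (- k) = cnj (fourier f k)"
proof -
  have 1: "(\<lambda>x. cnj (of_real (f x) * wave (- k) x)) = (\<lambda>x. of_real (f x) * wave (- (- k)) x)"
    by (simp add: wave_simps)
  have "cnj (mean g) = mean (\<lambda>x. cnj (g x))" if "continuous_on UNIV g" for g :: "real^'a \<Rightarrow> complex"
    using integral_linear[OF integrable_cell[OF that] bounded_linear_cnj] by (simp add: mean_def o_def)
  from this[OF continuous_on_sp_wave[OF assms, of "- k"]] show ?thesis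
    unfolding fourier_def 1 by (rule sym)
qed

lemma norm_fourier_le:
  assumes "smooth_periodic f" "\<And>x. \<bar>f x\<bar> \<le> B"
  shows "norm (fourier f k) \<le> B"
  unfolding fourier_def using assms
  by (intro mean_norm_le_const continuous_on_sp_wave) (auto simp: norm_mult wave_simps)

lemma wave_has_derivative:
  "(wave k has_derivative (\<lambda>v. \<i> * of_real (\<Sum>i\<in>UNIV. of_int (k i) * v $ i) * wave k x)) (at x)"
proof -
  have "((\<lambda>x. \<i> * complex_of_real (\<Sum>i\<in>UNIV. of_int (k i) * x $ i)) has_derivative
      (\<lambda>v. \<i> * complex_of_real (\<Sum>i\<in>UNIV. of_int (k i) * v $ i))) (at x)"
    by (auto intro!: derivative_eq_intros bounded_linear.has_derivative[OF bounded_linear_vec_nth])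
  from has_derivative_compose[OF this DERIV_exp[unfolded has_field_derivative_def]] show ?thesis
    by (simp add: wave_def[abs_def] cis_conv_exp mult.commute)
qed

text \<open>Integration by parts, in the form of \<open>mean_partial_zero\<close> applied to
  \<open>f\<close> times a wave.\<close>

lemma fourier_partial:
  assumes "smooth_periodic f"
  shows "fourier (partial_deriv i f) k = \<i> * of_int (k i) * fourier f k"
proof -
  let ?D = "\<lambda>x v. of_real (f x) * (\<i> * of_real (\<Sum>i\<in>UNIV. of_int ((- k) i) * v $ i) * wave (- k) x)
      + of_real (frechet_derivative f (at x) v) * wave (- k) x"
  have D: "((\<lambda>x. complex_of_real (f x) * wave (- k) x) has_derivative ?D x) (at x)" for x
    using smooth_on_deriv[OF smooth_periodicD(1)[OF assms] open_UNIV, of x]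
    by (intro has_derivative_mult wave_has_derivative bounded_linear.has_derivative[OF bounded_linear_of_real]) auto
  have "(\<Sum>j\<in>UNIV. of_int ((- k) j) * axis i 1 $ j) = (\<Sum>j\<in>UNIV. if j = i then - real_of_int (k i) else 0)"
    by (intro sum.cong) (auto simp: axis_def)
  then have De: "?D x (axis i 1) = - (\<i> * of_int (k i)) * (of_real (f x) * wave (- k) x)
      + of_real (partial_deriv i f x) * wave (- k) x" for x
    by (simp add: partial_deriv_def algebra_simps)
  have c: "continuous_on UNIV (\<lambda>x. ?D x (axis i 1))"
    unfolding De by (intro continuous_intros continuous_on_sp_wave sp_intros assms)
  have p: "periodic (\<lambda>x. complex_of_real (f x) * wave (- k) x)"
    using assms by (intro periodic_mult periodic_wave) (simp add: smooth_periodic_def periodic_def)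
  have "0 = mean (\<lambda>x. ?D x (axis i 1))"
    using mean_partial_zero[OF p D c] by (rule sym)
  also have "\<dots> = - (\<i> * of_int (k i)) * fourier f k + fourier (partial_deriv i f) k"
    unfolding De fourier_def mean_cmult[symmetric]
    by (intro mean_add continuous_intros continuous_on_sp_wave sp_intros assms)
  finally show ?thesis by (simp add: algebra_simps)
qed

lemma sp_partial_iter: "smooth_periodic f \<Longrightarrow> smooth_periodic ((partial_deriv i ^^ N) f)"
  by (induction N) (auto intro: sp_partial)

lemma fourier_partial_iter:
  "smooth_periodic f \<Longrightarrow> fourier ((partial_deriv i ^^ N) f) k = (\<i> * of_int (k i)) ^ N * fourier f k"
  by (induction N) (auto simp: fourier_partial sp_partial_iter)

lemma weight_ge_1: "weight k \<ge> 1"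
  by (simp add: weight_def sum_nonneg)

text \<open>The weight is comparable to the largest of 1 and the \<open>\<bar>k i\<bar>\<close>.
  Hence decay of the coefficients requires only pure iterated derivatives, each in a single
  direction.\<close>

lemma weight_power_le:
  "weight (k :: 'm::finite \<Rightarrow> int) ^ N \<le> real (CARD('m) + 1) ^ N * (1 + (\<Sum>i\<in>UNIV. \<bar>of_int (k i)\<bar> ^ N))"
proof -
  define A where "A = insert 1 (range (\<lambda>i. \<bar>real_of_int (k i)\<bar>))"
  define M where "M = Max A"
  have A: "finite A" "A \<noteq> {}" by (auto simp: A_def)
  have M: "M \<in> A" "\<And>a. a \<in> A \<Longrightarrow> a \<le> M" using A by (simp_all add: M_def)
  have "weight k \<le> 1 * M + (\<Sum>i\<in>(UNIV::'m set). M)"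
    unfolding weight_def using M(2) by (intro add_mono sum_mono) (auto simp: A_def)
  then have "weight k \<le> real (CARD('m) + 1) * M" by (simp add: algebra_simps)
  then have "weight k ^ N \<le> (real (CARD('m) + 1) * M) ^ N"
    using weight_ge_1[of k] by (intro power_mono) auto
  also have "\<dots> = real (CARD('m) + 1) ^ N * M ^ N" by (simp only: power_mult_distrib)
  also have "M ^ N \<le> 1 + (\<Sum>i\<in>UNIV. \<bar>of_int (k i)\<bar> ^ N)"
  proof (cases "M = 1")
    case True
    then show ?thesis by (simp add: sum_nonneg)
  next
    case False
    then obtain i where "M = \<bar>of_int (k i)\<bar>" using M(1) by (auto simp: A_def)
    then have "M ^ N \<le> (\<Sum>i\<in>UNIV. \<bar>of_int (k i)\<bar> ^ N)"
      by (metis (mono_tags, lifting) UNIV_I finite member_le_sum abs_ge_zero zero_le_power)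
    then show ?thesis by simp
  qed
  finally show ?thesis by (simp add: mult_left_mono)
qed

lemma fourier_decay:
  fixes f :: "real^'m \<Rightarrow> real"
  assumes f: "smooth_periodic f" and B: "\<And>x. \<bar>f x\<bar> \<le> B" "\<And>i x. \<bar>(partial_deriv i ^^ N) f x\<bar> \<le> B"
  shows "norm (fourier f k) * weight k ^ N \<le> real (CARD('m) + 1) ^ Suc N * B"
proof -
  have 1: "norm (fourier f k) * \<bar>of_int (k i)\<bar> ^ N \<le> B" for i
    using norm_fourier_le[OF sp_partial_iter[OF f, where i=i and N=N] B(2), of k]
    by (simp add: fourier_partial_iter[OF f] norm_mult norm_power mult.commute)
  have "norm (fourier f k) * weight k ^ N
      \<le> norm (fourier f k) * (real (CARD('m) + 1) ^ N * (1 + (\<Sum>i\<in>UNIV. \<bar>of_int (k i)\<bar> ^ N)))"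
    by (intro mult_left_mono weight_power_le) auto
  also have "\<dots> = real (CARD('m) + 1) ^ N * (norm (fourier f k) + (\<Sum>i\<in>UNIV. norm (fourier f k) * \<bar>of_int (k i)\<bar> ^ N))"
    by (simp add: algebra_simps sum_distrib_left)
  also have "\<dots> \<le> real (CARD('m) + 1) ^ N * (B + (\<Sum>i\<in>(UNIV::'m set). B))"
    using 1 norm_fourier_le[OF f B(1), of k] by (intro mult_left_mono add_mono sum_mono) auto
  also have "\<dots> = real (CARD('m) + 1) ^ Suc N * B" by (simp add: algebra_simps)
  finally show ?thesis .
qed

lemma summable_int_square: "(\<lambda>j::int. 1 / (1 + \<bar>of_int j\<bar>)\<^sup>2 :: real) summable_on UNIV"
proof -
  let ?f = "\<lambda>j::int. 1 / (1 + \<bar>of_int j\<bar>)\<^sup>2 :: real"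
  have "summable (\<lambda>n::nat. inverse ((real (Suc n))^2))"
    using inverse_power_summable[of 2, where 'a=real] by (subst summable_Suc_iff) simp
  then have s: "(\<lambda>n::nat. 1 / (1 + real n)\<^sup>2) summable_on UNIV"
    by (subst summable_on_UNIV_nonneg_real_iff) (simp_all add: divide_inverse add.commute)
  have "?f summable_on range int"
    using s by (subst summable_on_reindex) (simp_all add: o_def inj_on_def)
  moreover have "?f summable_on range (\<lambda>n. - int n)"
    using s by (subst summable_on_reindex) (simp_all add: o_def inj_on_def)
  moreover have "UNIV = range int \<union> range (\<lambda>n. - int n)"
    using int_cases2 by blast
  ultimately show ?thesis
    by (metis (no_types, lifting) summable_on_union)
qed

text \<open>\<open>weight k\<close> dominates each \<open>1 + \<bar>k i\<bar>\<close>, so its power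
  \<open>2 * CARD('m)\<close> dominates the product of their squares, and that product is summable
  because each factor is.\<close>

lemma summable_weight: "(\<lambda>k::'m::finite \<Rightarrow> int. 1 / weight k ^ (2 * CARD('m))) summable_on UNIV"
proof -
  have "Infinite_Set_Sum.abs_summable_on (\<lambda>g::'m \<Rightarrow> int. \<Prod>i\<in>UNIV. 1 / (1 + \<bar>real_of_int (g i)\<bar>)\<^sup>2) (PiE UNIV (\<lambda>_. UNIV))"
    using summable_int_square
    by (intro abs_summable_on_prod_PiE) (auto simp flip: abs_summable_equivalent)
  then have s: "(\<lambda>g::'m \<Rightarrow> int. \<Prod>i\<in>UNIV. 1 / (1 + \<bar>real_of_int (g i)\<bar>)\<^sup>2) summable_on UNIV"
    unfolding abs_summable_equivalent[symmetric] by (simp add: abs_prod)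
  show ?thesis
  proof (rule summable_on_comparison_test[OF s])
    fix k :: "'m \<Rightarrow> int"
    have "(\<Prod>i\<in>UNIV. (1 + \<bar>real_of_int (k i)\<bar>)\<^sup>2) \<le> (\<Prod>i\<in>(UNIV::'m set). (weight k)\<^sup>2)"
    proof (intro prod_mono conjI power_mono)
      show "1 + \<bar>real_of_int (k i)\<bar> \<le> weight k" for i
        unfolding weight_def by (intro add_left_mono member_le_sum) auto
    qed auto
    also have "\<dots> = weight k ^ (2 * CARD('m))" by (simp add: power_mult)
    finally have "1 / weight k ^ (2 * CARD('m)) \<le> 1 / (\<Prod>i\<in>UNIV. (1 + \<bar>real_of_int (k i)\<bar>)\<^sup>2)"
      by (intro divide_left_mono mult_pos_pos prod_pos zero_less_power) (use weight_ge_1[of k] in auto)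
    then show "1 / weight k ^ (2 * CARD('m)) \<le> (\<Prod>i\<in>UNIV. 1 / (1 + \<bar>real_of_int (k i)\<bar>)\<^sup>2)"
      by (simp add: prod_dividef)
    show "0 \<le> 1 / weight k ^ (2 * CARD('m))" using weight_ge_1[of k] by simp
  qed
qed

text \<open>Exchanges \<open>2 * CARD('m)\<close> powers of pointwise decay for summability; this is
  the number of derivatives lost in passing from sup norms to coefficient sums.\<close>

lemma decay_summable:
  fixes c :: "('m::finite \<Rightarrow> int) \<Rightarrow> complex"
  assumes "\<And>k. norm (c k) * weight k ^ (N + 2 * CARD('m)) \<le> B"
  shows "(\<lambda>k. norm (c k) * weight k ^ N) summable_on UNIV"
    and "(\<Sum>\<^sub>\<infinity>k. norm (c k) * weight k ^ N) \<le> B * (\<Sum>\<^sub>\<infinity>k::'m\<Rightarrow>int. 1 / weight k ^ (2 * CARD('m)))"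
proof -
  have le: "norm (c k) * weight k ^ N \<le> B * (1 / weight k ^ (2 * CARD('m)))" for k
    using assms[of k] weight_ge_1[of k] by (simp add: power_add field_simps)
  have s: "(\<lambda>k::'m\<Rightarrow>int. B * (1 / weight k ^ (2 * CARD('m)))) summable_on UNIV"
    by (intro summable_on_cmult_right summable_weight)
  show *: "(\<lambda>k. norm (c k) * weight k ^ N) summable_on UNIV"
  proof (rule summable_on_comparison_test[OF s le])
    show "0 \<le> norm (c k) * weight k ^ N" for k using weight_ge_1[of k] by simp
  qed
  have "(\<Sum>\<^sub>\<infinity>k. norm (c k) * weight k ^ N) \<le> (\<Sum>\<^sub>\<infinity>k::'m\<Rightarrow>int. B * (1 / weight k ^ (2 * CARD('m))))"
    by (rule has_sum_mono[OF has_sum_infsum[OF *] has_sum_infsum[OF s]]) (rule le)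
  then show "(\<Sum>\<^sub>\<infinity>k. norm (c k) * weight k ^ N) \<le> B * (\<Sum>\<^sub>\<infinity>k::'m\<Rightarrow>int. 1 / weight k ^ (2 * CARD('m)))"
    by (simp only: infsum_cmult_right')
qed

lemma sp_bounded:
  assumes "smooth_periodic f"
  obtains B where "B \<ge> 0" "\<And>x. \<bar>f x\<bar> \<le> B"
  using periodic_bounded[OF smooth_periodicD(3,2)[OF assms]] by (metis real_norm_def)

lemma rapid_fourier:
  assumes "smooth_periodic (f :: real^'m \<Rightarrow> real)"
  shows "rapid (fourier f)"
  unfolding rapid_def
proof
  fix N
  let ?N = "N + 2 * CARD('m)"
  obtain B0 where B0: "B0 \<ge> 0" "\<And>x. \<bar>f x\<bar> \<le> B0" using sp_bounded[OF assms] by blast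
  have "\<forall>i. \<exists>B. B \<ge> 0 \<and> (\<forall>x. \<bar>(partial_deriv i ^^ ?N) f x\<bar> \<le> B)"
    using sp_bounded[OF sp_partial_iter[OF assms]] by metis
  then obtain B1 where B1: "\<And>i. B1 i \<ge> 0" "\<And>i x. \<bar>(partial_deriv i ^^ ?N) f x\<bar> \<le> B1 i" by metis
  let ?B = "B0 + (\<Sum>i\<in>UNIV. B1 i)"
  have 1: "\<bar>f x\<bar> \<le> ?B" for x
    using B0(2)[of x] sum_nonneg[of UNIV B1] B1(1) by (simp add: add_increasing2)
  have 2: "\<bar>(partial_deriv i ^^ ?N) f x\<bar> \<le> ?B" for i x
    using B1(2)[of i x] member_le_sum[of i UNIV B1] B1(1) B0(1) by (smt (verit) UNIV_I finite)
  show "(\<lambda>k. norm (fourier f k) * weight k ^ N) summable_on UNIV"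
    by (rule decay_summable(1)[OF fourier_decay[OF assms 1 2]])
qed

lemma rapid_abs_summable: "rapid c \<Longrightarrow> (\<lambda>k. norm (c k)) summable_on UNIV"
  unfolding rapid_def by (drule spec[of _ 0]) simp

section \<open>Synthesis of functions from rapidly decreasing coefficients\<close>

definition wave_series :: "(('m::finite \<Rightarrow> int) \<Rightarrow> complex) \<Rightarrow> real^'m \<Rightarrow> complex" where
  "wave_series c x = (\<Sum>\<^sub>\<infinity>k. c k * wave k x)"

lemma wave_series:
  assumes "(\<lambda>k. norm (c k)) summable_on UNIV"
  shows "((\<lambda>k. c k * wave k x) has_sum wave_series c x) UNIV"
    and "continuous_on UNIV (wave_series c)" "periodic (wave_series c)"
    and "mean (\<lambda>x. wave_series c x * wave (- l) x) = c l"
proof -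
  have n: "norm (c k * wave k x) \<le> norm (c k)" for k x by (simp add: norm_mult wave_simps)
  have a: "(\<lambda>k. norm (c k * wave k x)) summable_on UNIV" for x
    using assms by (simp add: norm_mult wave_simps)
  have hs: "((\<lambda>k. c k * wave k x) has_sum wave_series c x) UNIV" for x
    unfolding wave_series_def by (rule has_sum_infsum[OF abs_summable_summable[OF a]])
  then show "((\<lambda>k. c k * wave k x) has_sum wave_series c x) UNIV" .
  have cw: "continuous_on UNIV (\<lambda>x. c k * wave k x)" for k by (intro continuous_intros)
  show "continuous_on UNIV (wave_series c)"
    unfolding wave_series_def[abs_def] by (rule mean_has_sum(2)[OF cw n assms])
  show "periodic (wave_series c)"
    unfolding periodic_def wave_series_def by (simp add: periodic_wave[unfolded periodic_def, rule_format])
  have n': "norm (c k * wave k x * wave (- l) x) \<le> norm (c k)" for k x by (simp add: norm_mult wave_simps)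
  have cw': "continuous_on UNIV (\<lambda>x. c k * wave k x * wave (- l) x)" for k by (intro continuous_intros)
  have "(\<Sum>\<^sub>\<infinity>k. c k * wave k x * wave (- l) x) = wave_series c x * wave (- l) x" for x
    by (rule infsumI[OF has_sum_cmult_left[OF hs]])
  then have "((\<lambda>k. mean (\<lambda>x. c k * wave k x * wave (- l) x)) has_sum mean (\<lambda>x. wave_series c x * wave (- l) x)) UNIV"
    using mean_has_sum(1)[OF cw' n' assms] by simp
  moreover have "mean (\<lambda>x. c k * wave k x * wave (- l) x) = (if k = l then c l else 0)" for k
  proof -
    have "mean (\<lambda>x. c k * wave k x * wave (- l) x) = c k * mean (wave (k + - l))"
      by (simp add: mult.assoc mean_cmult flip: wave_simps(2))
    moreover have "k + - l = 0 \<longleftrightarrow> k = l" by (auto simp: fun_eq_iff)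
    ultimately show ?thesis by (simp add: mean_wave)
  qed
  ultimately have "((\<lambda>k. if k = l then c l else 0) has_sum mean (\<lambda>x. wave_series c x * wave (- l) x)) UNIV" by simp
  moreover have "((\<lambda>k. if k = l then c l else 0) has_sum c l) UNIV"
    by (rule has_sum_finite_neutralI[of "{l}"]) auto
  ultimately show "mean (\<lambda>x. wave_series c x * wave (- l) x) = c l"
    by (rule has_sum_unique)
qed

text \<open>The difference of \<open>f\<close> and its Fourier series is continuous and periodic
  with zero coefficients, so \<open>fourier_unique\<close> applies.\<close>

lemma fourier_inversion:
  assumes f: "smooth_periodic f"
  shows "((\<lambda>k. fourier f k * wave k x) has_sum of_real (f x)) UNIV"
proof -
  have s: "(\<lambda>k. norm (fourier f k)) summable_on UNIV" using rapid_abs_summable[OF rapid_fourier[OF f]] .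
  note W = wave_series[OF s]
  let ?g = "\<lambda>x. complex_of_real (f x) - wave_series (fourier f) x"
  have g: "continuous_on UNIV ?g" using f by (intro continuous_intros smooth_periodicD W(2)) auto
  have p: "periodic ?g" using W(3) smooth_periodicD(2)[OF f] by (simp add: periodic_def)
  have "mean (\<lambda>x. ?g x * wave k x) = 0" for k
  proof -
    have "mean (\<lambda>x. ?g x * wave (- (- k)) x) = mean (\<lambda>x. of_real (f x) * wave (- (- k)) x)
        - mean (\<lambda>x. wave_series (fourier f) x * wave (- (- k)) x)"
      unfolding left_diff_distrib by (intro mean_diff continuous_on_sp_wave f continuous_intros W(2))
    also have "\<dots> = 0" unfolding W(4) by (simp add: fourier_def)
    finally show ?thesis by simp
  qed
  then have "?g x = 0" by (rule fourier_unique[OF g p])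
  then show ?thesis using W(1)[of x] by simp
qed

lemma fourier_eqI:
  assumes "smooth_periodic f" "smooth_periodic g" "\<And>k. fourier f k = fourier g k"
  shows "f = g"
proof
  fix x
  show "f x = g x"
    using has_sum_unique[OF fourier_inversion[OF assms(1), of x, unfolded assms(3)] fourier_inversion[OF assms(2), of x]]
    by simp
qed

lemma rapid_partial:
  assumes "rapid c"
  shows "rapid (\<lambda>k. \<i> * of_int (k i) * c k)"
  unfolding rapid_def
proof
  fix N
  have s: "(\<lambda>k. norm (c k) * weight k ^ Suc N) summable_on UNIV" using assms unfolding rapid_def by blast
  show "(\<lambda>k. norm (\<i> * of_int (k i) * c k) * weight k ^ N) summable_on UNIV"
  proof (rule summable_on_comparison_test[OF s])
    fix k :: "'a \<Rightarrow> int"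
    have "\<bar>real_of_int (k i)\<bar> \<le> (\<Sum>i\<in>UNIV. \<bar>of_int (k i)\<bar>)" by (intro member_le_sum) auto
    then have "\<bar>real_of_int (k i)\<bar> \<le> weight k" by (simp add: weight_def)
    then have "\<bar>real_of_int (k i)\<bar> * (norm (c k) * weight k ^ N) \<le> weight k * (norm (c k) * weight k ^ N)"
      using weight_ge_1[of k] by (intro mult_right_mono) auto
    then show "norm (\<i> * of_int (k i) * c k) * weight k ^ N \<le> norm (c k) * weight k ^ Suc N"
      by (simp add: norm_mult algebra_simps)
    show "0 \<le> norm (\<i> * of_int (k i) * c k) * weight k ^ N" using weight_ge_1[of k] by auto
  qed
qed

lemma norm_cis_taylor: "norm (cis t - 1 - \<i> * of_real t) \<le> t\<^sup>2"
proof -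
  have "\<bar>sin t - t\<bar> \<le> t\<^sup>2 / 2"
    using Maclaurin_sin_bound[of t 2] by (simp add: sin_coeff_def numeral_2_eq_2)
  moreover have "\<bar>cos t - 1\<bar> \<le> t\<^sup>2 / 2"
  proof -
    have "cos t = 1 - 2 * (sin (t/2))\<^sup>2" using cos_double_sin[of "t/2"] by simp
    moreover have "(sin (t/2))\<^sup>2 \<le> (t/2)\<^sup>2" using abs_le_square_iff[of "sin (t/2)" "t/2"] abs_sin_x_le_abs_x[of "t/2"] by blast
    ultimately show ?thesis by (simp add: power_divide)
  qed
  moreover have "norm (cis t - 1 - \<i> * of_real t) \<le> \<bar>cos t - 1\<bar> + \<bar>sin t - t\<bar>"
    using cmod_le[of "cis t - 1 - \<i> * of_real t"] by simp
  ultimately show ?thesis by linarith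
qed

lemma has_sum_sum_finite:
  fixes f :: "'i \<Rightarrow> 'a \<Rightarrow> 'b::{topological_comm_monoid_add}"
  assumes "\<And>i. i \<in> I \<Longrightarrow> (f i has_sum s i) A"
  shows "((\<lambda>x. \<Sum>i\<in>I. f i x) has_sum (\<Sum>i\<in>I. s i)) A"
  using assms by (induction I rule: infinite_finite_induct) (auto intro: has_sum_add)

lemma has_sum_minus:
  fixes f :: "'a \<Rightarrow> 'b::real_normed_vector"
  assumes "(f has_sum s) A" "(g has_sum t) A"
  shows "((\<lambda>x. f x - g x) has_sum (s - t)) A"
  using has_sum_add[OF assms(1) has_sum_bounded_linear[OF bounded_linear_minus[OF bounded_linear_ident] assms(2)]]
  by simp

text \<open>The first-order Taylor remainder of a wave is at most \<open>(k . h)^2\<close>, hence at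
  most \<open>(weight k)^2 |h|^2\<close>. Summed against rapidly decreasing coefficients this is a
  remainder \<open>C |h|^2\<close> for the series, which gives differentiability directly.\<close>

lemma wave_series_has_derivative:
  fixes c :: "('m::finite \<Rightarrow> int) \<Rightarrow> complex"
  assumes c: "rapid c"
  shows "(wave_series c has_derivative (\<lambda>v. \<Sum>i\<in>UNIV. v $ i *\<^sub>R wave_series (\<lambda>k. \<i> * of_int (k i) * c k) x)) (at x)"
proof -
  let ?D = "\<lambda>v. \<Sum>i\<in>UNIV. v $ i *\<^sub>R wave_series (\<lambda>k. \<i> * of_int (k i) * c k) x"
  define C where "C = (\<Sum>\<^sub>\<infinity>k. norm (c k) * weight k ^ 2)"
  have C: "((\<lambda>k. norm (c k) * weight k ^ 2) has_sum C) UNIV"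
    using c by (auto simp: C_def rapid_def)
  have C0: "C \<ge> 0" unfolding C_def by (intro infsum_nonneg) auto
  note W = wave_series(1)[OF rapid_abs_summable]
  have rem: "norm (wave_series c (x + h) - wave_series c x - ?D h) \<le> C * (norm h)\<^sup>2" for h
  proof -
    have "((\<lambda>k. \<Sum>i\<in>UNIV. h $ i *\<^sub>R ((\<i> * of_int (k i) * c k) * wave k x)) has_sum ?D h) UNIV"
      by (intro has_sum_sum_finite has_sum_bounded_linear[OF bounded_linear_scaleR_right] W rapid_partial c)
    then have "((\<lambda>k. c k * wave k (x + h) - c k * wave k x - (\<Sum>i\<in>UNIV. h $ i *\<^sub>R ((\<i> * of_int (k i) * c k) * wave k x)))
        has_sum (wave_series c (x + h) - wave_series c x - ?D h)) UNIV"
      by (intro has_sum_minus W c)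
    moreover have "((\<lambda>k. norm (c k) * weight k ^ 2 * (norm h)\<^sup>2) has_sum (C * (norm h)\<^sup>2)) UNIV"
      by (intro has_sum_cmult_left C)
    moreover have "norm (c k * wave k (x + h) - c k * wave k x - (\<Sum>i\<in>UNIV. h $ i *\<^sub>R ((\<i> * of_int (k i) * c k) * wave k x)))
        \<le> norm (c k) * weight k ^ 2 * (norm h)\<^sup>2" for k
    proof -
      define t where "t = (\<Sum>i\<in>UNIV. of_int (k i) * h $ i)"
      have "(\<Sum>i\<in>UNIV. h $ i *\<^sub>R ((\<i> * of_int (k i) * c k) * wave k x)) = c k * wave k x * (\<i> * of_real t)"
        by (simp add: t_def scaleR_conv_of_real sum_distrib_left algebra_simps)
      moreover have "wave k (x + h) = wave k x * cis t" by (simp add: wave_simps(3)) (simp add: wave_def t_def)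
      ultimately have "c k * wave k (x + h) - c k * wave k x - (\<Sum>i\<in>UNIV. h $ i *\<^sub>R ((\<i> * of_int (k i) * c k) * wave k x))
          = c k * wave k x * (cis t - 1 - \<i> * of_real t)" by (simp add: algebra_simps)
      then have "norm (c k * wave k (x + h) - c k * wave k x - (\<Sum>i\<in>UNIV. h $ i *\<^sub>R ((\<i> * of_int (k i) * c k) * wave k x)))
          \<le> norm (c k) * t\<^sup>2" using norm_cis_taylor[of t] by (simp add: norm_mult wave_simps mult_left_mono)
      moreover have "t\<^sup>2 \<le> (weight k * norm h)\<^sup>2"
      proof -
        have "\<bar>t\<bar> \<le> (\<Sum>i\<in>UNIV. \<bar>of_int (k i)\<bar> * norm h)"
          unfolding t_def
          by (intro order_trans[OF sum_abs] sum_mono) (auto simp: abs_mult intro!: mult_left_mono component_le_norm_cart)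
        also have "\<dots> = (\<Sum>i\<in>UNIV. \<bar>of_int (k i)\<bar>) * norm h" by (simp only: sum_distrib_right)
        also have "\<dots> \<le> weight k * norm h" unfolding weight_def by (intro mult_right_mono) auto
        finally show ?thesis by (metis abs_ge_zero power2_abs power_mono)
      qed
      ultimately show ?thesis
        by (smt (verit, best) mult.assoc mult_left_mono norm_ge_zero power_mult_distrib)
    qed
    ultimately show ?thesis by (rule norm_infsum_le)
  qed
  have lin: "bounded_linear ?D"
    by (intro bounded_linear_sum bounded_linear_compose[OF bounded_linear_scaleR_left bounded_linear_vec_nth])
  show ?thesis
    unfolding has_derivative_at
  proof (intro conjI lin)
    have 1: "norm (norm (wave_series c (x + h) - wave_series c x - ?D h) / norm h) \<le> C * norm h" for h
      using rem[of h] C0 by (cases "h = 0") (auto simp: field_simps power2_eq_square)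
    have 2: "((\<lambda>h. C * norm h) \<longlongrightarrow> 0) (at (0::real^'m))" by (auto intro!: tendsto_eq_intros)
    show "(\<lambda>h. norm (wave_series c (x + h) - wave_series c x - ?D h) / norm h) \<midarrow>0\<rightarrow> 0"
      by (rule Lim_null_comparison[OF always_eventually 2]) (use 1 in blast)
  qed
qed

lemma smooth_wave_series:
  assumes "rapid c"
  shows "smooth_on (wave_series c) UNIV"
proof -
  have "Ck_on n (wave_series c) UNIV" for n
    using assms
  proof (induction n arbitrary: c)
    case 0
    then show ?case using wave_series(2)[OF rapid_abs_summable] by simp
  next
    case (Suc n)
    show ?case
    proof (rule Ck_onI[OF open_UNIV wave_series_has_derivative[OF Suc.prems]])
      show "Ck_on n (\<lambda>x. \<Sum>i\<in>UNIV. v $ i *\<^sub>R wave_series (\<lambda>k. \<i> * of_int (k i) * c k) x) UNIV" for v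
        by (intro Ck_on_sum Ck_on_bounded_linear[OF _ bounded_linear_scaleR_right] Suc.IH rapid_partial Suc.prems open_UNIV)
    qed
  qed
  then show ?thesis by (simp add: smooth_on_def)
qed

text \<open>The symmetry \<open>c (- k) = cnj (c k)\<close> makes the sum equal to its own
  conjugate, so nothing is lost in taking the real part.\<close>

lemma fourier_synthesis:
  assumes c: "rapid c" and h: "\<And>k. c (- k) = cnj (c k)"
  obtains f where "smooth_periodic f" "\<And>k. fourier f k = c k"
proof -
  note W = wave_series[OF rapid_abs_summable[OF c]]
  have real: "of_real (Re (wave_series c x)) = wave_series c x" for x
  proof -
    have "((\<lambda>k. cnj (c k * wave k x)) has_sum cnj (wave_series c x)) UNIV" using W(1)[of x] by (simp only: has_sum_cnj_iff)
    then have "((\<lambda>k. c (- k) * wave (- k) x) has_sum cnj (wave_series c x)) UNIV" by (simp add: h wave_simps)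
    moreover have "bij (uminus :: ('a \<Rightarrow> int) \<Rightarrow> _)" by (rule bij_uminus)
    ultimately have "((\<lambda>k. c k * wave k x) has_sum cnj (wave_series c x)) UNIV"
      using has_sum_reindex_bij_betw[of uminus UNIV UNIV "\<lambda>k. c k * wave k x"] by simp
    then have "cnj (wave_series c x) = wave_series c x" using W(1)[of x] has_sum_unique by blast
    then show ?thesis by (simp add: complex_eq_iff)
  qed
  let ?f = "\<lambda>x. Re (wave_series c x)"
  have "smooth_periodic ?f"
    unfolding smooth_periodic_def
  proof
    show "smooth_on ?f UNIV"
      by (rule smooth_on_bounded_linear[OF open_UNIV bounded_linear_Re smooth_wave_series[OF c]])
    show "periodic ?f" using W(3) by (simp add: periodic_def)
  qed
  moreover have "fourier ?f k = c k" for k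
    unfolding fourier_def real by (rule W(4))
  ultimately show thesis using that by blast
qed

lemma fourier_multiplier:
  assumes f: "smooth_periodic f" and \<mu>: "\<And>k. norm (\<mu> k) \<le> C" "\<And>k. \<mu> (- k) = cnj (\<mu> k)"
  obtains g where "smooth_periodic g" "\<And>k. fourier g k = \<mu> k * fourier f k"
proof -
  have "rapid (\<lambda>k. \<mu> k * fourier f k)"
    unfolding rapid_def
  proof
    fix N
    have "(\<lambda>k. C * (norm (fourier f k) * weight k ^ N)) summable_on UNIV"
      using rapid_fourier[OF f] by (intro summable_on_cmult_right) (auto simp: rapid_def)
    then show "(\<lambda>k. norm (\<mu> k * fourier f k) * weight k ^ N) summable_on UNIV"
    proof (rule summable_on_comparison_test)
      fix k :: "'a \<Rightarrow> int"
      show "norm (\<mu> k * fourier f k) * weight k ^ N \<le> C * (norm (fourier f k) * weight k ^ N)"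
        using \<mu>(1)[of k] weight_ge_1[of k] by (simp add: norm_mult mult.assoc mult_right_mono)
      show "0 \<le> norm (\<mu> k * fourier f k) * weight k ^ N" using weight_ge_1[of k] by auto
    qed
  qed
  moreover have "\<mu> (- k) * fourier f (- k) = cnj (\<mu> k * fourier f k)" for k
    by (simp add: \<mu>(2) fourier_cnj[OF f])
  ultimately show thesis using fourier_synthesis that by blast
qed

subsection \<open>Norms on smooth periodic functions\<close>

text \<open>Built by iterating first derivatives rather than by summing over multi-indices, so that
  estimates for products and compositions are inductions with one differentiation per step.\<close>

primrec nrm :: "((real^'m::finite \<Rightarrow> real) \<Rightarrow> real) \<Rightarrow> nat \<Rightarrow> (real^'m \<Rightarrow> real) \<Rightarrow> real" where
  "nrm \<nu> 0 f = \<nu> f"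
| "nrm \<nu> (Suc s) f = nrm \<nu> s f + (\<Sum>i\<in>UNIV. nrm \<nu> s (partial_deriv i f))"

text \<open>Instantiated twice: with the sup norm, in which compositions with smooth functions are
  easily estimated, and with the Wiener norm, in which Fourier multipliers are.\<close>

locale periodic_norm =
  fixes \<nu> :: "(real^'m::finite \<Rightarrow> real) \<Rightarrow> real"
  assumes nonneg: "smooth_periodic f \<Longrightarrow> 0 \<le> \<nu> f"
    and add: "smooth_periodic f \<Longrightarrow> smooth_periodic g \<Longrightarrow> \<nu> (\<lambda>x. f x + g x) \<le> \<nu> f + \<nu> g"
    and cmult: "smooth_periodic f \<Longrightarrow> \<nu> (\<lambda>x. c * f x) = \<bar>c\<bar> * \<nu> f"
    and mult: "smooth_periodic f \<Longrightarrow> smooth_periodic g \<Longrightarrow> \<nu> (\<lambda>x. f x * g x) \<le> \<nu> f * \<nu> g"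
begin

lemma nrm_nonneg: "smooth_periodic f \<Longrightarrow> 0 \<le> nrm \<nu> s f"
  by (induction s arbitrary: f) (auto intro!: nonneg add_nonneg_nonneg sum_nonneg sp_partial)

lemma nrm_add:
  "smooth_periodic f \<Longrightarrow> smooth_periodic g \<Longrightarrow> nrm \<nu> s (\<lambda>x. f x + g x) \<le> nrm \<nu> s f + nrm \<nu> s g"
proof (induction s arbitrary: f g)
  case (Suc s)
  have "(\<Sum>i\<in>UNIV. nrm \<nu> s (partial_deriv i (\<lambda>x. f x + g x)))
      \<le> (\<Sum>i\<in>UNIV. nrm \<nu> s (partial_deriv i f) + nrm \<nu> s (partial_deriv i g))"
    using Suc by (intro sum_mono) (auto simp: partial_add smooth_periodicD(1) sp_partial)
  then show ?case using Suc.IH[OF Suc.prems] by (simp add: sum.distrib)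
qed (simp add: add)

lemma nrm_cmult: "smooth_periodic f \<Longrightarrow> nrm \<nu> s (\<lambda>x. c * f x) = \<bar>c\<bar> * nrm \<nu> s f"
  by (induction s arbitrary: f)
    (auto simp: cmult partial_cmult smooth_periodicD(1) sp_partial sum_distrib_left distrib_left)

lemma nrm_zero: "nrm \<nu> s (\<lambda>_. 0) = 0"
  using nrm_cmult[OF sp_const, of s 0 0] by simp

lemma nrm_const: "nrm \<nu> s (\<lambda>_. c) = \<bar>c\<bar> * \<nu> (\<lambda>_. 1)"
  using cmult[OF sp_const, of c 1] by (induction s) (auto simp: partial_const nrm_zero)

lemma nrm_diff:
  assumes "smooth_periodic f" "smooth_periodic g"
  shows "nrm \<nu> s (\<lambda>x. f x - g x) \<le> nrm \<nu> s f + nrm \<nu> s g"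
  using nrm_add[OF assms(1) sp_minus[OF assms(2)], of s] nrm_cmult[OF assms(2), of s "-1"] by simp

lemma nrm_minus_commute:
  assumes "smooth_periodic f" "smooth_periodic g"
  shows "nrm \<nu> s (\<lambda>x. f x - g x) = nrm \<nu> s (\<lambda>x. g x - f x)"
  using nrm_cmult[OF sp_diff[OF assms], of s "-1"] by simp

lemma nrm_sum:
  "(\<And>i. i \<in> I \<Longrightarrow> smooth_periodic (f i)) \<Longrightarrow> nrm \<nu> s (\<lambda>x. \<Sum>i\<in>I. f i x) \<le> (\<Sum>i\<in>I. nrm \<nu> s (f i))"
proof (induction I rule: infinite_finite_induct)
  case (insert j I)
  have "nrm \<nu> s (\<lambda>x. f j x + (\<Sum>i\<in>I. f i x)) \<le> nrm \<nu> s (f j) + nrm \<nu> s (\<lambda>x. \<Sum>i\<in>I. f i x)"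
    using insert.prems by (intro nrm_add sp_sum) auto
  then show ?case using insert by simp
qed (simp_all add: nrm_zero)

lemma nrm_partial: "smooth_periodic f \<Longrightarrow> nrm \<nu> s (partial_deriv i f) \<le> nrm \<nu> (Suc s) f"
  using member_le_sum[of i UNIV "\<lambda>i. nrm \<nu> s (partial_deriv i f)"] nrm_nonneg[of f s]
  by (auto simp add: nrm_nonneg sp_partial add_increasing)

lemma nrm_Suc: "smooth_periodic f \<Longrightarrow> nrm \<nu> s f \<le> nrm \<nu> (Suc s) f"
  by (simp add: sum_nonneg nrm_nonneg sp_partial)

lemma nrm_mono: "smooth_periodic f \<Longrightarrow> s \<le> t \<Longrightarrow> nrm \<nu> s f \<le> nrm \<nu> t f"
  by (rule lift_Suc_mono_le[of "\<lambda>s. nrm \<nu> s f"]) (use nrm_Suc in auto)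

text \<open>The Leibniz terms all occur in the product of the two recursive sums, whose only other
  term, the product of the derivative sums, is nonnegative. Hence no combinatorial constant appears
  at any order.\<close>

lemma nrm_mult:
  "smooth_periodic f \<Longrightarrow> smooth_periodic g \<Longrightarrow> nrm \<nu> s (\<lambda>x. f x * g x) \<le> nrm \<nu> s f * nrm \<nu> s g"
proof (induction s arbitrary: f g)
  case (Suc s)
  let ?F = "\<Sum>i\<in>UNIV. nrm \<nu> s (partial_deriv i f)" and ?G = "\<Sum>i\<in>UNIV. nrm \<nu> s (partial_deriv i g)"
  have "nrm \<nu> s (partial_deriv i (\<lambda>x. f x * g x))
      \<le> nrm \<nu> s f * nrm \<nu> s (partial_deriv i g) + nrm \<nu> s (partial_deriv i f) * nrm \<nu> s g" for i
  proof -
    have "nrm \<nu> s (partial_deriv i (\<lambda>x. f x * g x))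
        \<le> nrm \<nu> s (\<lambda>x. f x * partial_deriv i g x) + nrm \<nu> s (\<lambda>x. partial_deriv i f x * g x)"
      unfolding partial_mult[OF smooth_periodicD(1)[OF Suc.prems(1)] smooth_periodicD(1)[OF Suc.prems(2)]]
      by (intro nrm_add sp_intros Suc.prems)
    moreover have "nrm \<nu> s (\<lambda>x. f x * partial_deriv i g x) \<le> nrm \<nu> s f * nrm \<nu> s (partial_deriv i g)"
      by (intro Suc sp_partial)
    moreover have "nrm \<nu> s (\<lambda>x. partial_deriv i f x * g x) \<le> nrm \<nu> s (partial_deriv i f) * nrm \<nu> s g"
      by (intro Suc sp_partial)
    ultimately show ?thesis by linarith
  qed
  then have "(\<Sum>i\<in>UNIV. nrm \<nu> s (partial_deriv i (\<lambda>x. f x * g x)))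
      \<le> (\<Sum>i\<in>UNIV. nrm \<nu> s f * nrm \<nu> s (partial_deriv i g) + nrm \<nu> s (partial_deriv i f) * nrm \<nu> s g)"
    by (intro sum_mono)
  also have "\<dots> = nrm \<nu> s f * ?G + ?F * nrm \<nu> s g"
    by (simp add: sum.distrib sum_distrib_left sum_distrib_right)
  finally have "nrm \<nu> (Suc s) (\<lambda>x. f x * g x) \<le> nrm \<nu> s f * nrm \<nu> s g + (nrm \<nu> s f * ?G + ?F * nrm \<nu> s g)"
    using Suc.IH[OF Suc.prems] by simp
  moreover have "0 \<le> ?F * ?G" by (intro mult_nonneg_nonneg sum_nonneg nrm_nonneg sp_partial Suc.prems)
  ultimately show ?case by (simp add: algebra_simps)
qed (simp add: mult)

text \<open>Only the base norm of \<open>f\<close> multiplies the top-order norm of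
  \<open>g\<close>, and with coefficient 1 at every order: if \<open>f\<close> is small in the base
  norm, multiplication by \<open>f\<close> is small at top order, however large the higher norms of
  \<open>f\<close> are. They enter with \<open>C\<close>, at lower order in
  \<open>g\<close>.\<close>

lemma nrm_mult_tame:
  "\<exists>C\<ge>0. \<forall>f g. smooth_periodic f \<longrightarrow> smooth_periodic g \<longrightarrow>
     nrm \<nu> (Suc s) (\<lambda>x. f x * g x) \<le> \<nu> f * nrm \<nu> (Suc s) g + C * nrm \<nu> (Suc s) f * nrm \<nu> s g"
proof (induction s)
  case 0
  have "nrm \<nu> (Suc 0) (\<lambda>x. f x * g x) \<le> \<nu> f * nrm \<nu> (Suc 0) g + 1 * nrm \<nu> (Suc 0) f * nrm \<nu> 0 g"
    if f: "smooth_periodic f" and g: "smooth_periodic g" for f g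
  proof -
    have "\<nu> (partial_deriv i (\<lambda>x. f x * g x)) \<le> \<nu> f * \<nu> (partial_deriv i g) + \<nu> (partial_deriv i f) * \<nu> g" for i
      unfolding partial_mult[OF smooth_periodicD(1)[OF f] smooth_periodicD(1)[OF g]]
      by (rule order_trans[OF add add_mono[OF mult mult]]) (intro sp_intros f g)+
    then have "(\<Sum>i\<in>UNIV. \<nu> (partial_deriv i (\<lambda>x. f x * g x)))
        \<le> (\<Sum>i\<in>UNIV. \<nu> f * \<nu> (partial_deriv i g) + \<nu> (partial_deriv i f) * \<nu> g)"
      by (intro sum_mono)
    also have "\<dots> = \<nu> f * (\<Sum>i\<in>UNIV. \<nu> (partial_deriv i g)) + (\<Sum>i\<in>UNIV. \<nu> (partial_deriv i f)) * \<nu> g"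
      by (simp add: sum.distrib sum_distrib_left sum_distrib_right)
    finally show ?thesis
      using mult[OF f g] mult_nonneg_nonneg[OF nonneg[OF f] nonneg[OF g]] by (simp add: algebra_simps)
  qed
  then show ?case by (intro exI[of _ 1]) auto
next
  case (Suc s)
  then obtain C where C: "C \<ge> 0" "\<And>f g. smooth_periodic f \<Longrightarrow> smooth_periodic g \<Longrightarrow>
     nrm \<nu> (Suc s) (\<lambda>x. f x * g x) \<le> \<nu> f * nrm \<nu> (Suc s) g + C * nrm \<nu> (Suc s) f * nrm \<nu> s g" by blast
  \<comment> \<open>The 1 takes the norm one order lower together with the derivative falling on
    \<open>f\<close>; each of the \<open>CARD('m)\<close> directions adds one \<open>C\<close> from
    the induction hypothesis.\<close>
  let ?C = "1 + CARD('m) * C"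
  have "nrm \<nu> (Suc (Suc s)) (\<lambda>x. f x * g x)
      \<le> \<nu> f * nrm \<nu> (Suc (Suc s)) g + ?C * nrm \<nu> (Suc (Suc s)) f * nrm \<nu> (Suc s) g"
    if f: "smooth_periodic f" and g: "smooth_periodic g" for f g
  proof -
    define a where "a = nrm \<nu> (Suc s) f"
    define b where "b = nrm \<nu> (Suc s) g"
    have ab: "a \<ge> 0" "b \<ge> 0" unfolding a_def b_def using f g nrm_nonneg by blast+
    have "nrm \<nu> (Suc s) (partial_deriv i (\<lambda>x. f x * g x))
        \<le> \<nu> f * nrm \<nu> (Suc s) (partial_deriv i g) + C * a * b + nrm \<nu> (Suc s) (partial_deriv i f) * b" for i
    proof -
      have "nrm \<nu> (Suc s) (partial_deriv i (\<lambda>x. f x * g x))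
          \<le> nrm \<nu> (Suc s) (\<lambda>x. f x * partial_deriv i g x) + nrm \<nu> (Suc s) (\<lambda>x. partial_deriv i f x * g x)"
        unfolding partial_mult[OF smooth_periodicD(1)[OF f] smooth_periodicD(1)[OF g]]
        by (intro nrm_add sp_intros f g)
      moreover have "nrm \<nu> (Suc s) (\<lambda>x. f x * partial_deriv i g x)
          \<le> \<nu> f * nrm \<nu> (Suc s) (partial_deriv i g) + C * a * nrm \<nu> s (partial_deriv i g)"
        unfolding a_def by (intro C sp_partial f g)
      moreover have "C * a * nrm \<nu> s (partial_deriv i g) \<le> C * a * b"
        unfolding b_def using C(1) ab(1) by (intro mult_left_mono nrm_partial g mult_nonneg_nonneg)
      moreover have "nrm \<nu> (Suc s) (\<lambda>x. partial_deriv i f x * g x) \<le> nrm \<nu> (Suc s) (partial_deriv i f) * b"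
        unfolding b_def by (intro nrm_mult sp_partial f g)
      ultimately show ?thesis by linarith
    qed
    then have "(\<Sum>i\<in>UNIV. nrm \<nu> (Suc s) (partial_deriv i (\<lambda>x. f x * g x)))
      \<le> (\<Sum>i\<in>UNIV. \<nu> f * nrm \<nu> (Suc s) (partial_deriv i g) + C * a * b + nrm \<nu> (Suc s) (partial_deriv i f) * b)"
      by (intro sum_mono)
    also have "\<dots> = \<nu> f * (\<Sum>i\<in>UNIV. nrm \<nu> (Suc s) (partial_deriv i g)) + CARD('m) * C * a * b
        + (\<Sum>i\<in>UNIV. nrm \<nu> (Suc s) (partial_deriv i f)) * b"
      by (simp add: sum.distrib sum_distrib_left sum_distrib_right del: nrm.simps)
    finally have 1: "nrm \<nu> (Suc (Suc s)) (\<lambda>x. f x * g x) \<le> a * b + (\<nu> f * (\<Sum>i\<in>UNIV. nrm \<nu> (Suc s) (partial_deriv i g))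
        + CARD('m) * C * a * b + (\<Sum>i\<in>UNIV. nrm \<nu> (Suc s) (partial_deriv i f)) * b)"
      using nrm_mult[OF f g, of "Suc s"] unfolding nrm.simps(2)[of \<nu> "Suc s"] a_def b_def by linarith
    have 2: "nrm \<nu> (Suc (Suc s)) f = a + (\<Sum>i\<in>UNIV. nrm \<nu> (Suc s) (partial_deriv i f))"
      "nrm \<nu> (Suc (Suc s)) g = b + (\<Sum>i\<in>UNIV. nrm \<nu> (Suc s) (partial_deriv i g))"
      unfolding a_def b_def by (rule nrm.simps(2))+
    have 3: "0 \<le> \<nu> f * b" "0 \<le> CARD('m) * C * (\<Sum>i\<in>UNIV. nrm \<nu> (Suc s) (partial_deriv i f)) * b"
      using C(1) ab nonneg[OF f] by (auto intro!: mult_nonneg_nonneg sum_nonneg nrm_nonneg sp_partial f simp del: nrm.simps)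
    show ?thesis using 1 3 unfolding 2 b_def[symmetric] by (simp add: algebra_simps)
  qed
  then show ?case using C(1) by (intro exI[of _ ?C]) auto
qed

text \<open>Differentiation turns a difference of compositions into differences of compositions with
  the partial derivatives of \<open>H\<close>, so the induction runs over all \<open>H\<close>
  simultaneously. The second norm \<open>Z\<close> is a parameter because the base estimate for the
  Wiener norm is available only in terms of sup norms of derivatives.\<close>

lemma nrm_comp_lipschitz:
  fixes H :: "real^'p::finite \<Rightarrow> real"
  assumes Z: "\<And>f. smooth_periodic f \<Longrightarrow> 0 \<le> Z f" "Z (\<lambda>_. 0) = 0"
    and base: "\<And>(H::real^'p \<Rightarrow> real) B. smooth_on H UNIV \<Longrightarrow> \<exists>C\<ge>0. \<forall>U V.
      (\<forall>p. smooth_periodic (U p) \<and> smooth_periodic (V p) \<and> Z (U p) \<le> B \<and> Z (V p) \<le> B) \<longrightarrow>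
      \<nu> (\<lambda>x. H (\<chi> p. U p x) - H (\<chi> p. V p x)) \<le> C * (\<Sum>p\<in>UNIV. Z (\<lambda>x. U p x - V p x))"
    and H: "smooth_on H UNIV"
  shows "\<exists>C\<ge>0. \<forall>U V.
      (\<forall>p. smooth_periodic (U p) \<and> smooth_periodic (V p) \<and> nrm \<nu> s (U p) + Z (U p) \<le> B \<and> nrm \<nu> s (V p) + Z (V p) \<le> B) \<longrightarrow>
      nrm \<nu> s (\<lambda>x. H (\<chi> p. U p x) - H (\<chi> p. V p x))
        \<le> C * (\<Sum>p\<in>UNIV. nrm \<nu> s (\<lambda>x. U p x - V p x) + Z (\<lambda>x. U p x - V p x))"
  using H
proof (induction s arbitrary: H)
  case 0
  obtain C where C: "C \<ge> 0" "\<And>U V. (\<And>p. smooth_periodic (U p) \<and> smooth_periodic (V p) \<and> Z (U p) \<le> B \<and> Z (V p) \<le> B) \<Longrightarrow>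
      \<nu> (\<lambda>x. H (\<chi> p. U p x) - H (\<chi> p. V p x)) \<le> C * (\<Sum>p\<in>UNIV. Z (\<lambda>x. U p x - V p x))"
    using base[OF 0, of B] by blast
  show ?case
  proof (intro exI[of _ C] conjI allI impI C(1))
    fix U V :: "'p \<Rightarrow> real^'m \<Rightarrow> real"
    assume A: "\<forall>p. smooth_periodic (U p) \<and> smooth_periodic (V p) \<and> nrm \<nu> 0 (U p) + Z (U p) \<le> B \<and> nrm \<nu> 0 (V p) + Z (V p) \<le> B"
    have "smooth_periodic (U p) \<and> smooth_periodic (V p) \<and> Z (U p) \<le> B \<and> Z (V p) \<le> B" for p
      using A[rule_format, of p] nonneg[of "U p"] nonneg[of "V p"] by auto
    then have "\<nu> (\<lambda>x. H (\<chi> p. U p x) - H (\<chi> p. V p x)) \<le> C * (\<Sum>p\<in>UNIV. Z (\<lambda>x. U p x - V p x))" by (rule C(2))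
    also have "\<dots> \<le> C * (\<Sum>p\<in>UNIV. nrm \<nu> 0 (\<lambda>x. U p x - V p x) + Z (\<lambda>x. U p x - V p x))"
      using A C(1) by (intro mult_left_mono sum_mono) (auto intro!: nonneg sp_diff)
    finally show "nrm \<nu> 0 (\<lambda>x. H (\<chi> p. U p x) - H (\<chi> p. V p x))
        \<le> C * (\<Sum>p\<in>UNIV. nrm \<nu> 0 (\<lambda>x. U p x - V p x) + Z (\<lambda>x. U p x - V p x))" by simp
  qed
next
  case (Suc s)
  let ?adm = "\<lambda>s U. \<forall>p::'p. smooth_periodic (U p) \<and> nrm \<nu> s (U p) + Z (U p) \<le> B"
  let ?S = "\<lambda>s U V. \<Sum>p\<in>(UNIV::'p set). nrm \<nu> s (\<lambda>x. U p x - V p x) + Z (\<lambda>x. U p x - V p x)"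
  have IH: "\<exists>C\<ge>0. \<forall>U V. ?adm s U \<longrightarrow> ?adm s V \<longrightarrow>
      nrm \<nu> s (\<lambda>x. H (\<chi> p. U p x) - H (\<chi> p. V p x)) \<le> C * ?S s U V" if "smooth_on H UNIV" for H :: "real^'p \<Rightarrow> real"
  proof -
    from Suc.IH[OF that] obtain C where "C \<ge> 0" and c: "\<forall>U V. (\<forall>p. smooth_periodic (U p) \<and> smooth_periodic (V p) \<and>
       nrm \<nu> s (U p) + Z (U p) \<le> B \<and> nrm \<nu> s (V p) + Z (V p) \<le> B) \<longrightarrow>
      nrm \<nu> s (\<lambda>x. H (\<chi> p. U p x) - H (\<chi> p. V p x)) \<le> C * ?S s U V" by auto
    show ?thesis
    proof (intro exI[of _ C] conjI allI impI)
      show "C \<ge> 0" by fact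
      fix U V assume "?adm s U" "?adm s V"
      then show "nrm \<nu> s (\<lambda>x. H (\<chi> p. U p x) - H (\<chi> p. V p x)) \<le> C * ?S s U V"
        by (intro c[rule_format]) simp
    qed
  qed
  have Hp: "smooth_on (partial_deriv p H) UNIV" for p using Suc.prems by (rule smooth_on_partial)
  obtain C0 where C0: "C0 \<ge> 0" "\<And>U V. ?adm s U \<Longrightarrow> ?adm s V \<Longrightarrow>
      nrm \<nu> s (\<lambda>x. H (\<chi> p. U p x) - H (\<chi> p. V p x)) \<le> C0 * ?S s U V"
    using IH[OF Suc.prems] by blast
  have "\<forall>q. \<exists>C\<ge>0. \<forall>U V. ?adm s U \<longrightarrow> ?adm s V \<longrightarrow>
      nrm \<nu> s (\<lambda>x. partial_deriv q H (\<chi> p. U p x) - partial_deriv q H (\<chi> p. V p x)) \<le> C * ?S s U V"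
    using IH[OF Hp] by blast
  from choice[OF this] obtain C1 where "\<forall>q. C1 q \<ge> 0 \<and> (\<forall>U V. ?adm s U \<longrightarrow> ?adm s V \<longrightarrow>
      nrm \<nu> s (\<lambda>x. partial_deriv q H (\<chi> p. U p x) - partial_deriv q H (\<chi> p. V p x)) \<le> C1 q * ?S s U V)"
    by (elim exE)
  then have C1: "\<And>q. C1 q \<ge> 0" "\<And>q U V. ?adm s U \<Longrightarrow> ?adm s V \<Longrightarrow>
      nrm \<nu> s (\<lambda>x. partial_deriv q H (\<chi> p. U p x) - partial_deriv q H (\<chi> p. V p x)) \<le> C1 q * ?S s U V"
    by simp_all
  \<comment> \<open>Bounds \<open>partial_deriv q H\<close> along \<open>V\<close> by its Lipschitz
    distance from the zero map plus its value at 0.\<close>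
  define K where "K = (\<lambda>q. C1 q * (CARD('p) * \<bar>B\<bar>) + \<bar>partial_deriv q H 0\<bar> * \<nu> (\<lambda>_. 1))"
  have K0: "K q \<ge> 0" for q
    unfolding K_def using C1(1)[of q] nonneg[OF sp_const, of 1] by simp
  define C where "C = C0 + (\<Sum>i\<in>(UNIV::'m set). \<Sum>q\<in>UNIV. C1 q * \<bar>B\<bar> + K q)"
  have C0': "C \<ge> 0" unfolding C_def using C0(1) C1(1) K0 by (simp add: sum_nonneg)
  show ?case
  proof (intro exI[of _ C] conjI allI impI C0')
    fix U V :: "'p \<Rightarrow> real^'m \<Rightarrow> real"
    assume A: "\<forall>p. smooth_periodic (U p) \<and> smooth_periodic (V p) \<and> nrm \<nu> (Suc s) (U p) + Z (U p) \<le> B \<and> nrm \<nu> (Suc s) (V p) + Z (V p) \<le> B"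
    have sU: "smooth_periodic (U p)" and sV: "smooth_periodic (V p)" for p using A by auto
    have sD: "smooth_periodic (\<lambda>x. U p x - V p x)" for p by (intro sp_diff sU sV)
    have aU: "?adm s U"
    proof (intro allI conjI sU)
      fix p show "nrm \<nu> s (U p) + Z (U p) \<le> B" using A[rule_format, of p] nrm_Suc[OF sU[of p], of s] by linarith
    qed
    have aV: "?adm s V"
    proof (intro allI conjI sV)
      fix p show "nrm \<nu> s (V p) + Z (V p) \<le> B" using A[rule_format, of p] nrm_Suc[OF sV[of p], of s] by linarith
    qed
    have B0: "B \<ge> 0"
      using A[rule_format, of undefined] nrm_nonneg[OF sU[of undefined], of "Suc s"] Z(1)[OF sU[of undefined]] by linarith
    have a0: "?adm s (\<lambda>_ _. 0)" using B0 by (simp add: sp_const nrm_zero Z(2))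
    have S0: "?S s U V \<le> ?S (Suc s) U V" by (intro sum_mono add_right_mono nrm_Suc sD)
    have Sn: "?S s U V \<ge> 0" by (intro sum_nonneg add_nonneg_nonneg nrm_nonneg Z(1) sD)
    have T: "nrm \<nu> (Suc s) (\<lambda>x. U q x - V q x) \<le> ?S (Suc s) U V" for q
    proof -
      have "nrm \<nu> (Suc s) (\<lambda>x. U q x - V q x) + Z (\<lambda>x. U q x - V q x) \<le> ?S (Suc s) U V"
        by (rule member_le_sum[of q UNIV "\<lambda>q. nrm \<nu> (Suc s) (\<lambda>x. U q x - V q x) + Z (\<lambda>x. U q x - V q x)"])
          (auto simp del: nrm.simps intro!: add_nonneg_nonneg nrm_nonneg Z(1) sD)
      then show ?thesis using Z(1)[OF sD, of q] by linarith
    qed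
    have sH: "smooth_periodic (\<lambda>x. partial_deriv q H (\<chi> p. W p x))" if "\<And>p. smooth_periodic (W p)" for q W
      by (intro sp_compose Hp that)
    have HV: "nrm \<nu> s (\<lambda>x. partial_deriv q H (\<chi> p. V p x)) \<le> K q" for q
    proof -
      have "(\<chi> p. 0) = (0 :: real^'p)" by (simp add: vec_eq_iff)
      then have 1: "nrm \<nu> s (\<lambda>x. partial_deriv q H (\<chi> p. V p x) - partial_deriv q H 0) \<le> C1 q * (\<Sum>p\<in>UNIV. nrm \<nu> s (V p) + Z (V p))"
        using C1(2)[OF aV a0, of q] by simp
      also have "\<dots> \<le> C1 q * (\<Sum>p\<in>(UNIV::'p set). \<bar>B\<bar>)"
        using aV B0 C1(1)[of q] by (intro mult_left_mono sum_mono) auto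
      finally have 1: "nrm \<nu> s (\<lambda>x. partial_deriv q H (\<chi> p. V p x) - partial_deriv q H 0) \<le> C1 q * (CARD('p) * \<bar>B\<bar>)" by simp
      have "nrm \<nu> s (\<lambda>x. (partial_deriv q H (\<chi> p. V p x) - partial_deriv q H 0) + partial_deriv q H 0)
          \<le> nrm \<nu> s (\<lambda>x. partial_deriv q H (\<chi> p. V p x) - partial_deriv q H 0) + nrm \<nu> s (\<lambda>_. partial_deriv q H 0)"
        by (intro nrm_add sp_diff sp_const sH sV)
      then show ?thesis using 1 unfolding K_def nrm_const by simp
    qed
    \<comment> \<open>The chain rule with a mixed term inserted: either the derivative of
      \<open>H\<close> changes between \<open>U\<close> and \<open>V\<close>, or the inner
      derivative does.\<close>
    have "partial_deriv i (\<lambda>x. H (\<chi> p. U p x) - H (\<chi> p. V p x))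
       = (\<lambda>x. \<Sum>q\<in>UNIV. (partial_deriv q H (\<chi> p. U p x) - partial_deriv q H (\<chi> p. V p x)) * partial_deriv i (U q) x
          + partial_deriv q H (\<chi> p. V p x) * partial_deriv i (\<lambda>x. U q x - V q x) x)" for i
    proof
      fix x
      have c: "partial_deriv i (\<lambda>x. H (\<chi> p. W p x)) x = (\<Sum>q\<in>UNIV. partial_deriv q H (\<chi> p. W p x) * partial_deriv i (W q) x)"
        if "\<And>p. smooth_periodic (W p)" for W
        using that by (intro partial_chain[OF Suc.prems _ _ smooth_periodicD(1)]) auto
      have d: "partial_deriv i (\<lambda>x. H (\<chi> p. U p x) - H (\<chi> p. V p x)) x
        = partial_deriv i (\<lambda>x. H (\<chi> p. U p x)) x - partial_deriv i (\<lambda>x. H (\<chi> p. V p x)) x"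
        by (rule fun_cong[OF partial_diff[OF smooth_periodicD(1)[OF sp_compose[OF Suc.prems sU]] smooth_periodicD(1)[OF sp_compose[OF Suc.prems sV]]]])
      have e: "partial_deriv i (\<lambda>x. U q x - V q x) x = partial_deriv i (U q) x - partial_deriv i (V q) x" for q
        by (rule fun_cong[OF partial_diff[OF smooth_periodicD(1)[OF sU] smooth_periodicD(1)[OF sV]]])
      show "partial_deriv i (\<lambda>x. H (\<chi> p. U p x) - H (\<chi> p. V p x)) x
        = (\<Sum>q\<in>UNIV. (partial_deriv q H (\<chi> p. U p x) - partial_deriv q H (\<chi> p. V p x)) * partial_deriv i (U q) x
          + partial_deriv q H (\<chi> p. V p x) * partial_deriv i (\<lambda>x. U q x - V q x) x)"
        unfolding d c[OF sU] c[OF sV] e sum_subtractf[symmetric] by (intro sum.cong refl) (simp add: algebra_simps)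
    qed
    then have "nrm \<nu> s (partial_deriv i (\<lambda>x. H (\<chi> p. U p x) - H (\<chi> p. V p x)))
      \<le> (\<Sum>q\<in>UNIV. (C1 q * \<bar>B\<bar> + K q) * ?S (Suc s) U V)" for i
    proof -
      let ?a = "\<lambda>q x. partial_deriv q H (\<chi> p. U p x) - partial_deriv q H (\<chi> p. V p x)"
      have eq: "partial_deriv i (\<lambda>x. H (\<chi> p. U p x) - H (\<chi> p. V p x))
       = (\<lambda>x. \<Sum>q\<in>UNIV. ?a q x * partial_deriv i (U q) x
          + partial_deriv q H (\<chi> p. V p x) * partial_deriv i (\<lambda>x. U q x - V q x) x)" by fact
      have "nrm \<nu> s (\<lambda>x. ?a q x * partial_deriv i (U q) x + partial_deriv q H (\<chi> p. V p x) * partial_deriv i (\<lambda>x. U q x - V q x) x)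
          \<le> (C1 q * \<bar>B\<bar> + K q) * ?S (Suc s) U V" for q
      proof -
        have "nrm \<nu> s (\<lambda>x. ?a q x * partial_deriv i (U q) x) \<le> nrm \<nu> s (?a q) * nrm \<nu> s (partial_deriv i (U q))"
          by (intro nrm_mult sp_diff sH sU sV sp_partial)
        also have "\<dots> \<le> (C1 q * ?S s U V) * \<bar>B\<bar>"
        proof (intro mult_mono C1(2)[OF aU aV])
          have "nrm \<nu> s (partial_deriv i (U q)) \<le> nrm \<nu> (Suc s) (U q)" by (intro nrm_partial sU)
          also have "\<dots> \<le> B" using A[rule_format, of q] Z(1)[OF sU, of q] by linarith
          finally show "nrm \<nu> s (partial_deriv i (U q)) \<le> \<bar>B\<bar>" by linarith
          show "0 \<le> C1 q * ?S s U V" using C1(1) Sn by simp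
          show "0 \<le> nrm \<nu> s (partial_deriv i (U q))" by (intro nrm_nonneg sp_partial sU)
        qed
        also have "\<dots> \<le> (C1 q * ?S (Suc s) U V) * \<bar>B\<bar>"
          using C1(1)[of q] S0 by (intro mult_right_mono mult_left_mono) auto
        finally have 1: "nrm \<nu> s (\<lambda>x. ?a q x * partial_deriv i (U q) x) \<le> C1 q * \<bar>B\<bar> * ?S (Suc s) U V" by (simp only: mult_ac)
        have "nrm \<nu> s (\<lambda>x. partial_deriv q H (\<chi> p. V p x) * partial_deriv i (\<lambda>x. U q x - V q x) x)
          \<le> nrm \<nu> s (\<lambda>x. partial_deriv q H (\<chi> p. V p x)) * nrm \<nu> s (partial_deriv i (\<lambda>x. U q x - V q x))"
          by (intro nrm_mult sH sV sp_partial sD)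
        also have "\<dots> \<le> K q * ?S (Suc s) U V"
          by (intro mult_mono HV K0 order_trans[OF nrm_partial T] nrm_nonneg sp_partial sD)
        finally have 2: "nrm \<nu> s (\<lambda>x. partial_deriv q H (\<chi> p. V p x) * partial_deriv i (\<lambda>x. U q x - V q x) x)
          \<le> K q * ?S (Suc s) U V" .
        have "nrm \<nu> s (\<lambda>x. ?a q x * partial_deriv i (U q) x + partial_deriv q H (\<chi> p. V p x) * partial_deriv i (\<lambda>x. U q x - V q x) x)
          \<le> nrm \<nu> s (\<lambda>x. ?a q x * partial_deriv i (U q) x) + nrm \<nu> s (\<lambda>x. partial_deriv q H (\<chi> p. V p x) * partial_deriv i (\<lambda>x. U q x - V q x) x)"
          by (intro nrm_add sp_mult sp_diff sH sU sV sp_partial)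
        then show ?thesis using 1 2 by (simp only: distrib_right)
      qed
      then show ?thesis
        unfolding eq by (intro order_trans[OF nrm_sum] sum_mono sp_add sp_mult sp_diff sH sU sV sp_partial)
    qed
    then have "(\<Sum>i\<in>UNIV. nrm \<nu> s (partial_deriv i (\<lambda>x. H (\<chi> p. U p x) - H (\<chi> p. V p x))))
      \<le> (\<Sum>i\<in>(UNIV::'m set). \<Sum>q\<in>UNIV. (C1 q * \<bar>B\<bar> + K q) * ?S (Suc s) U V)" by (intro sum_mono)
    also have "\<dots> = (\<Sum>i\<in>(UNIV::'m set). \<Sum>q\<in>UNIV. C1 q * \<bar>B\<bar> + K q) * ?S (Suc s) U V" by (simp only: sum_distrib_right)
    finally have 1: "(\<Sum>i\<in>UNIV. nrm \<nu> s (partial_deriv i (\<lambda>x. H (\<chi> p. U p x) - H (\<chi> p. V p x))))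
       \<le> (\<Sum>i\<in>(UNIV::'m set). \<Sum>q\<in>UNIV. C1 q * \<bar>B\<bar> + K q) * ?S (Suc s) U V" .
    have "nrm \<nu> s (\<lambda>x. H (\<chi> p. U p x) - H (\<chi> p. V p x)) \<le> C0 * ?S s U V" by (rule C0(2)[OF aU aV])
    also have "\<dots> \<le> C0 * ?S (Suc s) U V" using C0(1) S0 by (intro mult_left_mono)
    finally show "nrm \<nu> (Suc s) (\<lambda>x. H (\<chi> p. U p x) - H (\<chi> p. V p x)) \<le> C * ?S (Suc s) U V"
      using 1 unfolding C_def nrm.simps(2)[of \<nu> s "\<lambda>x. H (\<chi> p. U p x) - H (\<chi> p. V p x)"] distrib_right by linarith
  qed
qed

end

section \<open>The sup norm, the Wiener norm and compositions\<close>

lemma frechet_partial: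
  fixes f :: "real^'m::finite \<Rightarrow> real"
  assumes "(f has_derivative D) (at x)"
  shows "D v = (\<Sum>i\<in>UNIV. v $ i * partial_deriv i f x)"
proof -
  have l: "linear D" using assms has_derivative_linear by blast
  have ax: "axis i t = t *\<^sub>R axis i 1" for i :: 'm and t :: real by (simp add: vec_eq_iff axis_def)
  have "D v = D (\<Sum>i\<in>UNIV. axis i (v $ i))" by (simp add: sum_axis_eq)
  also have "\<dots> = (\<Sum>i\<in>UNIV. v $ i *\<^sub>R D (axis i 1))"
    unfolding linear_sum[OF l] by (intro sum.cong refl) (subst ax, simp add: linear_scale[OF l])
  finally show ?thesis using partial_deriv_eqI[OF assms] by simp
qed

definition supn :: "(real^'m::finite \<Rightarrow> real) \<Rightarrow> real" where
  "supn f = (SUP x. \<bar>f x\<bar>)"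

lemma supn_upper: "smooth_periodic f \<Longrightarrow> \<bar>f x\<bar> \<le> supn f"
  unfolding supn_def
proof (rule cSUP_upper)
  assume "smooth_periodic f"
  then obtain B where "\<And>x. \<bar>f x\<bar> \<le> B" using sp_bounded by blast
  then show "bdd_above (range (\<lambda>x. \<bar>f x\<bar>))" by (intro bdd_aboveI2)
qed simp

lemma supn_least: "(\<And>x. \<bar>f x\<bar> \<le> B) \<Longrightarrow> supn f \<le> B"
  unfolding supn_def by (rule cSUP_least) auto

interpretation sup: periodic_norm supn
proof
  fix f g :: "real^'m \<Rightarrow> real" and c :: real
  assume f: "smooth_periodic f"
  show n: "0 \<le> supn f" using supn_upper[OF f, of 0] by linarith
  show "supn (\<lambda>x. c * f x) = \<bar>c\<bar> * supn f"
  proof (rule antisym)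
    show "supn (\<lambda>x. c * f x) \<le> \<bar>c\<bar> * supn f"
      by (rule supn_least) (simp add: abs_mult mult_left_mono supn_upper[OF f])
    have "\<bar>c\<bar> * \<bar>f x\<bar> \<le> supn (\<lambda>x. c * f x)" for x
      using supn_upper[OF sp_mult[OF sp_const f], of c x] by (simp add: abs_mult)
    then have "c \<noteq> 0 \<Longrightarrow> supn f \<le> supn (\<lambda>x. c * f x) / \<bar>c\<bar>"
      by (intro supn_least) (simp add: field_simps)
    then show "\<bar>c\<bar> * supn f \<le> supn (\<lambda>x. c * f x)"
      by (cases "c = 0") (auto simp: field_simps supn_def)
  qed
  assume g: "smooth_periodic g"
  show "supn (\<lambda>x. f x + g x) \<le> supn f + supn g"
  proof (rule supn_least)
    fix x show "\<bar>f x + g x\<bar> \<le> supn f + supn g" using supn_upper[OF f, of x] supn_upper[OF g, of x] by linarith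
  qed
  show "supn (\<lambda>x. f x * g x) \<le> supn f * supn g"
    by (rule supn_least) (use n in \<open>auto simp: abs_mult intro!: mult_mono supn_upper f g\<close>)
qed

text \<open>The norm of the Wiener algebra of absolutely convergent Fourier series.\<close>

definition wiener :: "(real^'m::finite \<Rightarrow> real) \<Rightarrow> real" where
  "wiener f = (\<Sum>\<^sub>\<infinity>k. norm (fourier f k))"

lemma wiener_has_sum: "smooth_periodic f \<Longrightarrow> ((\<lambda>k. norm (fourier f k)) has_sum wiener f) UNIV"
  unfolding wiener_def by (intro has_sum_infsum rapid_abs_summable rapid_fourier)

text \<open>One factor is expanded into its absolutely convergent series, and the mean against the
  other is taken term by term.\<close>

lemma fourier_mult:
  assumes f: "smooth_periodic f" and g: "smooth_periodic g"
  shows "((\<lambda>l. fourier f l * fourier g (k - l)) has_sum fourier (\<lambda>x. f x * g x) k) UNIV"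
proof -
  let ?h = "\<lambda>l x. (fourier f l * wave l x) * (of_real (g x) * wave (- k) x)"
  obtain B where B: "B \<ge> 0" "\<And>x. \<bar>g x\<bar> \<le> B" using sp_bounded[OF g] by blast
  have c: "continuous_on UNIV (?h l)" for l
    by (intro continuous_intros continuous_on_sp_wave g)
  have b: "norm (?h l x) \<le> norm (fourier f l) * B" for l x
    using B(2)[of x] by (simp add: norm_mult wave_simps mult_left_mono)
  have "((\<lambda>l. mean (?h l)) has_sum mean (\<lambda>x. \<Sum>\<^sub>\<infinity>l. ?h l x)) UNIV"
    by (rule mean_has_sum(1)[OF c b]) (intro summable_on_cmult_left rapid_abs_summable rapid_fourier f)
  moreover have "(\<Sum>\<^sub>\<infinity>l. ?h l x) = of_real (f x * g x) * wave (- k) x" for x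
    using infsumI[OF has_sum_cmult_left[OF fourier_inversion[OF f, of x], of "of_real (g x) * wave (- k) x"]]
    by (simp add: mult.assoc)
  moreover have "mean (?h l) = fourier f l * fourier g (k - l)" for l
  proof -
    have "l + - k = - (k - l)" by (auto simp: fun_eq_iff)
    then have "?h l = (\<lambda>x. fourier f l * (of_real (g x) * wave (- (k - l)) x))"
      by (simp add: fun_eq_iff flip: wave_simps(2))
    then show ?thesis by (simp only: mean_cmult fourier_def[of g])
  qed
  ultimately show ?thesis by (simp add: fourier_def[of "\<lambda>x. f x * g x"])
qed

text \<open>The coefficients of a product are a convolution, and convolution is submultiplicative in
  \<open>l^1\<close>: the double family is summed in both orders, with a shift of the index.\<close>

lemma wiener_mult:
  assumes f: "smooth_periodic f" and g: "smooth_periodic g"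
  shows "wiener (\<lambda>x. f x * g x) \<le> wiener f * wiener g"
proof -
  define a where "a = (\<lambda>l. norm (fourier f l))"
  define b where "b = (\<lambda>l. norm (fourier g l))"
  have a: "(a has_sum wiener f) UNIV" and b: "(b has_sum wiener g) UNIV"
    using wiener_has_sum f g by (auto simp: a_def b_def)
  have ab0: "a l \<ge> 0" "b l \<ge> 0" for l by (auto simp: a_def b_def)
  have bs: "((\<lambda>k. b (k - l)) has_sum wiener g) UNIV" for l
  proof -
    have "bij (\<lambda>k. k - l)" by (rule bij_betw_byWitness[where f'="\<lambda>k. k + l"]) auto
    then show ?thesis using has_sum_reindex_bij_betw[of "\<lambda>k. k - l" UNIV UNIV b] b by simp
  qed
  have in1: "((\<lambda>k. a l * b (k - l)) has_sum a l * wiener g) UNIV" for l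
    using has_sum_cmult_right[OF bs] .
  have out1: "((\<lambda>l. a l * wiener g) has_sum wiener f * wiener g) UNIV"
    using has_sum_cmult_left[OF a] .
  have s: "(\<lambda>(l, k). a l * b (k - l)) summable_on UNIV \<times> UNIV"
    using in1 out1 ab0 by (intro summable_on_SigmaI[where g="\<lambda>l. a l * wiener g"]) (auto simp: summable_on_def)
  have hs: "((\<lambda>(l, k). a l * b (k - l)) has_sum wiener f * wiener g) (UNIV \<times> UNIV)"
    using has_sum_SigmaI[OF _ out1, of "\<lambda>(l, k). a l * b (k - l)" "\<lambda>_. UNIV"] in1 s by simp
  have hs': "((\<lambda>(k, l). a l * b (k - l)) has_sum wiener f * wiener g) (UNIV \<times> UNIV)"
    using hs has_sum_reindex_bij_betw[of prod.swap "UNIV \<times> UNIV" "UNIV \<times> UNIV" "\<lambda>(l, k). a l * b (k - l)" "wiener f * wiener g"]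
    by (simp add: case_prod_unfold bij_swap)
  have bb: "b j \<le> wiener g" for j
    using has_sum_mono_neutral[OF has_sum_finite[of "{j}" b] b] ab0 by auto
  have s2: "(\<lambda>l. a l * b (k - l)) summable_on UNIV" for k
    by (rule summable_on_comparison_test[OF has_sum_imp_summable[OF out1]]) (auto intro!: mult_left_mono mult_nonneg_nonneg bb ab0)
  have o2: "((\<lambda>k. \<Sum>\<^sub>\<infinity>l. a l * b (k - l)) has_sum wiener f * wiener g) UNIV"
    using has_sum_SigmaD[OF hs', of "\<lambda>k. \<Sum>\<^sub>\<infinity>l. a l * b (k - l)"] s2 by simp
  have "norm (fourier (\<lambda>x. f x * g x) k) \<le> (\<Sum>\<^sub>\<infinity>l. a l * b (k - l))" for k
    by (rule norm_infsum_le[OF fourier_mult[OF f g] has_sum_infsum[OF s2]]) (simp add: a_def b_def norm_mult)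
  then show ?thesis by (rule has_sum_mono[OF wiener_has_sum[OF sp_mult[OF f g]] o2])
qed

interpretation wiener: periodic_norm wiener
proof
  fix f g :: "real^'m \<Rightarrow> real" and c :: real
  assume f: "smooth_periodic f"
  show "0 \<le> wiener f" unfolding wiener_def by (intro infsum_nonneg) auto
  show "wiener (\<lambda>x. c * f x) = \<bar>c\<bar> * wiener f"
    by (simp add: wiener_def fourier_cmult norm_mult infsum_cmult_right')
  assume g: "smooth_periodic g"
  show "wiener (\<lambda>x. f x + g x) \<le> wiener f + wiener g"
    by (rule has_sum_mono[OF wiener_has_sum[OF sp_add[OF f g]] has_sum_add[OF wiener_has_sum[OF f] wiener_has_sum[OF g]]])
      (simp add: fourier_add[OF f g] norm_triangle_ineq)
  show "wiener (\<lambda>x. f x * g x) \<le> wiener f * wiener g" by (rule wiener_mult[OF f g])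
qed

lemma abs_le_wiener: "smooth_periodic f \<Longrightarrow> \<bar>f x\<bar> \<le> wiener f"
  using norm_infsum_le[OF fourier_inversion wiener_has_sum, of f f x] by (simp add: norm_mult wave_simps)

lemma nrm_sup_le_wiener: "smooth_periodic f \<Longrightarrow> nrm supn s f \<le> nrm wiener s f"
  by (induction s arbitrary: f) (auto intro!: supn_least abs_le_wiener add_mono sum_mono sp_partial)

lemma sup_partial_iter_le:
  "smooth_periodic f \<Longrightarrow> nrm supn s ((partial_deriv i ^^ j) f) \<le> nrm supn (s + j) f"
proof (induction j arbitrary: s)
  case (Suc j)
  have "nrm supn s (partial_deriv i ((partial_deriv i ^^ j) f)) \<le> nrm supn (Suc s) ((partial_deriv i ^^ j) f)"
    by (intro sup.nrm_partial sp_partial_iter Suc.prems)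
  also have "\<dots> \<le> nrm supn (Suc s + j) f" by (rule Suc.IH[OF Suc.prems])
  finally show ?case by simp
qed simp

text \<open>Pure derivatives of order \<open>2 * CARD('m)\<close> give decay at just the rate that
  \<open>summable_weight\<close> can sum.\<close>

lemma wiener_le_sup:
  obtains C where "C \<ge> 0"
    "\<And>f :: real^'m::finite \<Rightarrow> real. smooth_periodic f \<Longrightarrow> wiener f \<le> C * nrm supn (2 * CARD('m)) f"
proof -
  let ?N = "2 * CARD('m)" and ?W = "\<Sum>\<^sub>\<infinity>k::'m\<Rightarrow>int. 1 / weight k ^ (2 * CARD('m))"
  have W: "?W \<ge> 0" by (intro infsum_nonneg) (meson divide_nonneg_nonneg order_trans weight_ge_1 zero_le_one zero_le_power)
  have "wiener f \<le> (real (CARD('m) + 1) ^ Suc ?N * ?W) * nrm supn ?N f" if f: "smooth_periodic f" for f :: "real^'m \<Rightarrow> real"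
  proof -
    have 1: "\<bar>f x\<bar> \<le> nrm supn ?N f" for x
      using supn_upper[OF f, of x] sup.nrm_mono[OF f, of 0 ?N] by simp
    have 2: "\<bar>(partial_deriv i ^^ ?N) f x\<bar> \<le> nrm supn ?N f" for i x
      using supn_upper[OF sp_partial_iter[OF f, where i=i and N="?N"], of x] sup_partial_iter_le[OF f, where s=0 and i=i and j="?N"] by simp
    have "(\<Sum>\<^sub>\<infinity>k. norm (fourier f k) * weight k ^ 0) \<le> real (CARD('m) + 1) ^ Suc ?N * nrm supn ?N f * ?W"
      by (rule decay_summable(2)) (use fourier_decay[OF f 1 2] in simp)
    then show ?thesis by (simp add: wiener_def mult_ac)
  qed
  then show thesis using that[of "real (CARD('m) + 1) ^ Suc ?N * ?W"] W by simp
qed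

text \<open>A derivative in direction \<open>i\<close> multiplies the coefficient at
  \<open>k\<close> by \<open>\<bar>k i\<bar>\<close> in modulus; together with the 1 of the function
  itself these factors add up to \<open>weight k\<close>, one power per order.\<close>

lemma nrm_wiener_weight:
  "smooth_periodic f \<Longrightarrow> ((\<lambda>k. norm (fourier f k) * weight k ^ s) has_sum nrm wiener s f) UNIV"
proof (induction s arbitrary: f)
  case 0
  then show ?case using wiener_has_sum by simp
next
  case (Suc s)
  have "((\<lambda>k. norm (fourier f k) * weight k ^ s + (\<Sum>i\<in>UNIV. norm (fourier (partial_deriv i f) k) * weight k ^ s))
      has_sum nrm wiener (Suc s) f) UNIV"
    unfolding nrm.simps by (intro has_sum_add has_sum_sum_finite Suc sp_partial)
  moreover have "norm (fourier f k) * weight k ^ s + (\<Sum>i\<in>UNIV. norm (fourier (partial_deriv i f) k) * weight k ^ s)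
      = norm (fourier f k) * weight k ^ Suc s" for k
    by (simp add: fourier_partial[OF Suc.prems] norm_mult weight_def sum_distrib_left sum_distrib_right algebra_simps)
  ultimately show ?case by simp
qed

lemma wiener_zeroD: "smooth_periodic f \<Longrightarrow> wiener f \<le> 0 \<Longrightarrow> f x = 0"
  using abs_le_wiener[of f x] by linarith

text \<open>The mean value inequality on a cube that contains all values of \<open>U\<close> and
  \<open>V\<close>: compactness bounds the partial derivatives of \<open>H\<close>, convexity keeps
  the segments inside.\<close>

lemma sup_lipschitz:
  fixes H :: "real^'p::finite \<Rightarrow> real"
  assumes H: "smooth_on H UNIV"
  shows "\<exists>C\<ge>0. \<forall>(U :: 'p \<Rightarrow> real^'m::finite \<Rightarrow> real) V.
      (\<forall>p. smooth_periodic (U p) \<and> smooth_periodic (V p) \<and> supn (U p) \<le> B \<and> supn (V p) \<le> B) \<longrightarrow>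
      supn (\<lambda>x. H (\<chi> p. U p x) - H (\<chi> p. V p x)) \<le> C * (\<Sum>p\<in>UNIV. supn (\<lambda>x. U p x - V p x))"
proof -
  let ?S = "cbox (\<chi> p. - B) (\<chi> p. B) :: (real^'p) set"
  have "\<exists>M. M \<ge> 0 \<and> (\<forall>y\<in>?S. \<bar>partial_deriv p H y\<bar> \<le> M)" for p
  proof -
    have "compact (partial_deriv p H ` ?S)"
      by (intro compact_continuous_image compact_cbox continuous_on_subset[OF smooth_on_continuous[OF smooth_on_partial[OF H]]]) auto
    then obtain M where "\<forall>y\<in>?S. norm (partial_deriv p H y) \<le> M" using compact_imp_bounded bounded_iff by (metis imageI)
    then show ?thesis by (intro exI[of _ "max 0 M"]) auto
  qed
  then obtain M where M: "\<And>p. M p \<ge> 0" "\<And>p y. y \<in> ?S \<Longrightarrow> \<bar>partial_deriv p H y\<bar> \<le> M p" by metis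
  define C where "C = (\<Sum>p\<in>UNIV. M p)"
  have C0: "C \<ge> 0" unfolding C_def by (intro sum_nonneg M(1))
  have lip: "norm (H x - H y) \<le> C * norm (x - y)" if "x \<in> ?S" "y \<in> ?S" for x y
  proof (rule differentiable_bound[OF convex_box(1) _ _ that])
    fix z assume z: "z \<in> ?S"
    have d: "(H has_derivative frechet_derivative H (at z)) (at z)" using smooth_on_deriv[OF H open_UNIV] by blast
    then show "(H has_derivative frechet_derivative H (at z)) (at z within ?S)" by (rule has_derivative_at_withinI)
    show "onorm (frechet_derivative H (at z)) \<le> C"
    proof (rule onorm_le)
      fix v
      have "\<bar>frechet_derivative H (at z) v\<bar> \<le> (\<Sum>p\<in>UNIV. \<bar>v $ p * partial_deriv p H z\<bar>)"
        unfolding frechet_partial[OF d] by (rule sum_abs)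
      also have "\<dots> \<le> (\<Sum>p\<in>UNIV. norm v * M p)"
        unfolding abs_mult by (intro sum_mono mult_mono component_le_norm_cart M z) auto
      finally show "norm (frechet_derivative H (at z) v) \<le> C * norm v" by (simp add: C_def sum_distrib_left mult.commute)
    qed
  qed
  show ?thesis
  proof (intro exI[of _ C] conjI allI impI C0)
    fix U V :: "'p \<Rightarrow> real^'m \<Rightarrow> real"
    assume A: "\<forall>p. smooth_periodic (U p) \<and> smooth_periodic (V p) \<and> supn (U p) \<le> B \<and> supn (V p) \<le> B"
    show "supn (\<lambda>x. H (\<chi> p. U p x) - H (\<chi> p. V p x)) \<le> C * (\<Sum>p\<in>UNIV. supn (\<lambda>x. U p x - V p x))"
    proof (rule supn_least)
      fix x
      have in1: "\<bar>U p x\<bar> \<le> B" "\<bar>V p x\<bar> \<le> B" for p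
        using A supn_upper[of "U p" x] supn_upper[of "V p" x] order_trans by blast+
      have "\<bar>H (\<chi> p. U p x) - H (\<chi> p. V p x)\<bar> \<le> C * norm ((\<chi> p. U p x) - (\<chi> p. V p x))"
        using lip[of "\<chi> p. U p x" "\<chi> p. V p x"] in1 by (simp add: mem_box_cart abs_le_iff minus_le_iff)
      also have "norm ((\<chi> p. U p x) - (\<chi> p. V p x)) \<le> (\<Sum>p\<in>UNIV. \<bar>U p x - V p x\<bar>)"
        using norm_le_l1_cart[of "(\<chi> p. U p x) - (\<chi> p. V p x)"] by simp
      also have "\<dots> \<le> (\<Sum>p\<in>UNIV. supn (\<lambda>x. U p x - V p x))"
        using A by (intro sum_mono supn_upper sp_diff) auto
      finally show "\<bar>H (\<chi> p. U p x) - H (\<chi> p. V p x)\<bar> \<le> C * (\<Sum>p\<in>UNIV. supn (\<lambda>x. U p x - V p x))"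
        using C0 by (simp add: mult_left_mono)
    qed
  qed
qed

text \<open>Two passes of \<open>nrm_comp_lipschitz\<close>. In sup norms of order
  \<open>2 * CARD('m)\<close> the estimate starts from the mean value inequality;
  \<open>wiener_le_sup\<close> turns the result into the base estimate for the Wiener norm, from
  which the second pass climbs to order \<open>s\<close>.\<close>

lemma comp_lipschitz:
  fixes H :: "real^'p::finite \<Rightarrow> real"
  assumes H: "smooth_on H UNIV" and s: "2 * CARD('m) \<le> s"
  shows "\<exists>C\<ge>0. \<forall>(U :: 'p \<Rightarrow> real^'m::finite \<Rightarrow> real) V.
      (\<forall>p. smooth_periodic (U p) \<and> smooth_periodic (V p) \<and> nrm wiener s (U p) \<le> B \<and> nrm wiener s (V p) \<le> B) \<longrightarrow>
      nrm wiener s (\<lambda>x. H (\<chi> p. U p x) - H (\<chi> p. V p x)) \<le> C * (\<Sum>p\<in>UNIV. nrm wiener s (\<lambda>x. U p x - V p x))"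
proof -
  let ?K = "2 * CARD('m)"
  obtain C' where C': "C' \<ge> 0" "\<And>f :: real^'m \<Rightarrow> real. smooth_periodic f \<Longrightarrow> wiener f \<le> C' * nrm supn ?K f"
    using wiener_le_sup by blast
  have Z0: "supn (\<lambda>_::real^'m. 0) = 0" by (simp add: supn_def)
  have base: "\<exists>C\<ge>0. \<forall>(U :: 'p \<Rightarrow> real^'m \<Rightarrow> real) V.
      (\<forall>p. smooth_periodic (U p) \<and> smooth_periodic (V p) \<and> nrm supn ?K (U p) \<le> B \<and> nrm supn ?K (V p) \<le> B) \<longrightarrow>
      wiener (\<lambda>x. H (\<chi> p. U p x) - H (\<chi> p. V p x)) \<le> C * (\<Sum>p\<in>UNIV. nrm supn ?K (\<lambda>x. U p x - V p x))"
    if H: "smooth_on H UNIV" for H :: "real^'p \<Rightarrow> real" and B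
  proof -
    \<comment> \<open>First pass, with the sup norm in both roles. The bound \<open>2 * B\<close>
      leaves room for the sum of two norms that are each at most \<open>B\<close>.\<close>
    obtain C where C: "C \<ge> 0" "\<And>(U :: 'p \<Rightarrow> real^'m \<Rightarrow> real) V.
      (\<forall>p. smooth_periodic (U p) \<and> smooth_periodic (V p) \<and> nrm supn ?K (U p) + supn (U p) \<le> 2 * B \<and> nrm supn ?K (V p) + supn (V p) \<le> 2 * B) \<Longrightarrow>
      nrm supn ?K (\<lambda>x. H (\<chi> p. U p x) - H (\<chi> p. V p x)) \<le> C * (\<Sum>p\<in>UNIV. nrm supn ?K (\<lambda>x. U p x - V p x) + supn (\<lambda>x. U p x - V p x))"
      using sup.nrm_comp_lipschitz[OF sup.nonneg Z0 sup_lipschitz H, of ?K "2 * B"] by blast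
    show ?thesis
    proof (intro exI[of _ "C' * (C * 2)"] conjI allI impI)
      show "C' * (C * 2) \<ge> 0" using C(1) C'(1) by simp
      fix U V :: "'p \<Rightarrow> real^'m \<Rightarrow> real"
      assume A: "\<forall>p. smooth_periodic (U p) \<and> smooth_periodic (V p) \<and> nrm supn ?K (U p) \<le> B \<and> nrm supn ?K (V p) \<le> B"
      have le: "supn f \<le> nrm supn ?K f" if "smooth_periodic f" for f :: "real^'m \<Rightarrow> real"
        using sup.nrm_mono[OF that, of 0 ?K] by simp
      have "wiener (\<lambda>x. H (\<chi> p. U p x) - H (\<chi> p. V p x)) \<le> C' * nrm supn ?K (\<lambda>x. H (\<chi> p. U p x) - H (\<chi> p. V p x))"
        using A by (intro C' sp_diff sp_compose H) auto
      also have "\<dots> \<le> C' * (C * (\<Sum>p\<in>UNIV. nrm supn ?K (\<lambda>x. U p x - V p x) + supn (\<lambda>x. U p x - V p x)))"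
      proof (intro mult_left_mono C(2) allI conjI C'(1))
        fix p
        show "smooth_periodic (U p)" "smooth_periodic (V p)" using A by auto
        show "nrm supn ?K (U p) + supn (U p) \<le> 2 * B" "nrm supn ?K (V p) + supn (V p) \<le> 2 * B"
          using A[rule_format, of p] le[of "U p"] le[of "V p"] by auto
      qed
      also have "\<dots> \<le> C' * (C * (\<Sum>p\<in>UNIV. 2 * nrm supn ?K (\<lambda>x. U p x - V p x)))"
      proof (intro mult_left_mono sum_mono C C')
        fix p show "nrm supn ?K (\<lambda>x. U p x - V p x) + supn (\<lambda>x. U p x - V p x) \<le> 2 * nrm supn ?K (\<lambda>x. U p x - V p x)"
          using A le[OF sp_diff, of "U p" "V p"] by auto
      qed
      finally show "wiener (\<lambda>x. H (\<chi> p. U p x) - H (\<chi> p. V p x)) \<le> C' * (C * 2) * (\<Sum>p\<in>UNIV. nrm supn ?K (\<lambda>x. U p x - V p x))"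
        by (simp only: sum_distrib_left mult_ac)
    qed
  qed
  \<comment> \<open>Second pass, with the sup norm of order \<open>?K\<close> in the role of
    \<open>Z\<close>; since \<open>2 * CARD('m) \<le> s\<close>, it is dominated by the Wiener norm
    of order \<open>s\<close> in the end.\<close>
  obtain C where C: "C \<ge> 0" "\<And>(U :: 'p \<Rightarrow> real^'m \<Rightarrow> real) V.
      (\<forall>p. smooth_periodic (U p) \<and> smooth_periodic (V p) \<and> nrm wiener s (U p) + nrm supn ?K (U p) \<le> 2 * B \<and> nrm wiener s (V p) + nrm supn ?K (V p) \<le> 2 * B) \<Longrightarrow>
      nrm wiener s (\<lambda>x. H (\<chi> p. U p x) - H (\<chi> p. V p x)) \<le> C * (\<Sum>p\<in>UNIV. nrm wiener s (\<lambda>x. U p x - V p x) + nrm supn ?K (\<lambda>x. U p x - V p x))"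
    using wiener.nrm_comp_lipschitz[OF sup.nrm_nonneg sup.nrm_zero base H, of s "2 * B"] by blast
  have le: "nrm supn ?K f \<le> nrm wiener s f" if "smooth_periodic f" for f :: "real^'m \<Rightarrow> real"
    using nrm_sup_le_wiener[OF that, of ?K] wiener.nrm_mono[OF that s] by linarith
  show ?thesis
  proof (intro exI[of _ "C * 2"] conjI allI impI)
    show "C * 2 \<ge> 0" using C(1) by simp
    fix U V :: "'p \<Rightarrow> real^'m \<Rightarrow> real"
    assume A: "\<forall>p. smooth_periodic (U p) \<and> smooth_periodic (V p) \<and> nrm wiener s (U p) \<le> B \<and> nrm wiener s (V p) \<le> B"
    have "nrm wiener s (\<lambda>x. H (\<chi> p. U p x) - H (\<chi> p. V p x))
        \<le> C * (\<Sum>p\<in>UNIV. nrm wiener s (\<lambda>x. U p x - V p x) + nrm supn ?K (\<lambda>x. U p x - V p x))"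
    proof (intro C(2) allI conjI)
      fix p
      show "smooth_periodic (U p)" "smooth_periodic (V p)" using A by auto
      show "nrm wiener s (U p) + nrm supn ?K (U p) \<le> 2 * B" "nrm wiener s (V p) + nrm supn ?K (V p) \<le> 2 * B"
        using A[rule_format, of p] le[of "U p"] le[of "V p"] by auto
    qed
    also have "\<dots> \<le> C * (\<Sum>p\<in>UNIV. 2 * nrm wiener s (\<lambda>x. U p x - V p x))"
    proof (intro mult_left_mono sum_mono C)
      fix p show "nrm wiener s (\<lambda>x. U p x - V p x) + nrm supn ?K (\<lambda>x. U p x - V p x) \<le> 2 * nrm wiener s (\<lambda>x. U p x - V p x)"
        using A le[OF sp_diff, of "U p" "V p"] by auto
    qed
    finally show "nrm wiener s (\<lambda>x. H (\<chi> p. U p x) - H (\<chi> p. V p x)) \<le> C * 2 * (\<Sum>p\<in>UNIV. nrm wiener s (\<lambda>x. U p x - V p x))"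
      by (simp only: sum_distrib_left mult_ac)
  qed
qed

lemma comp_bound:
  fixes H :: "real^'p::finite \<Rightarrow> real"
  assumes H: "smooth_on H UNIV" and s: "2 * CARD('m) \<le> s"
  shows "\<exists>C\<ge>0. \<forall>U :: 'p \<Rightarrow> real^'m::finite \<Rightarrow> real.
      (\<forall>p. smooth_periodic (U p) \<and> nrm wiener s (U p) \<le> B) \<longrightarrow> nrm wiener s (\<lambda>x. H (\<chi> p. U p x)) \<le> C"
proof -
  obtain C where C: "C \<ge> 0" "\<And>(U :: 'p \<Rightarrow> real^'m \<Rightarrow> real) V.
      (\<forall>p. smooth_periodic (U p) \<and> smooth_periodic (V p) \<and> nrm wiener s (U p) \<le> \<bar>B\<bar> \<and> nrm wiener s (V p) \<le> \<bar>B\<bar>) \<Longrightarrow>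
      nrm wiener s (\<lambda>x. H (\<chi> p. U p x) - H (\<chi> p. V p x)) \<le> C * (\<Sum>p\<in>UNIV. nrm wiener s (\<lambda>x. U p x - V p x))"
    using comp_lipschitz[OF H s, of "\<bar>B\<bar>"] by blast
  let ?w = "wiener (\<lambda>_::real^'m. 1)"
  show ?thesis
  proof (intro exI[of _ "C * (CARD('p) * \<bar>B\<bar>) + \<bar>H 0\<bar> * ?w"] conjI allI impI)
    have "?w \<ge> 0" by (intro wiener.nonneg sp_const)
    then show "C * (CARD('p) * \<bar>B\<bar>) + \<bar>H 0\<bar> * ?w \<ge> 0" using C(1) by simp
    fix U :: "'p \<Rightarrow> real^'m \<Rightarrow> real"
    assume A: "\<forall>p. smooth_periodic (U p) \<and> nrm wiener s (U p) \<le> B"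
    have z: "(\<chi> p. 0) = (0 :: real^'p)" by (simp add: vec_eq_iff)
    have "nrm wiener s (\<lambda>x. H (\<chi> p. U p x) - H (\<chi> p. 0)) \<le> C * (\<Sum>p\<in>UNIV. nrm wiener s (\<lambda>x. U p x - 0))"
      using A by (intro C(2)[of U "\<lambda>_ _. 0"]) (auto simp: sp_const wiener.nrm_zero intro: order_trans)
    also have "\<dots> \<le> C * (\<Sum>p\<in>(UNIV::'p set). \<bar>B\<bar>)"
      using A C(1) by (intro mult_left_mono sum_mono) (auto intro: order_trans)
    finally have 1: "nrm wiener s (\<lambda>x. H (\<chi> p. U p x) - H 0) \<le> C * (CARD('p) * \<bar>B\<bar>)" by (simp add: z)
    have "nrm wiener s (\<lambda>x. (H (\<chi> p. U p x) - H 0) + H 0) \<le> nrm wiener s (\<lambda>x. H (\<chi> p. U p x) - H 0) + nrm wiener s (\<lambda>_::real^'m. H 0)"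
      using A by (intro wiener.nrm_add sp_diff sp_const sp_compose H) auto
    then show "nrm wiener s (\<lambda>x. H (\<chi> p. U p x)) \<le> C * (CARD('p) * \<bar>B\<bar>) + \<bar>H 0\<bar> * ?w"
      using 1 unfolding wiener.nrm_const by simp
  qed
qed

subsection \<open>A semilinear elliptic system\<close>

lemma weight_power_nonneg: "0 \<le> weight k ^ s"
  using weight_ge_1[of k] by simp

lemma fourier_sum:
  "(\<And>i. i \<in> I \<Longrightarrow> smooth_periodic (f i)) \<Longrightarrow> fourier (\<lambda>x. \<Sum>i\<in>I. f i x) k = (\<Sum>i\<in>I. fourier (f i) k)"
proof (induction I rule: infinite_finite_induct)
  case (insert j I)
  have "fourier (\<lambda>x. f j x + (\<Sum>i\<in>I. f i x)) k = fourier (f j) k + fourier (\<lambda>x. \<Sum>i\<in>I. f i x) k"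
    using insert.prems by (intro fourier_add sp_sum) auto
  then show ?case using insert by simp
qed (simp_all add: fourier_const)

lemma nrm_le_fourier:
  assumes "smooth_periodic f" "smooth_periodic g" "\<And>k. norm (fourier g k) \<le> C * norm (fourier f k)"
  shows "nrm wiener s g \<le> C * nrm wiener s f"
proof (rule has_sum_mono[OF nrm_wiener_weight[OF assms(2)] has_sum_cmult_right[OF nrm_wiener_weight[OF assms(1)]]])
  show "norm (fourier g k) * weight k ^ s \<le> C * (norm (fourier f k) * weight k ^ s)" for k
    using mult_right_mono[OF assms(3)[of k], of "weight k ^ s"] weight_ge_1[of k] by (simp add: mult.assoc)
qed

definition avg :: "(real^'m::finite \<Rightarrow> real) \<Rightarrow> real" where
  "avg f = Re (fourier f 0)"

lemma fourier_zero: "smooth_periodic f \<Longrightarrow> fourier f 0 = of_real (avg f)"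
  using fourier_cnj[of f 0] by (simp add: avg_def complex_eq_iff)

lemma avg_diff: "smooth_periodic f \<Longrightarrow> smooth_periodic g \<Longrightarrow> avg (\<lambda>x. f x - g x) = avg f - avg g"
  by (simp add: avg_def fourier_diff)

lemma abs_avg_le: "smooth_periodic f \<Longrightarrow> \<bar>avg f\<bar> \<le> wiener f"
proof -
  assume f: "smooth_periodic f"
  have "\<bar>avg f\<bar> = norm (fourier f 0)" by (simp add: fourier_zero[OF f])
  also have "\<dots> \<le> wiener f"
    by (rule has_sum_mono_neutral[OF has_sum_finite[of "{0}" "\<lambda>k. norm (fourier f k)", simplified] wiener_has_sum[OF f]]) auto
  finally show ?thesis .
qed

text \<open>An operator with constant coefficients and no terms below order two reaches only
  functions of mean zero. A function of mean 1 that vanishes near the origin can carry the mean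
  without disturbing the equation there.\<close>

lemma cutoff_away_from_zero:
  obtains \<psi> :: "real^'m::finite \<Rightarrow> real" and \<delta> :: real
  where "smooth_periodic \<psi>" "avg \<psi> = 1" "\<delta> > 0" "\<And>x. (\<And>i. \<bar>x $ i\<bar> < \<delta>) \<Longrightarrow> \<psi> x = 0"
proof -
  define i0 :: 'm where "i0 = undefined"
  \<comment> \<open>Zero exactly where \<open>cos (x $ i0) \<ge> 1/2\<close>, in particular for
    \<open>\<bar>x $ i0\<bar> \<le> pi / 3\<close>, and positive at
    \<open>x $ i0 = pi\<close>.\<close>
  define f where "f = (\<lambda>x::real^'m. flat_exp 0 (1/2 - cos (x $ i0)))"
  have "smooth_on (\<lambda>x::real^'m. 1/2 - cos (x $ i0)) UNIV" by (intro smooth_intros open_UNIV)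
  then have "smooth_on f UNIV" unfolding f_def
    by (rule smooth_on_compose[OF open_UNIV open_UNIV subset_UNIV smooth_on_flat_exp])
  moreover have "periodic f" by (auto simp: periodic_def f_def axis_def)
  ultimately have f: "smooth_periodic f" by (simp add: smooth_periodic_def)
  have f0: "f x \<ge> 0" for x by (simp add: f_def flat_exp_def)
  \<comment> \<open>A nonnegative function of mean zero has only zero coefficients and so vanishes,
    contrary to its value at \<open>pi\<close>.\<close>
  have "avg f \<noteq> 0"
  proof
    assume a0: "avg f = 0"
    have "fourier f k = 0" for k
    proof -
      have "norm (fourier f k) \<le> Re (mean (\<lambda>x. of_real (f x)))"
        unfolding fourier_def
        by (intro mean_norm_le continuous_on_sp_wave f smooth_periodicD(3)) (use f0 in \<open>auto simp: norm_mult wave_simps\<close>)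
      also have "mean (\<lambda>x. of_real (f x)) = fourier f 0" by (simp add: fourier_def wave_simps)
      finally show ?thesis using a0 by (simp add: avg_def)
    qed
    then have "f = (\<lambda>_. 0)" by (intro fourier_eqI f sp_const) (simp add: fourier_const)
    then have "f (axis i0 pi) = 0" by metis
    then show False by (simp add: f_def flat_exp_def axis_def)
  qed
  define \<psi> where "\<psi> = (\<lambda>x. inverse (avg f) * f x)"
  show thesis
  proof (rule that[of \<psi> 1])
    show "smooth_periodic \<psi>" unfolding \<psi>_def by (intro sp_mult sp_const f)
    show "avg \<psi> = 1" using \<open>avg f \<noteq> 0\<close> unfolding \<psi>_def by (simp add: avg_def fourier_cmult power2_eq_square)
    fix x :: "real^'m" assume "\<And>i. \<bar>x $ i\<bar> < 1"
    from this[of i0] have "\<bar>x $ i0\<bar> \<le> pi/3" using pi_gt3 by linarith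
    then have "cos (pi/3) \<le> cos \<bar>x $ i0\<bar>" by (intro cos_monotone_0_pi_le) auto
    then have "1/2 \<le> cos (x $ i0)" by (simp add: cos_60)
    then show "\<psi> x = 0" by (simp add: \<psi>_def f_def flat_exp_def)
  qed simp
qed

text \<open>\<open>arcsin (sin t)\<close> equals \<open>t\<close> near 0; with a smooth extension of
  the germ of \<open>arcsin\<close> at 0 in place of \<open>arcsin\<close> it becomes smooth and
  periodic everywhere.\<close>

lemma periodic_coordinates:
  obtains X :: "'m::finite \<Rightarrow> real^'m \<Rightarrow> real" and \<delta> :: real
  where "\<And>i. smooth_periodic (X i)" "\<delta> > 0" "\<And>x i. \<bar>x $ i\<bar> < \<delta> \<Longrightarrow> X i x = x $ i"
proof -
  have "open {-1<..<1::real}" "(0::real) \<in> {-1<..<1}" by auto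
  then obtain \<phi> r where \<phi>: "smooth_on \<phi> UNIV" "r > 0" "\<And>t::real. t \<in> ball 0 r \<Longrightarrow> \<phi> t = arcsin t"
    using smooth_extension[OF _ _ smooth_on_arcsin] by metis
  define X where "X = (\<lambda>i (x::real^'m). \<phi> (sin (x $ i)))"
  show thesis
  proof (rule that[of X "min r 1"])
    fix i
    have "smooth_on (\<lambda>x::real^'m. sin (x $ i)) UNIV" by (intro smooth_intros open_UNIV)
    then have "smooth_on (X i) UNIV" unfolding X_def
      by (rule smooth_on_compose[OF open_UNIV open_UNIV subset_UNIV \<phi>(1)])
    moreover have "periodic (X i)" by (auto simp: periodic_def X_def axis_def)
    ultimately show "smooth_periodic (X i)" by (simp add: smooth_periodic_def)
  next
    fix x :: "real^'m" and i assume x: "\<bar>x $ i\<bar> < min r 1"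
    then have "\<bar>sin (x $ i)\<bar> < r" using abs_sin_x_le_abs_x[of "x $ i"] by linarith
    then have "\<phi> (sin (x $ i)) = arcsin (sin (x $ i))" by (intro \<phi>(3)) (simp add: dist_real_def)
    also have "\<dots> = x $ i" using x pi_gt3 by (intro arcsin_sin) linarith+
    finally show "X i x = x $ i" by (simp add: X_def)
  qed (use \<phi>(2) in auto)
qed

text \<open>
  A right inverse of a constant coefficient elliptic operator, up to a multiple of a function
  that vanishes near the origin and absorbs the mean.
\<close>

lemma elliptic_inverse:
  fixes c :: "'m::finite \<Rightarrow> 'm \<Rightarrow> real"
  assumes ell: "lam > 0" "\<And>\<xi> :: 'm \<Rightarrow> real. lam * (\<Sum>i\<in>UNIV. (\<xi> i)\<^sup>2) \<le> (\<Sum>\<alpha>\<in>UNIV. \<Sum>\<beta>\<in>UNIV. c \<alpha> \<beta> * \<xi> \<alpha> * \<xi> \<beta>)"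
  obtains T :: "(real^'m \<Rightarrow> real) \<Rightarrow> real^'m \<Rightarrow> real" and L :: real and G :: "nat \<Rightarrow> real" and \<delta> :: real
  where "\<And>f. smooth_periodic f \<Longrightarrow> smooth_periodic (T f)"
    "\<And>f g. smooth_periodic f \<Longrightarrow> smooth_periodic g \<Longrightarrow> T (\<lambda>x. f x - g x) = (\<lambda>x. T f x - T g x)"
    "\<delta> > 0"
    "\<And>f x. smooth_periodic f \<Longrightarrow> (\<And>i. \<bar>x $ i\<bar> < \<delta>) \<Longrightarrow>
       (\<Sum>\<alpha>\<in>UNIV. \<Sum>\<beta>\<in>UNIV. c \<alpha> \<beta> * partial_deriv \<alpha> (partial_deriv \<beta> (T f)) x) = f x"
    "L \<ge> 0" "\<And>s. G s \<ge> 0"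
    "\<And>f s \<alpha> \<beta>. smooth_periodic f \<Longrightarrow>
       nrm wiener s (partial_deriv \<alpha> (partial_deriv \<beta> (T f))) \<le> L * nrm wiener s f + G s * wiener f"
    "\<And>f s. smooth_periodic f \<Longrightarrow> nrm wiener (Suc s) (T f) \<le> G s * nrm wiener s f"
    "\<And>f s \<alpha>. smooth_periodic f \<Longrightarrow> nrm wiener (Suc s) (partial_deriv \<alpha> (T f)) \<le> G s * nrm wiener s f"
proof -
  obtain \<psi> :: "real^'m \<Rightarrow> real" and \<delta> where \<psi>: "smooth_periodic \<psi>" "avg \<psi> = 1" "\<delta> > 0"
    "\<And>x. (\<And>i. \<bar>x $ i\<bar> < \<delta>) \<Longrightarrow> \<psi> x = 0"
    using cutoff_away_from_zero by blast
  define sq where "sq = (\<lambda>k::'m\<Rightarrow>int. \<Sum>i\<in>UNIV. (real_of_int (k i))\<^sup>2)"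
  define q where "q = (\<lambda>k::'m\<Rightarrow>int. \<Sum>\<alpha>\<in>UNIV. \<Sum>\<beta>\<in>UNIV. c \<alpha> \<beta> * of_int (k \<alpha>) * of_int (k \<beta>))"
  define L where "L = inverse lam"
  have L0: "L \<ge> 0" using ell(1) by (simp add: L_def)
  have qsq: "lam * sq k \<le> q k" for k unfolding q_def sq_def by (rule ell(2))
  \<comment> \<open>For integers the square dominates the modulus, so away from \<open>k = 0\<close>
    the symbol of order two dominates those of orders one and zero as well.\<close>
  have int_le: "\<bar>of_int j\<bar> \<le> (real_of_int j)\<^sup>2" for j
  proof (cases "j = 0")
    case False
    then have "1 \<le> \<bar>real_of_int j\<bar>" by linarith
    then have "\<bar>real_of_int j\<bar> * 1 \<le> \<bar>real_of_int j\<bar> * \<bar>real_of_int j\<bar>" by (intro mult_left_mono) auto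
    then show ?thesis by (simp add: power2_eq_square)
  qed simp
  have sq_i: "(real_of_int (k i))\<^sup>2 \<le> sq k" for k i unfolding sq_def by (rule member_le_sum) auto
  have sq1: "1 \<le> sq k" if "k \<noteq> 0" for k
  proof -
    obtain i where "k i \<noteq> 0" using \<open>k \<noteq> 0\<close> by (auto simp: fun_eq_iff)
    then have "1 \<le> \<bar>real_of_int (k i)\<bar>" by linarith
    then show ?thesis using int_le[of "k i"] sq_i[of k i] by linarith
  qed
  have qpos: "q k > 0" if "k \<noteq> 0" for k
    using qsq[of k] sq1[OF that] ell(1) by (smt (verit) mult_pos_pos)
  have ratio: "t / q k \<le> L" if "k \<noteq> 0" "t \<le> sq k" for t k
  proof -
    have "lam * t \<le> q k" using qsq[of k] mult_left_mono[OF that(2), of lam] ell(1) by linarith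
    then show ?thesis using qpos[OF that(1)] ell(1) by (simp add: L_def field_simps)
  qed
  have prod_le: "\<bar>of_int (k \<alpha>) * of_int (k \<beta>)\<bar> \<le> sq k" for k \<alpha> \<beta>
  proof -
    have "2 * (\<bar>real_of_int (k \<alpha>)\<bar> * \<bar>real_of_int (k \<beta>)\<bar>) \<le> (real_of_int (k \<alpha>))\<^sup>2 + (real_of_int (k \<beta>))\<^sup>2"
      using sum_squares_bound[of "\<bar>real_of_int (k \<alpha>)\<bar>" "\<bar>real_of_int (k \<beta>)\<bar>"] by simp
    then show ?thesis using sq_i[of k \<alpha>] sq_i[of k \<beta>] by (simp add: abs_mult)
  qed
  \<comment> \<open>The reciprocal of the symbol, with the sign from \<open>\<i>^2 = -1\<close>; at
    \<open>k = 0\<close>, where the symbol vanishes, the multiplier is set to 0.\<close>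
  define \<mu> where "\<mu> = (\<lambda>k. if k = 0 then 0 else - complex_of_real (inverse (q k)))"
  have \<mu>_le: "norm (\<mu> k) * t \<le> L" if "t \<le> sq k" for k t
  proof (cases "k = 0")
    case False
    then show ?thesis using ratio[OF False that] qpos[OF False]
      by (simp add: \<mu>_def divide_inverse mult.commute norm_inverse)
  qed (simp add: \<mu>_def L0)
  have \<mu>1: "norm (\<mu> k) \<le> L" for k
    using \<mu>_le[of 1 k] sq1[of k] L0 by (cases "k = 0") (auto simp: \<mu>_def)
  have \<mu>m: "\<mu> (- k) = cnj (\<mu> k)" for k by (simp add: \<mu>_def q_def)
  define S where "S = (\<lambda>f. SOME g. smooth_periodic g \<and> (\<forall>k. fourier g k = \<mu> k * fourier f k))"
  have "smooth_periodic (S f) \<and> (\<forall>k. fourier (S f) k = \<mu> k * fourier f k)" if "smooth_periodic f" for f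
  proof -
    have "\<exists>g. smooth_periodic g \<and> (\<forall>k. fourier g k = \<mu> k * fourier f k)"
      using fourier_multiplier[where f=f and \<mu>=\<mu> and C=L] that \<mu>1 \<mu>m by metis
    then show ?thesis unfolding S_def by (rule someI_ex)
  qed
  then have S: "smooth_periodic (S f)" "fourier (S f) k = \<mu> k * fourier f k" if "smooth_periodic f" for f k
    using that by auto
  have S0: "nrm wiener s (S f) \<le> L * nrm wiener s f" if f: "smooth_periodic f" for f s
    using \<mu>1 by (intro nrm_le_fourier f S(1)) (simp add: S(2)[OF f] norm_mult mult_right_mono)
  have S1: "nrm wiener s (partial_deriv \<alpha> (S f)) \<le> L * nrm wiener s f" if f: "smooth_periodic f" for f s \<alpha>
  proof (intro nrm_le_fourier f S(1) sp_partial)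
    fix k
    have "norm (\<mu> k) * \<bar>of_int (k \<alpha>)\<bar> \<le> L" using int_le[of "k \<alpha>"] sq_i[of k \<alpha>] by (intro \<mu>_le) linarith
    from mult_right_mono[OF this, of "norm (fourier f k)"]
    show "norm (fourier (partial_deriv \<alpha> (S f)) k) \<le> L * norm (fourier f k)"
      by (simp add: fourier_partial S f norm_mult mult_ac)
  qed
  have S2: "nrm wiener s (partial_deriv \<alpha> (partial_deriv \<beta> (S f))) \<le> L * nrm wiener s f" if f: "smooth_periodic f" for f s \<alpha> \<beta>
  proof (intro nrm_le_fourier f S(1) sp_partial)
    fix k
    have "norm (\<mu> k) * \<bar>of_int (k \<alpha>) * of_int (k \<beta>)\<bar> \<le> L" by (intro \<mu>_le prod_le)
    from mult_right_mono[OF this, of "norm (fourier f k)"]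
    show "norm (fourier (partial_deriv \<alpha> (partial_deriv \<beta> (S f))) k) \<le> L * norm (fourier f k)"
      by (simp add: fourier_partial sp_partial S f norm_mult abs_mult mult_ac)
  qed
  have S_eq: "(\<Sum>\<alpha>\<in>UNIV. \<Sum>\<beta>\<in>UNIV. c \<alpha> \<beta> * partial_deriv \<alpha> (partial_deriv \<beta> (S f)) x) = f x - avg f"
    if f: "smooth_periodic f" for f x
  proof -
    have "(\<lambda>x. \<Sum>\<alpha>\<in>UNIV. \<Sum>\<beta>\<in>UNIV. c \<alpha> \<beta> * partial_deriv \<alpha> (partial_deriv \<beta> (S f)) x) = (\<lambda>x. f x - avg f)"
    proof (intro fourier_eqI sp_sum sp_mult sp_const sp_partial S sp_diff f)
      fix k
      have "fourier (\<lambda>x. \<Sum>\<alpha>\<in>UNIV. \<Sum>\<beta>\<in>UNIV. c \<alpha> \<beta> * partial_deriv \<alpha> (partial_deriv \<beta> (S f)) x) k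
        = (\<Sum>\<alpha>\<in>UNIV. \<Sum>\<beta>\<in>UNIV. of_real (c \<alpha> \<beta>) * (\<i> * of_int (k \<alpha>) * (\<i> * of_int (k \<beta>) * (\<mu> k * fourier f k))))"
        by (simp add: fourier_sum fourier_cmult fourier_partial S sp_sum sp_mult sp_const sp_partial f)
      also have "\<dots> = - of_real (q k) * \<mu> k * fourier f k"
        by (simp add: q_def sum_distrib_right sum_distrib_left sum_negf mult_ac)
      also have "\<dots> = fourier f k - (if k = 0 then of_real (avg f) else 0)"
        using qpos[of k] fourier_zero[OF f] by (cases "k = 0") (simp_all add: \<mu>_def less_imp_neq[symmetric])
      also have "\<dots> = fourier (\<lambda>x. f x - avg f) k" by (simp add: fourier_diff f sp_const fourier_const)
      finally show "fourier (\<lambda>x. \<Sum>\<alpha>\<in>UNIV. \<Sum>\<beta>\<in>UNIV. c \<alpha> \<beta> * partial_deriv \<alpha> (partial_deriv \<beta> (S f)) x) k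
          = fourier (\<lambda>x. f x - avg f) k" .
    qed
    then show ?thesis by meson
  qed
  \<comment> \<open>\<open>S\<close> solves the equation up to the mean \<open>avg f\<close>. Since
    \<open>avg \<psi> = 1\<close>, subtracting \<open>avg f * S \<psi>\<close> replaces the constant
    \<open>avg f\<close> by \<open>avg f * \<psi>\<close>, which is zero near the origin.\<close>
  define T where "T = (\<lambda>f x. S f x - avg f * S \<psi> x)"
  have T: "smooth_periodic (T f)" if "smooth_periodic f" for f
    unfolding T_def by (intro sp_intros S that \<psi>)
  have pT: "partial_deriv \<alpha> (T f) = (\<lambda>x. partial_deriv \<alpha> (S f) x - avg f * partial_deriv \<alpha> (S \<psi>) x)"
    if f: "smooth_periodic f" for f \<alpha>
    unfolding T_def using f \<psi>(1)
    by (simp add: partial_diff partial_cmult smooth_periodicD(1) S sp_mult sp_const)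
  have ppT: "partial_deriv \<alpha> (partial_deriv \<beta> (T f)) = (\<lambda>x. partial_deriv \<alpha> (partial_deriv \<beta> (S f)) x - avg f * partial_deriv \<alpha> (partial_deriv \<beta> (S \<psi>)) x)"
    if f: "smooth_periodic f" for f \<alpha> \<beta>
    unfolding pT[OF f] using f \<psi>(1)
    by (simp add: partial_diff partial_cmult smooth_periodicD(1) S sp_mult sp_const sp_partial)
  have comb: "nrm wiener s (\<lambda>x. u x - avg f * v x) \<le> L * nrm wiener s f + (L * nrm wiener s \<psi>) * wiener f"
    if f: "smooth_periodic f" and "smooth_periodic u" "smooth_periodic v" "nrm wiener s u \<le> L * nrm wiener s f" "nrm wiener s v \<le> L * nrm wiener s \<psi>" for u v f s
  proof -
    have "nrm wiener s (\<lambda>x. u x - avg f * v x) \<le> nrm wiener s u + \<bar>avg f\<bar> * nrm wiener s v"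
      using wiener.nrm_diff[OF that(2) sp_mult[OF sp_const that(3)], of s "avg f"] by (simp add: wiener.nrm_cmult that(3))
    also have "\<bar>avg f\<bar> * nrm wiener s v \<le> wiener f * (L * nrm wiener s \<psi>)"
      by (intro mult_mono abs_avg_le f that wiener.nonneg wiener.nrm_nonneg)
    finally show ?thesis using that(4) by (simp add: mult_ac)
  qed
  define G0 where "G0 = (\<lambda>s. L * nrm wiener s \<psi>)"
  have G0: "G0 s \<ge> 0" for s unfolding G0_def using L0 wiener.nrm_nonneg[OF \<psi>(1)] by simp
  have c0: "nrm wiener s (T f) \<le> L * nrm wiener s f + G0 s * wiener f" if f: "smooth_periodic f" for f s
    unfolding T_def G0_def by (intro comb f S S0 \<psi>)
  have c1: "nrm wiener s (partial_deriv \<alpha> (T f)) \<le> L * nrm wiener s f + G0 s * wiener f" if f: "smooth_periodic f" for f s \<alpha>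
    unfolding pT[OF f] G0_def by (intro comb f sp_partial S S1 \<psi>)
  have c2: "nrm wiener s (partial_deriv \<alpha> (partial_deriv \<beta> (T f))) \<le> L * nrm wiener s f + G0 s * wiener f" if f: "smooth_periodic f" for f s \<alpha> \<beta>
    unfolding ppT[OF f] G0_def by (intro comb f sp_partial S S2 \<psi>)
  \<comment> \<open>The factor counts a function and its first derivatives when the order rises by
    one. \<open>L\<close> is the same for all \<open>s\<close>; the dependence on \<open>s\<close>
    comes from the norms of \<open>\<psi>\<close>.\<close>
  define G where "G = (\<lambda>s. (1 + CARD('m)) * (L + G0 s))"
  have G0G: "G0 s \<le> G s" for s
    using G0[of s] L0 unfolding G_def by (simp add: algebra_simps add_increasing2)
  have cc: "L * nrm wiener s f + G0 s * wiener f \<le> (L + G0 s) * nrm wiener s f" if f: "smooth_periodic f" for f s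
    using mult_left_mono[OF wiener.nrm_mono[OF f, of 0 s] G0[of s]] by (simp add: algebra_simps)
  have up: "nrm wiener (Suc s) u \<le> G s * nrm wiener s f"
    if "nrm wiener s u \<le> (L + G0 s) * nrm wiener s f" "\<And>i. nrm wiener s (partial_deriv i u) \<le> (L + G0 s) * nrm wiener s f" for u f :: "real^'m \<Rightarrow> real" and s
  proof -
    have "nrm wiener (Suc s) u \<le> (L + G0 s) * nrm wiener s f + (\<Sum>i\<in>(UNIV::'m set). (L + G0 s) * nrm wiener s f)"
      unfolding nrm.simps by (intro add_mono sum_mono that)
    then show ?thesis by (simp add: G_def algebra_simps)
  qed
  show thesis
  proof (rule that[of T \<delta> L G])
    show "smooth_periodic (T f)" if "smooth_periodic f" for f by (rule T[OF that])
    show "T (\<lambda>x. f x - g x) = (\<lambda>x. T f x - T g x)" if f: "smooth_periodic f" and g: "smooth_periodic g" for f g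
    proof -
      have "S (\<lambda>x. f x - g x) = (\<lambda>x. S f x - S g x)"
        by (intro fourier_eqI S sp_diff f g) (simp add: fourier_diff S sp_diff f g algebra_simps)
      then show ?thesis unfolding T_def by (simp add: avg_diff f g algebra_simps)
    qed
    show "\<delta> > 0" by fact
    show "(\<Sum>\<alpha>\<in>UNIV. \<Sum>\<beta>\<in>UNIV. c \<alpha> \<beta> * partial_deriv \<alpha> (partial_deriv \<beta> (T f)) x) = f x"
      if f: "smooth_periodic f" and x: "\<And>i. \<bar>x $ i\<bar> < \<delta>" for f x
    proof -
      have "(\<Sum>\<alpha>\<in>UNIV. \<Sum>\<beta>\<in>UNIV. c \<alpha> \<beta> * partial_deriv \<alpha> (partial_deriv \<beta> (T f)) x)
        = (\<Sum>\<alpha>\<in>UNIV. \<Sum>\<beta>\<in>UNIV. c \<alpha> \<beta> * partial_deriv \<alpha> (partial_deriv \<beta> (S f)) x)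
          - avg f * (\<Sum>\<alpha>\<in>UNIV. \<Sum>\<beta>\<in>UNIV. c \<alpha> \<beta> * partial_deriv \<alpha> (partial_deriv \<beta> (S \<psi>)) x)"
        unfolding ppT[OF f] by (simp add: sum_distrib_left sum_subtractf algebra_simps)
      also have "\<dots> = f x - avg f * \<psi> x" unfolding S_eq[OF f] S_eq[OF \<psi>(1)] \<psi>(2) by (simp add: algebra_simps)
      finally show ?thesis using \<psi>(4)[OF x] by simp
    qed
    show "L \<ge> 0" by (rule L0)
    show "G s \<ge> 0" for s using G0[of s] G0G[of s] by linarith
    show "nrm wiener s (partial_deriv \<alpha> (partial_deriv \<beta> (T f))) \<le> L * nrm wiener s f + G s * wiener f"
      if f: "smooth_periodic f" for f s \<alpha> \<beta>
      using c2[OF f, of s \<alpha> \<beta>] mult_right_mono[OF G0G[of s] wiener.nonneg[OF f]] by linarith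
    show "nrm wiener (Suc s) (T f) \<le> G s * nrm wiener s f" if f: "smooth_periodic f" for f s
      by (intro up order_trans[OF c0 cc] order_trans[OF c1 cc] f)
    show "nrm wiener (Suc s) (partial_deriv \<alpha> (T f)) \<le> G s * nrm wiener s f" if f: "smooth_periodic f" for f s \<alpha>
      by (intro up order_trans[OF c1 cc] order_trans[OF c2 cc] f)
  qed
qed

section \<open>A fixed point theorem for smooth periodic functions\<close>

abbreviation vnrm :: "nat \<Rightarrow> ('n::finite \<Rightarrow> real^'m::finite \<Rightarrow> real) \<Rightarrow> real" where
  "vnrm s f \<equiv> \<Sum>i\<in>UNIV. nrm wiener s (f i)"

lemma convergent_geometric:
  fixes x :: "nat \<Rightarrow> complex"
  assumes "\<And>n. norm (x (Suc n) - x n) \<le> C * (1/2) ^ n"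
  shows "convergent x"
proof -
  have "summable (\<lambda>n. x (Suc n) - x n)"
    by (rule summable_comparison_test'[OF summable_mult[OF summable_geometric[of "1/2::real"]], where N=0]) (use assms in auto)
  then have "convergent (\<lambda>n. \<Sum>k<n. x (Suc k) - x k)" by (simp add: summable_iff_convergent)
  then have "convergent (\<lambda>n. x n - x 0)" by (simp add: sum_lessThan_telescope)
  then have "convergent (\<lambda>n. (x n - x 0) + x 0)" by (intro convergent_add convergent_const)
  then show ?thesis by simp
qed

text \<open>
  The iteration contracts in one norm only; the higher norms stay bounded along it, which is
  enough for the limit to be smooth.
\<close>

lemma smooth_fixed_point:
  fixes \<Phi> :: "('n::finite \<Rightarrow> real^'m::finite \<Rightarrow> real) \<Rightarrow> 'n \<Rightarrow> real^'m \<Rightarrow> real"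
  assumes sp: "\<And>f i. (\<And>i. smooth_periodic (f i)) \<Longrightarrow> smooth_periodic (\<Phi> f i)"
    and ball: "\<And>f. (\<And>i. smooth_periodic (f i)) \<Longrightarrow> vnrm K f \<le> 1 \<Longrightarrow> vnrm K (\<Phi> f) \<le> 1"
    and contr: "\<And>f g. (\<And>i. smooth_periodic (f i)) \<Longrightarrow> (\<And>i. smooth_periodic (g i)) \<Longrightarrow> vnrm K f \<le> 1 \<Longrightarrow> vnrm K g \<le> 1 \<Longrightarrow>
      vnrm K (\<lambda>i x. \<Phi> f i x - \<Phi> g i x) \<le> 1/2 * vnrm K (\<lambda>i x. f i x - g i x)"
    and tame: "\<And>s B. K \<le> s \<Longrightarrow> \<exists>C. \<forall>f. (\<forall>i. smooth_periodic (f i)) \<longrightarrow> vnrm K f \<le> 1 \<longrightarrow> vnrm s f \<le> B \<longrightarrow>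
      vnrm (Suc s) (\<Phi> f) \<le> 1/2 * vnrm (Suc s) f + C"
  obtains f where "\<And>i. smooth_periodic (f i)" "\<And>i x. \<Phi> f i x = f i x"
proof -
  define u where "u = (\<lambda>n. (\<Phi> ^^ n) (\<lambda>_ _. 0))"
  have u0: "u 0 = (\<lambda>_ _. 0)" and uS: "u (Suc n) = \<Phi> (u n)" for n by (simp_all add: u_def)
  have su: "smooth_periodic (u n i)" for n i
    by (induction n arbitrary: i) (auto simp: u0 uS sp_const intro: sp)
  have v0: "vnrm s (u 0) = 0" for s by (simp add: u0 wiener.nrm_zero)
  have b: "vnrm K (u n) \<le> 1" for n
    by (induction n) (use v0 in \<open>auto simp: uS intro!: ball su\<close>)
  have "\<exists>B. \<forall>n. vnrm (K + s) (u n) \<le> B" for s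
  proof (induction s)
    case 0
    then show ?case using b by auto
  next
    case (Suc s)
    then obtain B where B: "\<And>n. vnrm (K + s) (u n) \<le> B" by blast
    obtain C where C: "\<And>f. (\<And>i. smooth_periodic (f i)) \<Longrightarrow> vnrm K f \<le> 1 \<Longrightarrow> vnrm (K + s) f \<le> B \<Longrightarrow>
      vnrm (Suc (K + s)) (\<Phi> f) \<le> 1/2 * vnrm (Suc (K + s)) f + C"
      using tame[of "K + s" B] by auto
    \<comment> \<open>The map \<open>x \<mapsto> x / 2 + C\<close> leaves the bound
      \<open>2 * \<bar>C\<bar>\<close> invariant, and the iteration starts at 0.\<close>
    have "vnrm (Suc (K + s)) (u n) \<le> 2 * \<bar>C\<bar>" for n
    proof (induction n)
      case 0
      then show ?case using v0[of "Suc (K + s)"] by linarith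
    next
      case (Suc n)
      then show ?case using C[of "u n", OF su b B] unfolding uS by linarith
    qed
    then show ?case by auto
  qed
  then have bd: "\<exists>B. \<forall>n. vnrm s (u n) \<le> B" for s
  proof -
    obtain B where B: "\<And>n. vnrm (K + s) (u n) \<le> B" using \<open>\<And>s. \<exists>B. \<forall>n. vnrm (K + s) (u n) \<le> B\<close> by blast
    have "vnrm s (u n) \<le> vnrm (K + s) (u n)" for n by (intro sum_mono wiener.nrm_mono su) simp
    then show ?thesis using B order_trans by blast
  qed
  have step: "vnrm K (\<lambda>i x. u (Suc n) i x - u n i x) \<le> (1/2) ^ n" for n
  proof (induction n)
    case 0
    then show ?case using b[of 1] by (simp add: u0)
  next
    case (Suc n)
    have "vnrm K (\<lambda>i x. u (Suc (Suc n)) i x - u (Suc n) i x) \<le> 1/2 * vnrm K (\<lambda>i x. u (Suc n) i x - u n i x)"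
      using contr[of "u (Suc n)" "u n", OF su su b b] by (simp only: uS[of "Suc n"] uS[of n, symmetric])
    then show ?case using Suc by simp
  qed
  have vle: "nrm wiener s (f i) \<le> vnrm s f" if "\<And>i. smooth_periodic (f i)" for f :: "'n \<Rightarrow> real^'m \<Rightarrow> real" and i s
    by (rule member_le_sum) (auto intro!: wiener.nrm_nonneg that)
  \<comment> \<open>The factor \<open>1 - (1/2) ^ j\<close> keeps the partial geometric sum exact,
    so that the induction on \<open>j\<close> closes.\<close>
  have tri: "vnrm K (\<lambda>i x. u (n + j) i x - u n i x) \<le> 2 * (1/2) ^ n * (1 - (1/2) ^ j)" for n j
  proof (induction j)
    case 0
    then show ?case by (simp add: wiener.nrm_zero)
  next
    case (Suc j)
    have "nrm wiener K (\<lambda>x. u (n + Suc j) i x - u n i x)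
        \<le> nrm wiener K (\<lambda>x. u (Suc (n + j)) i x - u (n + j) i x) + nrm wiener K (\<lambda>x. u (n + j) i x - u n i x)" for i
      using wiener.nrm_add[OF sp_diff[OF su[of "Suc (n + j)" i] su[of "n + j" i]] sp_diff[OF su[of "n + j" i] su[of n i]], of K] by simp
    then have "vnrm K (\<lambda>i x. u (n + Suc j) i x - u n i x)
        \<le> vnrm K (\<lambda>i x. u (Suc (n + j)) i x - u (n + j) i x) + vnrm K (\<lambda>i x. u (n + j) i x - u n i x)"
      by (simp only: sum.distrib[symmetric] sum_mono)
    also have "\<dots> \<le> (1/2) ^ (n + j) + 2 * (1/2) ^ n * (1 - (1/2) ^ j)" using step[of "n + j"] Suc by linarith
    finally show ?case by (simp add: power_add algebra_simps)
  qed
  have cauchy: "vnrm K (\<lambda>i x. u (n + j) i x - u n i x) \<le> 2 * (1/2) ^ n" for n j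
  proof -
    have "2 * (1/2::real) ^ n * (1 - (1/2) ^ j) \<le> 2 * (1/2) ^ n * 1" by (intro mult_left_mono) auto
    then show ?thesis using tri[of n j] by linarith
  qed
  have fw: "norm (fourier g k) \<le> nrm wiener K g" if g: "smooth_periodic g" for g :: "real^'m \<Rightarrow> real" and k
  proof -
    have "norm (fourier g k) \<le> wiener g"
      by (rule has_sum_mono_neutral[OF has_sum_finite[of "{k}" "\<lambda>k. norm (fourier g k)", simplified] wiener_has_sum[OF g]]) auto
    then show ?thesis using wiener.nrm_mono[OF g, of 0 K] by simp
  qed
  \<comment> \<open>The limit is taken for each coefficient separately; the function is recovered
    from the limit coefficients by synthesis.\<close>
  have "convergent (\<lambda>n. fourier (u n i) k)" for i k
  proof (rule convergent_geometric[where C=1])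
    fix n
    have "norm (fourier (u (Suc n) i) k - fourier (u n i) k) \<le> nrm wiener K (\<lambda>x. u (Suc n) i x - u n i x)"
      using fw[OF sp_diff[OF su su], of "Suc n" i n i k] by (simp add: fourier_diff su)
    also have "\<dots> \<le> (1/2) ^ n"
      using vle[of "\<lambda>i x. u (Suc n) i x - u n i x" K i] step[of n] by (simp add: sp_diff su)
    finally show "norm (fourier (u (Suc n) i) k - fourier (u n i) k) \<le> 1 * (1/2) ^ n" by simp
  qed
  then obtain c where c: "\<And>i k. (\<lambda>n. fourier (u n i) k) \<longlonglongrightarrow> c i k"
    unfolding convergent_def by metis
  \<comment> \<open>A uniform bound passes to the limit in every finite partial sum, which will give
    rapid decay of the limit coefficients.\<close>
  have fin: "(\<Sum>k\<in>F. norm (c i k) * weight k ^ s) \<le> B" if "\<And>n. vnrm s (u n) \<le> B" "finite F" for i s B F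
  proof (rule LIMSEQ_le_const2)
    show "(\<lambda>n. \<Sum>k\<in>F. norm (fourier (u n i) k) * weight k ^ s) \<longlonglongrightarrow> (\<Sum>k\<in>F. norm (c i k) * weight k ^ s)"
      by (intro tendsto_intros c)
    have "(\<Sum>k\<in>F. norm (fourier (u n i) k) * weight k ^ s) \<le> B" for n
    proof -
      have "(\<Sum>k\<in>F. norm (fourier (u n i) k) * weight k ^ s) \<le> nrm wiener s (u n i)"
        by (rule has_sum_mono_neutral[OF has_sum_finite[OF that(2)] nrm_wiener_weight[OF su]])
          (auto simp: weight_power_nonneg)
      then show ?thesis using vle[of "u n" s i, OF su] that(1)[of n] by linarith
    qed
    then show "\<exists>N. \<forall>n\<ge>N. (\<Sum>k\<in>F. norm (fourier (u n i) k) * weight k ^ s) \<le> B" by blast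
  qed
  have rap: "rapid (c i)" for i
    unfolding rapid_def
  proof
    fix s
    obtain B where B: "\<And>n. vnrm s (u n) \<le> B" using bd by blast
    show "(\<lambda>k. norm (c i k) * weight k ^ s) summable_on UNIV"
    proof (rule nonneg_bdd_above_summable_on)
      show "0 \<le> norm (c i k) * weight k ^ s" for k using weight_ge_1[of k] by simp
      show "bdd_above (sum (\<lambda>k. norm (c i k) * weight k ^ s) ` {F. F \<subseteq> UNIV \<and> finite F})"
        using fin[OF B] by (intro bdd_aboveI2[of _ _ B]) auto
    qed
  qed
  have herm: "c i (- k) = cnj (c i k)" for i k
    using LIMSEQ_unique[OF c[of i "- k"]] tendsto_cnj[OF c[of i k]] by (simp add: fourier_cnj su)
  have "\<exists>f. smooth_periodic f \<and> (\<forall>k. fourier f k = c i k)" for i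
    using fourier_synthesis[OF rap herm] by metis
  then obtain f where f: "\<And>i. smooth_periodic (f i)" "\<And>i k. fourier (f i) k = c i k" by metis
  \<comment> \<open>\<open>j\<close> tends to infinity in the Cauchy estimate, again through finite
    partial sums; \<open>CARD('n)\<close> comes from adding the components.\<close>
  have near: "vnrm K (\<lambda>i x. u n i x - f i x) \<le> CARD('n) * (2 * (1/2) ^ n)" for n
  proof -
    have "nrm wiener K (\<lambda>x. u n i x - f i x) \<le> 2 * (1/2) ^ n" for i
    proof (rule has_sum_le_finite_sums[OF nrm_wiener_weight[OF sp_diff[OF su f(1)]]])
      fix F :: "('m \<Rightarrow> int) set" assume F: "finite F"
      show "(\<Sum>k\<in>F. norm (fourier (\<lambda>x. u n i x - f i x) k) * weight k ^ K) \<le> 2 * (1/2) ^ n"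
      proof (rule LIMSEQ_le_const2)
        show "(\<lambda>j. \<Sum>k\<in>F. norm (fourier (u n i) k - fourier (u j i) k) * weight k ^ K)
            \<longlonglongrightarrow> (\<Sum>k\<in>F. norm (fourier (\<lambda>x. u n i x - f i x) k) * weight k ^ K)"
          unfolding fourier_diff[OF su f(1)] f(2) by (intro tendsto_intros c)
        have "(\<Sum>k\<in>F. norm (fourier (u n i) k - fourier (u j i) k) * weight k ^ K) \<le> 2 * (1/2) ^ n" if "n \<le> j" for j
        proof -
          have "(\<Sum>k\<in>F. norm (fourier (\<lambda>x. u j i x - u n i x) k) * weight k ^ K) \<le> nrm wiener K (\<lambda>x. u j i x - u n i x)"
            by (rule has_sum_mono_neutral[OF has_sum_finite[OF F] nrm_wiener_weight[OF sp_diff[OF su su]]])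
              (auto simp: weight_power_nonneg)
          also have "\<dots> \<le> 2 * (1/2) ^ n"
            using cauchy[of n "j - n"] vle[of "\<lambda>i x. u j i x - u n i x" K i] that by (simp add: sp_diff su)
          finally show ?thesis by (simp add: fourier_diff su norm_minus_commute)
        qed
        then show "\<exists>N. \<forall>j\<ge>N. (\<Sum>k\<in>F. norm (fourier (u n i) k - fourier (u j i) k) * weight k ^ K) \<le> 2 * (1/2) ^ n" by blast
      qed
    qed
    then have "vnrm K (\<lambda>i x. u n i x - f i x) \<le> (\<Sum>i\<in>(UNIV::'n set). 2 * (1/2) ^ n)" by (intro sum_mono)
    then show ?thesis by simp
  qed
  have lim0: "(\<lambda>n. C * (2 * (1/2::real) ^ n)) \<longlonglongrightarrow> 0" for C
    using tendsto_mult[OF tendsto_const[of C] tendsto_mult[OF tendsto_const[of 2] LIMSEQ_power_zero[of "1/2::real"]]] by simp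
  have tri2: "vnrm K g \<le> vnrm K h + vnrm K (\<lambda>i x. g i x - h i x)"
    if "\<And>i. smooth_periodic (g i)" "\<And>i. smooth_periodic (h i)" for g h :: "'n \<Rightarrow> real^'m \<Rightarrow> real"
  proof -
    have "nrm wiener K (g i) \<le> nrm wiener K (h i) + nrm wiener K (\<lambda>x. g i x - h i x)" for i
      using wiener.nrm_add[OF that(2)[of i] sp_diff[OF that(1)[of i] that(2)[of i]], of K] by simp
    then show ?thesis by (simp only: sum.distrib[symmetric] sum_mono)
  qed
  have comm: "vnrm K (\<lambda>i x. g i x - h i x) = vnrm K (\<lambda>i x. h i x - g i x)"
    if "\<And>i. smooth_periodic (g i)" "\<And>i. smooth_periodic (h i)" for g h :: "'n \<Rightarrow> real^'m \<Rightarrow> real"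
    by (intro sum.cong refl wiener.nrm_minus_commute that)
  \<comment> \<open>The contraction may be applied to the limit only inside the unit ball.\<close>
  have bf: "vnrm K f \<le> 1"
  proof (rule LIMSEQ_le_const[where X="\<lambda>n. 1 + CARD('n) * (2 * (1/2) ^ n)"])
    show "(\<lambda>n. 1 + CARD('n) * (2 * (1/2) ^ n)) \<longlonglongrightarrow> (1::real)"
      using tendsto_add[OF tendsto_const[of 1] lim0[of "CARD('n)"]] by simp
    have "vnrm K f \<le> 1 + CARD('n) * (2 * (1/2) ^ n)" for n
      using tri2[of f "u n", OF f(1) su] comm[of f "u n", OF f(1) su] near[of n] b[of n] by linarith
    then show "\<exists>N. \<forall>n\<ge>N. vnrm K f \<le> 1 + CARD('n) * (2 * (1/2) ^ n)" by blast
  qed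
  have "vnrm K (\<lambda>i x. \<Phi> f i x - f i x) \<le> 0"
  proof (rule LIMSEQ_le_const[where X="\<lambda>n. (2 * CARD('n)) * (2 * (1/2) ^ n)"])
    show "(\<lambda>n. (2 * CARD('n)) * (2 * (1/2) ^ n)) \<longlonglongrightarrow> (0::real)" using lim0[of "2 * CARD('n)"] by simp
    have "vnrm K (\<lambda>i x. \<Phi> f i x - f i x) \<le> (2 * CARD('n)) * (2 * (1/2) ^ n)" for n
    proof -
      have "vnrm K (\<lambda>i x. \<Phi> f i x - f i x) \<le> vnrm K (\<lambda>i x. \<Phi> f i x - \<Phi> (u n) i x) + vnrm K (\<lambda>i x. u (Suc n) i x - f i x)"
      proof -
        have "nrm wiener K (\<lambda>x. \<Phi> f i x - f i x) \<le> nrm wiener K (\<lambda>x. \<Phi> f i x - \<Phi> (u n) i x) + nrm wiener K (\<lambda>x. u (Suc n) i x - f i x)" for i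
          using wiener.nrm_add[of "\<lambda>x. \<Phi> f i x - \<Phi> (u n) i x" "\<lambda>x. u (Suc n) i x - f i x" K]
          by (simp add: uS sp_diff sp f su)
        then show ?thesis by (simp only: sum.distrib[symmetric] sum_mono)
      qed
      moreover have "vnrm K (\<lambda>i x. \<Phi> f i x - \<Phi> (u n) i x) \<le> 1/2 * vnrm K (\<lambda>i x. f i x - u n i x)"
        by (rule contr[of f "u n", OF f(1) su bf b])
      moreover have "(1/2::real) ^ Suc n \<le> (1/2) ^ n" by simp
      then have "CARD('n) * (2 * (1/2::real) ^ Suc n) \<le> CARD('n) * (2 * (1/2) ^ n)" by (intro mult_left_mono) auto
      moreover have "0 \<le> CARD('n) * (2 * (1/2::real) ^ n)" by simp
      ultimately show ?thesis using near[of "Suc n"] near[of n] comm[of f "u n", OF f(1) su] by linarith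
    qed
    then show "\<exists>N. \<forall>n\<ge>N. vnrm K (\<lambda>i x. \<Phi> f i x - f i x) \<le> (2 * CARD('n)) * (2 * (1/2) ^ n)" by blast
  qed
  then have "wiener (\<lambda>x. \<Phi> f i x - f i x) \<le> 0" for i
    using vle[of "\<lambda>i x. \<Phi> f i x - f i x" K i] wiener.nrm_mono[of "\<lambda>x. \<Phi> f i x - f i x" 0 K]
    by (simp add: sp_diff sp f)
  then have "\<Phi> f i x - f i x = 0" for i x
    using wiener_zeroD[of "\<lambda>x. \<Phi> f i x - f i x" x] by (simp add: sp_diff sp f)
  then show thesis using that[of f] f(1) by simp
qed


section \<open>Local solutions with prescribed 1-jet\<close>

lemma finite_uniform_bound:
  fixes P :: "'i::finite \<Rightarrow> real \<Rightarrow> bool"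
  assumes "\<And>i. \<exists>C\<ge>0. P i C" "\<And>i C D. P i C \<Longrightarrow> C \<le> D \<Longrightarrow> P i D"
  obtains C where "C \<ge> 0" "\<And>i. P i C"
proof -
  have "\<forall>i. \<exists>C. C \<ge> 0 \<and> P i C" using assms(1) by blast
  from choice[OF this] obtain c where c: "\<forall>i. c i \<ge> 0 \<and> P i (c i)" by (elim exE)
  have "c i \<le> (\<Sum>i\<in>UNIV. c i)" for i using c by (intro member_le_sum) auto
  then show thesis using that[of "\<Sum>i\<in>UNIV. c i"] c assms(2) by (meson sum_nonneg)
qed

lemma (in periodic_norm) nrm_sum2_le:
  fixes u :: "'i::finite \<Rightarrow> 'j::finite \<Rightarrow> real^'m \<Rightarrow> real" and b :: real
  assumes "\<And>i j. smooth_periodic (u i j)" "\<And>i j. nrm \<nu> s (u i j) \<le> b"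
  shows "nrm \<nu> s (\<lambda>x. \<Sum>i\<in>UNIV. \<Sum>j\<in>UNIV. u i j x) \<le> CARD('i) * CARD('j) * b"
proof -
  have "nrm \<nu> s (\<lambda>x. \<Sum>i\<in>UNIV. \<Sum>j\<in>UNIV. u i j x) \<le> (\<Sum>i\<in>UNIV. nrm \<nu> s (\<lambda>x. \<Sum>j\<in>UNIV. u i j x))"
    by (intro nrm_sum sp_sum assms(1))
  also have "\<dots> \<le> (\<Sum>i\<in>(UNIV::'i set). \<Sum>j\<in>(UNIV::'j set). b)"
    by (intro sum_mono order_trans[OF nrm_sum] assms)
  finally show ?thesis by simp
qed

lemma partial_scale:
  fixes g :: "real^'m::finite \<Rightarrow> real"
  assumes "smooth_on g UNIV"
  shows "partial_deriv \<alpha> (\<lambda>x. g (c *\<^sub>R x)) = (\<lambda>x. c * partial_deriv \<alpha> g (c *\<^sub>R x))"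
proof
  fix x :: "real^'m"
  have 1: "((\<lambda>x. c *\<^sub>R x) has_derivative (\<lambda>v. c *\<^sub>R v)) (at x)" by (auto intro!: derivative_eq_intros)
  have 2: "(g has_derivative frechet_derivative g (at (c *\<^sub>R x))) (at (c *\<^sub>R x))"
    using smooth_on_deriv[OF assms open_UNIV] by blast
  show "partial_deriv \<alpha> (\<lambda>x. g (c *\<^sub>R x)) x = c * partial_deriv \<alpha> g (c *\<^sub>R x)"
    using partial_deriv_eqI[OF has_derivative_compose[OF 1 2], of \<alpha>] linear_scale[OF has_derivative_linear[OF 2]]
    by (simp add: partial_deriv_def)
qed

lemma partial_linear: "partial_deriv \<alpha> (\<lambda>x::real^'m::finite. \<Sum>\<beta>\<in>UNIV. c \<beta> * x $ \<beta>) = (\<lambda>_. c \<alpha>)"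
proof
  fix x :: "real^'m"
  have "((\<lambda>x::real^'m. \<Sum>\<beta>\<in>UNIV. c \<beta> * x $ \<beta>) has_derivative (\<lambda>v. \<Sum>\<beta>\<in>UNIV. c \<beta> * v $ \<beta>)) (at x)"
    by (intro has_derivative_sum has_derivative_mult_right bounded_linear_imp_has_derivative bounded_linear_vec_nth)
  from partial_deriv_eqI[OF this, of \<alpha>]
  have "partial_deriv \<alpha> (\<lambda>x::real^'m. \<Sum>\<beta>\<in>UNIV. c \<beta> * x $ \<beta>) x = (\<Sum>\<beta>\<in>UNIV. c \<beta> * axis \<alpha> 1 $ \<beta>)" .
  also have "\<dots> = (\<Sum>\<beta>\<in>UNIV. if \<beta> = \<alpha> then c \<alpha> else 0)" by (intro sum.cong) (auto simp: axis_def)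
  finally show "partial_deriv \<alpha> (\<lambda>x::real^'m. \<Sum>\<beta>\<in>UNIV. c \<beta> * x $ \<beta>) x = c \<alpha>" by simp
qed

declare nrm.simps(2) [simp del]

text \<open>Point, value and first derivatives are packed into one Euclidean vector so that the
  nonlinearity becomes a smooth function of a single vector, as the composition estimates
  require.\<close>

definition jet :: "('n::finite \<Rightarrow> real^'m::finite \<Rightarrow> real) \<Rightarrow> real^'m \<Rightarrow> real^('m + ('n + 'n \<times> 'm))" where
  "jet F x = (\<chi> p. case p of Inl \<alpha> \<Rightarrow> x $ \<alpha> | Inr (Inl j) \<Rightarrow> F j x | Inr (Inr (j, \<alpha>)) \<Rightarrow> partial_deriv \<alpha> (F j) x)"

text \<open>
  The ansatz is \<open>F (e z) = e (A z + w z - w 0 - Dw(0) z)\<close> with \<open>w = T f\<close>, which has the right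
  1-jet for every \<open>f\<close>. In the variable \<open>z\<close> the equation is a fixed point equation for \<open>f\<close> whose
  right-hand side has size \<open>e\<close>.
\<close>

lemma local_solution:
  fixes a :: "'m::finite \<Rightarrow> 'm \<Rightarrow> real^'m \<Rightarrow> real"
    and H :: "'n::finite \<Rightarrow> real^('m + ('n + 'n \<times> 'm)) \<Rightarrow> real"
    and A :: "'n \<Rightarrow> 'm \<Rightarrow> real"
  assumes a: "\<And>\<alpha> \<beta>. smooth_on (a \<alpha> \<beta>) UNIV" and H: "\<And>i. smooth_on (H i) UNIV"
    and ell: "lam > 0" "\<And>\<xi> :: 'm \<Rightarrow> real. lam * (\<Sum>i\<in>UNIV. (\<xi> i)\<^sup>2) \<le> (\<Sum>\<alpha>\<in>UNIV. \<Sum>\<beta>\<in>UNIV. a \<alpha> \<beta> 0 * \<xi> \<alpha> * \<xi> \<beta>)"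
  obtains F :: "'n \<Rightarrow> real^'m \<Rightarrow> real" and r :: real
  where "r > 0" "\<And>i. smooth_on (F i) UNIV" "\<And>i. F i 0 = 0" "\<And>i \<alpha>. partial_deriv \<alpha> (F i) 0 = A i \<alpha>"
    "\<And>x i. x \<in> ball 0 r \<Longrightarrow>
      (\<Sum>\<alpha>\<in>UNIV. \<Sum>\<beta>\<in>UNIV. a \<alpha> \<beta> x * partial_deriv \<alpha> (partial_deriv \<beta> (F i)) x) + H i (jet F x) = 0"
proof (rule elliptic_inverse[of lam "\<lambda>\<alpha> \<beta>. a \<alpha> \<beta> 0", OF ell])
  let ?N = "nrm wiener :: nat \<Rightarrow> (real^'m \<Rightarrow> real) \<Rightarrow> real"
  let ?pp = "\<lambda>\<alpha> \<beta> u. partial_deriv \<alpha> (partial_deriv \<beta> u)"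
  fix T :: "(real^'m \<Rightarrow> real) \<Rightarrow> real^'m \<Rightarrow> real" and L :: real and G :: "nat \<Rightarrow> real" and \<delta>1 :: real
  assume T: "\<And>f. smooth_periodic f \<Longrightarrow> smooth_periodic (T f)"
    and T_diff: "\<And>f g. smooth_periodic f \<Longrightarrow> smooth_periodic g \<Longrightarrow> T (\<lambda>x. f x - g x) = (\<lambda>x. T f x - T g x)"
    and \<delta>1: "\<delta>1 > 0"
    and T_eq: "\<And>f x. smooth_periodic f \<Longrightarrow> (\<And>i. \<bar>x $ i\<bar> < \<delta>1) \<Longrightarrow>
       (\<Sum>\<alpha>\<in>UNIV. \<Sum>\<beta>\<in>UNIV. a \<alpha> \<beta> 0 * ?pp \<alpha> \<beta> (T f) x) = f x"
    and L0: "L \<ge> 0" and G0: "\<And>s. G s \<ge> 0"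
    and T2: "\<And>f s \<alpha> \<beta>. smooth_periodic f \<Longrightarrow> ?N s (?pp \<alpha> \<beta> (T f)) \<le> L * ?N s f + G s * wiener f"
    and T0: "\<And>f s. smooth_periodic f \<Longrightarrow> ?N (Suc s) (T f) \<le> G s * ?N s f"
    and T1: "\<And>f s \<alpha>. smooth_periodic f \<Longrightarrow> ?N (Suc s) (partial_deriv \<alpha> (T f)) \<le> G s * ?N s f"
  obtain X :: "'m \<Rightarrow> real^'m \<Rightarrow> real" and \<delta>2 :: real
    where X: "\<And>i. smooth_periodic (X i)" and \<delta>2: "\<delta>2 > 0" "\<And>x i. \<bar>x $ i\<bar> < \<delta>2 \<Longrightarrow> X i x = x $ i"
    by (rule periodic_coordinates) (rule that; assumption)
  \<comment> \<open>The order from which on \<open>comp_lipschitz\<close> applies.\<close>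
  define K where "K = 2 * CARD('m)"
  have K: "K = Suc (K - 1)" "K \<le> Suc (K - 1)" by (simp_all add: K_def)
  define w1 where "w1 = wiener (\<lambda>_::real^'m. 1)"
  have w1: "w1 \<ge> 0" unfolding w1_def by (intro wiener.nonneg sp_const)
  define Nx where "Nx = (\<lambda>s. \<Sum>\<gamma>\<in>UNIV. ?N s (X \<gamma>))"
  have Nx_le: "?N s (X \<gamma>) \<le> Nx s" for s \<gamma>
    unfolding Nx_def by (rule member_le_sum) (auto intro!: wiener.nrm_nonneg X)
  have Nx0: "Nx s \<ge> 0" for s unfolding Nx_def by (intro sum_nonneg wiener.nrm_nonneg X)
  \<comment> \<open>\<open>TL h\<close> is \<open>T h\<close> without its affine Taylor part at 0
    and \<open>DL\<close> is its derivative, up to replacement of the coordinates by the periodic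
    functions \<open>X\<close>; near the origin the replacement makes no difference.\<close>
  define TL where "TL = (\<lambda>h x. T h x - T h 0 - (\<Sum>\<alpha>\<in>UNIV. partial_deriv \<alpha> (T h) 0 * X \<alpha> x))"
  define DL where "DL = (\<lambda>\<alpha> h x. partial_deriv \<alpha> (T h) x - partial_deriv \<alpha> (T h) 0)"
  have sTL: "smooth_periodic (TL h)" and sDL: "smooth_periodic (DL \<alpha> h)" if "smooth_periodic h" for h \<alpha>
    unfolding TL_def DL_def by (intro sp_intros T X that)+
  have pT_diff: "partial_deriv \<alpha> (T (\<lambda>x. f x - g x)) x = partial_deriv \<alpha> (T f) x - partial_deriv \<alpha> (T g) x"
    if f: "smooth_periodic f" and g: "smooth_periodic g" for f g \<alpha> x
    unfolding T_diff[OF f g] by (rule fun_cong[OF partial_diff[OF smooth_periodicD(1)[OF T[OF f]] smooth_periodicD(1)[OF T[OF g]]]])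
  have ppT_diff: "?pp \<alpha> \<beta> (T (\<lambda>x. f x - g x)) x = ?pp \<alpha> \<beta> (T f) x - ?pp \<alpha> \<beta> (T g) x"
    if f: "smooth_periodic f" and g: "smooth_periodic g" for f g \<alpha> \<beta> x
  proof -
    have "partial_deriv \<beta> (T (\<lambda>x. f x - g x)) = (\<lambda>x. partial_deriv \<beta> (T f) x - partial_deriv \<beta> (T g) x)"
      using pT_diff[OF f g] by (rule ext)
    then show ?thesis
      using fun_cong[OF partial_diff[OF smooth_periodicD(1)[OF sp_partial[OF T[OF f]]] smooth_periodicD(1)[OF sp_partial[OF T[OF g]]]]]
      by simp
  qed
  have TL_diff: "TL (\<lambda>x. f x - g x) x = TL f x - TL g x" and DL_diff: "DL \<alpha> (\<lambda>x. f x - g x) x = DL \<alpha> f x - DL \<alpha> g x"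
    if f: "smooth_periodic f" and g: "smooth_periodic g" for f g x \<alpha>
    unfolding TL_def DL_def pT_diff[OF f g] by (simp_all add: T_diff[OF f g] sum_subtractf algebra_simps)
  \<comment> \<open>The three summands account for \<open>T h\<close>, its value at 0 and its linear
    part.\<close>
  define Q where "Q = (\<lambda>s. G s * (1 + w1 + CARD('m) * Nx (Suc s)))"
  have Q0: "Q s \<ge> 0" for s unfolding Q_def using G0 w1 Nx0 by simp
  have point: "\<bar>u 0\<bar> \<le> ?N s u" if "smooth_periodic u" for u s
    using abs_le_wiener[OF that, of 0] wiener.nrm_mono[OF that, of 0 s] by simp
  have TL_le: "?N (Suc s) (TL h) \<le> Q s * ?N s h" if h: "smooth_periodic h" for h s
  proof -
    let ?g = "G s * ?N s h"
    have "?N (Suc s) (TL h) \<le> ?N (Suc s) (\<lambda>x. T h x - T h 0) + ?N (Suc s) (\<lambda>x. \<Sum>\<alpha>\<in>UNIV. partial_deriv \<alpha> (T h) 0 * X \<alpha> x)"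
      unfolding TL_def by (intro wiener.nrm_diff sp_intros T X h)
    also have "?N (Suc s) (\<lambda>x. T h x - T h 0) \<le> ?N (Suc s) (T h) + ?N (Suc s) (\<lambda>_. T h 0)"
      by (intro wiener.nrm_diff sp_intros T h)
    also have "\<dots> \<le> ?g + ?g * w1"
      unfolding wiener.nrm_const w1_def[symmetric]
      by (intro add_mono mult_right_mono T0 h w1 order_trans[OF point[OF T[OF h]] T0])
    also have "?N (Suc s) (\<lambda>x. \<Sum>\<alpha>\<in>UNIV. partial_deriv \<alpha> (T h) 0 * X \<alpha> x) \<le> (\<Sum>\<alpha>\<in>UNIV. ?N (Suc s) (\<lambda>x. partial_deriv \<alpha> (T h) 0 * X \<alpha> x))"
      by (intro wiener.nrm_sum sp_mult sp_const X)
    also have "\<dots> \<le> (\<Sum>\<alpha>\<in>(UNIV::'m set). ?g * Nx (Suc s))"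
    proof (intro sum_mono)
      fix \<alpha>
      have "\<bar>partial_deriv \<alpha> (T h) 0\<bar> \<le> ?g" by (rule order_trans[OF point[OF sp_partial[OF T[OF h]]] T1[OF h]])
      then show "?N (Suc s) (\<lambda>x. partial_deriv \<alpha> (T h) 0 * X \<alpha> x) \<le> ?g * Nx (Suc s)"
        unfolding wiener.nrm_cmult[OF X] by (intro mult_mono Nx_le wiener.nrm_nonneg X mult_nonneg_nonneg G0 h)
    qed
    finally show ?thesis by (simp add: Q_def algebra_simps)
  qed
  have DL_le: "?N (Suc s) (DL \<alpha> h) \<le> Q s * ?N s h" if h: "smooth_periodic h" for h s \<alpha>
  proof -
    let ?g = "G s * ?N s h"
    have g0: "?g \<ge> 0" by (intro mult_nonneg_nonneg G0 wiener.nrm_nonneg h)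
    have "?N (Suc s) (DL \<alpha> h) \<le> ?N (Suc s) (partial_deriv \<alpha> (T h)) + ?N (Suc s) (\<lambda>_. partial_deriv \<alpha> (T h) 0)"
      unfolding DL_def by (intro wiener.nrm_diff sp_intros T h)
    also have "\<dots> \<le> ?g + ?g * w1"
      unfolding wiener.nrm_const w1_def[symmetric]
      by (intro add_mono mult_right_mono T1 h w1 order_trans[OF point[OF sp_partial[OF T[OF h]]] T1])
    also have "\<dots> \<le> ?g + ?g * w1 + ?g * (CARD('m) * Nx (Suc s))"
      using mult_nonneg_nonneg[OF g0, of "CARD('m) * Nx (Suc s)"] Nx0[of "Suc s"] by simp
    finally show ?thesis by (simp add: Q_def algebra_simps)
  qed
  \<comment> \<open>The jet of the ansatz at \<open>x = e z\<close> as a function of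
    \<open>z\<close>: point and value carry a factor \<open>e\<close>, first derivatives carry
    none.\<close>
  define U where "U = (\<lambda>e f p. case p of Inl \<alpha> \<Rightarrow> (\<lambda>x. e * X \<alpha> x)
      | Inr (Inl j) \<Rightarrow> (\<lambda>x. e * ((\<Sum>\<alpha>\<in>UNIV. A j \<alpha> * X \<alpha> x) + TL (f j) x))
      | Inr (Inr (j, \<alpha>)) \<Rightarrow> (\<lambda>x. A j \<alpha> + DL \<alpha> (f j) x))"
  have U_simps: "U e f (Inl \<alpha>) = (\<lambda>x. e * X \<alpha> x)"
    "U e f (Inr (Inl j)) = (\<lambda>x. e * ((\<Sum>\<alpha>\<in>UNIV. A j \<alpha> * X \<alpha> x) + TL (f j) x))"
    "U e f (Inr (Inr (j, \<alpha>))) = (\<lambda>x. A j \<alpha> + DL \<alpha> (f j) x)" for e f \<alpha> and j :: 'n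
    by (simp_all add: U_def)
  have p_cases: "P p" if "\<And>\<alpha>. P (Inl \<alpha>)" "\<And>j. P (Inr (Inl j))" "\<And>j \<alpha>. P (Inr (Inr (j, \<alpha>)))"
    for P :: "'m + ('n + 'n \<times> 'm) \<Rightarrow> bool" and p
    using that by (metis old.sum.exhaust surj_pair)
  have sU: "smooth_periodic (U e f p)" if f: "\<And>i. smooth_periodic (f i)" for e f p
    by (rule p_cases[of _ p]; simp only: U_simps; intro sp_intros X sTL sDL f)
  define AA where "AA = (\<Sum>j\<in>UNIV. \<Sum>\<alpha>\<in>UNIV. \<bar>A j \<alpha>\<bar>)"
  have AA1: "(\<Sum>\<alpha>\<in>UNIV. \<bar>A j \<alpha>\<bar>) \<le> AA" for j
    unfolding AA_def by (rule member_le_sum) (auto intro!: sum_nonneg)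
  have AA2: "\<bar>A j \<alpha>\<bar> \<le> AA" for j \<alpha>
    using AA1[of j] member_le_sum[of \<alpha> UNIV "\<lambda>\<alpha>. \<bar>A j \<alpha>\<bar>"] by simp
  have AA0: "AA \<ge> 0" unfolding AA_def by (intro sum_nonneg) auto
  \<comment> \<open>A bound for the part of the jet that does not depend on
    \<open>f\<close>.\<close>
  define R where "R = (\<lambda>s. Nx (Suc s) + AA * (Nx (Suc s) + w1))"
  have vle: "?N s (f i) \<le> vnrm s f" if "\<And>i. smooth_periodic (f i)" for f :: "'n \<Rightarrow> real^'m \<Rightarrow> real" and i s
    by (rule member_le_sum) (auto intro!: wiener.nrm_nonneg that)
  have v0: "vnrm s f \<ge> 0" if "\<And>i. smooth_periodic (f i)" for f :: "'n \<Rightarrow> real^'m \<Rightarrow> real" and s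
    by (intro sum_nonneg wiener.nrm_nonneg that)
  \<comment> \<open>One order is gained from \<open>f\<close> to the jet, so the nonlinearity never
    involves the top-order norm of \<open>f\<close>.\<close>
  have U_le: "?N (Suc s) (U e f p) \<le> R s + Q s * vnrm s f"
    if f: "\<And>i. smooth_periodic (f i)" and e: "0 < e" "e \<le> 1" for e f p s
  proof (rule p_cases[of _ p])
    have Qv: "Q s * ?N s (f j) \<le> Q s * vnrm s f" for j by (intro mult_left_mono vle f Q0)
    have Qv0: "0 \<le> Q s * vnrm s f" by (intro mult_nonneg_nonneg Q0 v0 f)
    have e_le: "e * t \<le> t" if "t \<ge> 0" for t using e mult_right_mono[OF e(2) that] by simp
    show "?N (Suc s) (U e f (Inl \<alpha>)) \<le> R s + Q s * vnrm s f" for \<alpha>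
    proof -
      have "?N (Suc s) (U e f (Inl \<alpha>)) \<le> ?N (Suc s) (X \<alpha>)"
        unfolding U_simps wiener.nrm_cmult[OF X] using e e_le[OF wiener.nrm_nonneg[OF X]] by simp
      moreover have "0 \<le> AA * (Nx (Suc s) + w1)" using AA0 Nx0 w1 by simp
      ultimately show ?thesis using Nx_le[of "Suc s" \<alpha>] Qv0 unfolding R_def by linarith
    qed
    show "?N (Suc s) (U e f (Inr (Inl j))) \<le> R s + Q s * vnrm s f" for j
    proof -
      have s: "smooth_periodic (\<lambda>x. (\<Sum>\<alpha>\<in>UNIV. A j \<alpha> * X \<alpha> x) + TL (f j) x)" by (intro sp_intros X sTL f)
      have "?N (Suc s) (U e f (Inr (Inl j))) \<le> ?N (Suc s) (\<lambda>x. (\<Sum>\<alpha>\<in>UNIV. A j \<alpha> * X \<alpha> x) + TL (f j) x)"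
        unfolding U_simps wiener.nrm_cmult[OF s] using e e_le[OF wiener.nrm_nonneg[OF s]] by simp
      also have "\<dots> \<le> ?N (Suc s) (\<lambda>x. \<Sum>\<alpha>\<in>UNIV. A j \<alpha> * X \<alpha> x) + ?N (Suc s) (TL (f j))"
        by (intro wiener.nrm_add sp_intros X sTL f)
      also have "?N (Suc s) (\<lambda>x. \<Sum>\<alpha>\<in>UNIV. A j \<alpha> * X \<alpha> x) \<le> (\<Sum>\<alpha>\<in>UNIV. ?N (Suc s) (\<lambda>x. A j \<alpha> * X \<alpha> x))"
        by (intro wiener.nrm_sum sp_mult sp_const X)
      also have "\<dots> \<le> (\<Sum>\<alpha>\<in>UNIV. \<bar>A j \<alpha>\<bar> * Nx (Suc s))"
        unfolding wiener.nrm_cmult[OF X] by (intro sum_mono mult_left_mono Nx_le) auto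
      also have "\<dots> \<le> AA * Nx (Suc s)" unfolding sum_distrib_right[symmetric] by (intro mult_right_mono AA1 Nx0)
      finally have "?N (Suc s) (U e f (Inr (Inl j))) \<le> AA * Nx (Suc s) + ?N (Suc s) (TL (f j))" by simp
      moreover have "?N (Suc s) (TL (f j)) \<le> Q s * vnrm s f" by (rule order_trans[OF TL_le[OF f] Qv])
      moreover have "0 \<le> AA * w1" "0 \<le> Nx (Suc s)" using AA0 w1 Nx0 by auto
      ultimately show ?thesis unfolding R_def distrib_left by linarith
    qed
    show "?N (Suc s) (U e f (Inr (Inr (j, \<alpha>)))) \<le> R s + Q s * vnrm s f" for j \<alpha>
    proof -
      have "?N (Suc s) (U e f (Inr (Inr (j, \<alpha>)))) \<le> ?N (Suc s) (\<lambda>_. A j \<alpha>) + ?N (Suc s) (DL \<alpha> (f j))"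
        unfolding U_simps by (intro wiener.nrm_add sp_const sDL f)
      moreover have "?N (Suc s) (\<lambda>_. A j \<alpha>) \<le> AA * w1"
        unfolding wiener.nrm_const w1_def[symmetric] by (intro mult_right_mono AA2 w1)
      moreover have "?N (Suc s) (DL \<alpha> (f j)) \<le> Q s * vnrm s f" by (rule order_trans[OF DL_le[OF f] Qv])
      moreover have "0 \<le> AA * Nx (Suc s)" "0 \<le> Nx (Suc s)" using AA0 Nx0 by auto
      ultimately show ?thesis unfolding R_def distrib_left by linarith
    qed
  qed
  have U_diff: "?N (Suc s) (\<lambda>x. U e f p x - U e g p x) \<le> Q s * vnrm s (\<lambda>i x. f i x - g i x)"
    if f: "\<And>i. smooth_periodic (f i)" and g: "\<And>i. smooth_periodic (g i)" and e: "0 < e" "e \<le> 1" for e f g p s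
  proof (rule p_cases[of _ p])
    have d: "smooth_periodic (\<lambda>x. f i x - g i x)" for i by (intro sp_diff f g)
    have Qv: "Q s * ?N s (\<lambda>x. f j x - g j x) \<le> Q s * vnrm s (\<lambda>i x. f i x - g i x)" for j
      using vle[of "\<lambda>i x. f i x - g i x" s j, OF d] by (intro mult_left_mono Q0)
    show "?N (Suc s) (\<lambda>x. U e f (Inl \<alpha>) x - U e g (Inl \<alpha>) x) \<le> Q s * vnrm s (\<lambda>i x. f i x - g i x)" for \<alpha>
    proof -
      have "(\<lambda>x. U e f (Inl \<alpha>) x - U e g (Inl \<alpha>) x) = (\<lambda>_. 0)" by (simp add: U_simps)
      then have "?N (Suc s) (\<lambda>x. U e f (Inl \<alpha>) x - U e g (Inl \<alpha>) x) = 0" by (simp only: wiener.nrm_zero)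
      then show ?thesis using mult_nonneg_nonneg[OF Q0[of s] v0[of "\<lambda>i x. f i x - g i x" s, OF d]] by linarith
    qed
    show "?N (Suc s) (\<lambda>x. U e f (Inr (Inl j)) x - U e g (Inr (Inl j)) x) \<le> Q s * vnrm s (\<lambda>i x. f i x - g i x)" for j
    proof -
      have "(\<lambda>x. U e f (Inr (Inl j)) x - U e g (Inr (Inl j)) x) = (\<lambda>x. e * TL (\<lambda>x. f j x - g j x) x)"
        unfolding U_simps by (rule ext) (simp add: TL_diff[OF f g] algebra_simps)
      then have "?N (Suc s) (\<lambda>x. U e f (Inr (Inl j)) x - U e g (Inr (Inl j)) x) = e * ?N (Suc s) (TL (\<lambda>x. f j x - g j x))"
        using e by (simp add: wiener.nrm_cmult[OF sTL[OF d]])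
      also have "\<dots> \<le> ?N (Suc s) (TL (\<lambda>x. f j x - g j x))"
        using mult_right_mono[OF e(2) wiener.nrm_nonneg[OF sTL[OF d], of "Suc s" j]] by simp
      also have "\<dots> \<le> Q s * vnrm s (\<lambda>i x. f i x - g i x)" by (rule order_trans[OF TL_le[OF d] Qv])
      finally show ?thesis .
    qed
    show "?N (Suc s) (\<lambda>x. U e f (Inr (Inr (j, \<alpha>))) x - U e g (Inr (Inr (j, \<alpha>))) x) \<le> Q s * vnrm s (\<lambda>i x. f i x - g i x)" for j \<alpha>
    proof -
      have "(\<lambda>x. U e f (Inr (Inr (j, \<alpha>))) x - U e g (Inr (Inr (j, \<alpha>))) x) = DL \<alpha> (\<lambda>x. f j x - g j x)"
        unfolding U_simps by (rule ext) (simp add: DL_diff[OF f g])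
      then show ?thesis using order_trans[OF DL_le[OF d] Qv, of \<alpha> j] by simp
    qed
  qed
  \<comment> \<open>The deviation of the coefficients in the rescaled variable, made periodic. Its
    inner functions \<open>e * X\<close> are within a multiple of \<open>e\<close> of 0, so it has
    size \<open>e\<close> in every norm of order at least \<open>K\<close>, with a constant that
    depends on the order.\<close>
  define ae where "ae = (\<lambda>e \<alpha> \<beta> x. a \<alpha> \<beta> (\<chi> \<gamma>. e * X \<gamma> x) - a \<alpha> \<beta> 0)"
  have seX: "smooth_periodic (\<lambda>x. e * X \<gamma> x)" for e \<gamma> by (intro sp_intros X)
  have sae: "smooth_periodic (ae e \<alpha> \<beta>)" for e \<alpha> \<beta>
    unfolding ae_def by (intro sp_diff sp_const sp_compose[OF a] seX)
  have ae_le: "\<exists>C\<ge>0. \<forall>\<alpha> \<beta> e. 0 < e \<longrightarrow> e \<le> 1 \<longrightarrow> ?N s (ae e \<alpha> \<beta>) \<le> C * e" if s: "K \<le> s" for s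
  proof -
    have ex: "\<exists>C\<ge>0. \<forall>e. 0 < e \<longrightarrow> e \<le> 1 \<longrightarrow> ?N s (ae e (fst \<gamma>\<delta>) (snd \<gamma>\<delta>)) \<le> C * e" for \<gamma>\<delta>
    proof -
      obtain C where C: "C \<ge> 0" "\<And>(U :: 'm \<Rightarrow> real^'m \<Rightarrow> real) V.
        (\<forall>p. smooth_periodic (U p) \<and> smooth_periodic (V p) \<and> ?N s (U p) \<le> Nx s \<and> ?N s (V p) \<le> Nx s) \<Longrightarrow>
        ?N s (\<lambda>x. a (fst \<gamma>\<delta>) (snd \<gamma>\<delta>) (\<chi> p. U p x) - a (fst \<gamma>\<delta>) (snd \<gamma>\<delta>) (\<chi> p. V p x)) \<le> C * (\<Sum>p\<in>UNIV. ?N s (\<lambda>x. U p x - V p x))"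
        using comp_lipschitz[OF a, of s "Nx s"] s unfolding K_def by blast
      show ?thesis
      proof (intro exI[of _ "C * Nx s"] conjI allI impI)
        show "C * Nx s \<ge> 0" using C(1) Nx0 by simp
        fix e :: real assume e: "0 < e" "e \<le> 1"
        have z: "(\<chi> p. 0) = (0 :: real^'m)" by (simp add: vec_eq_iff)
        have n: "?N s (\<lambda>x. e * X p x) = e * ?N s (X p)" for p using e by (simp add: wiener.nrm_cmult X)
        have "?N s (\<lambda>x. a (fst \<gamma>\<delta>) (snd \<gamma>\<delta>) (\<chi> p. e * X p x) - a (fst \<gamma>\<delta>) (snd \<gamma>\<delta>) (\<chi> p. 0)) \<le> C * (\<Sum>p\<in>UNIV. ?N s (\<lambda>x. e * X p x - 0))"
        proof (intro C(2) allI conjI seX sp_const)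
          show "?N s (\<lambda>x. e * X p x) \<le> Nx s" for p
            unfolding n using mult_right_mono[OF e(2) wiener.nrm_nonneg[OF X]] Nx_le[of s p] by (smt (verit))
          show "?N s (\<lambda>_. 0) \<le> Nx s" by (simp add: wiener.nrm_zero Nx0)
        qed
        then show "?N s (ae e (fst \<gamma>\<delta>) (snd \<gamma>\<delta>)) \<le> C * Nx s * e"
          unfolding z by (simp add: ae_def n Nx_def sum_distrib_left mult_ac)
      qed
    qed
    obtain C where C: "C \<ge> 0" "\<And>\<gamma>\<delta>. \<forall>e. 0 < e \<longrightarrow> e \<le> 1 \<longrightarrow> ?N s (ae e (fst \<gamma>\<delta>) (snd \<gamma>\<delta>)) \<le> C * e"
    proof (rule finite_uniform_bound[where P="\<lambda>\<gamma>\<delta> C. \<forall>e. 0 < e \<longrightarrow> e \<le> 1 \<longrightarrow> ?N s (ae e (fst \<gamma>\<delta>) (snd \<gamma>\<delta>)) \<le> C * e"])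
      show "\<exists>C\<ge>0. \<forall>e. 0 < e \<longrightarrow> e \<le> 1 \<longrightarrow> ?N s (ae e (fst \<gamma>\<delta>) (snd \<gamma>\<delta>)) \<le> C * e" for \<gamma>\<delta> by (rule ex)
      show "\<forall>e. 0 < e \<longrightarrow> e \<le> 1 \<longrightarrow> ?N s (ae e (fst \<gamma>\<delta>) (snd \<gamma>\<delta>)) \<le> D * e"
        if "\<forall>e. 0 < e \<longrightarrow> e \<le> 1 \<longrightarrow> ?N s (ae e (fst \<gamma>\<delta>) (snd \<gamma>\<delta>)) \<le> C * e" "C \<le> D" for \<gamma>\<delta> C D
        using that by (meson less_imp_le mult_right_mono order_trans)
    qed blast
    show ?thesis
    proof (intro exI[of _ C] conjI allI impI C(1))
      fix \<alpha> \<beta> and e :: real assume "0 < e" "e \<le> 1"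
      then show "?N s (ae e \<alpha> \<beta>) \<le> C * e" using C(2)[of "(\<alpha>, \<beta>)"] by simp
    qed
  qed
  define HU where "HU = (\<lambda>e f i x. H i (\<chi> p. U e f p x))"
  have sHU: "smooth_periodic (HU e f i)" if f: "\<And>i. smooth_periodic (f i)" for e f i
    unfolding HU_def by (intro sp_compose[OF H] sU f)
  have HU_le: "\<exists>C\<ge>0. \<forall>e f i. 0 < e \<longrightarrow> e \<le> 1 \<longrightarrow> (\<forall>j. smooth_periodic (f j)) \<longrightarrow> vnrm s f \<le> B \<longrightarrow> ?N (Suc s) (HU e f i) \<le> C"
    if s: "K \<le> Suc s" for s B
  proof -
    let ?B = "R s + Q s * B"
    have ex: "\<exists>C\<ge>0. \<forall>e f. 0 < e \<longrightarrow> e \<le> 1 \<longrightarrow> (\<forall>j. smooth_periodic (f j)) \<longrightarrow> vnrm s f \<le> B \<longrightarrow> ?N (Suc s) (HU e f i) \<le> C" for i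
    proof -
      obtain C where C: "C \<ge> 0" "\<And>U :: 'm + ('n + 'n \<times> 'm) \<Rightarrow> real^'m \<Rightarrow> real.
        (\<forall>p. smooth_periodic (U p) \<and> ?N (Suc s) (U p) \<le> ?B) \<Longrightarrow> ?N (Suc s) (\<lambda>x. H i (\<chi> p. U p x)) \<le> C"
        using comp_bound[OF H, of "Suc s" ?B] s unfolding K_def by blast
      show ?thesis
      proof (intro exI[of _ C] conjI allI impI C(1))
        fix e :: real and f :: "'n \<Rightarrow> real^'m \<Rightarrow> real" assume e: "0 < e" "e \<le> 1" and f: "\<forall>j. smooth_periodic (f j)" and b: "vnrm s f \<le> B"
        show "?N (Suc s) (HU e f i) \<le> C"
          unfolding HU_def
        proof (intro C(2) allI conjI sU)
          show "smooth_periodic (f i)" for i using f by simp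
          show "?N (Suc s) (U e f p) \<le> ?B" for p
            using U_le[of f e s p] f e mult_left_mono[OF b Q0[of s]] by simp
        qed
      qed
    qed
    obtain C where C: "C \<ge> 0" "\<And>i. \<forall>e f. 0 < e \<longrightarrow> e \<le> 1 \<longrightarrow> (\<forall>j. smooth_periodic (f j)) \<longrightarrow> vnrm s f \<le> B \<longrightarrow> ?N (Suc s) (HU e f i) \<le> C"
      by (rule finite_uniform_bound[where P="\<lambda>i C. \<forall>e f. 0 < e \<longrightarrow> e \<le> 1 \<longrightarrow> (\<forall>j. smooth_periodic (f j)) \<longrightarrow> vnrm s f \<le> B \<longrightarrow> ?N (Suc s) (HU e f i) \<le> C"])
        (use ex in \<open>blast intro: order_trans\<close>)+
    then show ?thesis by blast
  qed
  have HU_lip: "\<exists>C\<ge>0. \<forall>i e f g. 0 < e \<longrightarrow> e \<le> 1 \<longrightarrow> (\<forall>j. smooth_periodic (f j)) \<longrightarrow> (\<forall>j. smooth_periodic (g j)) \<longrightarrow>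
      vnrm K f \<le> 1 \<longrightarrow> vnrm K g \<le> 1 \<longrightarrow> ?N K (\<lambda>x. HU e f i x - HU e g i x) \<le> C * vnrm K (\<lambda>i x. f i x - g i x)"
  proof -
    let ?B = "R (K - 1) + Q (K - 1) * 1" and ?P = "CARD('m + ('n + 'n \<times> 'm)) * Q (K - 1)"
    have down: "vnrm (K - 1) f \<le> vnrm K f" if "\<And>j. smooth_periodic (f j)" for f :: "'n \<Rightarrow> real^'m \<Rightarrow> real"
      by (intro sum_mono wiener.nrm_mono that) simp
    have ex: "\<exists>C\<ge>0. \<forall>e f g. 0 < e \<longrightarrow> e \<le> 1 \<longrightarrow> (\<forall>j. smooth_periodic (f j)) \<longrightarrow> (\<forall>j. smooth_periodic (g j)) \<longrightarrow>
      vnrm K f \<le> 1 \<longrightarrow> vnrm K g \<le> 1 \<longrightarrow> ?N K (\<lambda>x. HU e f i x - HU e g i x) \<le> C * vnrm K (\<lambda>i x. f i x - g i x)" for i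
    proof -
      obtain C where C: "C \<ge> 0" "\<And>(U :: 'm + ('n + 'n \<times> 'm) \<Rightarrow> real^'m \<Rightarrow> real) V.
        (\<forall>p. smooth_periodic (U p) \<and> smooth_periodic (V p) \<and> ?N K (U p) \<le> ?B \<and> ?N K (V p) \<le> ?B) \<Longrightarrow>
        ?N K (\<lambda>x. H i (\<chi> p. U p x) - H i (\<chi> p. V p x)) \<le> C * (\<Sum>p\<in>UNIV. ?N K (\<lambda>x. U p x - V p x))"
        using comp_lipschitz[OF H, of K ?B i] unfolding K_def by blast
      show ?thesis
      proof (intro exI[of _ "C * ?P"] conjI allI impI)
        show "C * ?P \<ge> 0" using C(1) Q0 by simp
        fix e :: real and f g :: "'n \<Rightarrow> real^'m \<Rightarrow> real" assume e: "0 < e" "e \<le> 1" and f: "\<forall>j. smooth_periodic (f j)" and g: "\<forall>j. smooth_periodic (g j)"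
          and b: "vnrm K f \<le> 1" "vnrm K g \<le> 1"
        have f': "smooth_periodic (f j)" and g': "smooth_periodic (g j)" for j using f g by auto
        have bnd: "?N K (U e h p) \<le> ?B" if h: "\<And>j. smooth_periodic (h j)" "vnrm K h \<le> 1" for h p
        proof -
          have "vnrm (K - 1) h \<le> 1" using down[of h, OF h(1)] h(2) by linarith
          from mult_left_mono[OF this Q0[of "K - 1"]] show ?thesis
            using U_le[of h e "K - 1" p, OF h(1) e] unfolding K(1)[symmetric] by linarith
        qed
        have "?N K (\<lambda>x. HU e f i x - HU e g i x) \<le> C * (\<Sum>p\<in>UNIV. ?N K (\<lambda>x. U e f p x - U e g p x))"
          unfolding HU_def by (intro C(2) allI conjI sU f' g' bnd b)
        also have "\<dots> \<le> C * (\<Sum>p\<in>(UNIV::('m + ('n + 'n \<times> 'm)) set). Q (K - 1) * vnrm K (\<lambda>i x. f i x - g i x))"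
        proof (intro mult_left_mono sum_mono C(1))
          fix p
          have "?N K (\<lambda>x. U e f p x - U e g p x) \<le> Q (K - 1) * vnrm (K - 1) (\<lambda>i x. f i x - g i x)"
            using U_diff[of f g e "K - 1" p, OF f' g' e] unfolding K(1)[symmetric] .
          also have "\<dots> \<le> Q (K - 1) * vnrm K (\<lambda>i x. f i x - g i x)"
            by (intro mult_left_mono down sp_diff f' g' Q0)
          finally show "?N K (\<lambda>x. U e f p x - U e g p x) \<le> Q (K - 1) * vnrm K (\<lambda>i x. f i x - g i x)" .
        qed
        finally show "?N K (\<lambda>x. HU e f i x - HU e g i x) \<le> C * ?P * vnrm K (\<lambda>i x. f i x - g i x)"
          by (simp only: sum_constant mult_ac)
      qed
    qed
    obtain C where C: "C \<ge> 0" "\<And>i. \<forall>e f g. 0 < e \<longrightarrow> e \<le> 1 \<longrightarrow> (\<forall>j. smooth_periodic (f j)) \<longrightarrow> (\<forall>j. smooth_periodic (g j)) \<longrightarrow>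
      vnrm K f \<le> 1 \<longrightarrow> vnrm K g \<le> 1 \<longrightarrow> ?N K (\<lambda>x. HU e f i x - HU e g i x) \<le> C * vnrm K (\<lambda>i x. f i x - g i x)"
    proof (rule finite_uniform_bound[where P="\<lambda>i C. \<forall>e f g. 0 < e \<longrightarrow> e \<le> 1 \<longrightarrow> (\<forall>j. smooth_periodic (f j)) \<longrightarrow> (\<forall>j. smooth_periodic (g j)) \<longrightarrow>
      vnrm K f \<le> 1 \<longrightarrow> vnrm K g \<le> 1 \<longrightarrow> ?N K (\<lambda>x. HU e f i x - HU e g i x) \<le> C * vnrm K (\<lambda>i x. f i x - g i x)"])
      show "\<exists>C\<ge>0. \<forall>e f g. 0 < e \<longrightarrow> e \<le> 1 \<longrightarrow> (\<forall>j. smooth_periodic (f j)) \<longrightarrow> (\<forall>j. smooth_periodic (g j)) \<longrightarrow>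
      vnrm K f \<le> 1 \<longrightarrow> vnrm K g \<le> 1 \<longrightarrow> ?N K (\<lambda>x. HU e f i x - HU e g i x) \<le> C * vnrm K (\<lambda>i x. f i x - g i x)" for i by (rule ex)
    next
      fix i C D assume 2: "\<forall>e f g. 0 < e \<longrightarrow> e \<le> 1 \<longrightarrow> (\<forall>j. smooth_periodic (f j)) \<longrightarrow> (\<forall>j. smooth_periodic (g j)) \<longrightarrow>
      vnrm K f \<le> 1 \<longrightarrow> vnrm K g \<le> 1 \<longrightarrow> ?N K (\<lambda>x. HU e f i x - HU e g i x) \<le> C * vnrm K (\<lambda>i x. f i x - g i x)" and CD: "C \<le> D"
      show "\<forall>e f g. 0 < e \<longrightarrow> e \<le> 1 \<longrightarrow> (\<forall>j. smooth_periodic (f j)) \<longrightarrow> (\<forall>j. smooth_periodic (g j)) \<longrightarrow>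
      vnrm K f \<le> 1 \<longrightarrow> vnrm K g \<le> 1 \<longrightarrow> ?N K (\<lambda>x. HU e f i x - HU e g i x) \<le> D * vnrm K (\<lambda>i x. f i x - g i x)"
      proof (intro allI impI)
        fix e :: real and f g :: "'n \<Rightarrow> real^'m \<Rightarrow> real" assume h: "0 < e" "e \<le> 1" "\<forall>j. smooth_periodic (f j)" "\<forall>j. smooth_periodic (g j)" "vnrm K f \<le> 1" "vnrm K g \<le> 1"
        have "C * vnrm K (\<lambda>i x. f i x - g i x) \<le> D * vnrm K (\<lambda>i x. f i x - g i x)"
          using h by (intro mult_right_mono CD v0 sp_diff) auto
        then show "?N K (\<lambda>x. HU e f i x - HU e g i x) \<le> D * vnrm K (\<lambda>i x. f i x - g i x)"
          using 2[rule_format, of e f g] h by (meson order_trans)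
      qed
    qed blast
    then show ?thesis by blast
  qed
  obtain Ca where Ca: "Ca \<ge> 0" "\<And>\<alpha> \<beta> e. 0 < e \<Longrightarrow> e \<le> 1 \<Longrightarrow> ?N K (ae e \<alpha> \<beta>) \<le> Ca * e" using ae_le[of K] by blast
  obtain C0 where C0: "C0 \<ge> 0" "\<And>e f i. 0 < e \<Longrightarrow> e \<le> 1 \<Longrightarrow> (\<forall>j. smooth_periodic (f j)) \<Longrightarrow> vnrm (K - 1) f \<le> 1 \<Longrightarrow> ?N K (HU e f i) \<le> C0"
    using HU_le[OF K(2), of 1] unfolding K(1)[symmetric] by blast
  obtain C1 where C1: "C1 \<ge> 0" "\<And>i e f g. 0 < e \<Longrightarrow> e \<le> 1 \<Longrightarrow> (\<forall>j. smooth_periodic (f j)) \<Longrightarrow> (\<forall>j. smooth_periodic (g j)) \<Longrightarrow>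
      vnrm K f \<le> 1 \<Longrightarrow> vnrm K g \<le> 1 \<Longrightarrow> ?N K (\<lambda>x. HU e f i x - HU e g i x) \<le> C1 * vnrm K (\<lambda>i x. f i x - g i x)"
    using HU_lip by blast
  define m2 where "m2 = real (CARD('m) * CARD('m))"
  define n1 where "n1 = real CARD('n)"
  define LK where "LK = L + G K"
  have LK0: "LK \<ge> 0" unfolding LK_def using L0 G0 by simp
  have T2': "?N s (?pp \<alpha> \<beta> (T h)) \<le> (L + G s) * ?N s h" if h: "smooth_periodic h" for h s \<alpha> \<beta>
    using T2[OF h, of s \<alpha> \<beta>] mult_left_mono[OF wiener.nrm_mono[OF h, of 0 s] G0[of s]] by (simp add: distrib_right)
  \<comment> \<open>\<open>t1\<close> and \<open>t2\<close> measure the second-order part and the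
    nonlinear part of the fixed point map, \<open>t3\<close> the Lipschitz constant of the latter,
    and \<open>t4\<close> the second-order part at top order, where only \<open>Ca\<close> and
    \<open>L\<close> enter, the same for all orders. With \<open>e = 1 / (1 + D)\<close>, each
    combination needed below is at most \<open>1/2\<close> after multiplication by
    \<open>e\<close>.\<close>
  define t1 where "t1 = m2 * Ca * LK"
  define t2 where "t2 = n1 * C0"
  define t3 where "t3 = n1 * C1"
  define t4 where "t4 = m2 * Ca * L"
  define D where "D = 2 * (t1 + t2 + t3) + 2 * (t4)"
  have parts: "0 \<le> t1" "0 \<le> t2" "0 \<le> t3" "0 \<le> t4"
    using Ca(1) LK0 C0(1) C1(1) L0 by (simp_all add: t1_def t2_def t3_def t4_def m2_def n1_def)
  define e where "e = 1 / (1 + D)"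
  have D0: "D \<ge> 0" unfolding D_def by (intro add_nonneg_nonneg mult_nonneg_nonneg parts zero_le_numeral)
  have e: "0 < e" "e \<le> 1" unfolding e_def using D0 by auto
  have eD: "e * t \<le> 1/2" if "2 * t \<le> D" for t
    using that D0 unfolding e_def by (simp add: field_simps)
  \<comment> \<open>Second derivatives in \<open>x\<close> are \<open>1 / e\<close> times those in
    \<open>z\<close>, so after multiplication by \<open>e\<close> the equation reads
    \<open>a(e z) D^2 w + e H = 0\<close>. Splitting off \<open>a(0)\<close>, for which
    \<open>a(0) D^2 (T f) = f\<close> near the origin, isolates \<open>f\<close>.\<close>
  define \<Phi> where "\<Phi> = (\<lambda>f i x. - (\<Sum>\<alpha>\<in>UNIV. \<Sum>\<beta>\<in>UNIV. ae e \<alpha> \<beta> x * ?pp \<alpha> \<beta> (T (f i)) x) - e * HU e f i x)"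
  have spp: "smooth_periodic (\<lambda>x. \<Sum>\<alpha>\<in>UNIV. \<Sum>\<beta>\<in>UNIV. ae e \<alpha> \<beta> x * ?pp \<alpha> \<beta> (T h) x)" if "smooth_periodic h" for h
    by (intro sp_sum sp_mult sae sp_partial T that)
  have main_le: "?N K (\<lambda>x. \<Sum>\<alpha>\<in>UNIV. \<Sum>\<beta>\<in>UNIV. ae e \<alpha> \<beta> x * ?pp \<alpha> \<beta> (T h) x) \<le> e * (t1) * ?N K h"
    if h: "smooth_periodic h" for h
  proof -
    have "?N K (\<lambda>x. ae e \<alpha> \<beta> x * ?pp \<alpha> \<beta> (T h) x) \<le> (Ca * e) * (LK * ?N K h)" for \<alpha> \<beta>
    proof -
      have "?N K (\<lambda>x. ae e \<alpha> \<beta> x * ?pp \<alpha> \<beta> (T h) x) \<le> ?N K (ae e \<alpha> \<beta>) * ?N K (?pp \<alpha> \<beta> (T h))"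
        by (intro wiener.nrm_mult sae sp_partial T h)
      also have "\<dots> \<le> (Ca * e) * (LK * ?N K h)"
        unfolding LK_def using Ca(1) e by (intro mult_mono Ca(2) T2' h wiener.nrm_nonneg sp_partial T) auto
      finally show ?thesis .
    qed
    then have "?N K (\<lambda>x. \<Sum>\<alpha>\<in>UNIV. \<Sum>\<beta>\<in>UNIV. ae e \<alpha> \<beta> x * ?pp \<alpha> \<beta> (T h) x) \<le> CARD('m) * CARD('m) * ((Ca * e) * (LK * ?N K h))"
      by (intro wiener.nrm_sum2_le sp_mult sae sp_partial T h)
    then show ?thesis by (simp add: t1_def m2_def mult_ac)
  qed
  obtain f where f: "\<And>i. smooth_periodic (f i)" and fix_eq: "\<And>i x. \<Phi> f i x = f i x"
  proof (rule smooth_fixed_point[where \<Phi>=\<Phi> and K=K])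
    show "smooth_periodic (\<Phi> f i)" if f: "\<And>i. smooth_periodic (f i)" for f i
      unfolding \<Phi>_def by (intro sp_diff sp_minus spp sp_mult sp_const sHU f)
  next
    fix f :: "'n \<Rightarrow> real^'m \<Rightarrow> real"
    assume f: "\<And>i. smooth_periodic (f i)" and b: "vnrm K f \<le> 1"
    have b': "vnrm (K - 1) f \<le> 1"
      by (rule order_trans[OF _ b]) (intro sum_mono wiener.nrm_mono f, simp)
    have "?N K (\<Phi> f i) \<le> e * (t1) * ?N K (f i) + e * C0" for i
    proof -
      have "?N K (\<Phi> f i) \<le> ?N K (\<lambda>x. - (\<Sum>\<alpha>\<in>UNIV. \<Sum>\<beta>\<in>UNIV. ae e \<alpha> \<beta> x * ?pp \<alpha> \<beta> (T (f i)) x)) + ?N K (\<lambda>x. e * HU e f i x)"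
        unfolding \<Phi>_def by (intro wiener.nrm_diff sp_minus spp sp_mult sp_const sHU f)
      also have "?N K (\<lambda>x. - (\<Sum>\<alpha>\<in>UNIV. \<Sum>\<beta>\<in>UNIV. ae e \<alpha> \<beta> x * ?pp \<alpha> \<beta> (T (f i)) x)) = ?N K (\<lambda>x. \<Sum>\<alpha>\<in>UNIV. \<Sum>\<beta>\<in>UNIV. ae e \<alpha> \<beta> x * ?pp \<alpha> \<beta> (T (f i)) x)"
        using wiener.nrm_cmult[OF spp[OF f], of K "-1" i] by simp
      also have "?N K (\<lambda>x. e * HU e f i x) = e * ?N K (HU e f i)" using e by (simp add: wiener.nrm_cmult sHU f)
      also have "?N K (\<lambda>x. \<Sum>\<alpha>\<in>UNIV. \<Sum>\<beta>\<in>UNIV. ae e \<alpha> \<beta> x * ?pp \<alpha> \<beta> (T (f i)) x) + e * ?N K (HU e f i)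
          \<le> e * t1 * ?N K (f i) + e * C0"
        using f b' e by (intro add_mono main_le mult_left_mono C0(2)) auto
      finally show ?thesis .
    qed
    then have "vnrm K (\<Phi> f) \<le> (\<Sum>i\<in>UNIV. e * (t1) * ?N K (f i) + e * C0)" by (intro sum_mono)
    also have "\<dots> = e * (t1) * vnrm K f + e * (t2)" by (simp add: t2_def n1_def sum.distrib sum_distrib_left)
    also have "e * (t1) * vnrm K f \<le> e * (t1) * 1"
      using e parts by (intro mult_left_mono b mult_nonneg_nonneg) auto
    finally have "vnrm K (\<Phi> f) \<le> e * (t1 + t2)" by (simp only: distrib_left mult_1_right)
    also have "\<dots> \<le> 1/2" using parts unfolding D_def[symmetric] by (intro eD) (simp add: D_def)
    finally show "vnrm K (\<Phi> f) \<le> 1" by simp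
  next
    fix f g :: "'n \<Rightarrow> real^'m \<Rightarrow> real"
    assume f: "\<And>i. smooth_periodic (f i)" and g: "\<And>i. smooth_periodic (g i)" and b: "vnrm K f \<le> 1" "vnrm K g \<le> 1"
    let ?d = "\<lambda>i x. f i x - g i x"
    have d: "smooth_periodic (?d i)" for i by (intro sp_diff f g)
    have "?N K (\<lambda>x. \<Phi> f i x - \<Phi> g i x) \<le> e * (t1) * ?N K (?d i) + e * (C1 * vnrm K ?d)" for i
    proof -
      have eq: "\<Phi> f i x - \<Phi> g i x = - (\<Sum>\<alpha>\<in>UNIV. \<Sum>\<beta>\<in>UNIV. ae e \<alpha> \<beta> x * ?pp \<alpha> \<beta> (T (?d i)) x) - e * (HU e f i x - HU e g i x)" for x
        unfolding \<Phi>_def ppT_diff[OF f g] by (simp add: sum_subtractf algebra_simps)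
      have "?N K (\<lambda>x. \<Phi> f i x - \<Phi> g i x) \<le> ?N K (\<lambda>x. - (\<Sum>\<alpha>\<in>UNIV. \<Sum>\<beta>\<in>UNIV. ae e \<alpha> \<beta> x * ?pp \<alpha> \<beta> (T (?d i)) x)) + ?N K (\<lambda>x. e * (HU e f i x - HU e g i x))"
        unfolding eq by (intro wiener.nrm_diff sp_minus spp sp_mult sp_const sp_diff sHU f g)
      also have "?N K (\<lambda>x. - (\<Sum>\<alpha>\<in>UNIV. \<Sum>\<beta>\<in>UNIV. ae e \<alpha> \<beta> x * ?pp \<alpha> \<beta> (T (?d i)) x)) = ?N K (\<lambda>x. \<Sum>\<alpha>\<in>UNIV. \<Sum>\<beta>\<in>UNIV. ae e \<alpha> \<beta> x * ?pp \<alpha> \<beta> (T (?d i)) x)"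
        using wiener.nrm_cmult[OF spp[OF d], of K "-1" i] by simp
      also have "?N K (\<lambda>x. e * (HU e f i x - HU e g i x)) = e * ?N K (\<lambda>x. HU e f i x - HU e g i x)"
        using e by (simp add: wiener.nrm_cmult sHU f g sp_diff)
      also have "?N K (\<lambda>x. \<Sum>\<alpha>\<in>UNIV. \<Sum>\<beta>\<in>UNIV. ae e \<alpha> \<beta> x * ?pp \<alpha> \<beta> (T (?d i)) x) + e * ?N K (\<lambda>x. HU e f i x - HU e g i x)
          \<le> e * t1 * ?N K (?d i) + e * (C1 * vnrm K ?d)"
        using f g b e by (intro add_mono main_le d mult_left_mono C1(2)) auto
      finally show ?thesis .
    qed
    then have "vnrm K (\<lambda>i x. \<Phi> f i x - \<Phi> g i x) \<le> (\<Sum>i\<in>UNIV. e * (t1) * ?N K (?d i) + e * (C1 * vnrm K ?d))" by (intro sum_mono)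
    also have "\<dots> = e * (t1 + t3) * vnrm K ?d" by (simp add: t3_def n1_def sum.distrib sum_distrib_left[symmetric] algebra_simps)
    also have "\<dots> \<le> 1/2 * vnrm K ?d"
      using parts by (intro mult_right_mono eD v0 d) (simp add: D_def)
    finally show "vnrm K (\<lambda>i x. \<Phi> f i x - \<Phi> g i x) \<le> 1/2 * vnrm K (\<lambda>i x. f i x - g i x)" .
  next
    fix s B assume s: "K \<le> s"
    obtain Cs where Cs: "Cs \<ge> 0" "\<And>\<alpha> \<beta> e. 0 < e \<Longrightarrow> e \<le> 1 \<Longrightarrow> ?N (Suc s) (ae e \<alpha> \<beta>) \<le> Cs * e"
      using ae_le[of "Suc s"] s by auto
    obtain Ch where Ch: "Ch \<ge> 0" "\<And>e f i. 0 < e \<Longrightarrow> e \<le> 1 \<Longrightarrow> (\<forall>j. smooth_periodic (f j)) \<Longrightarrow> vnrm s f \<le> B \<Longrightarrow> ?N (Suc s) (HU e f i) \<le> Ch"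
      using HU_le[of s B] s by auto
    obtain Ct where Ct: "Ct \<ge> 0" "\<And>f g :: real^'m \<Rightarrow> real. smooth_periodic f \<Longrightarrow> smooth_periodic g \<Longrightarrow>
       ?N (Suc s) (\<lambda>x. f x * g x) \<le> wiener f * ?N (Suc s) g + Ct * ?N (Suc s) f * ?N s g"
      using wiener.nrm_mult_tame[of s] by auto
    \<comment> \<open>Collects what the norm of order \<open>s\<close> already bounds: the
      lower-order part of the estimate for \<open>T\<close> and the terms with high norms of the
      coefficients.\<close>
    define E where "E = Ca * (G (Suc s) * \<bar>B\<bar>) + Ct * Cs * ((L + G s) * \<bar>B\<bar>)"
    have "vnrm (Suc s) (\<Phi> f) \<le> 1/2 * vnrm (Suc s) f + n1 * (m2 * E + Ch)"
      if f: "\<forall>i. smooth_periodic (f i)" and b: "vnrm s f \<le> B" for f :: "'n \<Rightarrow> real^'m \<Rightarrow> real"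
    proof -
      have f': "smooth_periodic (f i)" for i using f by simp
      have "?N (Suc s) (\<Phi> f i) \<le> e * (t4) * ?N (Suc s) (f i) + (m2 * E + Ch)" for i
      proof -
        have fB: "?N s (f i) \<le> \<bar>B\<bar>" using vle[of f s i, OF f'] b by linarith
        have wB: "wiener (f i) \<le> \<bar>B\<bar>" using wiener.nrm_mono[OF f', of 0 s i] fB by simp
        have each: "?N (Suc s) (\<lambda>x. ae e \<alpha> \<beta> x * ?pp \<alpha> \<beta> (T (f i)) x) \<le> (Ca * e) * (L * ?N (Suc s) (f i)) + E" for \<alpha> \<beta>
        proof -
          have sp1: "smooth_periodic (?pp \<alpha> \<beta> (T (f i)))" by (intro sp_partial T f')
          \<comment> \<open>The tame product puts \<open>wiener (ae e \<alpha> \<beta>)\<close>, at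
            most \<open>Ca * e\<close>, in front of the top order; the constant \<open>Cs\<close>
            depends on \<open>s\<close> but meets only the norm of order \<open>s\<close>. This is
            why \<open>e\<close> can be fixed before \<open>s\<close>.\<close>
          have "?N (Suc s) (\<lambda>x. ae e \<alpha> \<beta> x * ?pp \<alpha> \<beta> (T (f i)) x)
            \<le> wiener (ae e \<alpha> \<beta>) * ?N (Suc s) (?pp \<alpha> \<beta> (T (f i))) + Ct * ?N (Suc s) (ae e \<alpha> \<beta>) * ?N s (?pp \<alpha> \<beta> (T (f i)))"
            by (rule Ct(2)[OF sae sp1])
          also have "wiener (ae e \<alpha> \<beta>) * ?N (Suc s) (?pp \<alpha> \<beta> (T (f i))) \<le> (Ca * e) * (L * ?N (Suc s) (f i) + G (Suc s) * \<bar>B\<bar>)"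
          proof (intro mult_mono)
            show "wiener (ae e \<alpha> \<beta>) \<le> Ca * e" using wiener.nrm_mono[OF sae, of 0 K e \<alpha> \<beta>] Ca(2)[OF e, of \<alpha> \<beta>] by simp
            show "?N (Suc s) (?pp \<alpha> \<beta> (T (f i))) \<le> L * ?N (Suc s) (f i) + G (Suc s) * \<bar>B\<bar>"
              using T2[OF f', of "Suc s" \<alpha> \<beta> i] mult_left_mono[OF wB G0[of "Suc s"]] by linarith
          qed (use Ca(1) e in \<open>auto intro!: wiener.nrm_nonneg sp1 simp del: nrm.simps\<close>)
          also have "Ct * ?N (Suc s) (ae e \<alpha> \<beta>) * ?N s (?pp \<alpha> \<beta> (T (f i))) \<le> Ct * Cs * ((L + G s) * \<bar>B\<bar>)"
          proof (intro mult_mono)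
            show "?N (Suc s) (ae e \<alpha> \<beta>) \<le> Cs" using Cs(2)[OF e, of \<alpha> \<beta>] mult_left_mono[OF e(2) Cs(1)] by linarith
            show "?N s (?pp \<alpha> \<beta> (T (f i))) \<le> (L + G s) * \<bar>B\<bar>"
              using T2'[OF f', of s \<alpha> \<beta> i] mult_left_mono[OF fB, of "L + G s"] L0 G0[of s] by linarith
          qed (use Ct(1) Cs(1) in \<open>auto intro!: wiener.nrm_nonneg sp1 sae simp del: nrm.simps\<close>)
          also have "(Ca * e) * (L * ?N (Suc s) (f i) + G (Suc s) * \<bar>B\<bar>) \<le> (Ca * e) * (L * ?N (Suc s) (f i)) + Ca * (G (Suc s) * \<bar>B\<bar>)"
            unfolding distrib_left using mult_right_mono[OF mult_left_mono[OF e(2) Ca(1)], of "G (Suc s) * \<bar>B\<bar>"] G0[of "Suc s"] by simp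
          finally show ?thesis unfolding E_def by linarith
        qed
        have "?N (Suc s) (\<Phi> f i) \<le> ?N (Suc s) (\<lambda>x. - (\<Sum>\<alpha>\<in>UNIV. \<Sum>\<beta>\<in>UNIV. ae e \<alpha> \<beta> x * ?pp \<alpha> \<beta> (T (f i)) x)) + ?N (Suc s) (\<lambda>x. e * HU e f i x)"
          unfolding \<Phi>_def by (intro wiener.nrm_diff sp_minus spp sp_mult sp_const sHU f')
        also have "?N (Suc s) (\<lambda>x. - (\<Sum>\<alpha>\<in>UNIV. \<Sum>\<beta>\<in>UNIV. ae e \<alpha> \<beta> x * ?pp \<alpha> \<beta> (T (f i)) x)) = ?N (Suc s) (\<lambda>x. \<Sum>\<alpha>\<in>UNIV. \<Sum>\<beta>\<in>UNIV. ae e \<alpha> \<beta> x * ?pp \<alpha> \<beta> (T (f i)) x)"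
          using wiener.nrm_cmult[OF spp[OF f'], of "Suc s" "-1" i] by (simp del: nrm.simps)
        also have "\<dots> \<le> CARD('m) * CARD('m) * ((Ca * e) * (L * ?N (Suc s) (f i)) + E)"
          by (intro wiener.nrm_sum2_le sp_mult sae sp_partial T f' each)
        also have "?N (Suc s) (\<lambda>x. e * HU e f i x) = e * ?N (Suc s) (HU e f i)" using e by (simp add: wiener.nrm_cmult sHU f' del: nrm.simps)
        also have "e * ?N (Suc s) (HU e f i) \<le> 1 * Ch"
          using e by (intro mult_mono Ch(2) f b wiener.nrm_nonneg sHU f') auto
        finally show ?thesis by (simp add: t4_def m2_def algebra_simps)
      qed
      then have "vnrm (Suc s) (\<Phi> f) \<le> (\<Sum>i\<in>UNIV. e * (t4) * ?N (Suc s) (f i) + (m2 * E + Ch))" by (intro sum_mono)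
      also have "\<dots> = e * (t4) * vnrm (Suc s) f + n1 * (m2 * E + Ch)"
        by (simp add: n1_def sum.distrib sum_distrib_left[symmetric] algebra_simps)
      also have "e * (t4) * vnrm (Suc s) f \<le> 1/2 * vnrm (Suc s) f"
        using parts by (intro mult_right_mono eD v0 f') (simp add: D_def)
      finally show ?thesis by simp
    qed
    then show "\<exists>C. \<forall>f. (\<forall>i. smooth_periodic (f i)) \<longrightarrow> vnrm K f \<le> 1 \<longrightarrow> vnrm s f \<le> B \<longrightarrow> vnrm (Suc s) (\<Phi> f) \<le> 1/2 * vnrm (Suc s) f + C"
      by blast
  qed blast
  \<comment> \<open>The ansatz in \<open>z\<close> with the true coordinates in place of
    \<open>X\<close>: it need not be periodic, and the equation is claimed for it on a ball
    only.\<close>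
  define W where "W = (\<lambda>i x. (\<Sum>\<beta>\<in>UNIV. (A i \<beta> - partial_deriv \<beta> (T (f i)) 0) * x $ \<beta>) + (T (f i) x - T (f i) 0))"
  define F where "F = (\<lambda>i x. e * W i (inverse e *\<^sub>R x))"
  have sT: "smooth_on (T (f i)) UNIV" for i by (rule smooth_periodicD(1)[OF T[OF f]])
  have sW: "smooth_on (W i) UNIV" for i unfolding W_def by (intro smooth_intros open_UNIV sT)
  have pW: "partial_deriv \<alpha> (W i) = (\<lambda>x. A i \<alpha> + DL \<alpha> (f i) x)" for \<alpha> i
  proof -
    have "partial_deriv \<alpha> (W i) = (\<lambda>x. partial_deriv \<alpha> (\<lambda>x. \<Sum>\<beta>\<in>UNIV. (A i \<beta> - partial_deriv \<beta> (T (f i)) 0) * x $ \<beta>) x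
        + partial_deriv \<alpha> (\<lambda>x. T (f i) x - T (f i) 0) x)"
      unfolding W_def by (intro partial_add smooth_intros open_UNIV sT)
    moreover have "partial_deriv \<alpha> (\<lambda>x. T (f i) x - T (f i) 0) = (\<lambda>x. partial_deriv \<alpha> (T (f i)) x)"
      using partial_diff[OF sT[of i] smooth_on_const[OF open_UNIV], of \<alpha> "T (f i) 0"] by (simp add: partial_const)
    ultimately show ?thesis by (simp add: partial_linear DL_def fun_eq_iff)
  qed
  have ppW: "?pp \<alpha> \<beta> (W i) = ?pp \<alpha> \<beta> (T (f i))" for \<alpha> \<beta> i
  proof -
    have "partial_deriv \<beta> (W i) = (\<lambda>x. (A i \<beta> - partial_deriv \<beta> (T (f i)) 0) + partial_deriv \<beta> (T (f i)) x)"
      by (simp add: pW DL_def fun_eq_iff)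
    then show ?thesis
      using partial_add[OF smooth_on_const[OF open_UNIV] smooth_on_partial[OF sT[of i]], of \<alpha> _ \<beta>] by (simp add: partial_const)
  qed
  have sW': "smooth_on (\<lambda>x. W i (inverse e *\<^sub>R x)) UNIV" for i
    by (rule smooth_on_compose[OF open_UNIV open_UNIV subset_UNIV sW]) (intro smooth_intros open_UNIV)
  have sF: "smooth_on (F i) UNIV" for i unfolding F_def by (intro smooth_on_mult smooth_on_const open_UNIV sW')
  have pF: "partial_deriv \<alpha> (F i) = (\<lambda>x. partial_deriv \<alpha> (W i) (inverse e *\<^sub>R x))" for \<alpha> i
    unfolding F_def partial_cmult[OF sW'] partial_scale[OF sW] using e by (simp add: mult.assoc[symmetric])
  have ppF: "?pp \<alpha> \<beta> (F i) = (\<lambda>x. inverse e * ?pp \<alpha> \<beta> (T (f i)) (inverse e *\<^sub>R x))" for \<alpha> \<beta> i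
    unfolding pF partial_scale[OF smooth_on_partial[OF sW]] ppW ..
  show thesis
  proof (rule that[of "e * min \<delta>1 \<delta>2" F])
    show "e * min \<delta>1 \<delta>2 > 0" using e \<delta>1 \<delta>2 by simp
    show "smooth_on (F i) UNIV" for i by (rule sF)
    show "F i 0 = 0" for i by (simp add: F_def W_def)
    show "partial_deriv \<alpha> (F i) 0 = A i \<alpha>" for i \<alpha> by (simp add: pF pW DL_def)
    fix x :: "real^'m" and i :: 'n assume x: "x \<in> ball 0 (e * min \<delta>1 \<delta>2)"
    define z where "z = inverse e *\<^sub>R x"
    have "inverse e * norm x < inverse e * (e * min \<delta>1 \<delta>2)" using x e by (intro mult_strict_left_mono) auto
    also have "\<dots> = min \<delta>1 \<delta>2" using e by (simp add: mult.assoc[symmetric])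
    finally have "norm z < min \<delta>1 \<delta>2" using e by (simp add: z_def)
    then have zi: "\<bar>z $ j\<bar> < \<delta>1" "\<bar>z $ j\<bar> < \<delta>2" for j using component_le_norm_cart[of z j] by linarith+
    have "e *\<^sub>R z = x" using e by (simp add: z_def)
    then have xz: "x = (\<chi> \<gamma>. e * X \<gamma> z)" by (auto simp: \<delta>2(2)[OF zi(2)] vec_eq_iff)
    have Fz: "F j x = e * W j z" and pFz: "partial_deriv \<alpha> (F j) x = partial_deriv \<alpha> (W j) z" for j \<alpha>
      unfolding pF by (simp_all only: F_def z_def)
    have jet: "jet F x = (\<chi> p. U e f p z)"
      unfolding vec_eq_iff
    proof
      fix p
      show "jet F x $ p = (\<chi> p. U e f p z) $ p"
      proof (rule p_cases[of _ p])
        show "jet F x $ Inl \<alpha> = (\<chi> p. U e f p z) $ Inl \<alpha>" for \<alpha>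
          by (subst xz) (simp add: jet_def U_simps)
        show "jet F x $ Inr (Inl j) = (\<chi> p. U e f p z) $ Inr (Inl j)" for j
          by (simp add: jet_def U_simps Fz W_def TL_def \<delta>2(2)[OF zi(2)] sum_subtractf algebra_simps)
        show "jet F x $ Inr (Inr (j, \<alpha>)) = (\<chi> p. U e f p z) $ Inr (Inr (j, \<alpha>))" for j \<alpha>
          by (simp add: jet_def U_simps pFz pW)
      qed
    qed
    have ae: "ae e \<alpha> \<beta> z = a \<alpha> \<beta> x - a \<alpha> \<beta> 0" for \<alpha> \<beta> using xz by (simp add: ae_def)
    have "(\<Sum>\<alpha>\<in>UNIV. \<Sum>\<beta>\<in>UNIV. a \<alpha> \<beta> 0 * ?pp \<alpha> \<beta> (T (f i)) z) = f i z" by (rule T_eq[OF f zi(1)])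
    also have "\<dots> = - (\<Sum>\<alpha>\<in>UNIV. \<Sum>\<beta>\<in>UNIV. (a \<alpha> \<beta> x - a \<alpha> \<beta> 0) * ?pp \<alpha> \<beta> (T (f i)) z) - e * H i (jet F x)"
      using fix_eq[of i z] unfolding \<Phi>_def ae HU_def jet by simp
    finally have "(\<Sum>\<alpha>\<in>UNIV. \<Sum>\<beta>\<in>UNIV. a \<alpha> \<beta> x * ?pp \<alpha> \<beta> (T (f i)) z) = - e * H i (jet F x)"
      by (simp add: left_diff_distrib sum_subtractf)
    then have "inverse e * (\<Sum>\<alpha>\<in>UNIV. \<Sum>\<beta>\<in>UNIV. a \<alpha> \<beta> x * ?pp \<alpha> \<beta> (T (f i)) z) = - H i (jet F x)"
      using e by (simp add: mult.assoc[symmetric])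
    moreover have "inverse e * (\<Sum>\<alpha>\<in>UNIV. \<Sum>\<beta>\<in>UNIV. a \<alpha> \<beta> x * ?pp \<alpha> \<beta> (T (f i)) z)
        = (\<Sum>\<alpha>\<in>UNIV. \<Sum>\<beta>\<in>UNIV. a \<alpha> \<beta> x * ?pp \<alpha> \<beta> (F i) x)"
      unfolding ppF z_def[symmetric] by (simp add: sum_distrib_left mult_ac)
    ultimately show "(\<Sum>\<alpha>\<in>UNIV. \<Sum>\<beta>\<in>UNIV. a \<alpha> \<beta> x * ?pp \<alpha> \<beta> (F i) x) + H i (jet F x) = 0" by simp
  qed
qed

subsection \<open>Second derivatives and Christoffel symbols\<close>

abbreviation fd :: "('a::real_normed_vector \<Rightarrow> 'b::real_normed_vector) \<Rightarrow> 'a \<Rightarrow> 'a \<Rightarrow> 'b" where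
  "fd f x \<equiv> frechet_derivative f (at x)"

definition hess :: "('a::real_normed_vector \<Rightarrow> 'b::real_normed_vector) \<Rightarrow> 'a \<Rightarrow> 'a \<Rightarrow> 'a \<Rightarrow> 'b" where
  "hess f x u v = fd (\<lambda>y. fd f y v) x u"

lemma fd_eqI: "(f has_derivative f') (at x) \<Longrightarrow> fd f x = f'"
  by (rule frechet_derivative_at[symmetric])

lemma fd_cong:
  assumes "open S" "x \<in> S" "\<And>y. y \<in> S \<Longrightarrow> f y = g y"
  shows "fd f x u = fd g x u"
  using frechet_derivative_cong_open[of S x f g] assms by simp

lemma fd_linear:
  assumes "smooth_on f S" "open S" "x \<in> S"
  shows "linear (fd f x)"
  by (rule has_derivative_linear[OF smooth_on_deriv[OF assms]])

lemma fd_compose: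
  assumes f: "smooth_on f T" "open T" and g: "smooth_on g S" "open S" and x: "x \<in> S" "g x \<in> T"
  shows "fd (\<lambda>y. f (g y)) x v = fd f (g x) (fd g x v)"
  using fd_eqI[OF has_derivative_compose[OF smooth_on_deriv[OF g x(1)] smooth_on_deriv[OF f x(2)]]] by simp

lemma linear_axis_expand:
  fixes D :: "real^'m::finite \<Rightarrow> 'b::real_vector"
  assumes l: "linear D"
  shows "D v = (\<Sum>i\<in>UNIV. v $ i *\<^sub>R D (axis i 1))"
proof -
  have ax: "axis i t = t *\<^sub>R axis i 1" for i :: 'm and t :: real by (simp add: vec_eq_iff axis_def)
  have "D v = D (\<Sum>i\<in>UNIV. axis i (v $ i))" by (simp add: sum_axis_eq)
  also have "\<dots> = (\<Sum>i\<in>UNIV. v $ i *\<^sub>R D (axis i 1))"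
    unfolding linear_sum[OF l] by (intro sum.cong refl) (subst ax, simp add: linear_scale[OF l])
  finally show ?thesis .
qed

lemma fd_component:
  assumes "smooth_on f S" "open S" "x \<in> S"
  shows "fd f x v $ k = fd (\<lambda>y. f y $ k) x v"
  using fd_eqI[OF bounded_linear.has_derivative[OF bounded_linear_vec_nth smooth_on_deriv[OF assms]], of k] by simp

lemma partial_cong_open:
  "open S \<Longrightarrow> x \<in> S \<Longrightarrow> (\<And>y. y \<in> S \<Longrightarrow> f y = g y) \<Longrightarrow> partial_deriv i f x = partial_deriv i g x"
  unfolding partial_deriv_def using frechet_derivative_cong_open[of S x f g] by simp

lemma partial_shift:
  assumes "smooth_on g UNIV"
  shows "partial_deriv i (\<lambda>z. g (x + z)) z = partial_deriv i g (x + z)"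
proof -
  have "((\<lambda>z. x + z) has_derivative (\<lambda>v. v)) (at z)" by (auto intro!: derivative_eq_intros)
  from has_derivative_compose[OF this smooth_on_deriv[OF assms open_UNIV UNIV_I]]
  show ?thesis by (rule partial_deriv_eqI[THEN trans]) (simp add: partial_deriv_def)
qed

text \<open>Fourier coefficients make Schwarz's theorem evident for periodic functions.\<close>

lemma partial_commute:
  fixes f :: "real^'m::finite \<Rightarrow> real"
  assumes f: "smooth_on f S" "open S" "x \<in> S"
  shows "partial_deriv i (partial_deriv j f) x = partial_deriv j (partial_deriv i f) x"
proof -
  obtain g r where g: "smooth_on g UNIV" "r > 0" "\<And>y. y \<in> ball x r \<Longrightarrow> g y = f y"
    using smooth_extension[OF f(2,3,1)] by metis
  obtain X :: "'m \<Rightarrow> real^'m \<Rightarrow> real" and \<delta> :: real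
    where X: "\<And>i. smooth_periodic (X i)" "\<delta> > 0" "\<And>x i. \<bar>x $ i\<bar> < \<delta> \<Longrightarrow> X i x = x $ i"
    by (rule periodic_coordinates) (rule that; assumption)
  \<comment> \<open>A periodic function that agrees near 0 with \<open>f\<close> translated by
    \<open>x\<close>; second derivatives depend on this germ alone.\<close>
  define h where "h = (\<lambda>z. g (\<chi> p. x $ p + X p z))"
  have h: "smooth_periodic h" unfolding h_def by (intro sp_compose[OF g(1)] sp_add sp_const X(1))
  have hz: "h z = g (x + z)" if "z \<in> ball 0 \<delta>" for z
  proof -
    have "\<bar>z $ p\<bar> < \<delta>" for p using that component_le_norm_cart[of z p] by simp
    then have "(\<chi> p. x $ p + X p z) = x + z" by (simp add: vec_eq_iff X(3))
    then show ?thesis by (simp add: h_def)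
  qed
  have h2: "partial_deriv a (partial_deriv b h) 0 = partial_deriv a (partial_deriv b f) x" for a b
  proof -
    have 1: "partial_deriv b h z = partial_deriv b g (x + z)" if "z \<in> ball 0 \<delta>" for z
    proof -
      have "partial_deriv b h z = partial_deriv b (\<lambda>z. g (x + z)) z"
        by (rule partial_cong_open[OF open_ball that]) (rule hz)
      then show ?thesis by (simp add: partial_shift[OF g(1)])
    qed
    have "partial_deriv a (partial_deriv b h) 0 = partial_deriv a (\<lambda>z. partial_deriv b g (x + z)) 0"
      using X(2) 1 by (intro partial_cong_open[of "ball 0 \<delta>"]) auto
    also have "\<dots> = partial_deriv a (partial_deriv b g) x"
      using partial_shift[OF smooth_on_partial[OF g(1)], where x=x and z=0 and i=a] by simp
    also have "\<dots> = partial_deriv a (partial_deriv b f) x"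
    proof (rule partial_cong_open[of "ball x r"])
      show "partial_deriv b g y = partial_deriv b f y" if "y \<in> ball x r" for y
        by (rule partial_cong_open[OF open_ball that g(3)])
    qed (use g(2) in auto)
    finally show ?thesis .
  qed
  have "partial_deriv i (partial_deriv j h) = partial_deriv j (partial_deriv i h)"
    by (intro fourier_eqI sp_partial h) (simp add: fourier_partial sp_partial h)
  then show ?thesis using h2[of i j] h2[of j i] by simp
qed

lemma hess_expand:
  fixes f :: "real^'m::finite \<Rightarrow> real"
  assumes f: "smooth_on f S" "open S" "x \<in> S"
  shows "hess f x u v = (\<Sum>i\<in>UNIV. \<Sum>j\<in>UNIV. u $ i * v $ j * partial_deriv i (partial_deriv j f) x)"
proof -
  have s: "smooth_on (partial_deriv j f) S" for j by (rule smooth_on_partial[OF f(1)])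
  have "fd f y v = (\<Sum>j\<in>UNIV. v $ j * partial_deriv j f y)" if "y \<in> S" for y
    by (rule frechet_partial[OF smooth_on_deriv[OF f(1,2) that]])
  then have "hess f x u v = fd (\<lambda>y. \<Sum>j\<in>UNIV. v $ j * partial_deriv j f y) x u"
    unfolding hess_def by (intro fd_cong[OF f(2,3)])
  also have "\<dots> = (\<Sum>j\<in>UNIV. v $ j * fd (partial_deriv j f) x u)"
  proof -
    have "((\<lambda>y. \<Sum>j\<in>UNIV. v $ j * partial_deriv j f y) has_derivative
        (\<lambda>u. \<Sum>j\<in>UNIV. v $ j * fd (partial_deriv j f) x u)) (at x)"
      by (intro has_derivative_sum has_derivative_mult_right smooth_on_deriv[OF s f(2,3)])
    from fd_eqI[OF this] show ?thesis by simp
  qed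
  also have "\<dots> = (\<Sum>j\<in>UNIV. \<Sum>i\<in>UNIV. u $ i * v $ j * partial_deriv i (partial_deriv j f) x)"
    unfolding frechet_partial[OF smooth_on_deriv[OF s f(2,3)]] by (simp add: sum_distrib_left mult_ac)
  finally show ?thesis by (subst sum.swap)
qed

lemma hess_component:
  fixes f :: "real^'m::finite \<Rightarrow> real^'n::finite"
  assumes f: "smooth_on f S" "open S" "x \<in> S"
  shows "hess f x u v $ k = hess (\<lambda>y. f y $ k) x u v"
proof -
  have "hess f x u v $ k = fd (\<lambda>y. fd f y v $ k) x u"
    unfolding hess_def by (rule fd_component[OF smooth_on_frechet[OF f(1)] f(2,3)])
  also have "\<dots> = fd (\<lambda>y. fd (\<lambda>y. f y $ k) y v) x u"
    by (intro fd_cong[OF f(2,3)] fd_component[OF f(1,2)])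
  finally show ?thesis by (simp add: hess_def)
qed

lemma hess_expand_component:
  fixes f :: "real^'m::finite \<Rightarrow> real^'n::finite"
  assumes f: "smooth_on f S" "open S" "x \<in> S"
  shows "hess f x u v $ k = (\<Sum>i\<in>UNIV. \<Sum>j\<in>UNIV. u $ i * v $ j * partial_deriv i (partial_deriv j (\<lambda>y. f y $ k)) x)"
  unfolding hess_component[OF f] by (rule hess_expand[OF smooth_on_nth[OF f(2,1)] f(2,3)])

lemma hess_sym:
  fixes f :: "real^'m::finite \<Rightarrow> real^'n::finite"
  assumes f: "smooth_on f S" "open S" "x \<in> S"
  shows "hess f x u v = hess f x v u"
proof -
  have "hess f x u v $ k = hess f x v u $ k" for k
    unfolding hess_expand_component[OF f]
    by (subst sum.swap) (simp add: mult_ac partial_commute[OF smooth_on_nth[OF f(2,1)] f(2,3), of _ _ k])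
  then show ?thesis by (simp add: vec_eq_iff)
qed

text \<open>As in \<open>Ck_on_compose\<close>, the derivative of \<open>f\<close> in the moving
  direction \<open>Dg(y) v\<close> is expanded along the axes before it is differentiated
  again.\<close>

lemma hess_compose:
  fixes f :: "real^'n::finite \<Rightarrow> real^'k::finite" and g :: "real^'m::finite \<Rightarrow> real^'n"
  assumes f: "smooth_on f T" "open T" and g: "smooth_on g S" "open S" "g ` S \<subseteq> T" and x: "x \<in> S"
  shows "hess (\<lambda>y. f (g y)) x u v = hess f (g x) (fd g x u) (fd g x v) + fd f (g x) (hess g x u v)"
proof -
  let ?e = "\<lambda>i. axis i 1 :: real^'n"
  have gT: "g y \<in> T" if "y \<in> S" for y using g(3) that by auto
  have sf: "smooth_on (\<lambda>z. fd f z w) T" for w by (rule smooth_on_frechet[OF f(1)])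
  have sg: "smooth_on (\<lambda>y. fd g y v) S" by (rule smooth_on_frechet[OF g(1)])
  have expand: "fd f z w = (\<Sum>i\<in>UNIV. w $ i *\<^sub>R fd f z (?e i))" if "z \<in> T" for z w
    by (rule linear_axis_expand[OF fd_linear[OF f that]])
  have 1: "fd (\<lambda>y. f (g y)) y v = (\<Sum>i\<in>UNIV. fd g y v $ i *\<^sub>R fd f (g y) (?e i))" if "y \<in> S" for y
    unfolding fd_compose[OF f g(1,2) that gT[OF that]] by (rule expand[OF gT[OF that]])
  have "((\<lambda>y. \<Sum>i\<in>UNIV. fd g y v $ i *\<^sub>R fd f (g y) (?e i)) has_derivative
    (\<lambda>u. \<Sum>i\<in>UNIV. fd g x v $ i *\<^sub>R fd (\<lambda>z. fd f z (?e i)) (g x) (fd g x u) + (fd (\<lambda>y. fd g y v) x u) $ i *\<^sub>R fd f (g x) (?e i))) (at x)"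
    by (intro has_derivative_sum has_derivative_scaleR bounded_linear.has_derivative[OF bounded_linear_vec_nth]
        has_derivative_compose[OF smooth_on_deriv[OF g(1,2) x] smooth_on_deriv[OF sf f(2) gT[OF x]]] smooth_on_deriv[OF sg g(2) x])
  from fd_eqI[OF this] have H2: "fd (\<lambda>y. \<Sum>i\<in>UNIV. fd g y v $ i *\<^sub>R fd f (g y) (?e i)) x u
    = (\<Sum>i\<in>UNIV. fd g x v $ i *\<^sub>R hess f (g x) (fd g x u) (?e i)) + (\<Sum>i\<in>UNIV. hess g x u v $ i *\<^sub>R fd f (g x) (?e i))"
    by (simp add: hess_def sum.distrib)
  have H1: "hess (\<lambda>y. f (g y)) x u v = fd (\<lambda>y. \<Sum>i\<in>UNIV. fd g y v $ i *\<^sub>R fd f (g y) (?e i)) x u"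
    unfolding hess_def by (intro fd_cong[OF g(2) x] 1)
  have hexp: "hess f (g x) (fd g x u) w = (\<Sum>i\<in>UNIV. w $ i *\<^sub>R hess f (g x) (fd g x u) (?e i))" for w
  proof -
    have "hess f (g x) (fd g x u) w = fd (\<lambda>z. \<Sum>i\<in>UNIV. w $ i *\<^sub>R fd f z (?e i)) (g x) (fd g x u)"
      unfolding hess_def by (intro fd_cong[OF f(2) gT[OF x]] expand)
    moreover have "((\<lambda>z. \<Sum>i\<in>UNIV. w $ i *\<^sub>R fd f z (?e i)) has_derivative
        (\<lambda>u. \<Sum>i\<in>UNIV. w $ i *\<^sub>R fd (\<lambda>z. fd f z (?e i)) (g x) u)) (at (g x))"
      by (intro has_derivative_sum has_derivative_scaleR_right smooth_on_deriv[OF sf f(2) gT[OF x]])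
    ultimately show ?thesis unfolding hess_def by (simp add: fd_eqI)
  qed
  show ?thesis unfolding H1 H2 hexp[of "fd g x v"] expand[OF gT[OF x], of "hess g x u v"] ..
qed

definition chris :: "(real^'n::finite \<Rightarrow> real^'n^'n) \<Rightarrow> real^'n \<Rightarrow> real^'n \<Rightarrow> real^'n \<Rightarrow> real^'n" where
  "chris g y u v = (\<chi> i. \<Sum>j\<in>UNIV. \<Sum>k\<in>UNIV. christoffel g i j k y * u $ j * v $ k)"

lemma fd_matrix_component:
  fixes g :: "real^'n::finite \<Rightarrow> real^'n^'n"
  assumes g: "smooth_on g T" "open T" "y \<in> T"
  shows "fd g y w $ l $ k = (\<Sum>j\<in>UNIV. w $ j * partial_deriv j (\<lambda>z. g z $ l $ k) y)"
proof -
  have "fd g y w $ l $ k = fd (\<lambda>z. g z $ l) y w $ k"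
    by (simp add: fd_component[OF g])
  also have "\<dots> = fd (\<lambda>z. g z $ l $ k) y w"
    by (rule fd_component[OF smooth_on_nth[OF g(2,1)] g(2,3)])
  also have "\<dots> = (\<Sum>j\<in>UNIV. w $ j * partial_deriv j (\<lambda>z. g z $ l $ k) y)"
    by (rule frechet_partial[OF smooth_on_deriv[OF smooth_on_nth[OF g(2) smooth_on_nth[OF g(2,1)]] g(2,3)]])
  finally show ?thesis .
qed

text \<open>The Koszul formula for constant vector fields, whose brackets vanish. It describes the
  Christoffel map through inner products alone, so that its behaviour under changes of coordinates
  can be found without inverting the metric.\<close>

lemma koszul:
  fixes g :: "real^'n::finite \<Rightarrow> real^'n^'n"
  assumes g: "smooth_on g T" "open T" "y \<in> T" and sym: "\<And>z i j. z \<in> T \<Longrightarrow> g z $ i $ j = g z $ j $ i" and det: "det (g y) \<noteq> 0"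
  shows "2 * (w \<bullet> (g y *v chris g y u v)) = w \<bullet> (fd g y u *v v) + w \<bullet> (fd g y v *v u) - u \<bullet> (fd g y w *v v)"
proof -
  define P where "P = (\<lambda>j l k. partial_deriv j (\<lambda>z. g z $ l $ k) y)"
  have Psym: "P j l k = P j k l" for j l k unfolding P_def using sym by (intro partial_cong_open[OF g(2,3)]) auto
  have G: "fd g y w $ l $ k = (\<Sum>j\<in>UNIV. w $ j * P j l k)" for w l k
    unfolding P_def by (rule fd_matrix_component[OF g])
  define Kz where "Kz = (\<lambda>l j k. P j l k + P k j l - P l j k)"
  \<comment> \<open>Lowering the upper index cancels the inverse metric in the Christoffel
    symbols.\<close>
  have inv: "(\<Sum>i\<in>UNIV. g y $ l $ i * christoffel g i j k y) = 1/2 * Kz l j k" for l j k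
  proof -
    have "(\<Sum>i\<in>UNIV. g y $ l $ i * christoffel g i j k y)
      = 1/2 * (\<Sum>i\<in>UNIV. \<Sum>h\<in>UNIV. g y $ l $ i * matrix_inv (g y) $ i $ h * Kz h j k)"
      unfolding christoffel_def Kz_def P_def by (simp add: sum_distrib_left mult_ac)
    also have "(\<Sum>i\<in>UNIV. \<Sum>h\<in>UNIV. g y $ l $ i * matrix_inv (g y) $ i $ h * Kz h j k)
      = (\<Sum>h\<in>UNIV. (g y ** matrix_inv (g y)) $ l $ h * Kz h j k)"
      by (subst sum.swap) (simp add: matrix_matrix_mult_def sum_distrib_right)
    also have "\<dots> = (\<Sum>h\<in>UNIV. if h = l then Kz h j k else 0)"
      unfolding matrix_inv_mult[OF det] mat_def by (intro sum.cong) auto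
    finally show ?thesis by simp
  qed
  have "(g y *v chris g y u v) $ l = (\<Sum>j\<in>UNIV. \<Sum>k\<in>UNIV. 1/2 * Kz l j k * u $ j * v $ k)" for l
  proof -
    have "(g y *v chris g y u v) $ l = (\<Sum>i\<in>UNIV. \<Sum>j\<in>UNIV. \<Sum>k\<in>UNIV. g y $ l $ i * christoffel g i j k y * u $ j * v $ k)"
      by (simp add: matrix_vector_mult_def chris_def sum_distrib_left mult_ac)
    also have "\<dots> = (\<Sum>j\<in>UNIV. \<Sum>i\<in>UNIV. \<Sum>k\<in>UNIV. g y $ l $ i * christoffel g i j k y * u $ j * v $ k)"
      by (rule sum.swap)
    also have "\<dots> = (\<Sum>j\<in>UNIV. \<Sum>k\<in>UNIV. \<Sum>i\<in>UNIV. g y $ l $ i * christoffel g i j k y * u $ j * v $ k)"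
      by (intro sum.cong refl sum.swap)
    also have "\<dots> = (\<Sum>j\<in>UNIV. \<Sum>k\<in>UNIV. (\<Sum>i\<in>UNIV. g y $ l $ i * christoffel g i j k y) * u $ j * v $ k)"
      by (simp add: sum_distrib_right)
    finally show ?thesis unfolding inv .
  qed
  then have L: "2 * (w \<bullet> (g y *v chris g y u v)) = (\<Sum>l\<in>UNIV. \<Sum>j\<in>UNIV. \<Sum>k\<in>UNIV. w $ l * u $ j * v $ k * Kz l j k)"
    by (simp add: inner_vec_def sum_distrib_left mult_ac)
  have R1: "w \<bullet> (fd g y u *v v) = (\<Sum>l\<in>UNIV. \<Sum>j\<in>UNIV. \<Sum>k\<in>UNIV. w $ l * u $ j * v $ k * P j l k)"
  proof -
    have "w \<bullet> (fd g y u *v v) = (\<Sum>l\<in>UNIV. \<Sum>k\<in>UNIV. \<Sum>j\<in>UNIV. w $ l * u $ j * v $ k * P j l k)"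
      by (simp add: inner_vec_def matrix_vector_mult_def G sum_distrib_left sum_distrib_right mult_ac)
    also have "\<dots> = (\<Sum>l\<in>UNIV. \<Sum>j\<in>UNIV. \<Sum>k\<in>UNIV. w $ l * u $ j * v $ k * P j l k)" by (intro sum.cong refl sum.swap)
    finally show ?thesis .
  qed
  have R2: "w \<bullet> (fd g y v *v u) = (\<Sum>l\<in>UNIV. \<Sum>j\<in>UNIV. \<Sum>k\<in>UNIV. w $ l * u $ j * v $ k * P k j l)"
    by (simp add: inner_vec_def matrix_vector_mult_def G sum_distrib_left sum_distrib_right mult_ac) (simp only: Psym)
  have R3: "u \<bullet> (fd g y w *v v) = (\<Sum>l\<in>UNIV. \<Sum>j\<in>UNIV. \<Sum>k\<in>UNIV. w $ l * u $ j * v $ k * P l j k)"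
  proof -
    have "u \<bullet> (fd g y w *v v) = (\<Sum>j\<in>UNIV. \<Sum>k\<in>UNIV. \<Sum>l\<in>UNIV. w $ l * u $ j * v $ k * P l j k)"
      by (simp add: inner_vec_def matrix_vector_mult_def G sum_distrib_left sum_distrib_right mult_ac)
    also have "\<dots> = (\<Sum>j\<in>UNIV. \<Sum>l\<in>UNIV. \<Sum>k\<in>UNIV. w $ l * u $ j * v $ k * P l j k)" by (intro sum.cong refl sum.swap)
    also have "\<dots> = (\<Sum>l\<in>UNIV. \<Sum>j\<in>UNIV. \<Sum>k\<in>UNIV. w $ l * u $ j * v $ k * P l j k)" by (rule sum.swap)
    finally show ?thesis .
  qed
  show ?thesis unfolding L R1 R2 R3 Kz_def by (simp add: sum.distrib sum_subtractf algebra_simps)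
qed

lemma bounded_bilinear_matrix_vector_mult:
  "bounded_bilinear ((*v) :: real^'n::finite^'m::finite \<Rightarrow> real^'n \<Rightarrow> real^'m)"
  unfolding bilinear_conv_bounded_bilinear[symmetric] bilinear_def
  by (auto intro!: linearI simp: matrix_vector_mult_add_rdistrib matrix_vector_right_distrib
      matrix_vector_mult_def vec_eq_iff sum_distrib_left mult_ac sum.distrib algebra_simps)

lemma fd_quadratic:
  fixes h :: "real^'m::finite \<Rightarrow> real^'k::finite^'k"
  assumes h: "smooth_on h S" and p: "smooth_on p S" and q: "smooth_on q S" and S: "open S" "x \<in> S"
  shows "fd (\<lambda>x. p x \<bullet> (h x *v q x)) x w = fd p x w \<bullet> (h x *v q x) + p x \<bullet> (fd h x w *v q x) + p x \<bullet> (h x *v fd q x w)"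
proof -
  have "((\<lambda>x. p x \<bullet> (h x *v q x)) has_derivative
      (\<lambda>w. p x \<bullet> (h x *v fd q x w + fd h x w *v q x) + fd p x w \<bullet> (h x *v q x))) (at x)"
    by (intro has_derivative_inner bounded_bilinear.FDERIV[OF bounded_bilinear_matrix_vector_mult] smooth_on_deriv[OF h S]
        smooth_on_deriv[OF p S] smooth_on_deriv[OF q S])
  from fd_eqI[OF this] show ?thesis by (simp add: inner_add_right)
qed

definition metric_field :: "(real^'n::finite \<Rightarrow> real^'n^'n) \<Rightarrow> (real^'n) set \<Rightarrow> bool" where
  "metric_field g T \<longleftrightarrow> open T \<and> smooth_on g T \<and> (\<forall>z\<in>T. \<forall>i j. g z $ i $ j = g z $ j $ i) \<and> (\<forall>z\<in>T. \<forall>v. v \<noteq> 0 \<longrightarrow> v \<bullet> (g z *v v) > 0)"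

lemma metric_fieldD:
  assumes "metric_field g T"
  shows "open T" "smooth_on g T" "\<And>z i j. z \<in> T \<Longrightarrow> g z $ i $ j = g z $ j $ i"
    "\<And>z v. z \<in> T \<Longrightarrow> v \<noteq> 0 \<Longrightarrow> v \<bullet> (g z *v v) > 0"
  using assms by (auto simp: metric_field_def)

lemma sym_matrix_inner:
  fixes A :: "real^'n::finite^'n"
  assumes "\<And>i j. A $ i $ j = A $ j $ i"
  shows "u \<bullet> (A *v v) = v \<bullet> (A *v u)"
proof -
  have "u \<bullet> (A *v v) = (\<Sum>i\<in>UNIV. \<Sum>j\<in>UNIV. u $ i * A $ i $ j * v $ j)"
    by (simp add: inner_vec_def matrix_vector_mult_def sum_distrib_left mult_ac)
  also have "\<dots> = (\<Sum>j\<in>UNIV. \<Sum>i\<in>UNIV. u $ i * A $ i $ j * v $ j)" by (rule sum.swap)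
  also have "\<dots> = (\<Sum>j\<in>UNIV. \<Sum>i\<in>UNIV. v $ j * A $ j $ i * u $ i)"
    by (intro sum.cong refl) (simp add: assms mult_ac)
  also have "\<dots> = v \<bullet> (A *v u)"
    by (simp add: inner_vec_def matrix_vector_mult_def sum_distrib_left mult_ac)
  finally show ?thesis .
qed

text \<open>The segment from the identity to \<open>A\<close> consists of matrices with positive
  quadratic form, which are invertible; the determinant starts at 1 and cannot cross 0.\<close>

lemma pos_def_det_pos:
  fixes A :: "real^'n::finite^'n"
  assumes pos: "\<And>v. v \<noteq> 0 \<Longrightarrow> v \<bullet> (A *v v) > 0"
  shows "det A > 0"
proof -
  let ?B = "\<lambda>t. (1 - t) *\<^sub>R mat 1 + t *\<^sub>R A"
  have ne: "det (?B t) \<noteq> 0" if t: "0 \<le> t" "t \<le> 1" for t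
  proof
    assume "det (?B t) = 0"
    then have "\<not> invertible (?B t)" by (simp add: invertible_det_nz)
    then obtain v where v: "v \<noteq> 0" "?B t *v v = 0"
      using matrix_left_invertible_ker invertible_left_inverse by metis
    have "v \<bullet> (?B t *v v) = (1 - t) * (v \<bullet> v) + t * (v \<bullet> (A *v v))"
      by (simp add: matrix_vector_mult_add_rdistrib scaleR_matrix_vector_assoc[symmetric] inner_add_right)
    moreover have "0 < (1 - t) * (v \<bullet> v) + t * (v \<bullet> (A *v v))"
    proof (cases "t = 0")
      case False
      then have "0 < t * (v \<bullet> (A *v v))" using t pos[OF v(1)] by simp
      moreover have "0 \<le> (1 - t) * (v \<bullet> v)" using t by simp
      ultimately show ?thesis by linarith
    qed (use v(1) in simp)
    ultimately show False using v(2) by simp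
  qed
  have c: "continuous_on {0..1} (\<lambda>t. det (?B t))" unfolding det_def by (intro continuous_intros)
  show ?thesis
  proof (rule ccontr)
    assume "\<not> det A > 0"
    then have "det (?B 1) \<le> 0" "0 \<le> det (?B 0)" by simp_all
    then obtain t where "0 \<le> t" "t \<le> 1" "det (?B t) = 0"
      using IVT2'[of "\<lambda>t. det (?B t)" 1 0 0] c by auto
    then show False using ne by blast
  qed
qed

lemma metric_field_det: "metric_field g T \<Longrightarrow> y \<in> T \<Longrightarrow> det (g y) > 0"
  using pos_def_det_pos metric_fieldD(4) by metis

text \<open>The classical transformation law of the Christoffel symbols. Differentiating the
  pullback identity expresses the derivatives of \<open>h\<close> by those of \<open>g\<close> and
  the Hessian of \<open>\<phi>\<close>; the Koszul formulas then show the difference of both sides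
  to be orthogonal to the range of the derivative of \<open>\<phi>\<close>, which is
  everything.\<close>

lemma chris_pullback:
  fixes g h :: "real^'n::finite \<Rightarrow> real^'n^'n"
  assumes g: "metric_field g T" and h: "metric_field h S"
    and \<phi>: "smooth_on \<phi> S" "\<phi> ` S \<subseteq> T" and surj: "surj (fd \<phi> x)"
    and pull: "\<And>x a b. x \<in> S \<Longrightarrow> a \<bullet> (h x *v b) = fd \<phi> x a \<bullet> (g (\<phi> x) *v fd \<phi> x b)" and x: "x \<in> S"
  shows "fd \<phi> x (chris h x u v) = hess \<phi> x u v + chris g (\<phi> x) (fd \<phi> x u) (fd \<phi> x v)"
proof -
  note gD = metric_fieldD[OF g] and hD = metric_fieldD[OF h]
  let ?y = "\<phi> x"
  have y: "?y \<in> T" using \<phi>(2) x by auto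
  have sg: "smooth_on (\<lambda>x. g (\<phi> x)) S" by (rule smooth_on_compose[OF hD(1) gD(1) \<phi>(2) gD(2) \<phi>(1)])
  have s\<phi>: "smooth_on (\<lambda>x. fd \<phi> x a) S" for a by (rule smooth_on_frechet[OF \<phi>(1)])
  let ?g = "g ?y" and ?p = "fd \<phi> x" and ?H = "hess \<phi> x" and ?G = "\<lambda>w. fd g ?y (fd \<phi> x w)"
  have gs: "a \<bullet> (?g *v b) = b \<bullet> (?g *v a)" for a b by (rule sym_matrix_inner[OF gD(3)[OF y]])
  have dgs: "a \<bullet> (fd g ?y w *v b) = b \<bullet> (fd g ?y w *v a)" for a b w
  proof (rule sym_matrix_inner)
    fix i j
    have "partial_deriv k (\<lambda>z. g z $ i $ j) ?y = partial_deriv k (\<lambda>z. g z $ j $ i) ?y" for k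
      using gD(3) by (intro partial_cong_open[OF gD(1) y]) auto
    then show "fd g ?y w $ i $ j = fd g ?y w $ j $ i" by (simp add: fd_matrix_component[OF gD(2,1) y])
  qed
  have dh: "a \<bullet> (fd h x w *v b) = ?H w a \<bullet> (?g *v ?p b) + ?p a \<bullet> (?G w *v ?p b) + ?p a \<bullet> (?g *v ?H w b)" for a b w
  proof -
    have "a \<bullet> (fd h x w *v b) = fd (\<lambda>x. a \<bullet> (h x *v b)) x w"
      using fd_quadratic[OF hD(2) smooth_on_const[OF hD(1), of a] smooth_on_const[OF hD(1), of b] hD(1) x, of w]
      by (simp add: frechet_derivative_const)
    also have "\<dots> = fd (\<lambda>x. fd \<phi> x a \<bullet> (g (\<phi> x) *v fd \<phi> x b)) x w"
      using frechet_derivative_cong_open[OF hD(1) x pull] by simp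
    also have "\<dots> = ?H w a \<bullet> (?g *v ?p b) + ?p a \<bullet> (fd (\<lambda>x. g (\<phi> x)) x w *v ?p b) + ?p a \<bullet> (?g *v ?H w b)"
      unfolding hess_def by (rule fd_quadratic[OF sg s\<phi> s\<phi> hD(1) x])
    also have "fd (\<lambda>x. g (\<phi> x)) x w = ?G w" by (rule fd_compose[OF gD(2,1) \<phi>(1) hD(1) x y])
    finally show ?thesis .
  qed
  have Hs: "?H a b = ?H b a" for a b by (rule hess_sym[OF \<phi>(1) hD(1) x])
  let ?d = "fd \<phi> x (chris h x u v) - (hess \<phi> x u v + chris g ?y (?p u) (?p v))"
  have "?p w \<bullet> (?g *v ?d) = 0" for w
  proof -
    have 1: "2 * (w \<bullet> (h x *v chris h x u v)) = w \<bullet> (fd h x u *v v) + w \<bullet> (fd h x v *v u) - u \<bullet> (fd h x w *v v)"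
      using metric_field_det[OF h x] by (intro koszul[OF hD(2,1) x]) (auto simp: hD(3))
    have 2: "2 * (?p w \<bullet> (?g *v chris g ?y (?p u) (?p v))) = ?p w \<bullet> (?G u *v ?p v) + ?p w \<bullet> (?G v *v ?p u) - ?p u \<bullet> (?G w *v ?p v)"
      using metric_field_det[OF g y] by (intro koszul[OF gD(2,1) y]) (auto simp: gD(3))
    have 3: "w \<bullet> (h x *v chris h x u v) = ?p w \<bullet> (?g *v ?p (chris h x u v))" by (rule pull[OF x])
    \<comment> \<open>Six Hessian terms arise; by symmetry of the Hessian and of the metric four of
      them cancel and the other two are equal.\<close>
    have 4: "w \<bullet> (fd h x u *v v) + w \<bullet> (fd h x v *v u) - u \<bullet> (fd h x w *v v)
      = 2 * (?p w \<bullet> (?g *v ?H u v)) + (?p w \<bullet> (?G u *v ?p v) + ?p w \<bullet> (?G v *v ?p u) - ?p u \<bullet> (?G w *v ?p v))"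
      unfolding dh using gs[of "?H u w" "?p v"] gs[of "?H w u" "?p v"] gs[of "?H v w" "?p u"] gs[of "?H w v" "?p u"]
        gs[of "?H w v" "?p u"] Hs[of u w] Hs[of v w] Hs[of u v] by simp
    have "2 * (?p w \<bullet> (?g *v ?p (chris h x u v))) = 2 * (?p w \<bullet> (?g *v ?H u v)) + 2 * (?p w \<bullet> (?g *v chris g ?y (?p u) (?p v)))"
      using 1 2 3 4 by linarith
    then show ?thesis by (simp add: matrix_vector_mult_diff_distrib matrix_vector_right_distrib inner_diff_right inner_add_right)
  qed
  \<comment> \<open>By surjectivity the defect itself may serve as test vector, so its length is
    zero.\<close>
  moreover obtain w where "?p w = ?d" using surj by (metis surjD)
  ultimately have "?d \<bullet> (?g *v ?d) = 0" by metis
  then have "?d = 0" using gD(4)[OF y, of ?d] by fastforce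
  then show ?thesis by simp
qed

text \<open>The second fundamental form of a map, whose metric trace is the tension field.\<close>

definition sff :: "(real^'m::finite \<Rightarrow> real^'m^'m) \<Rightarrow> (real^'n::finite \<Rightarrow> real^'n^'n) \<Rightarrow> (real^'m \<Rightarrow> real^'n) \<Rightarrow>
    real^'m \<Rightarrow> real^'m \<Rightarrow> real^'m \<Rightarrow> real^'n" where
  "sff \<gamma> g F x u v = hess F x u v - fd F x (chris \<gamma> x u v) + chris g (F x) (fd F x u) (fd F x v)"

text \<open>The Hessian of \<open>\<phi>\<close> enters twice, through the chain rule and through
  the Christoffel symbols of the domain, and cancels.\<close>

lemma sff_domain_change:
  fixes F :: "real^'m::finite \<Rightarrow> real^'n::finite" and \<phi> :: "real^'m \<Rightarrow> real^'m"
  assumes \<gamma>: "metric_field \<gamma> T" and \<eta>: "metric_field \<eta> S" and \<phi>: "smooth_on \<phi> S" "\<phi> ` S \<subseteq> T" and surj: "surj (fd \<phi> x)"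
    and pull: "\<And>x a b. x \<in> S \<Longrightarrow> a \<bullet> (\<eta> x *v b) = fd \<phi> x a \<bullet> (\<gamma> (\<phi> x) *v fd \<phi> x b)" and x: "x \<in> S"
    and F: "smooth_on F T"
  shows "sff \<eta> g (\<lambda>y. F (\<phi> y)) x u v = sff \<gamma> g F (\<phi> x) (fd \<phi> x u) (fd \<phi> x v)"
proof -
  have o: "open T" "open S" using \<gamma> \<eta> metric_fieldD(1) by auto
  have y: "\<phi> x \<in> T" using \<phi>(2) x by auto
  have c: "fd (\<lambda>y. F (\<phi> y)) x w = fd F (\<phi> x) (fd \<phi> x w)" for w by (rule fd_compose[OF F o(1) \<phi>(1) o(2) x y])
  have l: "linear (fd F (\<phi> x))" by (rule fd_linear[OF F o(1) y])
  have P: "fd \<phi> x (chris \<eta> x u v) = hess \<phi> x u v + chris \<gamma> (\<phi> x) (fd \<phi> x u) (fd \<phi> x v)"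
    by (rule chris_pullback[OF \<gamma> \<eta> \<phi> surj pull x])
  show ?thesis
    unfolding sff_def hess_compose[OF F o(1) \<phi>(1) o(2) \<phi>(2) x] c P linear_add[OF l] by simp
qed

text \<open>The Hessian of \<open>\<psi>\<close> from the chain rule cancels against the one in the
  transformation law of the target Christoffel symbols; what remains is in the image of the
  derivative of \<open>\<psi>\<close>.\<close>

lemma sff_target_change:
  fixes F :: "real^'m::finite \<Rightarrow> real^'n::finite" and \<psi> :: "real^'n \<Rightarrow> real^'n"
  assumes g: "metric_field g T" and h: "metric_field h T'" and \<psi>: "smooth_on \<psi> T" "\<psi> ` T \<subseteq> T'" and surj: "surj (fd \<psi> (F x))"
    and pull: "\<And>y a b. y \<in> T \<Longrightarrow> a \<bullet> (g y *v b) = fd \<psi> y a \<bullet> (h (\<psi> y) *v fd \<psi> y b)"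
    and F: "smooth_on F S" "open S" "F ` S \<subseteq> T" "x \<in> S"
  shows "sff \<gamma> h (\<lambda>z. \<psi> (F z)) x u v = fd \<psi> (F x) (sff \<gamma> g F x u v)"
proof -
  have o: "open T" using g metric_fieldD(1) by auto
  have y: "F x \<in> T" using F(3,4) by auto
  have c: "fd (\<lambda>z. \<psi> (F z)) x w = fd \<psi> (F x) (fd F x w)" for w by (rule fd_compose[OF \<psi>(1) o F(1,2,4) y])
  have l: "linear (fd \<psi> (F x))" by (rule fd_linear[OF \<psi>(1) o y])
  have P: "fd \<psi> (F x) (chris g (F x) a b) = hess \<psi> (F x) a b + chris h (\<psi> (F x)) (fd \<psi> (F x) a) (fd \<psi> (F x) b)" for a b
    by (rule chris_pullback[OF h g \<psi> surj pull y])
  show ?thesis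
    unfolding sff_def hess_compose[OF \<psi>(1) o F(1,2,3,4)] c linear_add[OF l] linear_diff[OF l] P by simp
qed

subsection \<open>The tension field under changes of charts\<close>

text \<open>Solving \<open>d = c A\<close> for the row \<open>c\<close> writes the new row as a
  combination of the rows of \<open>A\<close>, and Cramer's rule picks out the coefficient of the
  row it replaces.\<close>

lemma det_row_expand:
  fixes A :: "real^'n::finite^'n"
  assumes "det A \<noteq> 0"
  shows "det (\<chi> j. if j = i then d else row j A) = (\<Sum>k\<in>UNIV. d $ k * matrix_inv A $ k $ i) * det A"
proof -
  define c where "c = (\<chi> l. \<Sum>k\<in>UNIV. d $ k * matrix_inv A $ k $ l)"
  have "sum (\<lambda>l. c $ l *s row l A) UNIV $ m = d $ m" for m
  proof -
    have "sum (\<lambda>l. c $ l *s row l A) UNIV $ m = (\<Sum>l\<in>UNIV. \<Sum>k\<in>UNIV. d $ k * (matrix_inv A $ k $ l * A $ l $ m))"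
      by (simp add: c_def row_def sum_distrib_right sum_distrib_left mult_ac)
    also have "\<dots> = (\<Sum>k\<in>UNIV. d $ k * (matrix_inv A ** A) $ k $ m)"
      by (subst sum.swap) (simp add: matrix_matrix_mult_def sum_distrib_left)
    also have "\<dots> = (\<Sum>k\<in>UNIV. if k = m then d $ k else 0)"
      unfolding matrix_inv_mult(2)[OF assms] mat_def by (intro sum.cong) auto
    finally show ?thesis by simp
  qed
  then have "sum (\<lambda>l. c $ l *s row l A) UNIV = d" by (simp add: vec_eq_iff)
  from cramer_lemma_transpose[of i c A, unfolded this] show ?thesis by (simp add: c_def)
qed

text \<open>Jacobi's formula: the Leibniz expansion is differentiated row by row, and
  \<open>det_row_expand\<close> evaluates each determinant with a replaced row.\<close>

lemma fd_det:
  fixes A :: "'a::real_normed_vector \<Rightarrow> real^'n::finite^'n"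
  assumes A: "smooth_on A S" "open S" "x \<in> S" and nz: "det (A x) \<noteq> 0"
  shows "fd (\<lambda>y. det (A y)) x w = det (A x) * (\<Sum>k\<in>UNIV. \<Sum>l\<in>UNIV. matrix_inv (A x) $ l $ k * fd A x w $ k $ l)"
proof -
  let ?D = "fd A x w" and ?P = "{p. p permutes (UNIV :: 'n set)}"
  have d: "((\<lambda>y. A y $ i $ j) has_derivative (\<lambda>w. fd A x w $ i $ j)) (at x)" for i j
    by (intro bounded_linear.has_derivative[OF bounded_linear_vec_nth] smooth_on_deriv[OF A])
  have "((\<lambda>y. det (A y)) has_derivative
    (\<lambda>w. \<Sum>p\<in>?P. of_int (sign p) * (\<Sum>i\<in>UNIV. fd A x w $ i $ p i * (\<Prod>j\<in>UNIV - {i}. A x $ j $ p j)))) (at x)"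
    unfolding det_def by (intro has_derivative_sum has_derivative_mult_right has_derivative_prod d)
  from fd_eqI[OF this] have "fd (\<lambda>y. det (A y)) x w
    = (\<Sum>p\<in>?P. \<Sum>i\<in>UNIV. of_int (sign p) * (?D $ i $ p i * (\<Prod>j\<in>UNIV - {i}. A x $ j $ p j)))"
    by (simp add: sum_distrib_left)
  also have "\<dots> = (\<Sum>i\<in>UNIV. \<Sum>p\<in>?P. of_int (sign p) * (?D $ i $ p i * (\<Prod>j\<in>UNIV - {i}. A x $ j $ p j)))"
    by (rule sum.swap)
  also have "\<dots> = (\<Sum>i\<in>UNIV. det (\<chi> j. if j = i then ?D $ i else row j (A x)))"
  proof (intro sum.cong refl)
    fix i :: 'n
    have "?D $ i $ p i * (\<Prod>j\<in>UNIV - {i}. A x $ j $ p j) = (\<Prod>j\<in>UNIV. (\<chi> j. if j = i then ?D $ i else row j (A x)) $ j $ p j)" for p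
      by (subst prod.remove[of UNIV i]) (auto simp: row_def intro!: prod.cong)
    then show "(\<Sum>p\<in>?P. of_int (sign p) * (?D $ i $ p i * (\<Prod>j\<in>UNIV - {i}. A x $ j $ p j)))
      = det (\<chi> j. if j = i then ?D $ i else row j (A x))" unfolding det_def by simp
  qed
  finally show ?thesis unfolding det_row_expand[OF nz]
    by (simp add: sum_distrib_left sum_distrib_right mult_ac)
qed

text \<open>Differentiate \<open>matrix_inv A ** A = mat 1\<close> and multiply by the inverse from
  the right.\<close>

lemma fd_matrix_inv:
  fixes A :: "'a::real_normed_vector \<Rightarrow> real^'n::finite^'n"
  assumes A: "smooth_on A S" "open S" "x \<in> S" and nz: "\<And>y. y \<in> S \<Longrightarrow> det (A y) \<noteq> 0"
  shows "fd (\<lambda>y. matrix_inv (A y) $ a $ b) x w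
    = - (\<Sum>k\<in>UNIV. \<Sum>l\<in>UNIV. matrix_inv (A x) $ a $ k * fd A x w $ k $ l * matrix_inv (A x) $ l $ b)"
proof -
  let ?I = "\<lambda>y. matrix_inv (A y)"
  define E where "E = (\<chi> i j. fd (\<lambda>y. ?I y $ i $ j) x w)"
  have sI: "smooth_on (\<lambda>y. ?I y $ i $ j) S" for i j by (intro smooth_intros A nz)
  have dA: "((\<lambda>y. A y $ i $ j) has_derivative (\<lambda>w. fd A x w $ i $ j)) (at x)" for i j
    by (intro bounded_linear.has_derivative[OF bounded_linear_vec_nth] smooth_on_deriv[OF A])
  have "(E ** A x) $ i $ j + (?I x ** fd A x w) $ i $ j = 0" for i j
  proof -
    have "((\<lambda>y. \<Sum>k\<in>UNIV. ?I y $ i $ k * A y $ k $ j) has_derivative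
      (\<lambda>w. \<Sum>k\<in>UNIV. ?I x $ i $ k * fd A x w $ k $ j + fd (\<lambda>y. ?I y $ i $ k) x w * A x $ k $ j)) (at x)"
      by (intro has_derivative_sum has_derivative_mult dA smooth_on_deriv[OF sI A(2,3)])
    from fd_eqI[OF this] have "fd (\<lambda>y. \<Sum>k\<in>UNIV. ?I y $ i $ k * A y $ k $ j) x w = (?I x ** fd A x w) $ i $ j + (E ** A x) $ i $ j"
      by (simp add: matrix_matrix_mult_def E_def sum.distrib)
    moreover have "(\<Sum>k\<in>UNIV. ?I y $ i $ k * A y $ k $ j) = (mat 1 :: real^'n^'n) $ i $ j" if "y \<in> S" for y
      unfolding matrix_inv_mult(2)[OF nz[OF that], symmetric] by (simp add: matrix_matrix_mult_def)
    then have "fd (\<lambda>y. \<Sum>k\<in>UNIV. ?I y $ i $ k * A y $ k $ j) x w = fd (\<lambda>y. (mat 1 :: real^'n^'n) $ i $ j) x w"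
      by (intro fd_cong[OF A(2,3)])
    ultimately show ?thesis by (simp add: frechet_derivative_const)
  qed
  then have "E ** A x + ?I x ** fd A x w = 0" by (simp add: vec_eq_iff)
  then have "(E ** A x + ?I x ** fd A x w) ** ?I x = 0" by (simp add: matrix_matrix_mult_def vec_eq_iff)
  moreover have distr: "(B + C) ** D = B ** D + C ** D" for B C D :: "real^'n^'n"
    by (simp add: matrix_matrix_mult_def vec_eq_iff distrib_right sum.distrib)
  ultimately have "E + ?I x ** fd A x w ** ?I x = 0"
    unfolding distr by (simp add: matrix_mul_assoc[symmetric] matrix_inv_mult[OF nz[OF A(3)]])
  then have "E $ a $ b = - ((?I x ** fd A x w ** ?I x) $ a $ b)" by (simp add: vec_eq_iff eq_neg_iff_add_eq_0)
  also have "(?I x ** fd A x w ** ?I x) $ a $ b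
    = (\<Sum>l\<in>UNIV. \<Sum>k\<in>UNIV. ?I x $ a $ k * fd A x w $ k $ l * ?I x $ l $ b)"
    by (simp add: matrix_matrix_mult_def sum_distrib_right)
  also have "\<dots> = (\<Sum>k\<in>UNIV. \<Sum>l\<in>UNIV. ?I x $ a $ k * fd A x w $ k $ l * ?I x $ l $ b)" by (rule sum.swap)
  finally show ?thesis by (simp add: E_def)
qed

lemma matrix_inv_sym:
  fixes A :: "real^'n::finite^'n"
  assumes d: "det A \<noteq> 0" and s: "\<And>i j. A $ i $ j = A $ j $ i"
  shows "matrix_inv A $ i $ j = matrix_inv A $ j $ i"
proof -
  have "transpose A = A" by (simp add: transpose_def vec_eq_iff s[of _ i for i])
  then have "transpose (matrix_inv A) ** A = mat 1"
    by (metis matrix_inv_mult(1)[OF d] matrix_transpose_mul transpose_mat)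
  then have "transpose (matrix_inv A) = matrix_inv A"
    by (metis matrix_inv_mult(1)[OF d] matrix_mul_assoc matrix_mul_lid matrix_mul_rid)
  then have "transpose (matrix_inv A) $ j $ i = matrix_inv A $ j $ i" by simp
  then show ?thesis by (simp add: transpose_def)
qed

lemma sum_swap_pairs:
  "(\<Sum>j\<in>A. \<Sum>k\<in>B. \<Sum>a\<in>C. \<Sum>b\<in>D. f j k a b) = (\<Sum>a\<in>C. \<Sum>b\<in>D. \<Sum>j\<in>A. \<Sum>k\<in>B. f j k a b)"
proof -
  have "(\<Sum>j\<in>A. \<Sum>k\<in>B. \<Sum>a\<in>C. \<Sum>b\<in>D. f j k a b) = (\<Sum>j\<in>A. \<Sum>a\<in>C. \<Sum>k\<in>B. \<Sum>b\<in>D. f j k a b)"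
    by (intro sum.cong refl sum.swap)
  also have "\<dots> = (\<Sum>a\<in>C. \<Sum>j\<in>A. \<Sum>k\<in>B. \<Sum>b\<in>D. f j k a b)" by (rule sum.swap)
  also have "\<dots> = (\<Sum>a\<in>C. \<Sum>j\<in>A. \<Sum>b\<in>D. \<Sum>k\<in>B. f j k a b)" by (intro sum.cong refl sum.swap)
  also have "\<dots> = (\<Sum>a\<in>C. \<Sum>b\<in>D. \<Sum>j\<in>A. \<Sum>k\<in>B. f j k a b)" by (intro sum.cong refl sum.swap)
  finally show ?thesis .
qed

definition sff_coeff :: "(real^'m::finite \<Rightarrow> real^'m^'m) \<Rightarrow> (real^'n::finite \<Rightarrow> real^'n^'n) \<Rightarrow> (real^'m \<Rightarrow> real^'n) \<Rightarrow>
    real^'m \<Rightarrow> 'm \<Rightarrow> 'm \<Rightarrow> 'n \<Rightarrow> real" where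
  "sff_coeff \<gamma> g F x \<alpha> \<beta> i = partial_deriv \<alpha> (partial_deriv \<beta> (\<lambda>y. F y $ i)) x
     - (\<Sum>\<sigma>\<in>UNIV. christoffel \<gamma> \<sigma> \<alpha> \<beta> x * partial_deriv \<sigma> (\<lambda>y. F y $ i) x)
     + (\<Sum>j\<in>UNIV. \<Sum>k\<in>UNIV. christoffel g i j k (F x) * partial_deriv \<alpha> (\<lambda>y. F y $ j) x * partial_deriv \<beta> (\<lambda>y. F y $ k) x)"

lemma sff_expand:
  fixes F :: "real^'m::finite \<Rightarrow> real^'n::finite"
  assumes F: "smooth_on F S" "open S" "x \<in> S"
  shows "sff \<gamma> g F x u v $ i = (\<Sum>\<alpha>\<in>UNIV. \<Sum>\<beta>\<in>UNIV. u $ \<alpha> * v $ \<beta> * sff_coeff \<gamma> g F x \<alpha> \<beta> i)"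
proof -
  have fdF: "fd F x w $ j = (\<Sum>\<sigma>\<in>UNIV. w $ \<sigma> * partial_deriv \<sigma> (\<lambda>y. F y $ j) x)" for w j
    unfolding fd_component[OF F] by (rule frechet_partial[OF smooth_on_deriv[OF smooth_on_nth[OF F(2,1)] F(2,3)]])
  have 2: "fd F x (chris \<gamma> x u v) $ i = (\<Sum>\<alpha>\<in>UNIV. \<Sum>\<beta>\<in>UNIV. \<Sum>\<sigma>\<in>UNIV. u $ \<alpha> * v $ \<beta> * (christoffel \<gamma> \<sigma> \<alpha> \<beta> x * partial_deriv \<sigma> (\<lambda>y. F y $ i) x))"
  proof -
    have "fd F x (chris \<gamma> x u v) $ i = (\<Sum>\<sigma>\<in>UNIV. \<Sum>\<alpha>\<in>UNIV. \<Sum>\<beta>\<in>UNIV. u $ \<alpha> * v $ \<beta> * (christoffel \<gamma> \<sigma> \<alpha> \<beta> x * partial_deriv \<sigma> (\<lambda>y. F y $ i) x))"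
      unfolding fdF by (simp add: chris_def sum_distrib_left sum_distrib_right mult_ac)
    also have "\<dots> = (\<Sum>\<alpha>\<in>UNIV. \<Sum>\<sigma>\<in>UNIV. \<Sum>\<beta>\<in>UNIV. u $ \<alpha> * v $ \<beta> * (christoffel \<gamma> \<sigma> \<alpha> \<beta> x * partial_deriv \<sigma> (\<lambda>y. F y $ i) x))"
      by (rule sum.swap)
    also have "\<dots> = (\<Sum>\<alpha>\<in>UNIV. \<Sum>\<beta>\<in>UNIV. \<Sum>\<sigma>\<in>UNIV. u $ \<alpha> * v $ \<beta> * (christoffel \<gamma> \<sigma> \<alpha> \<beta> x * partial_deriv \<sigma> (\<lambda>y. F y $ i) x))"
      by (intro sum.cong refl sum.swap)
    finally show ?thesis .
  qed
  have 3: "chris g (F x) (fd F x u) (fd F x v) $ i = (\<Sum>\<alpha>\<in>UNIV. \<Sum>\<beta>\<in>UNIV. \<Sum>j\<in>UNIV. \<Sum>k\<in>UNIV.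
      u $ \<alpha> * v $ \<beta> * (christoffel g i j k (F x) * partial_deriv \<alpha> (\<lambda>y. F y $ j) x * partial_deriv \<beta> (\<lambda>y. F y $ k) x))"
  proof -
    have "chris g (F x) (fd F x u) (fd F x v) $ i = (\<Sum>j\<in>UNIV. \<Sum>k\<in>UNIV. \<Sum>\<alpha>\<in>UNIV. \<Sum>\<beta>\<in>UNIV.
      u $ \<alpha> * v $ \<beta> * (christoffel g i j k (F x) * partial_deriv \<alpha> (\<lambda>y. F y $ j) x * partial_deriv \<beta> (\<lambda>y. F y $ k) x))"
      unfolding chris_def fdF vec_lambda_beta mult.assoc sum_product by (simp add: sum_distrib_left mult_ac)
    also note sum_swap_pairs
    finally show ?thesis .
  qed
  show ?thesis
    unfolding sff_def vector_add_component vector_minus_component hess_expand_component[OF F] 2 3 sff_coeff_def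
    by (simp add: sum_distrib_left sum.distrib sum_subtractf algebra_simps)
qed

lemma sff_axis:
  fixes F :: "real^'m::finite \<Rightarrow> real^'n::finite"
  assumes F: "smooth_on F S" "open S" "x \<in> S"
  shows "sff \<gamma> g F x (axis \<alpha> 1) (axis \<beta> 1) $ i = sff_coeff \<gamma> g F x \<alpha> \<beta> i"
proof -
  have "sff \<gamma> g F x (axis \<alpha> 1) (axis \<beta> 1) $ i
    = (\<Sum>a\<in>UNIV. if a = \<alpha> then \<Sum>b\<in>UNIV. if b = \<beta> then sff_coeff \<gamma> g F x a b i else 0 else 0)"
  proof -
    have e: "axis \<alpha> 1 $ a * axis \<beta> 1 $ b * C = (if a = \<alpha> then if b = \<beta> then C else 0 else 0)" for a b and C :: real
      by (simp add: axis_def)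
    show ?thesis unfolding sff_expand[OF F] e by (intro sum.cong refl) auto
  qed
  then show ?thesis by simp
qed

text \<open>The divergence form of the Laplace-Beltrami operator becomes a trace, because the
  derivatives of the volume density and of the inverse metric combine to contracted Christoffel
  symbols. Only the trace form transforms visibly as a tensor.\<close>

lemma tension_trace:
  fixes F :: "real^'m::finite \<Rightarrow> real^'n::finite"
  assumes \<gamma>: "metric_field \<gamma> S" and F: "smooth_on F S" and x: "x \<in> S"
  shows "tension \<gamma> g F i x = (\<Sum>\<alpha>\<in>UNIV. \<Sum>\<beta>\<in>UNIV. matrix_inv (\<gamma> x) $ \<alpha> $ \<beta> * sff_coeff \<gamma> g F x \<alpha> \<beta> i)"
proof -
  note D = metric_fieldD[OF \<gamma>] and det = metric_field_det[OF \<gamma>]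
  have nz: "y \<in> S \<Longrightarrow> det (\<gamma> y) \<noteq> 0" for y using det[of y] by simp
  let ?G = "matrix_inv (\<gamma> x)" and ?f = "\<lambda>y. F y $ i" and ?s = "\<lambda>y. sqrt (det (\<gamma> y))"
  define P where "P = (\<lambda>j l k. partial_deriv j (\<lambda>z. \<gamma> z $ l $ k) x)"
  have Psym: "P j l k = P j k l" for j l k unfolding P_def using D(3) by (intro partial_cong_open[OF D(1) x]) auto
  have Gsym: "?G $ a $ b = ?G $ b $ a" for a b by (rule matrix_inv_sym[OF nz[OF x] D(3)[OF x]])
  have s0: "?s x > 0" using det[OF x] by simp
  have fdP: "fd \<gamma> x (axis \<alpha> 1) $ k $ l = P \<alpha> k l" for \<alpha> k l
    unfolding fd_matrix_component[OF D(2,1) x] P_def by (simp add: axis_def if_distrib if_distribR cong: if_cong)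
  have sdet: "smooth_on (\<lambda>y. det (\<gamma> y)) S" by (intro smooth_intros D)
  have ss: "smooth_on ?s S" using det by (intro smooth_intros D) auto
  have sG: "smooth_on (\<lambda>y. matrix_inv (\<gamma> y) $ a $ b) S" for a b by (intro smooth_intros D nz)
  have sf: "smooth_on (partial_deriv \<beta> ?f) S" for \<beta> by (intro smooth_on_partial smooth_intros D F)
  have ds: "partial_deriv \<alpha> ?s x = ?s x * (\<Sum>k\<in>UNIV. \<Sum>l\<in>UNIV. ?G $ l $ k * P \<alpha> k l) / 2" for \<alpha>
  proof -
    have "(?s has_derivative (\<lambda>w. fd (\<lambda>y. det (\<gamma> y)) x w * (inverse (?s x) / 2))) (at x)"
      using has_derivative_real_sqrt[OF det[OF x] smooth_on_deriv[OF sdet D(1) x]] by simp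
    from fd_eqI[OF this] have "partial_deriv \<alpha> ?s x = fd (\<lambda>y. det (\<gamma> y)) x (axis \<alpha> 1) * (inverse (?s x) / 2)"
      by (simp add: partial_deriv_def)
    also have "\<dots> = (?s x * ?s x) * (\<Sum>k\<in>UNIV. \<Sum>l\<in>UNIV. ?G $ l $ k * P \<alpha> k l) * (inverse (?s x) / 2)"
      unfolding fd_det[OF D(2,1) x nz[OF x]] fdP using det[OF x] by simp
    also have "\<dots> = ?s x * (\<Sum>k\<in>UNIV. \<Sum>l\<in>UNIV. ?G $ l $ k * P \<alpha> k l) / 2"
    proof -
      have "s * s * X * (inverse s / 2) = s * X / 2" if "s > 0" for s X :: real using that by (simp add: field_simps)
      then show ?thesis using s0 by blast
    qed
    finally show ?thesis .
  qed
  have dG: "partial_deriv \<alpha> (\<lambda>y. matrix_inv (\<gamma> y) $ \<alpha> $ \<beta>) x = - (\<Sum>k\<in>UNIV. \<Sum>l\<in>UNIV. ?G $ \<alpha> $ k * P \<alpha> k l * ?G $ l $ \<beta>)" for \<alpha> \<beta>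
    unfolding partial_deriv_def fdP[symmetric] by (rule fd_matrix_inv[OF D(2,1) x nz])
  have st1: "partial_deriv \<alpha> (\<lambda>y. \<Sum>\<beta>\<in>UNIV. ?s y * matrix_inv (\<gamma> y) $ \<alpha> $ \<beta> * partial_deriv \<beta> ?f y) x
    = (\<Sum>\<beta>\<in>UNIV. ?s x * ?G $ \<alpha> $ \<beta> * partial_deriv \<alpha> (partial_deriv \<beta> ?f) x
        + (?s x * partial_deriv \<alpha> (\<lambda>y. matrix_inv (\<gamma> y) $ \<alpha> $ \<beta>) x + partial_deriv \<alpha> ?s x * ?G $ \<alpha> $ \<beta>) * partial_deriv \<beta> ?f x)" for \<alpha>
  proof -
    have "((\<lambda>y. \<Sum>\<beta>\<in>UNIV. ?s y * matrix_inv (\<gamma> y) $ \<alpha> $ \<beta> * partial_deriv \<beta> ?f y) has_derivative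
      (\<lambda>w. \<Sum>\<beta>\<in>UNIV. ?s x * ?G $ \<alpha> $ \<beta> * fd (partial_deriv \<beta> ?f) x w
        + (?s x * fd (\<lambda>y. matrix_inv (\<gamma> y) $ \<alpha> $ \<beta>) x w + fd ?s x w * ?G $ \<alpha> $ \<beta>) * partial_deriv \<beta> ?f x)) (at x)"
      by (intro has_derivative_sum has_derivative_mult smooth_on_deriv[OF ss D(1) x] smooth_on_deriv[OF sG D(1) x]
          smooth_on_deriv[OF sf D(1) x])
    from fd_eqI[OF this] show ?thesis unfolding partial_deriv_def by simp
  qed
  have st2: "(\<Sum>\<beta>\<in>UNIV. ?s x * ?G $ \<alpha> $ \<beta> * partial_deriv \<alpha> (partial_deriv \<beta> ?f) x
        + (?s x * partial_deriv \<alpha> (\<lambda>y. matrix_inv (\<gamma> y) $ \<alpha> $ \<beta>) x + partial_deriv \<alpha> ?s x * ?G $ \<alpha> $ \<beta>) * partial_deriv \<beta> ?f x)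
     = ?s x * (\<Sum>\<beta>\<in>UNIV. ?G $ \<alpha> $ \<beta> * partial_deriv \<alpha> (partial_deriv \<beta> ?f) x
        + (1/2 * (\<Sum>k\<in>UNIV. \<Sum>l\<in>UNIV. ?G $ l $ k * P \<alpha> k l) * ?G $ \<alpha> $ \<beta> - (\<Sum>k\<in>UNIV. \<Sum>l\<in>UNIV. ?G $ \<alpha> $ k * P \<alpha> k l * ?G $ l $ \<beta>)) * partial_deriv \<beta> ?f x)" for \<alpha>
  proof -
    have r: "s * G * H + (s * (- B) + s * A / 2 * G) * f = s * (G * H + (1/2 * A * G - B) * f)" for s G H A B f :: real
      by (simp add: algebra_simps)
    show ?thesis unfolding ds dG r by (simp only: sum_distrib_left)
  qed
  have A: "1 / ?s x * (\<Sum>\<alpha>\<in>UNIV. partial_deriv \<alpha> (\<lambda>y. \<Sum>\<beta>\<in>UNIV. ?s y * matrix_inv (\<gamma> y) $ \<alpha> $ \<beta> * partial_deriv \<beta> ?f y) x)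
    = (\<Sum>\<alpha>\<in>UNIV. \<Sum>\<beta>\<in>UNIV. ?G $ \<alpha> $ \<beta> * partial_deriv \<alpha> (partial_deriv \<beta> ?f) x)
      + (\<Sum>\<beta>\<in>UNIV. (\<Sum>\<alpha>\<in>UNIV. 1/2 * (\<Sum>k\<in>UNIV. \<Sum>l\<in>UNIV. ?G $ l $ k * P \<alpha> k l) * ?G $ \<alpha> $ \<beta>
          - (\<Sum>k\<in>UNIV. \<Sum>l\<in>UNIV. ?G $ \<alpha> $ k * P \<alpha> k l * ?G $ l $ \<beta>)) * partial_deriv \<beta> ?f x)"
  proof -
    have r: "1 / s * (\<Sum>\<alpha>\<in>UNIV. s * (\<Sum>\<beta>\<in>UNIV. X \<alpha> \<beta> + Y \<alpha> \<beta> * f \<beta>))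
      = (\<Sum>\<alpha>\<in>UNIV. \<Sum>\<beta>\<in>UNIV. X \<alpha> \<beta>) + (\<Sum>\<beta>\<in>UNIV. (\<Sum>\<alpha>\<in>UNIV. Y \<alpha> \<beta>) * f \<beta>)"
      if "s > 0" for s and X Y :: "'m \<Rightarrow> 'm \<Rightarrow> real" and f :: "'m \<Rightarrow> real"
    proof -
      have "1 / s * (\<Sum>\<alpha>\<in>UNIV. s * (\<Sum>\<beta>\<in>UNIV. X \<alpha> \<beta> + Y \<alpha> \<beta> * f \<beta>))
        = (\<Sum>\<alpha>\<in>UNIV. \<Sum>\<beta>\<in>UNIV. X \<alpha> \<beta>) + (\<Sum>\<alpha>\<in>UNIV. \<Sum>\<beta>\<in>UNIV. Y \<alpha> \<beta> * f \<beta>)"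
        using that by (simp add: sum_distrib_left[symmetric] sum.distrib)
      also have "(\<Sum>\<alpha>\<in>UNIV. \<Sum>\<beta>\<in>UNIV. Y \<alpha> \<beta> * f \<beta>) = (\<Sum>\<beta>\<in>UNIV. \<Sum>\<alpha>\<in>UNIV. Y \<alpha> \<beta> * f \<beta>)" by (rule sum.swap)
      finally show ?thesis by (simp add: sum_distrib_right)
    qed
    show ?thesis unfolding st1 st2 by (rule r[OF s0])
  qed
  \<comment> \<open>Half the logarithmic derivative of the determinant together with the derivative
    of the inverse metric is minus the contracted Christoffel symbol. Both sides equal
    \<open>1/2 * ?Y - ?X\<close>: the first two terms of the symbol contract to \<open>?X\<close>
    each, the third to \<open>?Y\<close>.\<close>
  have Q: "(\<Sum>\<alpha>\<in>UNIV. 1/2 * (\<Sum>k\<in>UNIV. \<Sum>l\<in>UNIV. ?G $ l $ k * P \<alpha> k l) * ?G $ \<alpha> $ \<beta>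
          - (\<Sum>k\<in>UNIV. \<Sum>l\<in>UNIV. ?G $ \<alpha> $ k * P \<alpha> k l * ?G $ l $ \<beta>))
    = - (\<Sum>\<alpha>\<in>UNIV. \<Sum>k\<in>UNIV. ?G $ \<alpha> $ k * christoffel \<gamma> \<beta> \<alpha> k x)" for \<beta>
  proof -
    let ?X = "\<Sum>a\<in>UNIV. \<Sum>k\<in>UNIV. \<Sum>l\<in>UNIV. ?G $ a $ k * ?G $ \<beta> $ l * P a k l"
    let ?Y = "\<Sum>a\<in>UNIV. \<Sum>k\<in>UNIV. \<Sum>l\<in>UNIV. ?G $ a $ k * ?G $ \<beta> $ l * P l a k"
    have 1: "(\<Sum>a\<in>UNIV. \<Sum>k\<in>UNIV. \<Sum>l\<in>UNIV. ?G $ a $ k * ?G $ \<beta> $ l * P k a l) = ?X"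
      by (subst sum.swap) (simp add: Gsym[of _ k for k])
    have chr: "christoffel \<gamma> \<beta> a k x = 1/2 * (\<Sum>l\<in>UNIV. ?G $ \<beta> $ l * (P a k l + P k a l - P l a k))" for a k
    proof -
      have "partial_deriv a (\<lambda>z. \<gamma> z $ l $ k) x = P a k l" for l using Psym[of a l k] by (simp add: P_def)
      then show ?thesis by (simp add: christoffel_def P_def)
    qed
    have "(\<Sum>\<alpha>\<in>UNIV. \<Sum>k\<in>UNIV. ?G $ \<alpha> $ k * christoffel \<gamma> \<beta> \<alpha> k x)
      = (\<Sum>a\<in>UNIV. \<Sum>k\<in>UNIV. \<Sum>l\<in>UNIV. 1/2 * (?G $ a $ k * ?G $ \<beta> $ l * P a k l
          + ?G $ a $ k * ?G $ \<beta> $ l * P k a l - ?G $ a $ k * ?G $ \<beta> $ l * P l a k))"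
      unfolding chr sum_distrib_left by (intro sum.cong refl) (simp add: algebra_simps)
    also have "\<dots> = 1/2 * (?X + ?X - ?Y)"
      unfolding sum_distrib_left[symmetric] sum.distrib sum_subtractf 1 ..
    finally have c: "- (\<Sum>\<alpha>\<in>UNIV. \<Sum>k\<in>UNIV. ?G $ \<alpha> $ k * christoffel \<gamma> \<beta> \<alpha> k x) = 1/2 * ?Y - ?X" by simp
    have X: "(\<Sum>\<alpha>\<in>UNIV. \<Sum>k\<in>UNIV. \<Sum>l\<in>UNIV. ?G $ \<alpha> $ k * P \<alpha> k l * ?G $ l $ \<beta>) = ?X"
      by (intro sum.cong refl) (simp add: Gsym[of _ \<beta>])
    have "(\<Sum>\<alpha>\<in>UNIV. (\<Sum>k\<in>UNIV. \<Sum>l\<in>UNIV. ?G $ l $ k * P \<alpha> k l) * ?G $ \<alpha> $ \<beta>)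
      = (\<Sum>l\<in>UNIV. \<Sum>a\<in>UNIV. \<Sum>k\<in>UNIV. ?G $ a $ k * ?G $ \<beta> $ l * P l a k)"
      unfolding sum_distrib_right by (intro sum.cong refl) (simp add: Gsym)
    also have "\<dots> = (\<Sum>a\<in>UNIV. \<Sum>l\<in>UNIV. \<Sum>k\<in>UNIV. ?G $ a $ k * ?G $ \<beta> $ l * P l a k)" by (rule sum.swap)
    also have "\<dots> = ?Y" by (intro sum.cong refl sum.swap)
    finally have Y: "(\<Sum>\<alpha>\<in>UNIV. (\<Sum>k\<in>UNIV. \<Sum>l\<in>UNIV. ?G $ l $ k * P \<alpha> k l) * ?G $ \<alpha> $ \<beta>) = ?Y" .
    have r: "(\<Sum>\<alpha>\<in>UNIV. 1/2 * A \<alpha> * H \<alpha> - B \<alpha>) = 1/2 * (\<Sum>\<alpha>\<in>UNIV. A \<alpha> * H \<alpha>) - (\<Sum>\<alpha>\<in>UNIV. B \<alpha>)"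
      for A H B :: "'m \<Rightarrow> real" by (simp add: sum_subtractf sum_distrib_left mult.assoc)
    show ?thesis unfolding c r X Y ..
  qed
  have B: "(\<Sum>\<alpha>\<in>UNIV. \<Sum>\<beta>\<in>UNIV. ?G $ \<alpha> $ \<beta> * (\<Sum>\<sigma>\<in>UNIV. christoffel \<gamma> \<sigma> \<alpha> \<beta> x * partial_deriv \<sigma> ?f x))
    = (\<Sum>\<sigma>\<in>UNIV. (\<Sum>\<alpha>\<in>UNIV. \<Sum>k\<in>UNIV. ?G $ \<alpha> $ k * christoffel \<gamma> \<sigma> \<alpha> k x) * partial_deriv \<sigma> ?f x)"
  proof -
    have "(\<Sum>\<alpha>\<in>UNIV. \<Sum>\<beta>\<in>UNIV. ?G $ \<alpha> $ \<beta> * (\<Sum>\<sigma>\<in>UNIV. christoffel \<gamma> \<sigma> \<alpha> \<beta> x * partial_deriv \<sigma> ?f x))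
      = (\<Sum>\<alpha>\<in>UNIV. \<Sum>\<beta>\<in>UNIV. \<Sum>\<sigma>\<in>UNIV. ?G $ \<alpha> $ \<beta> * christoffel \<gamma> \<sigma> \<alpha> \<beta> x * partial_deriv \<sigma> ?f x)"
      by (simp add: sum_distrib_left mult.assoc)
    also have "\<dots> = (\<Sum>\<alpha>\<in>UNIV. \<Sum>\<sigma>\<in>UNIV. \<Sum>\<beta>\<in>UNIV. ?G $ \<alpha> $ \<beta> * christoffel \<gamma> \<sigma> \<alpha> \<beta> x * partial_deriv \<sigma> ?f x)"
      by (intro sum.cong refl sum.swap)
    also have "\<dots> = (\<Sum>\<sigma>\<in>UNIV. \<Sum>\<alpha>\<in>UNIV. \<Sum>\<beta>\<in>UNIV. ?G $ \<alpha> $ \<beta> * christoffel \<gamma> \<sigma> \<alpha> \<beta> x * partial_deriv \<sigma> ?f x)"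
      by (rule sum.swap)
    finally show ?thesis by (simp add: sum_distrib_right)
  qed
  have C: "(\<Sum>\<alpha>\<in>UNIV. \<Sum>\<beta>\<in>UNIV. ?G $ \<alpha> $ \<beta> * sff_coeff \<gamma> g F x \<alpha> \<beta> i)
    = (\<Sum>\<alpha>\<in>UNIV. \<Sum>\<beta>\<in>UNIV. ?G $ \<alpha> $ \<beta> * partial_deriv \<alpha> (partial_deriv \<beta> ?f) x)
      - (\<Sum>\<alpha>\<in>UNIV. \<Sum>\<beta>\<in>UNIV. ?G $ \<alpha> $ \<beta> * (\<Sum>\<sigma>\<in>UNIV. christoffel \<gamma> \<sigma> \<alpha> \<beta> x * partial_deriv \<sigma> ?f x))
      + (\<Sum>\<alpha>\<in>UNIV. \<Sum>\<beta>\<in>UNIV. ?G $ \<alpha> $ \<beta> * (\<Sum>j\<in>UNIV. \<Sum>k\<in>UNIV. christoffel g i j k (F x)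
          * partial_deriv \<alpha> (\<lambda>y. F y $ j) x * partial_deriv \<beta> (\<lambda>y. F y $ k) x))"
    unfolding sff_coeff_def by (simp only: distrib_left right_diff_distrib sum.distrib sum_subtractf)
  have E: "(\<Sum>\<alpha>\<in>UNIV. \<Sum>\<beta>\<in>UNIV. ?G $ \<alpha> $ \<beta> * (\<Sum>j\<in>UNIV. \<Sum>k\<in>UNIV. christoffel g i j k (F x)
          * partial_deriv \<alpha> (\<lambda>y. F y $ j) x * partial_deriv \<beta> (\<lambda>y. F y $ k) x))
    = (\<Sum>\<alpha>\<in>UNIV. \<Sum>\<beta>\<in>UNIV. \<Sum>j\<in>UNIV. \<Sum>k\<in>UNIV. ?G $ \<alpha> $ \<beta> * christoffel g i j k (F x)
          * partial_deriv \<alpha> (\<lambda>y. F y $ j) x * partial_deriv \<beta> (\<lambda>y. F y $ k) x)"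
    by (simp add: sum_distrib_left mult.assoc)
  have N: "(\<Sum>\<beta>\<in>UNIV. - Z \<beta> * partial_deriv \<beta> ?f x) = - (\<Sum>\<beta>\<in>UNIV. Z \<beta> * partial_deriv \<beta> ?f x)" for Z
    by (simp add: sum_negf)
  show ?thesis unfolding tension_def A Q N C B E by simp
qed

text \<open>Where the metric is pulled back, its inverse is pushed forward; this is what makes the
  metric trace independent of the chart.\<close>

lemma inverse_metric_pushforward:
  fixes h g P :: "real^'m::finite^'m"
  assumes h: "det h \<noteq> 0" and g: "det g \<noteq> 0" and pull: "\<And>a b. a \<bullet> (h *v b) = (P *v a) \<bullet> (g *v (P *v b))"
  shows "P ** matrix_inv h ** transpose P = matrix_inv g"
proof -
  have tr: "(P *v a) \<bullet> w = a \<bullet> (transpose P *v w)" for a w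
    using dot_lmul_matrix[of w P a] by (simp add: transpose_matrix_vector inner_commute)
  have "a \<bullet> (h *v b) = a \<bullet> ((transpose P ** g ** P) *v b)" for a b
    unfolding pull tr by (simp add: matrix_vector_mul_assoc matrix_mul_assoc)
  then have "h *v b = (transpose P ** g ** P) *v b" for b by (metis vector_eq_ldot)
  then have "h = transpose P ** g ** P" by (simp add: matrix_eq)
  then have "(transpose P ** g) ** (P ** matrix_inv h) = mat 1"
    by (metis matrix_inv_mult(1)[OF h] matrix_mul_assoc)
  \<comment> \<open>Two square matrices with product 1 commute, so no separate proof that
    \<open>P\<close> is invertible is required.\<close>
  then have "(P ** matrix_inv h) ** (transpose P ** g) = mat 1" by (simp add: matrix_left_right_inverse)
  then have "(P ** matrix_inv h ** transpose P) ** g ** matrix_inv g = matrix_inv g" by (simp add: matrix_mul_assoc)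
  then show ?thesis by (simp add: matrix_mul_assoc[symmetric] matrix_inv_mult(1)[OF g])
qed

lemma trace_pushforward:
  fixes h g P :: "real^'m::finite^'m"
  assumes "P ** h ** transpose P = g"
  shows "(\<Sum>\<alpha>\<in>UNIV. \<Sum>\<beta>\<in>UNIV. h $ \<alpha> $ \<beta> * (\<Sum>a\<in>UNIV. \<Sum>b\<in>UNIV. P $ a $ \<alpha> * P $ b $ \<beta> * C a b))
    = (\<Sum>a\<in>UNIV. \<Sum>b\<in>UNIV. g $ a $ b * C a b)"
proof -
  have g: "g $ a $ b = (\<Sum>\<alpha>\<in>UNIV. \<Sum>\<beta>\<in>UNIV. h $ \<alpha> $ \<beta> * (P $ a $ \<alpha> * P $ b $ \<beta>))" for a b
  proof -
    have "g $ a $ b = (\<Sum>\<beta>\<in>UNIV. \<Sum>\<alpha>\<in>UNIV. h $ \<alpha> $ \<beta> * (P $ a $ \<alpha> * P $ b $ \<beta>))"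
      unfolding assms[symmetric] by (simp add: matrix_matrix_mult_def transpose_def sum_distrib_left sum_distrib_right mult_ac)
    also note sum.swap
    finally show ?thesis .
  qed
  have "(\<Sum>\<alpha>\<in>UNIV. \<Sum>\<beta>\<in>UNIV. h $ \<alpha> $ \<beta> * (\<Sum>a\<in>UNIV. \<Sum>b\<in>UNIV. P $ a $ \<alpha> * P $ b $ \<beta> * C a b))
    = (\<Sum>\<alpha>\<in>UNIV. \<Sum>\<beta>\<in>UNIV. \<Sum>a\<in>UNIV. \<Sum>b\<in>UNIV. h $ \<alpha> $ \<beta> * (P $ a $ \<alpha> * P $ b $ \<beta>) * C a b)"
    by (simp add: sum_distrib_left mult_ac)
  also have "\<dots> = (\<Sum>a\<in>UNIV. \<Sum>b\<in>UNIV. \<Sum>\<alpha>\<in>UNIV. \<Sum>\<beta>\<in>UNIV. h $ \<alpha> $ \<beta> * (P $ a $ \<alpha> * P $ b $ \<beta>) * C a b)"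
    by (rule sum_swap_pairs)
  finally show ?thesis unfolding g sum_distrib_right .
qed

text \<open>The second fundamental form is pulled back by the derivative of \<open>\<phi>\<close>
  while the inverse metric is pushed forward, so the trace is unchanged.\<close>

lemma tension_domain_change:
  fixes F :: "real^'m::finite \<Rightarrow> real^'n::finite" and \<phi> :: "real^'m \<Rightarrow> real^'m"
  assumes \<gamma>: "metric_field \<gamma> T" and \<eta>: "metric_field \<eta> S" and \<phi>: "smooth_on \<phi> S" "\<phi> ` S \<subseteq> T" and surj: "surj (fd \<phi> x)"
    and pull: "\<And>x a b. x \<in> S \<Longrightarrow> a \<bullet> (\<eta> x *v b) = fd \<phi> x a \<bullet> (\<gamma> (\<phi> x) *v fd \<phi> x b)" and x: "x \<in> S"
    and F: "smooth_on F T"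
  shows "tension \<eta> g (\<lambda>y. F (\<phi> y)) i x = tension \<gamma> g F i (\<phi> x)"
proof -
  have o: "open T" "open S" using \<gamma> \<eta> metric_fieldD(1) by auto
  have y: "\<phi> x \<in> T" using \<phi>(2) x by auto
  have sF\<phi>: "smooth_on (\<lambda>y. F (\<phi> y)) S" by (rule smooth_on_compose[OF o(2,1) \<phi>(2) F \<phi>(1)])
  define P where "P = matrix (fd \<phi> x)"
  have P: "fd \<phi> x w = P *v w" for w unfolding P_def by (simp add: fd_linear[OF \<phi>(1) o(2) x])
  have Pc: "fd \<phi> x (axis \<alpha> 1) $ a = P $ a $ \<alpha>" for \<alpha> a unfolding P_def by (simp add: matrix_def)
  have inv: "P ** matrix_inv (\<eta> x) ** transpose P = matrix_inv (\<gamma> (\<phi> x))"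
    using metric_field_det[OF \<eta> x] metric_field_det[OF \<gamma> y] pull[OF x]
    by (intro inverse_metric_pushforward) (auto simp: P)
  have c: "sff_coeff \<eta> g (\<lambda>y. F (\<phi> y)) x \<alpha> \<beta> i = (\<Sum>a\<in>UNIV. \<Sum>b\<in>UNIV. P $ a $ \<alpha> * P $ b $ \<beta> * sff_coeff \<gamma> g F (\<phi> x) a b i)" for \<alpha> \<beta>
  proof -
    have "sff \<eta> g (\<lambda>y. F (\<phi> y)) x (axis \<alpha> 1) (axis \<beta> 1) = sff \<gamma> g F (\<phi> x) (fd \<phi> x (axis \<alpha> 1)) (fd \<phi> x (axis \<beta> 1))"
      by (rule sff_domain_change[OF \<gamma> \<eta> \<phi> surj pull x F])
    then show ?thesis unfolding sff_axis[OF sF\<phi> o(2) x, symmetric] by (simp only: sff_expand[OF F o(1) y] Pc)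
  qed
  show ?thesis
    unfolding tension_trace[OF \<eta> sF\<phi> x] tension_trace[OF \<gamma> F y] c by (rule trace_pushforward[OF inv])
qed

text \<open>The tension transforms as a tangent vector of the target; in particular, if it vanishes
  in one target chart, it vanishes in the other.\<close>

lemma tension_target_change:
  fixes F :: "real^'m::finite \<Rightarrow> real^'n::finite" and \<psi> :: "real^'n \<Rightarrow> real^'n"
  assumes g: "metric_field g T" and h: "metric_field h T'" and \<psi>: "smooth_on \<psi> T" "\<psi> ` T \<subseteq> T'" and surj: "surj (fd \<psi> (F x))"
    and pull: "\<And>y a b. y \<in> T \<Longrightarrow> a \<bullet> (g y *v b) = fd \<psi> y a \<bullet> (h (\<psi> y) *v fd \<psi> y b)"
    and \<gamma>: "metric_field \<gamma> S" and F: "smooth_on F S" "F ` S \<subseteq> T" "x \<in> S"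
  shows "tension \<gamma> h (\<lambda>z. \<psi> (F z)) i x = (\<Sum>j\<in>UNIV. tension \<gamma> g F j x * fd \<psi> (F x) (axis j 1) $ i)"
proof -
  have o: "open T" "open S" using g \<gamma> metric_fieldD(1) by auto
  have y: "F x \<in> T" using F by auto
  have s: "smooth_on (\<lambda>z. \<psi> (F z)) S" by (rule smooth_on_compose[OF o(2,1) F(2) \<psi>(1) F(1)])
  have c: "sff_coeff \<gamma> h (\<lambda>z. \<psi> (F z)) x \<alpha> \<beta> i = (\<Sum>j\<in>UNIV. sff_coeff \<gamma> g F x \<alpha> \<beta> j * fd \<psi> (F x) (axis j 1) $ i)" for \<alpha> \<beta>
  proof -
    have "sff_coeff \<gamma> h (\<lambda>z. \<psi> (F z)) x \<alpha> \<beta> i = fd \<psi> (F x) (sff \<gamma> g F x (axis \<alpha> 1) (axis \<beta> 1)) $ i"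
    proof -
      have "sff \<gamma> h (\<lambda>z. \<psi> (F z)) x (axis \<alpha> 1) (axis \<beta> 1) = fd \<psi> (F x) (sff \<gamma> g F x (axis \<alpha> 1) (axis \<beta> 1))"
        by (rule sff_target_change[OF g h \<psi> surj pull F(1) o(2) F(2,3)])
      then show ?thesis unfolding sff_axis[OF s o(2) F(3), symmetric] by (simp only:)
    qed
    also have "\<dots> = (\<Sum>j\<in>UNIV. sff \<gamma> g F x (axis \<alpha> 1) (axis \<beta> 1) $ j * fd \<psi> (F x) (axis j 1) $ i)"
      by (subst linear_axis_expand[OF fd_linear[OF \<psi>(1) o(1) y]]) simp
    finally show ?thesis unfolding sff_axis[OF F(1) o(2) F(3)] .
  qed
  have "(\<Sum>\<alpha>\<in>UNIV. \<Sum>\<beta>\<in>UNIV. \<Sum>j\<in>UNIV. matrix_inv (\<gamma> x) $ \<alpha> $ \<beta> * (sff_coeff \<gamma> g F x \<alpha> \<beta> j * fd \<psi> (F x) (axis j 1) $ i))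
    = (\<Sum>\<alpha>\<in>UNIV. \<Sum>j\<in>UNIV. \<Sum>\<beta>\<in>UNIV. matrix_inv (\<gamma> x) $ \<alpha> $ \<beta> * (sff_coeff \<gamma> g F x \<alpha> \<beta> j * fd \<psi> (F x) (axis j 1) $ i))"
    by (intro sum.cong refl sum.swap)
  also have "\<dots> = (\<Sum>j\<in>UNIV. \<Sum>\<alpha>\<in>UNIV. \<Sum>\<beta>\<in>UNIV. matrix_inv (\<gamma> x) $ \<alpha> $ \<beta> * (sff_coeff \<gamma> g F x \<alpha> \<beta> j * fd \<psi> (F x) (axis j 1) $ i))"
    by (rule sum.swap)
  finally show ?thesis
    unfolding tension_trace[OF \<gamma> s F(3)] tension_trace[OF \<gamma> F(1,3)] c by (simp add: sum_distrib_left sum_distrib_right mult.assoc)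
qed

subsection \<open>Harmonic maps in coordinates\<close>

lemma smooth_on_christoffel:
  assumes g: "metric_field g T"
  shows "smooth_on (\<lambda>y. christoffel g i j k y) T"
proof -
  note D = metric_fieldD[OF g]
  have "det (g y) \<noteq> 0" if "y \<in> T" for y using metric_field_det[OF g that] by simp
  then show ?thesis unfolding christoffel_def
    by (intro smooth_intros smooth_on_partial D(1,2))
qed

text \<open>The minimum over the compact unit sphere, extended by homogeneity. It supplies the
  ellipticity constant.\<close>

lemma pos_def_lower_bound:
  fixes A :: "real^'n::finite^'n"
  assumes pos: "\<And>v. v \<noteq> 0 \<Longrightarrow> v \<bullet> (A *v v) > 0"
  obtains lam where "lam > 0" "\<And>v. lam * (v \<bullet> v) \<le> v \<bullet> (A *v v)"
proof -
  have ne: "sphere 0 1 \<noteq> ({} :: (real^'n) set)" by (metis sphere_eq_empty not_one_less_zero)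
  have "continuous_on (sphere 0 1) (\<lambda>v. v \<bullet> (A *v v))"
    by (intro continuous_intros bounded_linear.continuous_on[OF matrix_vector_mul_bounded_linear])
  then obtain u where u: "u \<in> sphere 0 1" "\<And>v. v \<in> sphere 0 1 \<Longrightarrow> u \<bullet> (A *v u) \<le> v \<bullet> (A *v v)"
    using continuous_attains_inf[OF compact_sphere ne] by metis
  show ?thesis
  proof (rule that)
    show "0 < u \<bullet> (A *v u)" using u(1) by (intro pos) auto
    fix v :: "real^'n"
    show "u \<bullet> (A *v u) * (v \<bullet> v) \<le> v \<bullet> (A *v v)"
    proof (cases "v = 0")
      case False
      define w where "w = v /\<^sub>R norm v"
      have w: "w \<in> sphere 0 1" "v = norm v *\<^sub>R w" using False by (auto simp: w_def)
      have "v \<bullet> (A *v v) = (norm v)\<^sup>2 * (w \<bullet> (A *v w))"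
        by (subst (1 2) w(2)) (simp add: matrix_vector_mult_scaleR power2_eq_square)
      moreover have "(norm v)\<^sup>2 * (u \<bullet> (A *v u)) \<le> (norm v)\<^sup>2 * (w \<bullet> (A *v w))"
        by (intro mult_left_mono u(2) w(1)) simp
      ultimately show ?thesis by (simp add: power2_norm_eq_inner mult.commute)
    qed simp
  qed
qed

text \<open>\<open>local_solution\<close> wants coefficients on the whole space, base points at the
  origin and an equation in non-divergence form. So the inverse metric and the Christoffel symbols
  are extended smoothly, both base points are translated to 0, and the tension is used as a trace;
  on the final ball the extensions have their true values.\<close>

lemma local_harmonic:
  fixes A :: "real^'m::finite^'n::finite"
  assumes \<gamma>: "metric_field \<gamma> S" "x0 \<in> S" and g: "metric_field g T" "y0 \<in> T"
  obtains f :: "real^'m \<Rightarrow> real^'n" and r :: real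
  where "r > 0" "ball x0 r \<subseteq> S" "smooth_on f UNIV" "f ` ball x0 r \<subseteq> T" "f x0 = y0" "\<And>v. fd f x0 v = A *v v"
    "\<And>x i. x \<in> ball x0 r \<Longrightarrow> tension \<gamma> g f i x = 0"
proof -
  note D\<gamma> = metric_fieldD[OF \<gamma>(1)] and Dg = metric_fieldD[OF g(1)]
  have nz: "det (\<gamma> x) \<noteq> 0" if "x \<in> S" for x using metric_field_det[OF \<gamma>(1) that] by simp
  have "smooth_on (\<lambda>x. matrix_inv (\<gamma> x)) S" by (intro smooth_intros D\<gamma>(1,2) nz)
  from smooth_extension[OF D\<gamma>(1) \<gamma>(2) this] obtain G r1
    where G: "smooth_on G UNIV" "r1 > 0" "ball x0 r1 \<subseteq> S" "\<And>x. x \<in> ball x0 r1 \<Longrightarrow> G x = matrix_inv (\<gamma> x)" by metis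
  have "smooth_on (\<lambda>x. \<chi> \<sigma> \<alpha> \<beta>. christoffel \<gamma> \<sigma> \<alpha> \<beta> x) S"
    by (intro smooth_intros D\<gamma>(1) smooth_on_christoffel[OF \<gamma>(1)])
  from smooth_extension[OF D\<gamma>(1) \<gamma>(2) this] obtain K r2
    where K: "smooth_on K UNIV" "r2 > 0" "ball x0 r2 \<subseteq> S" "\<And>x. x \<in> ball x0 r2 \<Longrightarrow> K x = (\<chi> \<sigma> \<alpha> \<beta>. christoffel \<gamma> \<sigma> \<alpha> \<beta> x)" by metis
  have "smooth_on (\<lambda>y. \<chi> i j k. christoffel g i j k y) T"
    by (intro smooth_intros Dg(1) smooth_on_christoffel[OF g(1)])
  from smooth_extension[OF Dg(1) g(2) this] obtain C r3
    where C: "smooth_on C UNIV" "r3 > 0" "ball y0 r3 \<subseteq> T" "\<And>y. y \<in> ball y0 r3 \<Longrightarrow> C y = (\<chi> i j k. christoffel g i j k y)" by metis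
  let ?x = "\<lambda>z :: real^('m + ('n + 'n \<times> 'm)). x0 + (\<chi> \<alpha>. z $ Inl \<alpha>)"
  let ?y = "\<lambda>z :: real^('m + ('n + 'n \<times> 'm)). y0 + (\<chi> j. z $ Inr (Inl j))"
  define a where "a = (\<lambda>\<alpha> \<beta> x. G (x0 + x) $ \<alpha> $ \<beta>)"
  \<comment> \<open>The trace of the terms of the second fundamental form below order two, with the
    derivatives of the map read from the slots of the jet.\<close>
  define H where "H = (\<lambda>i z. \<Sum>\<alpha>\<in>UNIV. \<Sum>\<beta>\<in>UNIV. G (?x z) $ \<alpha> $ \<beta> *
      (- (\<Sum>\<sigma>\<in>UNIV. K (?x z) $ \<sigma> $ \<alpha> $ \<beta> * z $ Inr (Inr (i, \<sigma>)))
       + (\<Sum>j\<in>UNIV. \<Sum>k\<in>UNIV. C (?y z) $ i $ j $ k * z $ Inr (Inr (j, \<alpha>)) * z $ Inr (Inr (k, \<beta>)))))"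
  have sx: "smooth_on ?x UNIV" and sy: "smooth_on ?y UNIV" by (intro smooth_intros open_UNIV)+
  have sGx: "smooth_on (\<lambda>z. G (?x z)) UNIV" by (rule smooth_on_compose[OF open_UNIV open_UNIV _ G(1) sx]) simp
  have sKx: "smooth_on (\<lambda>z. K (?x z)) UNIV" by (rule smooth_on_compose[OF open_UNIV open_UNIV _ K(1) sx]) simp
  have sCy: "smooth_on (\<lambda>z. C (?y z)) UNIV" by (rule smooth_on_compose[OF open_UNIV open_UNIV _ C(1) sy]) simp
  have sz: "smooth_on (\<lambda>z :: real^('m + ('n + 'n \<times> 'm)). z $ p) UNIV" for p by (intro smooth_intros open_UNIV)
  have sH: "smooth_on (H i) UNIV" for i
  proof -
    have 1: "smooth_on (\<lambda>z. G (?x z) $ \<alpha> $ \<beta>) UNIV" for \<alpha> \<beta> by (intro smooth_on_nth open_UNIV sGx)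
    have 2: "smooth_on (\<lambda>z. K (?x z) $ \<sigma> $ \<alpha> $ \<beta>) UNIV" for \<sigma> \<alpha> \<beta> by (intro smooth_on_nth open_UNIV sKx)
    have 3: "smooth_on (\<lambda>z. C (?y z) $ i $ j $ k) UNIV" for i j k by (intro smooth_on_nth open_UNIV sCy)
    show ?thesis unfolding H_def
      by (intro smooth_on_sum smooth_on_mult smooth_on_add smooth_on_minus open_UNIV 1 2 3 sz)
  qed
  have sa: "smooth_on (a \<alpha> \<beta>) UNIV" for \<alpha> \<beta>
  proof -
    have "smooth_on (\<lambda>x. G (x0 + x)) UNIV"
      by (rule smooth_on_compose[OF open_UNIV open_UNIV _ G(1)]) (simp, intro smooth_intros open_UNIV)
    then show ?thesis unfolding a_def by (intro smooth_on_nth open_UNIV)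
  qed
  have Gx0: "G x0 = matrix_inv (\<gamma> x0)" using G(2,4) by simp
  \<comment> \<open>With \<open>w = G x0 *v v\<close> this is the value of the metric itself on
    \<open>w\<close>.\<close>
  have "v \<bullet> (G x0 *v v) > 0" if "v \<noteq> 0" for v
  proof -
    define w where "w = G x0 *v v"
    have v: "\<gamma> x0 *v w = v" unfolding w_def Gx0 by (simp add: matrix_vector_mul_assoc matrix_inv_mult nz[OF \<gamma>(2)])
    then have "w \<noteq> 0" using that by auto
    from D\<gamma>(4)[OF \<gamma>(2) this] show ?thesis unfolding v by (simp add: w_def inner_commute)
  qed
  from pos_def_lower_bound[OF this] obtain lam where lam: "lam > 0" "\<And>v. lam * (v \<bullet> v) \<le> v \<bullet> (G x0 *v v)" by metis
  have ell: "lam * (\<Sum>i\<in>UNIV. (\<xi> i)\<^sup>2) \<le> (\<Sum>\<alpha>\<in>UNIV. \<Sum>\<beta>\<in>UNIV. a \<alpha> \<beta> 0 * \<xi> \<alpha> * \<xi> \<beta>)" for \<xi> :: "'m \<Rightarrow> real"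
    using lam(2)[of "\<chi> \<alpha>. \<xi> \<alpha>"] by (simp add: inner_vec_def matrix_vector_mult_def a_def sum_distrib_left power2_eq_square mult_ac)
  obtain F r4 where F: "r4 > 0" "\<And>i. smooth_on (F i) UNIV" "\<And>i. F i 0 = 0" "\<And>i \<alpha>. partial_deriv \<alpha> (F i) 0 = A $ i $ \<alpha>"
    "\<And>x i. x \<in> ball 0 r4 \<Longrightarrow> (\<Sum>\<alpha>\<in>UNIV. \<Sum>\<beta>\<in>UNIV. a \<alpha> \<beta> x * partial_deriv \<alpha> (partial_deriv \<beta> (F i)) x) + H i (jet F x) = 0"
    by (rule local_solution[of a H lam "\<lambda>i \<alpha>. A $ i $ \<alpha>", OF sa sH lam(1) ell]) (rule that; assumption)
  define f where "f = (\<lambda>x. y0 + (\<chi> i. F i (- x0 + x)))"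
  have sFs: "smooth_on (\<lambda>x. F i (- x0 + x)) UNIV" for i
    by (rule smooth_on_compose[OF open_UNIV open_UNIV _ F(2)]) (simp, intro smooth_intros open_UNIV)
  have sf: "smooth_on f UNIV" unfolding f_def by (intro smooth_intros open_UNIV sFs)
  have fx0: "f x0 = y0" by (simp add: f_def F(3) vec_eq_iff)
  have pf: "partial_deriv \<alpha> (\<lambda>y. f y $ j) x = partial_deriv \<alpha> (F j) (- x0 + x)" for \<alpha> j x
  proof -
    have "((\<lambda>y. y0 $ j + F j (- x0 + y)) has_derivative (\<lambda>v. 0 + fd (\<lambda>y. F j (- x0 + y)) x v)) (at x)"
      by (intro has_derivative_add has_derivative_const smooth_on_deriv[OF sFs open_UNIV UNIV_I])
    from fd_eqI[OF this] have "partial_deriv \<alpha> (\<lambda>y. f y $ j) x = partial_deriv \<alpha> (\<lambda>y. F j (- x0 + y)) x"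
      by (simp add: partial_deriv_def f_def)
    then show ?thesis by (simp only: partial_shift[OF F(2)])
  qed
  have ppf: "partial_deriv \<alpha> (partial_deriv \<beta> (\<lambda>y. f y $ j)) x = partial_deriv \<alpha> (partial_deriv \<beta> (F j)) (- x0 + x)" for \<alpha> \<beta> j x
    unfolding pf by (rule partial_shift[OF smooth_on_partial[OF F(2)]])
  \<comment> \<open>Keeps the image in the ball where the extended Christoffel symbols of the target
    are the true ones.\<close>
  obtain r5 where r5: "r5 > 0" "\<And>x. x \<in> ball x0 r5 \<Longrightarrow> f x \<in> ball y0 r3"
  proof -
    have "isCont f x0" using smooth_on_continuous[OF sf] by (simp add: continuous_on_eq_continuous_at)
    then obtain \<delta> where "\<delta> > 0" "\<And>x. dist x x0 < \<delta> \<Longrightarrow> dist (f x) (f x0) < r3"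
      using C(2) unfolding continuous_at_eps_delta by metis
    then show ?thesis using that[of \<delta>] by (auto simp: fx0 dist_commute)
  qed
  define r where "r = Min {r1, r2, r4, r5}"
  have r: "r > 0" "r \<le> r1" "r \<le> r2" "r \<le> r4" "r \<le> r5" using G(2) K(2) F(1) r5(1) by (auto simp: r_def)
  show ?thesis
  proof (rule that[OF r(1)])
    show S: "ball x0 r \<subseteq> S" using G(3) r(2) by (auto dest: subset_ball)
    show "smooth_on f UNIV" "f x0 = y0" by (fact sf, fact fx0)
    show "f ` ball x0 r \<subseteq> T" using r5(2) C(3) r(5) by (auto dest: subset_ball)
    show "fd f x0 v = A *v v" for v
    proof -
      have "fd f x0 v $ i = (A *v v) $ i" for i
      proof -
        have "fd f x0 v $ i = (\<Sum>\<alpha>\<in>UNIV. v $ \<alpha> * partial_deriv \<alpha> (\<lambda>y. f y $ i) x0)"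
          unfolding fd_component[OF sf open_UNIV UNIV_I]
          by (rule frechet_partial[OF smooth_on_deriv[OF smooth_on_nth[OF open_UNIV sf] open_UNIV UNIV_I]])
        then show ?thesis unfolding pf by (simp add: F(4) matrix_vector_mult_def mult.commute)
      qed
      then show ?thesis by (simp add: vec_eq_iff)
    qed
    fix x i assume x: "x \<in> ball x0 r"
    have x': "x \<in> ball x0 r1" "x \<in> ball x0 r2" "- x0 + x \<in> ball 0 r4" "x \<in> ball x0 r5" "x \<in> S"
      using x r S by (auto simp: dist_norm norm_minus_commute)
    let ?z = "jet F (- x0 + x)"
    have X: "?x ?z = x" by (simp add: jet_def vec_eq_iff)
    have Y: "?y ?z = f x" by (simp add: jet_def f_def)
    have Z: "?z $ Inr (Inr (j, \<alpha>)) = partial_deriv \<alpha> (F j) (- x0 + x)" for j \<alpha> by (simp add: jet_def)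
    have GX: "a \<alpha> \<beta> (- x0 + x) = matrix_inv (\<gamma> x) $ \<alpha> $ \<beta>" "G x = matrix_inv (\<gamma> x)" for \<alpha> \<beta>
      using G(4)[OF x'(1)] by (simp_all add: a_def)
    have KX: "K x $ \<sigma> $ \<alpha> $ \<beta> = christoffel \<gamma> \<sigma> \<alpha> \<beta> x" for \<sigma> \<alpha> \<beta> using K(4)[OF x'(2)] by simp
    have CX: "C (f x) $ i $ j $ k = christoffel g i j k (f x)" for i j k using C(4)[OF r5(2)[OF x'(4)]] by simp
    have "tension \<gamma> g f i x = (\<Sum>\<alpha>\<in>UNIV. \<Sum>\<beta>\<in>UNIV. matrix_inv (\<gamma> x) $ \<alpha> $ \<beta> * sff_coeff \<gamma> g f x \<alpha> \<beta> i)"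
      by (rule tension_trace[OF \<gamma>(1) smooth_on_subset[OF sf subset_UNIV] x'(5)])
    also have "\<dots> = (\<Sum>\<alpha>\<in>UNIV. \<Sum>\<beta>\<in>UNIV. a \<alpha> \<beta> (- x0 + x) * partial_deriv \<alpha> (partial_deriv \<beta> (F i)) (- x0 + x)) + H i ?z"
      unfolding H_def X Y Z GX KX CX sff_coeff_def ppf pf sum.distrib[symmetric] distrib_left[symmetric]
      by (intro sum.cong refl arg_cong2[where f = "(*)"]) simp
    finally show "tension \<gamma> g f i x = 0" using F(5)[OF x'(3), of i] by simp
  qed
qed

subsection \<open>Charts and tangent spaces\<close>

lemma smooth_atlasD:
  assumes "smooth_atlas X A" "c \<in> A"
  shows "openin X (chart_dom c)" "open (chart_map c ` chart_dom c)" "inj_on (chart_map c) (chart_dom c)"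
    "\<And>Q. openin X Q \<Longrightarrow> open (chart_map c ` (Q \<inter> chart_dom c))"
    "\<And>Q. open Q \<Longrightarrow> openin X {P \<in> chart_dom c. chart_map c P \<in> Q}"
    "\<And>d. d \<in> A \<Longrightarrow> smooth_on (chart_map d \<circ> chart_inv c) (chart_map c ` (chart_dom c \<inter> chart_dom d))"
proof -
  let ?D = "chart_dom c" and ?f = "chart_map c"
  have ch: "is_chart X c" using assms by (auto simp: smooth_atlas_def)
  then have o: "openin X ?D" "open (?f ` ?D)" and h: "homeomorphic_map (subtopology X ?D) (top_of_set (?f ` ?D)) ?f"
    by (auto simp: is_chart_def)
  have ts: "topspace (subtopology X ?D) = ?D" using openin_subset[OF o(1)] by auto
  show "openin X ?D" "open (?f ` ?D)" by (fact o)+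
  show "inj_on ?f ?D" using homeomorphic_imp_injective_map[OF h] unfolding ts .
  show "open (?f ` (Q \<inter> ?D))" if "openin X Q" for Q
  proof -
    have "openin (subtopology X ?D) (Q \<inter> ?D)" using that by (auto simp: openin_subtopology)
    then have "openin (top_of_set (?f ` ?D)) (?f ` (Q \<inter> ?D))"
      using homeomorphic_imp_open_map[OF h] by (auto simp: open_map_def)
    then show ?thesis using o(2) openin_open_trans by blast
  qed
  show "openin X {P \<in> ?D. ?f P \<in> Q}" if "open Q" for Q
  proof -
    have "continuous_map (subtopology X ?D) euclidean ?f"
      using homeomorphic_imp_continuous_map[OF h] by (rule continuous_map_into_fulltopology)
    then have "openin (subtopology X ?D) {P \<in> topspace (subtopology X ?D). ?f P \<in> Q}"
      using that by (intro openin_continuous_map_preimage) auto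
    then show ?thesis unfolding ts openin_open_subtopology[OF o(1)] by auto
  qed
  show "smooth_on (chart_map d \<circ> chart_inv c) (chart_map c ` (chart_dom c \<inter> chart_dom d))" if "d \<in> A" for d
    using assms that by (auto simp: smooth_atlas_def)
qed

lemma chart_inv_chart_map:
  assumes "smooth_atlas X A" "c \<in> A" "P \<in> chart_dom c"
  shows "chart_inv c (chart_map c P) = P"
  unfolding chart_inv_def by (rule inv_into_f_f[OF smooth_atlasD(3)[OF assms(1,2)] assms(3)])

lemma chart_inv_in:
  assumes "x \<in> chart_map c ` chart_dom c"
  shows "chart_inv c x \<in> chart_dom c" "chart_map c (chart_inv c x) = x"
  unfolding chart_inv_def using assms by (auto intro: inv_into_into f_inv_into_f)

abbreviation transition :: "('a, 'm::finite) chart \<Rightarrow> ('a, 'm) chart \<Rightarrow> real^'m \<Rightarrow> real^'m" where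
  "transition c d \<equiv> \<lambda>x. chart_map d (chart_inv c x)"

abbreviation jacobian :: "('a, 'm::finite) chart \<Rightarrow> ('a, 'm) chart \<Rightarrow> 'a \<Rightarrow> real^'m \<Rightarrow> real^'m" where
  "jacobian c d P \<equiv> fd (transition c d) (chart_map c P)"

lemma transition_smooth:
  assumes A: "smooth_atlas X A" and cd: "c \<in> A" "d \<in> A"
  shows "open (chart_map c ` (chart_dom c \<inter> chart_dom d))"
    "smooth_on (transition c d) (chart_map c ` (chart_dom c \<inter> chart_dom d))"
  using smooth_atlasD(4)[OF A cd(1) smooth_atlasD(1)[OF A cd(2)]] smooth_atlasD(6)[OF A cd]
  by (simp_all add: Int_commute comp_def)

lemma transition_chart_map:
  "smooth_atlas X A \<Longrightarrow> c \<in> A \<Longrightarrow> P \<in> chart_dom c \<Longrightarrow> transition c d (chart_map c P) = chart_map d P"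
  by (simp add: chart_inv_chart_map)

lemma jacobian_linear:
  assumes "smooth_atlas X A" "c \<in> A" "d \<in> A" "P \<in> chart_dom c" "P \<in> chart_dom d"
  shows "linear (jacobian c d P)"
  using assms by (intro fd_linear[OF transition_smooth(2,1)[OF assms(1-3)]]) auto

lemma jacobian_chain:
  assumes A: "smooth_atlas X A" and cde: "c \<in> A" "d \<in> A" "e \<in> A" and P: "P \<in> chart_dom c" "P \<in> chart_dom d" "P \<in> chart_dom e"
  shows "jacobian c e P v = jacobian d e P (jacobian c d P v)"
proof -
  let ?Q = "chart_dom d \<inter> chart_dom e" and ?x = "chart_map c P"
  have op: "open (chart_map c ` (?Q \<inter> chart_dom c))"
    using smooth_atlasD(1)[OF A] cde by (intro smooth_atlasD(4)[OF A cde(1)] openin_Int)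
  have x: "?x \<in> chart_map c ` (?Q \<inter> chart_dom c)" using P by auto
  have "jacobian c e P v = fd (\<lambda>x. transition d e (transition c d x)) ?x v"
    by (rule fd_cong[OF op x]) (auto simp: chart_inv_chart_map[OF A] cde)
  also have "\<dots> = fd (transition d e) (transition c d ?x) (jacobian c d P v)"
    using P by (intro fd_compose[OF transition_smooth(2,1)[OF A cde(2,3)] transition_smooth(2,1)[OF A cde(1,2)]])
      (auto simp: chart_inv_chart_map[OF A] cde)
  finally show ?thesis by (simp add: chart_inv_chart_map[OF A cde(1) P(1)])
qed

lemma jacobian_id:
  assumes A: "smooth_atlas X A" "c \<in> A" and P: "P \<in> chart_dom c"
  shows "jacobian c c P v = v"
proof -
  have "jacobian c c P v = fd (\<lambda>x. x) (chart_map c P) v"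
    using P by (intro fd_cong[OF smooth_atlasD(2)[OF A]]) (auto simp: chart_inv_in)
  then show ?thesis by simp
qed

lemma jacobian_inverse:
  assumes A: "smooth_atlas X A" and cd: "c \<in> A" "d \<in> A" and P: "P \<in> chart_dom c" "P \<in> chart_dom d"
  shows "jacobian d c P (jacobian c d P v) = v"
  using jacobian_chain[OF A cd(1,2,1) P(1,2,1)] jacobian_id[OF A cd(1) P(1)] by metis

lemma tangent_of_coords_apply:
  "tangent_of_coords A c P e = (\<lambda>d. if d \<in> A \<and> P \<in> chart_dom d then jacobian c d P e else 0)"
  unfolding tangent_of_coords_def comp_def ..

lemma tangent_of_coords_self:
  assumes "smooth_atlas X A" "c \<in> A" "P \<in> chart_dom c"
  shows "tangent_of_coords A c P e c = e"
  using assms by (simp add: tangent_of_coords_apply jacobian_id[OF assms])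

lemma tangent_of_coords_in:
  assumes "smooth_atlas X A" "c \<in> A" "P \<in> chart_dom c"
  shows "tangent_of_coords A c P e \<in> tangent_space A P"
  unfolding tangent_space_def mem_Collect_eq comp_def
proof (intro conjI ballI allI impI)
  fix d d' assume "d \<in> A" "d' \<in> A" "P \<in> chart_dom d \<inter> chart_dom d'"
  then show "tangent_of_coords A c P e d' = jacobian d d' P (tangent_of_coords A c P e d)"
    using jacobian_chain[OF assms(1,2) _ _ assms(3), of d d' e] by (simp add: tangent_of_coords_apply)
next
  fix d assume "\<not> (d \<in> A \<and> P \<in> chart_dom d)"
  then show "tangent_of_coords A c P e d = 0" unfolding tangent_of_coords_apply by (rule if_not_P)
qed

lemma tangent_spaceD:
  assumes "v \<in> tangent_space A P"
  shows "c \<in> A \<Longrightarrow> d \<in> A \<Longrightarrow> P \<in> chart_dom c \<Longrightarrow> P \<in> chart_dom d \<Longrightarrow> v d = jacobian c d P (v c)"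
    "\<not> (d \<in> A \<and> P \<in> chart_dom d) \<Longrightarrow> v d = 0"
  using assms unfolding tangent_space_def comp_def by blast+

text \<open>Since a tangent vector is 0 on all charts that do not contain \<open>P\<close>, its
  coordinates in one chart determine it as a function.\<close>

lemma tangent_of_coords_coords:
  assumes "c \<in> A" "P \<in> chart_dom c" "v \<in> tangent_space A P"
  shows "tangent_of_coords A c P (v c) = v"
proof
  fix d
  show "tangent_of_coords A c P (v c) d = v d"
    using tangent_spaceD(1)[OF assms(3,1) _ assms(2), of d] tangent_spaceD(2)[OF assms(3), of d]
    unfolding tangent_of_coords_apply by argo
qed

lemma linear_tangent_of_coords:
  assumes "smooth_atlas X A" "c \<in> A" "P \<in> chart_dom c"
  shows "linear (tangent_of_coords A c P)"
proof (intro linearI ext)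
  fix a b d and t :: real
  have l: "d \<in> A \<Longrightarrow> P \<in> chart_dom d \<Longrightarrow> linear (jacobian c d P)" by (rule jacobian_linear[OF assms(1,2) _ assms(3)])
  show "tangent_of_coords A c P (a + b) d = (tangent_of_coords A c P a + tangent_of_coords A c P b) d"
    "tangent_of_coords A c P (t *\<^sub>R a) d = (t *\<^sub>R tangent_of_coords A c P a) d"
    by (simp_all add: tangent_of_coords_apply scaleR_fun_def linear_add[OF l] linear_scale[OF l])
qed

lemma tangent_of_coords_change:
  assumes "smooth_atlas X A" "c \<in> A" "d \<in> A" "P \<in> chart_dom c" "P \<in> chart_dom d"
  shows "tangent_of_coords A c P e = tangent_of_coords A d P (jacobian c d P e)"
proof
  fix f
  show "tangent_of_coords A c P e f = tangent_of_coords A d P (jacobian c d P e) f"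
    using jacobian_chain[OF assms(1-3) _ assms(4,5), of f e] by (simp add: tangent_of_coords_apply)
qed

subsection \<open>The metric in coordinates\<close>

lemma riemannianD:
  assumes "riemannian_manifold M"
  shows "smooth_atlas (mtop M) (atlas M)"
    "\<And>P. P \<in> topspace (mtop M) \<Longrightarrow> inner_product_on (tangent_space (atlas M) P) (metric M P)"
    "\<And>c. c \<in> atlas M \<Longrightarrow> smooth_on (metric_matrix M c) (chart_map c ` chart_dom c)"
  using assms by (auto simp: riemannian_manifold_def smooth_manifold_def)

lemma metric_matrix_inner:
  assumes M: "riemannian_manifold M" and c: "c \<in> atlas M" "P \<in> chart_dom c"
  shows "a \<bullet> (metric_matrix M c (chart_map c P) *v b)
    = metric M P (tangent_of_coords (atlas M) c P a) (tangent_of_coords (atlas M) c P b)"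
proof -
  note A = riemannianD(1)[OF M]
  let ?t = "tangent_of_coords (atlas M) c P"
  let ?B = "\<lambda>a b. metric M P (?t a) (?t b)"
  have "P \<in> topspace (mtop M)" using openin_subset[OF smooth_atlasD(1)[OF A c(1)]] c(2) by auto
  note ip = riemannianD(2)[OF M this, unfolded inner_product_on_def]
  have t: "?t a \<in> tangent_space (atlas M) P" for a by (rule tangent_of_coords_in[OF A c])
  note lt = linear_tangent_of_coords[OF A c]
  have lin: "linear (\<lambda>a. ?B a b)" for b
    using ip t by (intro linearI) (auto simp: linear_add[OF lt] linear_scale[OF lt])
  have sym: "?B a b = ?B b a" for a b using ip t by auto
  have ex: "?B a b = (\<Sum>i\<in>UNIV. a $ i * ?B (axis i 1) b)" for a b
    using linear_axis_expand[OF lin[of b], where v = a] by simp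
  \<comment> \<open>\<open>inner_product_on\<close> states linearity in the first argument; symmetry
    carries it over to the second.\<close>
  have "?B a b = (\<Sum>i\<in>UNIV. a $ i * (\<Sum>j\<in>UNIV. b $ j * ?B (axis i 1) (axis j 1)))"
    by (subst ex, subst sym, subst ex, subst sym) (rule refl)
  moreover have "metric_matrix M c (chart_map c P) $ i $ j = ?B (axis i 1) (axis j 1)" for i j
    by (simp add: metric_matrix_def chart_inv_chart_map[OF A c])
  ultimately show ?thesis by (simp add: inner_vec_def matrix_vector_mult_def mult.commute)
qed

lemma metric_field_metric_matrix:
  assumes M: "riemannian_manifold M" and c: "c \<in> atlas M"
  shows "metric_field (metric_matrix M c) (chart_map c ` chart_dom c)"
proof -
  note A = riemannianD(1)[OF M]
  have 1: "metric_matrix M c (chart_map c P) $ i $ j = metric_matrix M c (chart_map c P) $ j $ i"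
    "v \<noteq> 0 \<Longrightarrow> v \<bullet> (metric_matrix M c (chart_map c P) *v v) > 0" if P: "P \<in> chart_dom c" for P i j v
  proof -
    let ?t = "tangent_of_coords (atlas M) c P"
    have "P \<in> topspace (mtop M)" using openin_subset[OF smooth_atlasD(1)[OF A c]] P by auto
    note ip = riemannianD(2)[OF M this, unfolded inner_product_on_def]
    have t: "?t a \<in> tangent_space (atlas M) P" for a by (rule tangent_of_coords_in[OF A c P])
    show "metric_matrix M c (chart_map c P) $ i $ j = metric_matrix M c (chart_map c P) $ j $ i"
      using ip t by (auto simp: metric_matrix_def chart_inv_chart_map[OF A c P])
    assume v: "v \<noteq> 0"
    then have "?t v \<noteq> 0" using tangent_of_coords_self[OF A c P, of v] by auto
    then show "v \<bullet> (metric_matrix M c (chart_map c P) *v v) > 0"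
      using ip t by (simp add: metric_matrix_inner[OF M c P])
  qed
  show ?thesis unfolding metric_field_def
    using smooth_atlasD(2)[OF A c] riemannianD(3)[OF M c] 1 by (auto simp del: split_paired_All)
qed

lemma metric_field_subset: "metric_field g T \<Longrightarrow> open S \<Longrightarrow> S \<subseteq> T \<Longrightarrow> metric_field g S"
  unfolding metric_field_def using smooth_on_subset by blast

text \<open>Both sides evaluate the metric on the same pair of tangent vectors, once through the
  chart \<open>c\<close> and once through \<open>d\<close>.\<close>

lemma metric_matrix_pullback:
  assumes M: "riemannian_manifold M" and cd: "c \<in> atlas M" "d \<in> atlas M"
    and x: "x \<in> chart_map c ` (chart_dom c \<inter> chart_dom d)"
  shows "a \<bullet> (metric_matrix M c x *v b)
    = fd (transition c d) x a \<bullet> (metric_matrix M d (transition c d x) *v fd (transition c d) x b)"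
proof -
  note A = riemannianD(1)[OF M]
  obtain P where P: "x = chart_map c P" "P \<in> chart_dom c" "P \<in> chart_dom d" using x by auto
  show ?thesis
    unfolding P(1) transition_chart_map[OF A cd(1) P(2)] metric_matrix_inner[OF M cd(1) P(2)] metric_matrix_inner[OF M cd(2) P(3)]
    by (simp only: tangent_of_coords_change[OF A cd P(2,3), symmetric])
qed

text \<open>A basis of \<open>W\<close> is distributed injectively over the columns, and all other
  columns are zero.\<close>

lemma subspace_range_of_matrix:
  fixes W :: "(real^'n::finite) set"
  assumes W: "subspace W" and d: "dim W \<le> CARD('m::finite)"
  obtains A :: "real^'m^'n" where "range (\<lambda>v. A *v v) = W"
proof -
  obtain B where B: "B \<subseteq> W" "independent B" "span B = W" "card B = dim W"
    using basis_exists[of W] span_minimal[OF _ W] by (metis subset_antisym)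
  have "finite B" using B(2) independent_imp_finite by blast
  then obtain h :: "real^'n \<Rightarrow> 'm" where h: "inj_on h B" using card_le_inj[of B "UNIV :: 'm set"] B(4) d by auto
  define \<phi> where "\<phi> = (\<lambda>\<alpha>. if \<alpha> \<in> h ` B then inv_into B h \<alpha> else 0)"
  define A :: "real^'m^'n" where "A = (\<chi> i \<alpha>. \<phi> \<alpha> $ i)"
  have sub: "B \<subseteq> range \<phi>"
  proof
    fix b assume b: "b \<in> B"
    then have "\<phi> (h b) = b" by (simp add: \<phi>_def inv_into_f_f[OF h])
    then show "b \<in> range \<phi>" by (metis rangeI)
  qed
  have "\<phi> \<alpha> \<in> insert 0 B" for \<alpha> by (auto simp: \<phi>_def inv_into_into)
  then have "range \<phi> \<subseteq> span B" by (metis image_subsetI insertE span_base span_zero)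
  then have s: "span (range \<phi>) = W" using B(3) span_mono[OF sub] span_minimal[of "range \<phi>" "span B"] by auto
  have Aax: "A *v axis \<alpha> 1 = \<phi> \<alpha>" for \<alpha>
    by (simp add: matrix_vector_mult_basis column_def A_def vec_eq_iff)
  have "v \<in> span (range (\<lambda>\<alpha>. axis \<alpha> 1))" for v :: "real^'m"
  proof -
    have "v = (\<Sum>i\<in>UNIV. v $ i *\<^sub>R axis i 1)"
      using linear_axis_expand[OF linear_ident, of v] .
    moreover have "\<dots> \<in> span (range (\<lambda>\<alpha>. axis \<alpha> 1))" by (intro span_sum span_scale span_base) auto
    ultimately show ?thesis by simp
  qed
  then have "range (\<lambda>v. A *v v) = (\<lambda>v. A *v v) ` span (range (\<lambda>\<alpha>. axis \<alpha> 1))" by auto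
  also have "\<dots> = span ((\<lambda>v. A *v v) ` range (\<lambda>\<alpha>. axis \<alpha> 1))"
    by (simp add: linear_span_image matrix_vector_mul_linear)
  also have "(\<lambda>v. A *v v) ` range (\<lambda>\<alpha>. axis \<alpha> 1) = range \<phi>" by (simp add: image_image Aax)
  finally show ?thesis using that s by simp
qed

theorem theoremD:
  fixes M :: "('a, 'm::finite) riemannian"
    and N :: "('b, 'n::finite) riemannian"
    and p :: 'a and q :: 'b
    and V :: "('b, 'n) tangent_vector set"
  assumes "riemannian_manifold M"
    and "riemannian_manifold N"
    and "p \<in> topspace (mtop M)"
    and "q \<in> topspace (mtop N)"
    and "V \<subseteq> tangent_space (atlas N) q"
    and "subspace V"
    and "dim V \<le> CARD('m)"
  shows "\<exists>U f. openin (mtop M) U \<and> p \<in> U \<and> harmonic_map_on M N U f \<and> f p = q \<and>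
           differential (atlas M) (atlas N) f p ` tangent_space (atlas M) p = V"
proof -
  note AM = riemannianD(1)[OF assms(1)] and AN = riemannianD(1)[OF assms(2)]
  note MM = assms(1) and NN = assms(2)
  have "p \<in> (\<Union>c\<in>atlas M. chart_dom c)" using AM assms(3) unfolding smooth_atlas_def by simp
  then obtain c where c: "c \<in> atlas M" "p \<in> chart_dom c" by blast
  have "q \<in> (\<Union>c\<in>atlas N. chart_dom c)" using AN assms(4) unfolding smooth_atlas_def by simp
  then obtain d where d: "d \<in> atlas N" "q \<in> chart_dom d" by blast
  let ?t = "tangent_of_coords (atlas N) d q"
  note lt = linear_tangent_of_coords[OF AN d]
  have injt: "inj ?t" by (metis injI tangent_of_coords_self[OF AN d])
  \<comment> \<open>\<open>V\<close> in the coordinates of the chart \<open>d\<close>.\<close>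
  define W where "W = (\<lambda>v. v d) ` V"
  have tW: "?t ` W = V"
    using tangent_of_coords_coords[OF d] assms(5) by (force simp: W_def image_image)
  have W: "subspace W" unfolding W_def
    by (intro linear_subspace_image assms(6) linearI) (simp_all add: scaleR_fun_def)
  \<comment> \<open>\<open>V\<close> lies in a space of functions, so its dimension is computed by
    carrying a basis of \<open>W\<close> over along the injective linear map
    \<open>?t\<close>.\<close>
  have "dim W \<le> CARD('m)"
  proof -
    obtain B where B: "B \<subseteq> W" "independent B" "span B = W" "card B = dim W"
      using basis_exists[of W] span_minimal[OF _ W] by (metis subset_antisym)
    have "span (?t ` B) = V" using linear_span_image[OF lt, of B] B(3) tW by simp
    then have "span (?t ` B) = span V" by (simp add: span_eq_iff[THEN iffD2, OF assms(6)])
    moreover have "independent (?t ` B)"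
      by (rule linear_independent_injective_image[OF lt B(2)]) (rule inj_on_subset[OF injt subset_UNIV])
    ultimately have "dim V = card (?t ` B)" by (rule dim_eq_card)
    then show ?thesis using assms(7) B(4) card_image[OF inj_on_subset[OF injt subset_UNIV], of B] by simp
  qed
  then obtain A :: "real^'m^'n" where A: "range (\<lambda>v. A *v v) = W" by (rule subspace_range_of_matrix[OF W])
  define x0 where "x0 = chart_map c p"
  define y0 where "y0 = chart_map d q"
  have x0: "x0 \<in> chart_map c ` chart_dom c" and y0: "y0 \<in> chart_map d ` chart_dom d" using c d by (auto simp: x0_def y0_def)
  obtain F r where F: "r > 0" "ball x0 r \<subseteq> chart_map c ` chart_dom c" "smooth_on F UNIV" "F ` ball x0 r \<subseteq> chart_map d ` chart_dom d"
    "F x0 = y0" "\<And>v. fd F x0 v = A *v v" "\<And>x i. x \<in> ball x0 r \<Longrightarrow> tension (metric_matrix M c) (metric_matrix N d) F i x = 0"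
    by (rule local_harmonic[OF metric_field_metric_matrix[OF MM c(1)] x0 metric_field_metric_matrix[OF NN d(1)] y0, of A]) (rule that; assumption)
  define U where "U = {P \<in> chart_dom c. chart_map c P \<in> ball x0 r}"
  define f where "f = (\<lambda>P. chart_inv d (F (chart_map c P)))"
  have U: "openin (mtop M) U" unfolding U_def by (rule smooth_atlasD(5)[OF AM c(1) open_ball])
  have pU: "p \<in> U" using c F(1) by (simp add: U_def x0_def)
  have fp: "f p = q" using F(5) chart_inv_chart_map[OF AN d] by (simp add: f_def x0_def y0_def)
  have fU: "f P \<in> chart_dom d" "chart_map d (f P) = F (chart_map c P)" if "P \<in> U" for P
  proof -
    have "F (chart_map c P) \<in> chart_map d ` chart_dom d" using that F(4) unfolding U_def by blast
    then show "f P \<in> chart_dom d" "chart_map d (f P) = F (chart_map c P)"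
      unfolding f_def by (rule chart_inv_in)+
  qed
  have pre: "openin (mtop M) {P \<in> U. f P \<in> Q}" if "openin (mtop N) Q" for Q
  proof -
    have "continuous_on (ball x0 r) F" by (rule smooth_on_continuous[OF smooth_on_subset[OF F(3) subset_UNIV]])
    from continuous_open_preimage[OF this open_ball smooth_atlasD(4)[OF AN d(1) that]]
    have "openin (mtop M) {P \<in> chart_dom c. chart_map c P \<in> ball x0 r \<inter> F -` (chart_map d ` (Q \<inter> chart_dom d))}"
      by (rule smooth_atlasD(5)[OF AM c(1)])
    moreover have "F (chart_map c P) \<in> chart_map d ` (Q \<inter> chart_dom d) \<longleftrightarrow> f P \<in> Q" if P: "P \<in> U" for P
    proof
      assume "F (chart_map c P) \<in> chart_map d ` (Q \<inter> chart_dom d)"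
      then show "f P \<in> Q" using chart_inv_chart_map[OF AN d(1)] by (auto simp: f_def)
    next
      assume "f P \<in> Q"
      then show "F (chart_map c P) \<in> chart_map d ` (Q \<inter> chart_dom d)" unfolding fU(2)[OF P, symmetric] using fU(1)[OF P] by blast
    qed
    then have "{P \<in> chart_dom c. chart_map c P \<in> ball x0 r \<inter> F -` (chart_map d ` (Q \<inter> chart_dom d))} = {P \<in> U. f P \<in> Q}"
      by (auto simp: U_def)
    ultimately show ?thesis by simp
  qed
  have cont: "continuous_map (subtopology (mtop M) U) (mtop N) f"
  proof -
    have ts: "topspace (subtopology (mtop M) U) = U" using openin_subset[OF U] by auto
    have "f P \<in> topspace (mtop N)" if "P \<in> U" for P
      using fU(1)[OF that] openin_subset[OF smooth_atlasD(1)[OF AN d(1)]] by auto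
    then show ?thesis unfolding continuous_map_def ts openin_open_subtopology[OF U] using pre by auto
  qed
  \<comment> \<open>\<open>WW c' d'\<close> is the domain of \<open>f\<close> as seen in the charts
    \<open>c'\<close> and \<open>d'\<close>; \<open>Z d'\<close> is the part of the ball whose image
    under \<open>F\<close> lies in the overlap of \<open>d\<close> and \<open>d'\<close>. The
    transition from \<open>c'\<close> to \<open>c\<close> maps the former into the latter.\<close>
  define WW where "WW = (\<lambda>(c' :: ('a, 'm) chart) (d' :: ('b, 'n) chart). chart_map c' ` {x \<in> U \<inter> chart_dom c'. f x \<in> chart_dom d'})"
  define Z where "Z = (\<lambda>d' :: ('b, 'n) chart. {x \<in> ball x0 r. F x \<in> chart_map d ` (chart_dom d \<inter> chart_dom d')})"
  have f': "chart_map d' \<circ> f \<circ> chart_inv c' = (\<lambda>y. transition d d' (F (transition c' c y)))" for c' d'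
    by (simp add: f_def fun_eq_iff)
  have sF: "smooth_on F (Z d')" for d' by (rule smooth_on_subset[OF F(3) subset_UNIV])
  have FZ: "F ` Z d' \<subseteq> chart_map d ` (chart_dom d \<inter> chart_dom d')" for d' by (auto simp: Z_def)
  have oZ: "open (Z d')" if "d' \<in> atlas N" for d'
  proof -
    have "continuous_on (ball x0 r) F" by (rule smooth_on_continuous[OF smooth_on_subset[OF F(3) subset_UNIV]])
    from continuous_open_preimage[OF this open_ball transition_smooth(1)[OF AN d(1) that]]
    show ?thesis by (simp add: Z_def vimage_def Int_def)
  qed
  have oW: "open (WW c' d')" if "c' \<in> atlas M" "d' \<in> atlas N" for c' d'
  proof -
    have "{x \<in> U \<inter> chart_dom c'. f x \<in> chart_dom d'} = {x \<in> U. f x \<in> chart_dom d'} \<inter> chart_dom c'" by auto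
    then show ?thesis unfolding WW_def
      using smooth_atlasD(4)[OF AM that(1) pre[OF smooth_atlasD(1)[OF AN that(2)]]] by simp
  qed
  have Wsub: "WW c' d' \<subseteq> chart_map c' ` (chart_dom c' \<inter> chart_dom c)" for c' d' by (auto simp: WW_def U_def)
  have s\<phi>: "smooth_on (transition c' c) (WW c' d')" if "c' \<in> atlas M" for c' d'
    by (rule smooth_on_subset[OF transition_smooth(2)[OF AM that c(1)] Wsub])
  have \<phi>W: "transition c' c ` WW c' d' \<subseteq> Z d'" if c': "c' \<in> atlas M" for c' d'
  proof -
    have "chart_map c P \<in> Z d'" if P: "P \<in> U" "f P \<in> chart_dom d'" for P
    proof -
      have "F (chart_map c P) \<in> chart_map d ` (chart_dom d \<inter> chart_dom d')"
        using fU[OF P(1)] P(2) by (metis IntI imageI)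
      then show ?thesis using P(1) by (simp add: Z_def U_def)
    qed
    then show ?thesis by (auto simp: WW_def chart_inv_chart_map[OF AM c'])
  qed
  have s1: "smooth_on (\<lambda>x. transition d d' (F x)) (Z d')" if d': "d' \<in> atlas N" for d'
    by (rule smooth_on_compose[OF oZ[OF d'] transition_smooth(1)[OF AN d(1) d'] FZ transition_smooth(2)[OF AN d(1) d'] sF])
  have s2: "smooth_on (\<lambda>y. transition d d' (F (transition c' c y))) (WW c' d')" if c': "c' \<in> atlas M" and d': "d' \<in> atlas N" for c' d'
    by (rule smooth_on_compose[OF oW[OF c' d'] oZ[OF d'] \<phi>W[OF c'] s1[OF d'] s\<phi>[OF c']])
  \<comment> \<open>The equation is moved in two stages: the domain chart is exchanged while the
    target chart stays \<open>d'\<close>, then the target chart is exchanged. Each stage rests on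
    the invertibility of a transition Jacobian.\<close>
  have t0: "tension (metric_matrix M c') (metric_matrix N d') (\<lambda>y. transition d d' (F (transition c' c y))) i y = 0"
    if c': "c' \<in> atlas M" and d': "d' \<in> atlas N" and y: "y \<in> WW c' d'" for c' d' i y
  proof -
    obtain P where P: "P \<in> U" "P \<in> chart_dom c'" "f P \<in> chart_dom d'" "y = chart_map c' P" using y by (auto simp: WW_def)
    have Pc: "P \<in> chart_dom c" using P(1) by (simp add: U_def)
    have ty: "transition c' c y = chart_map c P" unfolding P(4) by (rule transition_chart_map[OF AM c' P(2)])
    let ?x = "transition c' c y"
    have xZ: "?x \<in> Z d'" by (rule subsetD[OF \<phi>W[OF c'] imageI[OF y]])
    have Fx: "F ?x = chart_map d (f P)" unfolding ty using fU[OF P(1)] by simp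
    have mZ: "metric_field (metric_matrix M c) (Z d')"
      using F(2) by (intro metric_field_subset[OF metric_field_metric_matrix[OF MM c(1)] oZ[OF d']]) (auto simp: Z_def)
    have mW: "metric_field (metric_matrix M c') (WW c' d')"
      by (intro metric_field_subset[OF metric_field_metric_matrix[OF MM c'] oW[OF c' d']]) (auto simp: WW_def)
    have mT: "metric_field (metric_matrix N d) (chart_map d ` (chart_dom d \<inter> chart_dom d'))"
      by (intro metric_field_subset[OF metric_field_metric_matrix[OF NN d(1)] transition_smooth(1)[OF AN d(1) d']]) auto
    have surj1: "surj (fd (transition c' c) y)" unfolding P(4)
      by (rule surjI) (rule jacobian_inverse[OF AM c(1) c' Pc P(2)])
    have surj2: "surj (fd (transition d d') (F ?x))" unfolding Fx
      by (rule surjI) (rule jacobian_inverse[OF AN d' d(1) P(3) fU(1)[OF P(1)]])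
    have pull1: "a \<bullet> (metric_matrix M c' x *v b) = fd (transition c' c) x a \<bullet> (metric_matrix M c (transition c' c x) *v fd (transition c' c) x b)"
      if "x \<in> WW c' d'" for x a b
      by (rule metric_matrix_pullback[OF MM c' c(1) subsetD[OF Wsub that]])
    have "tension (metric_matrix M c') (metric_matrix N d') (\<lambda>y. transition d d' (F (transition c' c y))) i y
      = tension (metric_matrix M c) (metric_matrix N d') (\<lambda>x. transition d d' (F x)) i ?x"
      by (rule tension_domain_change[OF mZ mW s\<phi>[OF c'] \<phi>W[OF c'] surj1 pull1 y s1[OF d']])
    also have "\<dots> = (\<Sum>j\<in>UNIV. tension (metric_matrix M c) (metric_matrix N d) F j ?x * fd (transition d d') (F ?x) (axis j 1) $ i)"
    proof (rule tension_target_change[OF mT metric_field_metric_matrix[OF NN d'] transition_smooth(2)[OF AN d(1) d'] _ surj2 _ mZ sF FZ xZ])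
      show "transition d d' ` chart_map d ` (chart_dom d \<inter> chart_dom d') \<subseteq> chart_map d' ` chart_dom d'"
        by (auto simp: chart_inv_chart_map[OF AN d(1)])
    qed (rule metric_matrix_pullback[OF NN d(1) d'])
    also have "\<dots> = 0" using xZ by (simp add: F(7) Z_def)
    finally show ?thesis .
  qed
  have harm: "harmonic_map_on M N U f"
    unfolding harmonic_map_on_def Let_def f' using cont s2[unfolded WW_def] t0[unfolded WW_def] by blast
  \<comment> \<open>\<open>differential\<close> selects its own chart around \<open>p\<close>; the
    compatibility of the coordinates of \<open>v\<close> leads back to \<open>c\<close>.\<close>
  have diff: "differential (atlas M) (atlas N) f p v = ?t (A *v v c)" if v: "v \<in> tangent_space (atlas M) p" for v
  proof -
    define c' where "c' = (SOME c. c \<in> atlas M \<and> p \<in> chart_dom c)"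
    have c': "c' \<in> atlas M" "p \<in> chart_dom c'" using someI[of "\<lambda>c. c \<in> atlas M \<and> p \<in> chart_dom c" c] c by (auto simp: c'_def)
    have vc: "jacobian c' c p (v c') = v c" by (rule tangent_spaceD(1)[OF v c'(1) c(1) c'(2) c(2), symmetric])
    have "fd (chart_map e \<circ> f \<circ> chart_inv c') (chart_map c' p) (v c') = jacobian d e q (A *v v c)"
      if e: "e \<in> atlas N" "q \<in> chart_dom e" for e
    proof -
      have y: "chart_map c' p \<in> WW c' e" using pU c' e fp by (auto simp: WW_def)
      have x: "transition c' c (chart_map c' p) = x0" unfolding x0_def by (rule transition_chart_map[OF AM c'])
      have xZ: "x0 \<in> Z e" using subsetD[OF \<phi>W[OF c'(1)] imageI[OF y]] unfolding x .
      have Fz: "F x0 \<in> chart_map d ` (chart_dom d \<inter> chart_dom e)" using xZ by (simp add: Z_def)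
      have "fd (chart_map e \<circ> f \<circ> chart_inv c') (chart_map c' p) (v c')
        = fd (\<lambda>x. transition d e (F x)) x0 (v c)"
        unfolding f' using fd_compose[OF s1[OF e(1)] oZ[OF e(1)] s\<phi>[OF c'(1)] oW[OF c'(1) e(1)] y] xZ
        unfolding x by (simp add: vc)
      also have "\<dots> = fd (transition d e) (F x0) (fd F x0 (v c))"
        by (rule fd_compose[OF transition_smooth(2,1)[OF AN d(1) e(1)] sF oZ[OF e(1)] xZ Fz])
      finally show ?thesis unfolding F(5,6) y0_def .
    qed
    then show ?thesis unfolding differential_def tangent_of_coords_apply c'_def[symmetric] Let_def fp by (auto simp: fun_eq_iff)
  qed
  \<comment> \<open>Every vector is the coordinate vector of some tangent vector at
    \<open>p\<close>, so the image of the differential corresponds to the full range of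
    \<open>A\<close>.\<close>
  have coords: "(\<lambda>v. v c) ` tangent_space (atlas M) p = UNIV"
    using tangent_of_coords_in[OF AM c] tangent_of_coords_self[OF AM c] by (metis (mono_tags, lifting) UNIV_eq_I image_iff)
  have "differential (atlas M) (atlas N) f p ` tangent_space (atlas M) p = (\<lambda>v. ?t (A *v v c)) ` tangent_space (atlas M) p"
    by (rule image_cong[OF refl diff])
  also have "\<dots> = ?t ` (\<lambda>v. A *v v) ` (\<lambda>v. v c) ` tangent_space (atlas M) p" by (simp only: image_image)
  also have "\<dots> = V" unfolding coords A tW ..
  finally have "differential (atlas M) (atlas N) f p ` tangent_space (atlas M) p = V" .
  then show ?thesis using U pU harm fp by blast
qed

end
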